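(* Let $t=2m'+1\ge3$ be odd, $r\ge2$, $R'=m'+r$, and $\Lambda=(\Lambda_1\ge\dots\ge\Lambda_{R'}\ge0)$ an integral dominant weight of $SO_{2R'+1}$. With the notation of the context: (i) for $w\in W^1$, $\tau^B_t(\eta_w)\ne0$ if and only if $S(w)$ is a transversal: it contains exactly one index from each nonzero folded class and none from class $0$. (ii) Consequently $|\operatorname{supp}\nu(\Lambda,\cdot)|=2\prod_{j=1}^{m'}n_j$, counted among unfolded $D_r$ weights, where the two chiralities of a transversal are two distinct points. (iii) In particular $\nu(\Lambda,\cdot)\equiv0$ if and only if some $n_j=0$ ($1\le j\le m'$). (iv) At the point $\mu_w$ with $S=S(w)$ a transversal, the value of $\nu(\Lambda,\cdot)$ is $\epsilon_t\,\det(w)\,\delta_S\in\{\pm1\}$, where $\epsilon_t=\left(\tfrac{-2}{t}\right)^{(t+3)/2}(-1)^{m'(m'-1)/2}$ (Jacobi symbol). (v) Assume all $n_j\ge1$ and let $S_{\min}$ be the transversal taking, in each nonzero class, the index with the largest label, equivalently the smallest value of $V$. Then the alternant index of $(S_{\min},+)$ dominates coordinatewise the alternant index of every other point of $\operatorname{supp}\nu(\Lambda,\cdot)$, strictly in at least one coordinate. In particular it is the unique maximiser over the support of $\langle w_0,\cdot\rangle$ for every $w_0\in\mathbb R^r$ with all coordinates positive.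
   Context: Notation. $\rho_{B_n}=(n-\tfrac12,\dots,\tfrac12)$, $\rho_{D_r}=(r-1,\dots,0)$, $\zeta=e^{2\pi i/t}$. $\tau^B_t(\eta)$ is the irreducible character of $SO_{2m'+1}$ of highest weight $\eta$ (a partition with at most $m'$ parts) at the torus element with eigenvalues $1,\zeta^{\pm1},\dots,\zeta^{\pm m'}$. Put $u=\Lambda+\rho_{B_{R'}}$, $V=2u\in\mathbb Z^{R'}$ (strictly decreasing positive odd integers). $W^1$ is the set of signed permutations $w\in W(B_{R'})$ such that $w(u)=(p_1,\dots,p_{m'},q_1,\dots,q_r)$ with $p_1>\dots>p_{m'}>0$ and $q_1>\dots>q_{r-1}>|q_r|$; write $w(u)=(\eta_w+\rho_{B_{m'}},\mu_w+\rho_{D_r})$. Each $w\in W^1$ is the datum of the subset $S(w)\subset\{1,\dots,R'\}$, $|S(w)|=m'$, of indices $i$ such that $u_i$ is placed in the first block, together with a chirality, namely the sign of the last coordinate $q_r$. Define $\nu(\Lambda,\mu)=\sum_{w\in W^1,\ \mu_w=\mu}\det(w)\tau^B_t(\eta_w)$ (here $\det(w)=(-1)^{\ell(w)}$). The alternant index of the point attached to $(S,\pm)$ is $2(\mu_w+\rho_{D_r})$: the entries $V_i$, $i\notin S$, in decreasing order, with the last one multiplied by the chirality sign. The folded class of an integer $a$ is the unique $c\in\{0,\dots,m'\}$ with $a\equiv\pm c\pmod t$; its folding sign is $+1$ if $a\equiv c \pmod t$ and $-1$ otherwise. $n_j$ is the number of $i\in\{1,\dots,R'\}$ such that $V_i$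 has folded class $j$. The classes $1,\dots,m'$ are the nonzero classes. For a transversal $S$ with elements $i_1<\dots<i_{m'}$, let $c_p$ and $\varepsilon_p$ be the folded class and folding sign of $V_{i_p}$; then $\delta_S=\operatorname{sgn}(\sigma)\prod_p\varepsilon_p$, where $\sigma$ is the permutation $p\mapsto m'+1-c_p$ (i.e. the classes read against the decreasing order $m',\dots,1$). *)

theory Defs
  imports
    "HOL-Number_Theory.Number_Theory"
    "HOL-Combinatorics.Permutations"
    "Jordan_Normal_Form.Determinant"
    Complex_Main
begin

text \<open>
  All coordinates and matrix indices start at 0, so the index called $i$ here is the index
  $i + 1$ of the usual notation.  The letter \<open>m\<close> is the rank $m'$, \<open>t = 2m + 1\<close>
  and \<open>R = m + r\<close> is the rank $R'$.
\<close>

section \<open>Irreducible characters of the odd orthogonal groups\<close>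

text \<open>
  The group $SO_{2m+1}$ is the complex algebraic group preserving the symmetric form whose
  Gram matrix is antidiagonal.  In this split form a maximal torus consists of diagonal
  matrices and a Borel subgroup of upper triangular ones.
\<close>

definition antidiag :: "nat \<Rightarrow> complex mat" where
  "antidiag N = mat N N (\<lambda>(i, j). if i + j + 1 = N then 1 else 0)"

definition SO_odd :: "nat \<Rightarrow> complex mat set" where
  "SO_odd m = {g \<in> carrier_mat (2 * m + 1) (2 * m + 1).
     transpose_mat g * antidiag (2 * m + 1) * g = antidiag (2 * m + 1) \<and> det g = 1}"

text \<open>\<open>torus_elt m x\<close> is $\mathrm{diag}(x_0, \dots, x_{m-1}, 1, x_{m-1}^{-1}, \dots, x_0^{-1})$.\<close>

definition torus_elt :: "nat \<Rightarrow> (nat \<Rightarrow> complex) \<Rightarrow> complex mat" where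
  "torus_elt m x = mat (2 * m + 1) (2 * m + 1) (\<lambda>(i, j).
     if i \<noteq> j then 0
     else if i < m then x i
     else if i = m then 1
     else inverse (x (2 * m - i)))"

definition unipotent_upper :: "nat \<Rightarrow> complex mat set" where
  "unipotent_upper m = {g \<in> SO_odd m. upper_triangular g \<and> (\<forall>i < 2 * m + 1. g $$ (i, i) = 1)}"

text \<open>Polynomial functions of the entries of an \<open>N \<times> N\<close> matrix.\<close>

inductive polyfun :: "nat \<Rightarrow> (complex mat \<Rightarrow> complex) \<Rightarrow> bool" for N where
  polyfun_const: "polyfun N (\<lambda>_. c)"
| polyfun_entry: "i < N \<Longrightarrow> j < N \<Longrightarrow> polyfun N (\<lambda>g. g $$ (i, j))"
| polyfun_add: "polyfun N f \<Longrightarrow> polyfun N h \<Longrightarrow> polyfun N (\<lambda>g. f g + h g)"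
| polyfun_mult: "polyfun N f \<Longrightarrow> polyfun N h \<Longrightarrow> polyfun N (\<lambda>g. f g * h g)"

text \<open>
  A rational representation on $\mathbb{C}^d$.  As $SO_{2m+1}$ is closed in the space of
  matrices, its regular functions are the restrictions of the polynomial ones.
\<close>

definition rational_rep :: "nat \<Rightarrow> nat \<Rightarrow> (complex mat \<Rightarrow> complex mat) \<Rightarrow> bool" where
  "rational_rep m d \<pi> \<longleftrightarrow>
     (\<forall>g \<in> SO_odd m. \<pi> g \<in> carrier_mat d d) \<and>
     \<pi> (1\<^sub>m (2 * m + 1)) = 1\<^sub>m d \<and>
     (\<forall>g \<in> SO_odd m. \<forall>h \<in> SO_odd m. \<pi> (g * h) = \<pi> g * \<pi> h) \<and>
     (\<forall>i < d. \<forall>j < d. \<exists>f. polyfun (2 * m + 1) f \<and> (\<forall>g \<in> SO_odd m. \<pi> g $$ (i, j) = f g))"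

definition invariant_subspace ::
    "nat \<Rightarrow> nat \<Rightarrow> (complex mat \<Rightarrow> complex mat) \<Rightarrow> complex vec set \<Rightarrow> bool" where
  "invariant_subspace m d \<pi> W \<longleftrightarrow>
     W \<subseteq> carrier_vec d \<and> 0\<^sub>v d \<in> W \<and>
     (\<forall>v \<in> W. \<forall>w \<in> W. v + w \<in> W) \<and> (\<forall>c. \<forall>v \<in> W. c \<cdot>\<^sub>v v \<in> W) \<and>
     (\<forall>g \<in> SO_odd m. \<forall>v \<in> W. \<pi> g *\<^sub>v v \<in> W)"

definition irreducible_rep :: "nat \<Rightarrow> nat \<Rightarrow> (complex mat \<Rightarrow> complex mat) \<Rightarrow> bool" where
  "irreducible_rep m d \<pi> \<longleftrightarrow> rational_rep m d \<pi> \<and> d > 0 \<and>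
     (\<forall>W. invariant_subspace m d \<pi> W \<longrightarrow> W = {0\<^sub>v d} \<or> W = carrier_vec d)"

definition has_highest_weight ::
    "nat \<Rightarrow> nat \<Rightarrow> (complex mat \<Rightarrow> complex mat) \<Rightarrow> int vec \<Rightarrow> bool" where
  "has_highest_weight m d \<pi> \<eta> \<longleftrightarrow>
     (\<exists>v \<in> carrier_vec d. v \<noteq> 0\<^sub>v d \<and>
        (\<forall>g \<in> unipotent_upper m. \<pi> g *\<^sub>v v = v) \<and>
        (\<forall>x. (\<forall>i < m. x i \<noteq> 0) \<longrightarrow>
           \<pi> (torus_elt m x) *\<^sub>v v = (\<Prod>i < m. x i powi (\<eta> $ i)) \<cdot>\<^sub>v v))"

text \<open>
  The value at \<open>g\<close> of the irreducible character of highest weight \<open>\<eta>\<close>; it is meant for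
  \<open>\<eta>\<close> a partition with at most \<open>m\<close> parts, for which there is exactly one
  irreducible representation up to isomorphism.
\<close>

definition irr_character :: "nat \<Rightarrow> int vec \<Rightarrow> complex mat \<Rightarrow> complex" where
  "irr_character m \<eta> g = (THE c. \<exists>d \<pi>. irreducible_rep m d \<pi> \<and> has_highest_weight m d \<pi> \<eta> \<and>
     c = (\<Sum>i < d. \<pi> g $$ (i, i)))"

definition tau_B :: "nat \<Rightarrow> int vec \<Rightarrow> complex" where
  "tau_B m \<eta> = irr_character m \<eta> (torus_elt m (\<lambda>i. cis (2 * pi / real (2 * m + 1)) ^ (i + 1)))"

section \<open>Branching data\<close>

definition rho_B :: "nat \<Rightarrow> real vec" where
  "rho_B n = vec n (\<lambda>i. real n - real i - 1 / 2)"

definition rho_D :: "nat \<Rightarrow> real vec" where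
  "rho_D r = vec r (\<lambda>i. real r - 1 - real i)"

definition dominant_SO_odd :: "nat \<Rightarrow> int vec \<Rightarrow> bool" where
  "dominant_SO_odd R \<Lambda> \<longleftrightarrow> \<Lambda> \<in> carrier_vec R \<and>
     (\<forall>i j. i < j \<and> j < R \<longrightarrow> \<Lambda> $ j \<le> \<Lambda> $ i) \<and> (\<forall>i < R. 0 \<le> \<Lambda> $ i)"

definition u_vec :: "nat \<Rightarrow> int vec \<Rightarrow> real vec" where
  "u_vec R \<Lambda> = map_vec real_of_int \<Lambda> + rho_B R"

text \<open>The entries of $V = 2u$ are integers; the floor only changes the type.\<close>

definition V_vec :: "nat \<Rightarrow> int vec \<Rightarrow> int vec" where
  "V_vec R \<Lambda> = map_vec floor (2 \<cdot>\<^sub>v u_vec R \<Lambda>)"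

text \<open>
  The signed permutations, as matrices acting on $\mathbb{R}^R$; thus $\det(w)$ is the
  determinant of the matrix.
\<close>

definition weyl_B :: "nat \<Rightarrow> real mat set" where
  "weyl_B R = {mat R R (\<lambda>(i, j). if j = \<sigma> i then \<epsilon> i else 0) | \<sigma> \<epsilon>.
     \<sigma> permutes {..<R} \<and> (\<forall>i < R. \<epsilon> i = 1 \<or> \<epsilon> i = -1)}"

text \<open>The two blocks $(p_1, \dots, p_m)$ and $(q_1, \dots, q_r)$ of $w(u)$.\<close>

definition p_block :: "nat \<Rightarrow> nat \<Rightarrow> int vec \<Rightarrow> real mat \<Rightarrow> real vec" where
  "p_block m r \<Lambda> w = vec_first (w *\<^sub>v u_vec (m + r) \<Lambda>) m"

definition q_block :: "nat \<Rightarrow> nat \<Rightarrow> int vec \<Rightarrow> real mat \<Rightarrow> real vec" where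
  "q_block m r \<Lambda> w = vec_last (w *\<^sub>v u_vec (m + r) \<Lambda>) r"

definition W1 :: "nat \<Rightarrow> nat \<Rightarrow> int vec \<Rightarrow> real mat set" where
  "W1 m r \<Lambda> = {w \<in> weyl_B (m + r).
     (let p = p_block m r \<Lambda> w; q = q_block m r \<Lambda> w in
       (\<forall>i j. i < j \<and> j < m \<longrightarrow> p $ j < p $ i) \<and> (\<forall>i < m. 0 < p $ i) \<and>
       (\<forall>i j. i < j \<and> j < r - 1 \<longrightarrow> q $ j < q $ i) \<and> (\<forall>i < r - 1. \<bar>q $ (r - 1)\<bar> < q $ i))}"

text \<open>
  $\eta_w$ is an integer vector (again the floor only changes the type), whereas
  $\mu_w$ has half-odd-integer entries.
\<close>

definition eta_of :: "nat \<Rightarrow> nat \<Rightarrow> int vec \<Rightarrow> real mat \<Rightarrow> int vec" where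
  "eta_of m r \<Lambda> w = map_vec floor (p_block m r \<Lambda> w - rho_B m)"

definition mu_of :: "nat \<Rightarrow> nat \<Rightarrow> int vec \<Rightarrow> real mat \<Rightarrow> real vec" where
  "mu_of m r \<Lambda> w = q_block m r \<Lambda> w - rho_D r"

text \<open>\<open>S_of m r w\<close> is the set of indices that \<open>w\<close> places in the first block.\<close>

definition S_of :: "nat \<Rightarrow> nat \<Rightarrow> real mat \<Rightarrow> nat set" where
  "S_of m r w = {i. i < m + r \<and> (\<exists>k < m. w $$ (k, i) \<noteq> 0)}"

definition chirality :: "nat \<Rightarrow> nat \<Rightarrow> int vec \<Rightarrow> real mat \<Rightarrow> real" where
  "chirality m r \<Lambda> w = sgn (q_block m r \<Lambda> w $ (r - 1))"

definition nu :: "nat \<Rightarrow> nat \<Rightarrow> int vec \<Rightarrow> real vec \<Rightarrow> complex" where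
  "nu m r \<Lambda> \<mu> = (\<Sum>w | w \<in> W1 m r \<Lambda> \<and> mu_of m r \<Lambda> w = \<mu>.
     complex_of_real (det w) * tau_B m (eta_of m r \<Lambda> w))"

definition supp_nu :: "nat \<Rightarrow> nat \<Rightarrow> int vec \<Rightarrow> real vec set" where
  "supp_nu m r \<Lambda> = {\<mu> \<in> carrier_vec r. nu m r \<Lambda> \<mu> \<noteq> 0}"

text \<open>The point $\mu_w$ attached to $(S, \pm)$, where \<open>w\<close> is the element of $W^1$ with datum \<open>(S, s)\<close>.\<close>

definition point :: "nat \<Rightarrow> nat \<Rightarrow> int vec \<Rightarrow> nat set \<Rightarrow> real \<Rightarrow> real vec" where
  "point m r \<Lambda> S s =
     mu_of m r \<Lambda> (THE w. w \<in> W1 m r \<Lambda> \<and> S_of m r w = S \<and> chirality m r \<Lambda> w = s)"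

definition alternant_index :: "nat \<Rightarrow> real vec \<Rightarrow> real vec" where
  "alternant_index r \<mu> = 2 \<cdot>\<^sub>v (\<mu> + rho_D r)"

section \<open>Folded classes and transversals\<close>

definition folded_class :: "nat \<Rightarrow> int \<Rightarrow> nat" where
  "folded_class m a = (THE c. c \<le> m \<and>
     ([a = int c] (mod int (2 * m + 1)) \<or> [a = - int c] (mod int (2 * m + 1))))"

definition folding_sign :: "nat \<Rightarrow> int \<Rightarrow> int" where
  "folding_sign m a = (if [a = int (folded_class m a)] (mod int (2 * m + 1)) then 1 else -1)"

definition V_class :: "nat \<Rightarrow> nat \<Rightarrow> int vec \<Rightarrow> nat \<Rightarrow> nat" where
  "V_class m r \<Lambda> i = folded_class m (V_vec (m + r) \<Lambda> $ i)"

definition class_count :: "nat \<Rightarrow> nat \<Rightarrow> int vec \<Rightarrow> nat \<Rightarrow> nat" where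
  "class_count m r \<Lambda> j = card {i. i < m + r \<and> V_class m r \<Lambda> i = j}"

definition transversal :: "nat \<Rightarrow> nat \<Rightarrow> int vec \<Rightarrow> nat set \<Rightarrow> bool" where
  "transversal m r \<Lambda> S \<longleftrightarrow> S \<subseteq> {..<m + r} \<and>
     (\<forall>j \<in> {1..m}. \<exists>!i. i \<in> S \<and> V_class m r \<Lambda> i = j) \<and>
     (\<forall>i \<in> S. V_class m r \<Lambda> i \<noteq> 0)"

text \<open>
  With positions \<open>p\<close> running over \<open>{0..<m}\<close>, the permutation
  $p \mapsto m + 1 - c_p$ of $\{1, \dots, m\}$ becomes $p \mapsto m - c_p$.
\<close>

definition delta_sign :: "nat \<Rightarrow> nat \<Rightarrow> int vec \<Rightarrow> nat set \<Rightarrow> int" where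
  "delta_sign m r \<Lambda> S =
     (let i = (\<lambda>p. sorted_list_of_set S ! p) in
       sign (\<lambda>p. if p < m then m - V_class m r \<Lambda> (i p) else p) *
       (\<Prod>p < m. folding_sign m (V_vec (m + r) \<Lambda> $ i p)))"

definition S_min :: "nat \<Rightarrow> nat \<Rightarrow> int vec \<Rightarrow> nat set" where
  "S_min m r \<Lambda> = (\<lambda>j. Max {i. i < m + r \<and> V_class m r \<Lambda> i = j}) ` {1..m}"

text \<open>The Jacobi symbol, for odd positive \<open>n\<close>.\<close>

definition Jacobi :: "int \<Rightarrow> nat \<Rightarrow> int" where
  "Jacobi a n = (\<Prod>p \<in># prime_factorization n. Legendre a (int p))"

definition epsilon :: "nat \<Rightarrow> int" where
  "epsilon t = Jacobi (-2) t ^ ((t + 3) div 2) *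
     (let m = (t - 1) div 2 in (-1) ^ (m * (m - 1) div 2))"

end

theory Submission
  imports Defs "HOL-Library.Function_Algebras" "HOL-Library.Poly_Mapping" "HOL-Library.FuncSet"
begin

text \<open>
  The value \<open>tau_B\<close> comes from the Weyl character formula, proved here for an arbitrary
  irreducible rational representation without complete reducibility. The differentiated
  representation yields root operators, and the Casimir operator is scalar because it is invariant
  and the highest weight vector generates. Taking traces on weight spaces, this says that the
  Weyl denominator times the character is an eigenfunction of the Laplacian on Laurent
  polynomials; being alternating with the right leading term, it must be an alternant. Existence of
  the representation follows from tensor products of exterior powers: a representation of
  minimal dimension among those with a given highest weight vector is irreducible.

  At the square root of the torus element, whose entries are the powers of a primitive \<open>t\<close>-th root
  of unity, an alternant with exponents \<open>V\<close> depends, up to sign, only on the folded classes of its exponents. So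
  it vanishes unless each nonzero class occurs once, and otherwise the quotient by the denominator is
  \<open>delta_sign\<close> times the same sign for $2\rho$. The latter is evaluated by an explicit permutation, and
  the Jacobi symbol by Gauss's lemma.
\<close>

section \<open>Laurent polynomials\<close>

text \<open>\<open>irr_character\<close> is a definite description over all irreducible
  representations with the given highest weight, in any dimension; so the trace must be computed for
  every one of them, and one of them must be exhibited. Global statements about the group come down
  to density: a polynomial function that vanishes on lower unipotent times torus times upper
  unipotent vanishes on all of SO. The obstacle is that the group is given by equations and not by a
  parametrisation; it is met by writing an element as an even product of reflections and joining
  reflections by rational curves. Density makes the lower unipotent orbit of the highest weight
  vector span the space, which in turn bounds the weights and gives the highest one multiplicity
  one. Because \<rho> is half-integral, exponents are doubled and characters are evaluated at square
  roots of the torus coordinates. As t is odd, \<zeta>^{(t+1)/2} is a square root of \<zeta> which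
  is again a t-th root of unity, whence exponents count only modulo t. Finally a point of the
  support determines its subset and chirality, so the sums defining \<open>nu\<close> have one term
  and cannot cancel.\<close>

type_synonym wt = "nat \<Rightarrow> int"
type_synonym laur = "wt \<Rightarrow>\<^sub>0 complex"

abbreviation lk :: "laur \<Rightarrow> wt \<Rightarrow> complex" where "lk \<equiv> Poly_Mapping.lookup"
abbreviation ks :: "laur \<Rightarrow> wt set" where "ks \<equiv> Poly_Mapping.keys"
abbreviation sg :: "wt \<Rightarrow> complex \<Rightarrow> laur" where "sg \<equiv> Poly_Mapping.single"
abbreviation xp :: "wt \<Rightarrow> laur" where "xp \<mu> \<equiv> Poly_Mapping.single \<mu> 1"

lemma laur_expand: "f = (\<Sum>\<mu>\<in>ks f. sg \<mu> (lk f \<mu>))"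
  by (rule poly_mapping_eqI) (simp add: lookup_sum lookup_single when_def in_keys_iff)

lemma laur_induct [case_names single add]:
  assumes "\<And>\<mu> c. P (sg \<mu> c)" "\<And>f g. P f \<Longrightarrow> P g \<Longrightarrow> P (f + g)"
  shows "P (f :: laur)"
proof -
  have "P (\<Sum>\<mu>\<in>S. sg \<mu> (c \<mu>))" if "finite S" for S c
    using that
  proof induction
    case empty
    show ?case using assms(1)[of 0 0] by simp
  next
    case (insert x F)
    then show ?case using assms by simp
  qed
  then show ?thesis using laur_expand[of f] by (metis finite_keys)
qed

section \<open>Evaluation at points of the torus\<close>

definition mon :: "nat \<Rightarrow> (nat \<Rightarrow> complex) \<Rightarrow> wt \<Rightarrow> complex" where
  "mon m x \<mu> = (\<Prod>i<m. x i powi \<mu> i)"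

definition ev :: "nat \<Rightarrow> (nat \<Rightarrow> complex) \<Rightarrow> laur \<Rightarrow> complex" where
  "ev m x f = (\<Sum>\<mu>\<in>ks f. lk f \<mu> * mon m x \<mu>)"

definition unitvals :: "nat \<Rightarrow> (nat \<Rightarrow> complex) \<Rightarrow> bool" where
  "unitvals m x \<longleftrightarrow> (\<forall>i<m. x i \<noteq> 0)"

lemma mon_0 [simp]: "mon m x 0 = 1"
  by (simp add: mon_def)

lemma mon_nonzero: "unitvals m x \<Longrightarrow> mon m x \<mu> \<noteq> 0"
  by (simp add: mon_def unitvals_def)

lemma mon_add: "unitvals m x \<Longrightarrow> mon m x (\<mu> + \<nu>) = mon m x \<mu> * mon m x \<nu>"
  by (simp add: mon_def unitvals_def power_int_add prod.distrib)

lemma mon_mult: "mon m (\<lambda>i. x i * y i) \<mu> = mon m x \<mu> * mon m y \<mu>"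
  by (simp add: mon_def power_int_mult_distrib prod.distrib)

lemma ev_superset: "finite S \<Longrightarrow> ks f \<subseteq> S \<Longrightarrow> ev m x f = (\<Sum>\<mu>\<in>S. lk f \<mu> * mon m x \<mu>)"
  unfolding ev_def by (rule sum.mono_neutral_left) (auto simp: in_keys_iff)

lemma ev_add: "ev m x (f + g) = ev m x f + ev m x g"
proof -
  let ?S = "ks f \<union> ks g"
  have "ks (f + g) \<subseteq> ?S" by (rule Poly_Mapping.keys_add)
  then show ?thesis
    by (simp add: ev_superset[of ?S] lookup_add sum.distrib distrib_right)
qed

lemma ev_single: "ev m x (sg \<mu> c) = c * mon m x \<mu>"
  by (simp add: ev_def)

lemma ev_0 [simp]: "ev m x 0 = 0"
  by (simp add: ev_def)

lemma ev_1 [simp]: "ev m x 1 = 1"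
  using ev_single[of m x 0 1] by simp

lemma ev_mult:
  assumes x: "unitvals m x"
  shows "ev m x (f * g) = ev m x f * ev m x g"
proof (induction f rule: laur_induct)
  case (single \<mu> c)
  show ?case
    by (induction g rule: laur_induct)
      (simp_all add: mult_single ev_single mon_add[OF x] distrib_left ev_add)
qed (simp add: distrib_right ev_add)

lemma ev_hom: "unitvals m x \<Longrightarrow> comm_ring_hom (ev m x)"
  by unfold_locales (simp_all add: ev_mult ev_add)

lemma ev_uminus: "ev m x (- f) = - ev m x f"
  by (simp add: ev_def sum_negf)

lemma ev_diff: "ev m x (f - g) = ev m x f - ev m x g"
  using ev_add[of m x f "- g"] by (simp add: ev_uminus)

lemma ev_sum: "ev m x (\<Sum>a\<in>A. f a) = (\<Sum>a\<in>A. ev m x (f a))"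
  by (induction A rule: infinite_finite_induct) (simp_all add: ev_add)

lemma ev_prod: "unitvals m x \<Longrightarrow> ev m x (\<Prod>a\<in>A. f a) = (\<Prod>a\<in>A. ev m x (f a))"
  by (induction A rule: infinite_finite_induct) (simp_all add: ev_mult)

text \<open>Weights are functions on all natural numbers, so that Laurent polynomials of every rank
  share one type; this set recovers the weight lattice of rank m.\<close>

definition wts :: "nat \<Rightarrow> wt set" where
  "wts m = {\<mu>. \<forall>i\<ge>m. \<mu> i = 0}"

lemma wts_0 [simp]: "0 \<in> wts m"
  and wts_add: "\<mu> \<in> wts m \<Longrightarrow> \<nu> \<in> wts m \<Longrightarrow> \<mu> + \<nu> \<in> wts m"
  by (auto simp: wts_def)

lemma wts_eqI: "\<mu> \<in> wts m \<Longrightarrow> \<nu> \<in> wts m \<Longrightarrow> (\<And>i. i < m \<Longrightarrow> \<mu> i = \<nu> i) \<Longrightarrow> \<mu> = \<nu>"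
  by (auto simp: wts_def fun_eq_iff) (metis not_le)

lemma mon_separates:
  assumes "\<mu> \<in> wts m" "\<nu> \<in> wts m" "\<mu> \<noteq> \<nu>"
  obtains y where "unitvals m y" "mon m y \<mu> \<noteq> mon m y \<nu>"
proof -
  obtain i where i: "i < m" "\<mu> i \<noteq> \<nu> i" using assms wts_eqI by blast
  \<comment> \<open>The number 2 is not a root of unity: powers of 2 with different exponents have
    different absolute values.\<close>
  define y where "y = (\<lambda>j. if j = i then 2 else (1::complex))"
  have mon: "mon m y \<kappa> = 2 powi \<kappa> i" for \<kappa>
  proof -
    have "mon m y \<kappa> = (\<Prod>j<m. if j = i then 2 powi \<kappa> i else 1)"
      unfolding mon_def y_def by (rule prod.cong) auto
    then show ?thesis using i by simp
  qed
  have "(2::real) powi \<mu> i \<noteq> 2 powi \<nu> i"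
    using i power_int_strict_increasing[of "\<mu> i" "\<nu> i" "2::real"]
      power_int_strict_increasing[of "\<nu> i" "\<mu> i" "2::real"] by (cases "\<mu> i < \<nu> i") auto
  then have "norm ((2::complex) powi \<mu> i) \<noteq> norm ((2::complex) powi \<nu> i)"
    by (simp add: norm_power_int)
  then have "mon m y \<mu> \<noteq> mon m y \<nu>" by (metis mon)
  moreover have "unitvals m y" by (simp add: unitvals_def y_def)
  ultimately show thesis using that by blast
qed

text \<open>Dedekind's argument for the independence of characters: from the relation at the product
  point xy subtract \<open>mon m y \<mu>\<close> times the relation at x. This removes the term
  \<mu> and multiplies every other coefficient by a difference that some y makes nonzero.\<close>

lemma mon_indep:
  assumes "finite S" "S \<subseteq> wts m"
    and "\<And>x. unitvals m x \<Longrightarrow> (\<Sum>\<mu>\<in>S. c \<mu> * mon m x \<mu>) = 0"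
  shows "\<forall>\<mu>\<in>S. c \<mu> = 0"
  using assms
proof (induction S arbitrary: c)
  case (insert \<mu> S)
  have "c \<nu> * (mon m y \<nu> - mon m y \<mu>) = 0" if \<nu>: "\<nu> \<in> S" and y: "unitvals m y" for y \<nu>
  proof -
    have "(\<Sum>\<nu>\<in>S. c \<nu> * (mon m y \<nu> - mon m y \<mu>) * mon m x \<nu>) = 0" if x: "unitvals m x" for x
    proof -
      have "unitvals m (\<lambda>i. x i * y i)" using x y by (simp add: unitvals_def)
      then have "c \<mu> * mon m x \<mu> * mon m y \<mu> + (\<Sum>\<nu>\<in>S. c \<nu> * (mon m x \<nu> * mon m y \<nu>)) = 0"
        using insert.prems(2)[of "\<lambda>i. x i * y i"] insert.hyps by (simp add: mon_mult ac_simps)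
      moreover have "c \<mu> * mon m x \<mu> = - (\<Sum>\<nu>\<in>S. c \<nu> * mon m x \<nu>)"
        using insert.prems(2)[OF x] insert.hyps by (simp add: eq_neg_iff_add_eq_0)
      ultimately show ?thesis
        by (simp add: algebra_simps sum_subtractf sum_distrib_left sum_distrib_right)
    qed
    then show ?thesis using insert.IH[of "\<lambda>\<nu>. c \<nu> * (mon m y \<nu> - mon m y \<mu>)"] insert.prems \<nu> by auto
  qed
  then have S0: "\<forall>\<nu>\<in>S. c \<nu> = 0"
    by (metis insert.hyps(2) insert.prems(1) insert_subset mon_separates mult_eq_0_iff
        right_minus_eq subsetD)
  then have "c \<mu> * mon m (\<lambda>_. 1) \<mu> = 0"
    using insert.prems(2)[of "\<lambda>_. 1"] insert.hyps by (simp add: unitvals_def)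
  then show ?case using S0 mon_nonzero[of m "\<lambda>_. 1"] by (simp add: unitvals_def)
qed simp

lemma ev_eq_0_imp:
  assumes "ks f \<subseteq> wts m" "\<And>x. unitvals m x \<Longrightarrow> ev m x f = 0"
  shows "f = 0"
proof -
  have "\<forall>\<mu>\<in>ks f. lk f \<mu> = 0"
    using assms by (intro mon_indep[where m = m]) (auto simp: ev_def)
  then show ?thesis by (metis in_keys_iff poly_mapping_eqI lookup_zero)
qed

subsection \<open>Derivations and the Laplacian\<close>

text \<open>The Euler derivation x_k d/dx_k, diagonal on monomials.\<close>

definition Dv :: "nat \<Rightarrow> laur \<Rightarrow> laur" where
  "Dv k f = Poly_Mapping.mapp (\<lambda>\<mu> c. of_int (\<mu> k) * c) f"

lemma lk_Dv: "lk (Dv k f) \<mu> = of_int (\<mu> k) * lk f \<mu>"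
  by (simp add: Dv_def lookup_mapp when_def in_keys_iff)

lemma Dv_add: "Dv k (f + g) = Dv k f + Dv k g"
  by (rule poly_mapping_eqI) (simp add: lk_Dv lookup_add algebra_simps)

lemma Dv_single: "Dv k (sg \<mu> c) = sg \<mu> (of_int (\<mu> k) * c)"
  by (rule poly_mapping_eqI) (simp add: lk_Dv lookup_single when_def)

lemma Dv_mult: "Dv k (f * g) = Dv k f * g + f * Dv k g"
proof (induction f rule: laur_induct)
  case (single \<mu> c)
  show ?case
    by (induction g rule: laur_induct)
      (simp_all add: mult_single Dv_single Dv_add single_add[symmetric] algebra_simps)
qed (simp add: distrib_right Dv_add algebra_simps)

lemma Dv_1 [simp]: "Dv k 1 = 0"
  by (rule poly_mapping_eqI) (simp add: lk_Dv lookup_one when_def)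

lemma Dv_prod:
  "finite A \<Longrightarrow> Dv k (\<Prod>a\<in>A. f a) = (\<Sum>a\<in>A. Dv k (f a) * (\<Prod>b\<in>A - {a}. f b))"
proof (induction A rule: finite_induct)
  case (insert x F)
  have "Dv k (f a) * (\<Prod>b\<in>insert x F - {a}. f b) = Dv k (f a) * (\<Prod>b\<in>F - {a}. f b) * f x"
    if "a \<in> F" for a
  proof -
    have "insert x F - {a} = insert x (F - {a})" using that insert by auto
    then show ?thesis using insert by (simp add: ac_simps)
  qed
  then show ?case using insert
    by (simp add: Dv_mult sum_distrib_left ac_simps)
qed simp

text \<open>The invariant Laplacian of the torus; a monomial is an eigenvector whose eigenvalue is
  the squared norm of its exponent.\<close>

definition Lap :: "nat \<Rightarrow> laur \<Rightarrow> laur" where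
  "Lap m f = (\<Sum>k<m. Dv k (Dv k f))"

definition sqn :: "nat \<Rightarrow> wt \<Rightarrow> int" where
  "sqn m \<mu> = (\<Sum>k<m. (\<mu> k)\<^sup>2)"

lemma lk_Lap: "lk (Lap m f) \<mu> = of_int (sqn m \<mu>) * lk f \<mu>"
  by (simp add: Lap_def lookup_sum lk_Dv sqn_def sum_distrib_right power2_eq_square mult.assoc)

lemma Lap_mult: "Lap m (f * g) = Lap m f * g + 2 * (\<Sum>k<m. Dv k f * Dv k g) + f * Lap m g"
  by (simp add: Lap_def Dv_mult Dv_add sum.distrib sum_distrib_left sum_distrib_right algebra_simps)

definition bin :: "wt \<Rightarrow> laur" where
  "bin a = xp a - xp (- a)"

lemma lk_of_int_mult: "lk (of_int c * f) \<mu> = of_int c * lk f \<mu>"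
proof -
  have "lk (of_nat n * f) \<mu> = of_nat n * lk f \<mu>" for n
    by (induction n) (simp_all add: lookup_add distrib_right)
  then show ?thesis
    by (cases c rule: int_cases2) (simp_all add: lookup_uminus)
qed

lemma Dv_bin: "Dv k (bin a) = of_int (a k) * (xp a + xp (- a))"
proof (rule poly_mapping_eqI)
  fix \<mu>
  have "a k = 0" if "- a = a" using that by (metis fun_Compl_def neg_equal_zero)
  then show "lk (Dv k (bin a)) \<mu> = lk (of_int (a k) * (xp a + xp (- a))) \<mu>"
    by (auto simp: bin_def lk_Dv lk_of_int_mult lookup_add lookup_minus lookup_single when_def)
qed

text \<open>The radial part of the Casimir operator. In the cross term of the product rule,
  differentiating one binomial gives (x^\<alpha> + x^{-\<alpha>}) times a multiple of \<alpha>; the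
  hypothesis on T trades this for the missing binomial times T, so the full product factors out
  again.\<close>

lemma Lap_prod_bin:
  assumes fin: "finite A"
    and T: "\<And>a. a \<in> A \<Longrightarrow> 2 * (bin (\<alpha> a) * T a) = (xp (\<alpha> a) + xp (- \<alpha> a)) * (\<Sum>k<m. of_int (\<alpha> a k) * Dv k g)"
  shows "Lap m ((\<Prod>a\<in>A. bin (\<alpha> a)) * g) =
    Lap m (\<Prod>a\<in>A. bin (\<alpha> a)) * g + (\<Prod>a\<in>A. bin (\<alpha> a)) * (Lap m g + 4 * (\<Sum>a\<in>A. T a))"
proof -
  let ?P = "\<lambda>a. \<Prod>b\<in>A - {a}. bin (\<alpha> b)"
  have "(\<Sum>k<m. Dv k (\<Prod>a\<in>A. bin (\<alpha> a)) * Dv k g) =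
      (\<Sum>k<m. \<Sum>a\<in>A. of_int (\<alpha> a k) * (xp (\<alpha> a) + xp (- \<alpha> a)) * ?P a * Dv k g)"
    by (simp add: Dv_prod[OF fin] Dv_bin sum_distrib_right)
  also have "\<dots> = (\<Sum>a\<in>A. ?P a * ((xp (\<alpha> a) + xp (- \<alpha> a)) * (\<Sum>k<m. of_int (\<alpha> a k) * Dv k g)))"
    by (subst sum.swap) (simp add: sum_distrib_left ac_simps)
  also have "\<dots> = (\<Sum>a\<in>A. ?P a * (2 * (bin (\<alpha> a) * T a)))"
    by (rule sum.cong) (simp_all add: T)
  also have "\<dots> = (\<Sum>a\<in>A. 2 * ((bin (\<alpha> a) * ?P a) * T a))"
    by (simp add: ac_simps)
  also have "\<dots> = (\<Sum>a\<in>A. 2 * ((\<Prod>b\<in>A. bin (\<alpha> b)) * T a))"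
    by (rule sum.cong) (simp_all add: prod.remove[OF fin])
  also have "\<dots> = 2 * ((\<Prod>b\<in>A. bin (\<alpha> b)) * (\<Sum>a\<in>A. T a))"
    by (simp add: sum_distrib_left)
  finally show ?thesis
    by (simp add: Lap_mult algebra_simps)
qed

subsection \<open>Signed permutations of the variables\<close>

text \<open>The Weyl group acts only through reflections below, and these are additive involutions
  of the weight lattice.\<close>

definition invo :: "(wt \<Rightarrow> wt) \<Rightarrow> bool" where
  "invo w \<longleftrightarrow> (\<forall>\<mu>. w (w \<mu>) = \<mu>) \<and> (\<forall>\<mu> \<nu>. w (\<mu> + \<nu>) = w \<mu> + w \<nu>)"

text \<open>Coefficients are pulled back along w; as w is its own inverse, this is also the
  push-forward that applies w to each exponent.\<close>

definition twist :: "(wt \<Rightarrow> wt) \<Rightarrow> laur \<Rightarrow> laur" where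
  "twist w f = Poly_Mapping.map_key w f"

lemma invo_inj: "invo w \<Longrightarrow> inj w"
  by (metis injI invo_def)

lemma lk_twist: "invo w \<Longrightarrow> lk (twist w f) \<mu> = lk f (w \<mu>)"
  by (simp add: twist_def map_key.rep_eq invo_inj)

lemma twist_add: "invo w \<Longrightarrow> twist w (f + g) = twist w f + twist w g"
  by (rule poly_mapping_eqI) (simp add: lk_twist lookup_add)

lemma twist_diff: "invo w \<Longrightarrow> twist w (f - g) = twist w f - twist w g"
  by (rule poly_mapping_eqI) (simp add: lk_twist lookup_minus)

lemma twist_single: "invo w \<Longrightarrow> twist w (sg \<mu> c) = sg (w \<mu>) c"
  by (rule poly_mapping_eqI) (auto simp: lk_twist lookup_single when_def invo_def)

lemma invo_zero: "invo w \<Longrightarrow> w 0 = 0"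
  unfolding invo_def by (metis add_cancel_right_right)

lemma invo_uminus:
  assumes w: "invo w"
  shows "w (- \<mu>) = - w \<mu>"
proof -
  have "w (- \<mu>) + w \<mu> = w (- \<mu> + \<mu>)" using w by (simp only: invo_def)
  then have "w (- \<mu>) + w \<mu> = 0" using invo_zero[OF w] by simp
  then show ?thesis by (simp only: eq_neg_iff_add_eq_0)
qed

lemma twist_1 [simp]:
  assumes w: "invo w"
  shows "twist w 1 = 1"
  using twist_single[OF w, of 0 1] unfolding invo_zero[OF w] by simp

lemma twist_mult:
  assumes w: "invo w"
  shows "twist w (f * g) = twist w f * twist w g"
proof (induction f rule: laur_induct)
  case (single \<mu> c)
  have "w (\<mu> + \<nu>) = w \<mu> + w \<nu>" for \<nu> using w by (simp add: invo_def)
  then show ?case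
    by (induction g rule: laur_induct)
      (simp_all add: mult_single twist_single[OF w] distrib_left twist_add[OF w])
qed (simp add: distrib_right twist_add[OF w])

lemma twist_hom: "invo w \<Longrightarrow> comm_ring_hom (twist w)"
  by unfold_locales (simp_all add: twist_mult twist_add, simp add: poly_mapping_eqI lk_twist)

lemma twist_prod: "invo w \<Longrightarrow> twist w (\<Prod>a\<in>A. f a) = (\<Prod>a\<in>A. twist w (f a))"
  by (induction A rule: infinite_finite_induct) (simp_all add: twist_mult)

lemma twist_bin: "invo w \<Longrightarrow> twist w (bin a) = bin (w a)"
  unfolding bin_def by (simp only: twist_diff twist_single invo_uminus)

definition swp :: "nat \<Rightarrow> wt \<Rightarrow> wt" where
  "swp k \<mu> = \<mu> \<circ> Transposition.transpose k (Suc k)"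

definition flp :: "nat \<Rightarrow> wt \<Rightarrow> wt" where
  "flp k \<mu> = \<mu>(k := - \<mu> k)"

lemma invo_swp: "invo (swp k)"
  by (auto simp: invo_def swp_def fun_eq_iff)

lemma invo_flp: "invo (flp k)"
  by (auto simp: invo_def flp_def fun_eq_iff)

section \<open>Alternating polynomials, height and leading terms\<close>

definition alternating :: "nat \<Rightarrow> laur \<Rightarrow> bool" where
  "alternating m f \<longleftrightarrow> (\<forall>k. Suc k < m \<longrightarrow> twist (swp k) f = - f) \<and> (0 < m \<longrightarrow> twist (flp (m - 1)) f = - f)"

definition symmetric :: "nat \<Rightarrow> laur \<Rightarrow> bool" where
  "symmetric m f \<longleftrightarrow> (\<forall>k. Suc k < m \<longrightarrow> twist (swp k) f = f) \<and> (0 < m \<longrightarrow> twist (flp (m - 1)) f = f)"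

lemma alternating_mult: "alternating m f \<Longrightarrow> symmetric m g \<Longrightarrow> alternating m (f * g)"
  by (simp add: alternating_def symmetric_def twist_mult invo_swp invo_flp)

lemma alternating_diff: "alternating m f \<Longrightarrow> alternating m g \<Longrightarrow> alternating m (f - g)"
  by (simp add: alternating_def twist_diff invo_swp invo_flp)

definition sdom :: "nat \<Rightarrow> wt \<Rightarrow> bool" where
  "sdom m \<nu> \<longleftrightarrow> (\<forall>k. Suc k < m \<longrightarrow> \<nu> (Suc k) < \<nu> k) \<and> (0 < m \<longrightarrow> 0 < \<nu> (m - 1))"

text \<open>The pairing with the regular dominant vector (m, m-1, ..., 1): every positive root has
  positive height, and a simple reflection raises the height of a weight lying on the wrong side of
  its wall.\<close>

definition hgt :: "nat \<Rightarrow> wt \<Rightarrow> int" where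
  "hgt m \<nu> = (\<Sum>i<m. (int m - int i) * \<nu> i)"

lemma hgt_swp:
  assumes "Suc k < m"
  shows "hgt m (swp k \<nu>) = hgt m \<nu> + (\<nu> (Suc k) - \<nu> k)"
proof -
  let ?s = "Transposition.transpose k (Suc k)"
  have s: "?s permutes {..<m}" using assms by (intro permutes_swap_id) auto
  have "hgt m (swp k \<nu>) = (\<Sum>i<m. (int m - int (?s (?s i))) * \<nu> (?s i))"
    by (simp add: hgt_def swp_def)
  also have "\<dots> = (\<Sum>i<m. (int m - int (?s i)) * \<nu> i)"
    using sum.permute[OF s, of "\<lambda>i. (int m - int (?s i)) * \<nu> i"] by (simp add: o_def)
  finally have "hgt m (swp k \<nu>) - hgt m \<nu> = (\<Sum>i<m. (int i - int (?s i)) * \<nu> i)"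
    by (simp add: hgt_def sum_subtractf[symmetric] algebra_simps)
  also have "\<dots> = (\<Sum>i\<in>{k, Suc k}. (int i - int (?s i)) * \<nu> i)"
    using assms by (intro sum.mono_neutral_right) (auto simp: Transposition.transpose_def)
  also have "\<dots> = \<nu> (Suc k) - \<nu> k"
    by (simp add: Transposition.transpose_def algebra_simps)
  finally show ?thesis by simp
qed

lemma hgt_flp:
  assumes "0 < m"
  shows "hgt m (flp (m - 1) \<nu>) = hgt m \<nu> - 2 * \<nu> (m - 1)"
proof -
  have "hgt m (flp (m - 1) \<nu>) - hgt m \<nu> = (\<Sum>i<m. if i = m - 1 then - 2 * \<nu> (m - 1) else 0)"
    using assms unfolding hgt_def sum_subtractf[symmetric]
    by (intro sum.cong) (auto simp: flp_def of_nat_diff)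
  also have "\<dots> = - 2 * \<nu> (m - 1)" using assms by simp
  finally show ?thesis by simp
qed

text \<open>An orbit representative of maximal height in the support is strictly dominant.\<close>

lemma alternating_eq_0:
  assumes alt: "alternating m f" and dom: "\<And>\<nu>. \<nu> \<in> ks f \<Longrightarrow> sdom m \<nu> \<Longrightarrow> lk f \<nu> = 0"
  shows "f = 0"
proof (rule ccontr)
  assume "f \<noteq> 0"
  then have ne: "ks f \<noteq> {}" by simp
  have "Max (hgt m ` ks f) \<in> hgt m ` ks f" using ne by (intro Max_in) auto
  then obtain \<nu> where \<nu>: "\<nu> \<in> ks f" and "hgt m \<nu> = Max (hgt m ` ks f)" by auto
  then have max: "\<And>\<kappa>. \<kappa> \<in> ks f \<Longrightarrow> hgt m \<kappa> \<le> hgt m \<nu>" by simp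
  have sw: "lk f (swp k \<nu>) = - lk f \<nu>" if "Suc k < m" for k
    using alt that by (metis alternating_def invo_swp lk_twist lookup_uminus)
  have fl: "lk f (flp (m - 1) \<nu>) = - lk f \<nu>" if "0 < m"
    using alt that by (metis alternating_def invo_flp lk_twist lookup_uminus)
  have nz: "lk f \<nu> \<noteq> 0" using \<nu> by (simp add: in_keys_iff)
  have "\<nu> (Suc k) < \<nu> k" if k: "Suc k < m" for k
  proof (rule ccontr)
    assume "\<not> ?thesis"
    moreover have "\<nu> (Suc k) \<noteq> \<nu> k"
    proof
      assume "\<nu> (Suc k) = \<nu> k"
      then have "swp k \<nu> = \<nu>" by (auto simp: swp_def fun_eq_iff Transposition.transpose_def)
      then show False using sw[OF k] nz by simp
    qed
    ultimately have "hgt m (swp k \<nu>) > hgt m \<nu>" using hgt_swp[OF k] by simp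
    moreover have "swp k \<nu> \<in> ks f" using sw[OF k] nz by (simp add: in_keys_iff)
    ultimately show False using max by fastforce
  qed
  moreover have "0 < \<nu> (m - 1)" if k: "0 < m"
  proof (rule ccontr)
    assume "\<not> ?thesis"
    moreover have "\<nu> (m - 1) \<noteq> 0"
    proof
      assume "\<nu> (m - 1) = 0"
      then have "flp (m - 1) \<nu> = \<nu>" by (auto simp: flp_def fun_eq_iff)
      then show False using fl[OF k] nz by simp
    qed
    ultimately have "hgt m (flp (m - 1) \<nu>) > hgt m \<nu>" using hgt_flp[OF k] by simp
    moreover have "flp (m - 1) \<nu> \<in> ks f" using fl[OF k] nz by (simp add: in_keys_iff)
    ultimately show False using max by fastforce
  qed
  ultimately have "sdom m \<nu>" by (simp add: sdom_def)
  then show False using dom[OF \<nu>] nz by simp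
qed

text \<open>Monic with a single exponent of largest height. Although height only preorders the
  weights, this notion of leading term is stable under products.\<close>

definition topp :: "nat \<Rightarrow> laur \<Rightarrow> wt \<Rightarrow> bool" where
  "topp m f a \<longleftrightarrow> lk f a = 1 \<and> (\<forall>\<kappa>\<in>ks f. \<kappa> \<noteq> a \<longrightarrow> hgt m \<kappa> < hgt m a)"

lemma hgt_add: "hgt m (\<mu> + \<nu>) = hgt m \<mu> + hgt m \<nu>"
  by (simp add: hgt_def distrib_left sum.distrib)

lemma hgt_uminus: "hgt m (- \<mu>) = - hgt m \<mu>"
  by (simp add: hgt_def sum_negf)

lemma lk_mult_single: "lk (sg \<mu> c * g) \<nu> = c * lk g (\<nu> - \<mu>)"
proof (induction g rule: laur_induct)
  case (single \<kappa> d)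
  show ?case by (auto simp: mult_single lookup_single when_def)
qed (simp add: distrib_left lookup_add)

lemma lk_mult: "lk (f * g) \<nu> = (\<Sum>\<mu>\<in>ks f. lk f \<mu> * lk g (\<nu> - \<mu>))"
  by (subst laur_expand[of f]) (simp add: sum_distrib_right lookup_sum lk_mult_single)

lemma topp_mult:
  assumes f: "topp m f a" and g: "topp m g b"
  shows "topp m (f * g) (a + b)"
proof -
  have a: "a \<in> ks f" using f by (simp add: topp_def in_keys_iff)
  have "lk (f * g) (a + b) = (\<Sum>\<mu>\<in>ks f. if \<mu> = a then 1 else 0)"
    unfolding lk_mult
  proof (rule sum.cong)
    fix \<mu> assume \<mu>: "\<mu> \<in> ks f"
    show "lk f \<mu> * lk g (a + b - \<mu>) = (if \<mu> = a then 1 else 0)"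
    proof (cases "\<mu> = a")
      case True
      then show ?thesis using f g by (simp add: topp_def)
    next
      case False
      then have "hgt m \<mu> < hgt m a" using f \<mu> by (simp add: topp_def)
      moreover have "hgt m (a + b - \<mu>) + hgt m \<mu> = hgt m a + hgt m b"
        by (metis diff_add_cancel hgt_add)
      ultimately have "hgt m (a + b - \<mu>) > hgt m b" by linarith
      then have "a + b - \<mu> \<notin> ks g" using g by (auto simp: topp_def)
      then show ?thesis using False by (simp add: in_keys_iff)
    qed
  qed simp
  then have 1: "lk (f * g) (a + b) = 1" using a by simp
  have "hgt m \<kappa> < hgt m (a + b)" if \<kappa>: "\<kappa> \<in> ks (f * g)" "\<kappa> \<noteq> a + b" for \<kappa>
  proof -
    obtain x y where xy: "\<kappa> = x + y" "x \<in> ks f" "y \<in> ks g"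
      using \<kappa> keys_mult[of f g] by auto
    have "x = a \<or> hgt m x < hgt m a" "y = b \<or> hgt m y < hgt m b" "x \<noteq> a \<or> y \<noteq> b"
      using f g \<kappa> xy by (auto simp: topp_def)
    then have "hgt m x + hgt m y < hgt m a + hgt m b" by auto
    then show ?thesis by (simp add: xy(1) hgt_add)
  qed
  then show ?thesis using 1 by (simp add: topp_def)
qed

lemma topp_1: "topp m 1 0"
  by (simp add: topp_def)

lemma topp_prod:
  "(\<And>a. a \<in> A \<Longrightarrow> topp m (f a) (t a)) \<Longrightarrow> topp m (\<Prod>a\<in>A. f a) (\<Sum>a\<in>A. t a)"
  by (induction A rule: infinite_finite_induct) (auto intro: topp_mult topp_1)

lemma topp_bin: "hgt m a > 0 \<Longrightarrow> topp m (bin a) a"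
proof -
  assume a: "hgt m a > 0"
  then have "- a \<noteq> a" by (metis hgt_uminus neg_equal_zero order_less_irrefl)
  then show ?thesis using a keys_diff[of "xp a" "xp (- a)"]
    by (auto simp: topp_def bin_def lookup_minus lookup_single when_def hgt_uminus)
qed

section \<open>The root system of type B and alternating Laurent polynomials\<close>

definition ew :: "nat \<Rightarrow> wt" where
  "ew i = (\<lambda>k. if k = i then 1 else 0)"

text \<open>The weight of the \<open>i\<close>-th entry of \<open>torus_elt\<close>.\<close>

definition wtv :: "nat \<Rightarrow> nat \<Rightarrow> wt" where
  "wtv m i = (if i < m then ew i else if i = m then 0 else - ew (2 * m - i))"

definition rt :: "nat \<Rightarrow> nat \<times> nat \<Rightarrow> wt" where
  "rt m a = wtv m (fst a) - wtv m (snd a)"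

text \<open>
  The root spaces of the pairs \<open>(i, j)\<close> and \<open>(2m - j, 2m - i)\<close> agree; \<open>Phi\<close> picks one
  pair for each positive root.
\<close>

definition Phi :: "nat \<Rightarrow> (nat \<times> nat) set" where
  "Phi m = {(i, j). i < j \<and> i + j < 2 * m}"

definition Delta :: "nat \<Rightarrow> laur" where
  "Delta m = (\<Prod>a\<in>Phi m. bin (rt m a))"

definition rho2 :: "nat \<Rightarrow> wt" where
  "rho2 m = (\<lambda>k. if k < m then 2 * (int m - int k) - 1 else 0)"

definition Pr :: "nat \<Rightarrow> (nat \<times> nat) set" where
  "Pr m = {(i, j). i < j \<and> j < m}"

lemma finite_Phi [simp]: "finite (Phi m)"
  by (rule finite_subset[of _ "{..2*m} \<times> {..2*m}"]) (auto simp: Phi_def)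

lemma finite_Pr [simp]: "finite (Pr m)"
  by (rule finite_subset[of _ "{..m} \<times> {..m}"]) (auto simp: Pr_def)

text \<open>The three kinds of positive roots: \<open>(i, m)\<close> gives the short root e_i,
  \<open>(i, j)\<close> in \<open>Pr m\<close> gives e_i - e_j, and \<open>(i, 2 * m - j)\<close>
  gives e_i + e_j.\<close>

lemma Phi_eq: "Phi m = (\<lambda>i. (i, m)) ` {..<m} \<union> (Pr m \<union> (\<lambda>(i, j). (i, 2 * m - j)) ` Pr m)"
proof (rule equalityI; rule subsetI)
  fix a assume a: "a \<in> Phi m"
  obtain i j where ij: "a = (i, j)" "i < j" "i + j < 2 * m" using a by (auto simp: Phi_def)
  consider "j = m" | "j < m" | "j > m" by linarith
  then show "a \<in> (\<lambda>i. (i, m)) ` {..<m} \<union> (Pr m \<union> (\<lambda>(i, j). (i, 2 * m - j)) ` Pr m)"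
  proof cases
    case 3
    then have "(i, 2 * m - j) \<in> Pr m" "a = (\<lambda>(i, j). (i, 2 * m - j)) (i, 2 * m - j)"
      using ij by (auto simp: Pr_def)
    then show ?thesis by blast
  qed (use ij in \<open>auto simp: Pr_def\<close>)
qed (auto simp: Phi_def Pr_def)

lemma inj_on_reflect: "inj_on (\<lambda>(i, j). (i, 2 * m - j)) (Pr m)"
  by (auto simp: inj_on_def Pr_def)

lemma prod_Phi:
  "(\<Prod>a\<in>Phi m. f a) = (\<Prod>i<m. f (i, m)) * (\<Prod>(i, j)\<in>Pr m. f (i, j) * f (i, 2 * m - j))"
  for f :: "nat \<times> nat \<Rightarrow> 'a :: comm_monoid_mult"
proof -
  have "(\<Prod>a\<in>Phi m. f a) = (\<Prod>a\<in>(\<lambda>i. (i, m)) ` {..<m}. f a) *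
      ((\<Prod>a\<in>Pr m. f a) * (\<Prod>a\<in>(\<lambda>(i, j). (i, 2 * m - j)) ` Pr m. f a))"
    unfolding Phi_eq by (subst prod.union_disjoint, simp, simp, force simp: Pr_def,
        subst prod.union_disjoint, simp, simp, force simp: Pr_def, rule refl)
  also have "(\<Prod>a\<in>(\<lambda>i. (i, m)) ` {..<m}. f a) = (\<Prod>i<m. f (i, m))"
    by (subst prod.reindex) (auto simp: inj_on_def)
  also have "(\<Prod>a\<in>(\<lambda>(i, j). (i, 2 * m - j)) ` Pr m. f a) = (\<Prod>(i, j)\<in>Pr m. f (i, 2 * m - j))"
    by (subst prod.reindex[OF inj_on_reflect]) (simp add: case_prod_unfold)
  finally show ?thesis by (simp add: prod.distrib case_prod_unfold)
qed

lemma sum_Phi: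
  "(\<Sum>a\<in>Phi m. f a) = (\<Sum>i<m. f (i, m)) + (\<Sum>(i, j)\<in>Pr m. f (i, j) + f (i, 2 * m - j))"
  for f :: "nat \<times> nat \<Rightarrow> 'a :: comm_monoid_add"
proof -
  have "(\<Sum>a\<in>Phi m. f a) = (\<Sum>a\<in>(\<lambda>i. (i, m)) ` {..<m}. f a) +
      ((\<Sum>a\<in>Pr m. f a) + (\<Sum>a\<in>(\<lambda>(i, j). (i, 2 * m - j)) ` Pr m. f a))"
    unfolding Phi_eq by (subst sum.union_disjoint, simp, simp, force simp: Pr_def,
        subst sum.union_disjoint, simp, simp, force simp: Pr_def, rule refl)
  also have "(\<Sum>a\<in>(\<lambda>i. (i, m)) ` {..<m}. f a) = (\<Sum>i<m. f (i, m))"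
    by (subst sum.reindex) (auto simp: inj_on_def)
  also have "(\<Sum>a\<in>(\<lambda>(i, j). (i, 2 * m - j)) ` Pr m. f a) = (\<Sum>(i, j)\<in>Pr m. f (i, 2 * m - j))"
    by (subst sum.reindex[OF inj_on_reflect]) (simp add: case_prod_unfold)
  finally show ?thesis by (simp add: sum.distrib case_prod_unfold)
qed

lemma sum_wt_apply: "(\<Sum>a\<in>A. f a) k = (\<Sum>a\<in>A. (f a :: wt) k)"
  by (induction A rule: infinite_finite_induct) auto

lemma rt_wts: "i \<le> 2 * m \<Longrightarrow> j \<le> 2 * m \<Longrightarrow> rt m (i, j) \<in> wts m"
  by (auto simp: rt_def wtv_def wts_def ew_def)

lemma sum_rt: "(\<Sum>a\<in>Phi m. rt m a) = rho2 m"
proof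
  fix k
  have "(\<Sum>a\<in>Phi m. rt m a k) = (\<Sum>i<m. ew i k) + (\<Sum>(i, j)\<in>Pr m. 2 * ew i k)"
    unfolding sum_Phi
    by (intro arg_cong2[where f = "(+)"] sum.cong)
      (auto simp: rt_def wtv_def Pr_def)
  also have "(\<Sum>i<m. ew i k) = (if k < m then 1 else 0)"
    by (simp add: ew_def if_distrib eq_commute cong: if_cong)
  also have "(\<Sum>(i, j)\<in>Pr m. 2 * ew i k) = (if k < m then 2 * (int m - 1 - int k) else 0)"
  proof -
    have "(\<Sum>(i, j)\<in>Pr m. 2 * ew i k) = (\<Sum>(i, j)\<in>(\<lambda>j. (k, j)) ` {k<..<m}. 2)"
      by (rule sum.mono_neutral_cong_right[OF finite_Pr]) (auto simp: Pr_def ew_def)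
    also have "\<dots> = 2 * int (card {k<..<m})"
      by (subst sum.reindex) (auto simp: inj_on_def)
    finally show ?thesis by auto
  qed
  finally show "(\<Sum>a\<in>Phi m. rt m a) k = rho2 m k"
    by (auto simp: sum_wt_apply rho2_def)
qed

subsection \<open>The Weyl denominator is alternating\<close>

text \<open>The binomials of e_i - e_j and e_i + e_j multiply to a difference of two such terms
  x_i^2 + x_i^{-2}. The long roots of the Weyl denominator thus form a Vandermonde product in these
  variables.\<close>

definition Zv :: "nat \<Rightarrow> laur" where
  "Zv i = xp (ew i + ew i) + xp (- (ew i + ew i))"

lemma bin_mult_bin: "bin (ew i - ew j) * bin (ew i + ew j) = Zv i - Zv j"
proof -
  have e: "ew i - ew j + (ew i + ew j) = ew i + ew i" "ew i - ew j + - (ew i + ew j) = - (ew j + ew j)"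
     "- (ew i - ew j) + (ew i + ew j) = ew j + ew j" "- (ew i - ew j) + - (ew i + ew j) = - (ew i + ew i)"
    by simp_all
  show ?thesis unfolding bin_def Zv_def
    by (simp only: right_diff_distrib left_diff_distrib mult_single e) simp
qed

lemma Delta_eq: "Delta m = (\<Prod>i<m. bin (ew i)) * (\<Prod>(i, j)\<in>Pr m. Zv i - Zv j)"
  unfolding Delta_def prod_Phi
  by (intro arg_cong2[where f = "(*)"] prod.cong refl)
    (auto simp: rt_def wtv_def Pr_def bin_mult_bin[symmetric])

lemma swp_ew: "swp k (ew i) = ew (Transposition.transpose k (Suc k) i)"
  by (auto simp: swp_def ew_def fun_eq_iff Transposition.transpose_def)

lemma flp_ew: "flp k (ew i) = (if i = k then - ew i else ew i)"
  by (auto simp: flp_def ew_def fun_eq_iff)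

lemma invo_add: "invo w \<Longrightarrow> w (\<mu> + \<nu>) = w \<mu> + w \<nu>"
  by (simp add: invo_def)

lemma twist_Zv_swp: "twist (swp k) (Zv i) = Zv (Transposition.transpose k (Suc k) i)"
  unfolding Zv_def
  by (simp only: twist_add[OF invo_swp] twist_single[OF invo_swp] invo_add[OF invo_swp]
      invo_uminus[OF invo_swp] swp_ew)

lemma twist_Zv_flp: "twist (flp k) (Zv i) = Zv i"
  unfolding Zv_def
  by (simp only: twist_add[OF invo_flp] twist_single[OF invo_flp] invo_add[OF invo_flp]
      invo_uminus[OF invo_flp] flp_ew) (auto simp: add.commute)

lemma bin_uminus: "bin (- a) = - bin a"
  by (simp add: bin_def)

text \<open>An adjacent swap permutes the ordered pairs other than (k, k+1) among themselves and
  negates the factor of that one pair.\<close>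

lemma prod_Pr_swap:
  fixes Z :: "nat \<Rightarrow> 'a :: comm_ring_1"
  assumes k: "Suc k < m"
  defines "s \<equiv> Transposition.transpose k (Suc k)"
  shows "(\<Prod>(i, j)\<in>Pr m. Z (s i) - Z (s j)) = - (\<Prod>(i, j)\<in>Pr m. Z i - Z j)"
proof -
  let ?P = "Pr m - {(k, Suc k)}"
  have kk: "(k, Suc k) \<in> Pr m" using k by (simp add: Pr_def)
  have b: "bij_betw (\<lambda>(i, j). (s i, s j)) ?P ?P"
  proof (rule bij_betw_byWitness[where f' = "\<lambda>(i, j). (s i, s j)"])
    show "(\<lambda>(i, j). (s i, s j)) ` ?P \<subseteq> ?P" "(\<lambda>(i, j). (s i, s j)) ` ?P \<subseteq> ?P"
      using k by (auto simp: Pr_def s_def Transposition.transpose_def split: if_splits)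
  qed (auto simp: s_def)
  have "(\<Prod>(i, j)\<in>?P. Z (s i) - Z (s j)) = (\<Prod>(i, j)\<in>?P. Z i - Z j)"
    using prod.reindex_bij_betw[OF b, of "\<lambda>(i, j). Z i - Z j"] by (simp add: case_prod_unfold)
  moreover have "Z (s k) - Z (s (Suc k)) = - (Z k - Z (Suc k))" by (simp add: s_def)
  ultimately have "(\<Prod>(i, j)\<in>Pr m. Z (s i) - Z (s j)) = - (Z k - Z (Suc k)) * (\<Prod>(i, j)\<in>?P. Z i - Z j)"
    using prod.remove[OF finite_Pr kk, of "\<lambda>(i, j). Z (s i) - Z (s j)"] by simp
  then show ?thesis
    using prod.remove[OF finite_Pr kk, of "\<lambda>(i, j). Z i - Z j"]
    by (simp only: prod.case mult_minus_left)
qed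

lemma alternating_Delta: "alternating m (Delta m)"
  unfolding alternating_def
proof (intro conjI allI impI)
  fix k assume k: "Suc k < m"
  let ?s = "Transposition.transpose k (Suc k)"
  have s: "?s permutes {..<m}" using k by (intro permutes_swap_id) auto
  have "twist (swp k) (Delta m) = (\<Prod>i<m. bin (ew (?s i))) * (\<Prod>(i, j)\<in>Pr m. Zv (?s i) - Zv (?s j))"
    unfolding Delta_eq by (simp add: twist_mult[OF invo_swp] twist_prod[OF invo_swp] twist_bin[OF invo_swp]
       swp_ew case_prod_unfold twist_diff[OF invo_swp] twist_Zv_swp)
  also have "(\<Prod>i<m. bin (ew (?s i))) = (\<Prod>i<m. bin (ew i))"
    using prod.permute[OF s, of "\<lambda>i. bin (ew i)"] by (simp add: o_def)
  finally show "twist (swp k) (Delta m) = - Delta m"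
    using prod_Pr_swap[OF k, of Zv] by (simp add: Delta_eq)
next
  assume m: "0 < m"
  have "(\<Prod>i<m. bin (flp (m - 1) (ew i))) = (\<Prod>i<m. (if i = m - 1 then - 1 else 1) * bin (ew i))"
    by (intro prod.cong) (auto simp: flp_ew bin_uminus)
  also have "\<dots> = - (\<Prod>i<m. bin (ew i))"
    using m by (simp add: prod.distrib)
  finally have *: "(\<Prod>i<m. bin (flp (m - 1) (ew i))) = - (\<Prod>i<m. bin (ew i))" .
  show "twist (flp (m - 1)) (Delta m) = - Delta m"
    unfolding Delta_eq twist_mult[OF invo_flp] twist_prod[OF invo_flp] twist_bin[OF invo_flp] *
       case_prod_unfold twist_diff[OF invo_flp] twist_Zv_flp by simp
qed

subsection \<open>Exponents of products of binomials\<close>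

lemma keys_bin: "ks (bin a) \<subseteq> {a, - a}"
  unfolding bin_def using keys_diff[of "xp a" "xp (- a)"] by auto

text \<open>Expanding the product means choosing one of the two terms in each binomial; s records
  the choices.\<close>

lemma keys_prod_bin:
  assumes "finite A" "\<kappa> \<in> ks (\<Prod>a\<in>A. bin (f a))"
  shows "\<exists>s. (\<forall>a. s a = 1 \<or> s a = - 1) \<and> (\<forall>k. \<kappa> k = (\<Sum>a\<in>A. s a * f a k))"
  using assms
proof (induction A arbitrary: \<kappa>)
    case empty
    then show ?case by (auto intro!: exI[of _ "\<lambda>_. 1"])
  next
    case (insert x F)
    then obtain u v where uv: "\<kappa> = u + v" "u \<in> ks (bin (f x))" "v \<in> ks (\<Prod>a\<in>F. bin (f a))"
      using keys_mult[of "bin (f x)" "\<Prod>a\<in>F. bin (f a)"] by auto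
    obtain s where s: "\<forall>a. s a = 1 \<or> s a = - 1" "\<forall>k. v k = (\<Sum>a\<in>F. s a * f a k)"
      using insert.IH[OF uv(3)] by auto
    have "u = f x \<or> u = - f x" using uv(2) keys_bin[of "f x"] by blast
    then have "(\<forall>k. u k = 1 * f x k) \<or> (\<forall>k. u k = - 1 * f x k)" by auto
    then obtain c where c: "c = 1 \<or> c = - 1" "\<forall>k. u k = c * f x k" by blast
    have "\<forall>k. \<kappa> k = (\<Sum>a\<in>insert x F. (s(x := c)) a * f a k)"
    proof
      fix k
      have "(\<Sum>a\<in>F. (s(x := c)) a * f a k) = (\<Sum>a\<in>F. s a * f a k)"
        using insert.hyps by (intro sum.cong) auto
      then show "\<kappa> k = (\<Sum>a\<in>insert x F. (s(x := c)) a * f a k)"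
        using insert.hyps uv(1) s(2) c(2) by simp
    qed
    then show ?case using s(1) c(1) by (intro exI[of _ "s(x := c)"]) auto
qed

text \<open>The pairing with the fundamental coweight (1, ..., 1, 0, ..., 0). Comparing all these
  partial sums up to m is the dominance order, up to lattice conditions.\<close>

definition psum :: "nat \<Rightarrow> wt \<Rightarrow> int" where
  "psum k \<nu> = (\<Sum>i<k. \<nu> i)"

lemma psum_add: "psum k (\<mu> + \<nu>) = psum k \<mu> + psum k \<nu>"
  by (simp add: psum_def sum.distrib)

lemma psum_sum: "psum k (\<lambda>i. \<Sum>a\<in>A. s a * f a i) = (\<Sum>a\<in>A. s a * psum k (f a))"
  unfolding psum_def by (subst sum.swap) (simp add: sum_distrib_left)

lemma psum_rt_nonneg:
  assumes "a \<in> Phi m" "k \<le> m"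
  shows "0 \<le> psum k (rt m a)"
proof -
  have e: "psum k (ew i) = (if i < k then 1 else 0)" for i
    by (simp add: psum_def ew_def eq_commute cong: if_cong)
  have u: "psum k (- \<nu>) = - psum k \<nu>" for \<nu> by (simp add: psum_def sum_negf)
  obtain i j where ij: "a = (i, j)" "i < j" "i + j < 2 * m" using assms by (auto simp: Phi_def)
  have "psum k (rt m a) + psum k (wtv m j) = psum k (wtv m i)"
    by (simp add: psum_add[symmetric] rt_def ij(1))
  moreover have "psum k (0 :: wt) = 0" by (simp add: psum_def)
  ultimately show ?thesis using ij by (auto simp: wtv_def e u split: if_splits)
qed

text \<open>Every exponent is a signed sum of the positive roots, so it differs from 2\<rho> by
  twice a sum of some of them. This gives the dominance bound and the parity at once.\<close>

lemma keys_Delta: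
  assumes "\<kappa> \<in> ks (Delta m)"
  shows "\<kappa> \<in> wts m" "k \<le> m \<Longrightarrow> psum k \<kappa> \<le> psum k (rho2 m)" "even (\<kappa> i - rho2 m i)"
proof -
  obtain s where "\<forall>a. s a = 1 \<or> s a = - 1" "\<forall>k. \<kappa> k = (\<Sum>a\<in>Phi m. s a * rt m a k)"
    using keys_prod_bin[OF finite_Phi assms[unfolded Delta_def]] by (elim exE conjE)
  note s = this[rule_format]
  have rho: "rho2 m = (\<lambda>k. \<Sum>a\<in>Phi m. 1 * rt m a k)"
    by (auto simp: fun_eq_iff sum_rt[symmetric] sum_wt_apply)
  show "\<kappa> \<in> wts m"
    unfolding wts_def s(2)
  proof (safe intro!: sum.neutral)
    fix l a b assume "m \<le> l" "(a, b) \<in> Phi m"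
    then show "s (a, b) * rt m (a, b) l = 0"
      using rt_wts[of a m b] by (auto simp: wts_def Phi_def)
  qed
  show "psum k \<kappa> \<le> psum k (rho2 m)" if "k \<le> m"
  proof -
    have "psum k \<kappa> = (\<Sum>a\<in>Phi m. s a * psum k (rt m a))"
      using s(2) by (subst psum_sum[symmetric]) (simp add: psum_def)
    also have "\<dots> \<le> (\<Sum>a\<in>Phi m. 1 * psum k (rt m a))"
    proof (intro sum_mono mult_right_mono)
      fix a assume "a \<in> Phi m"
      then show "0 \<le> psum k (rt m a)" using psum_rt_nonneg[OF _ that] by simp
      show "s a \<le> 1" using s(1)[of a] by auto
    qed
    also have "\<dots> = psum k (rho2 m)"
      unfolding rho psum_sum by simp
    finally show ?thesis .
  qed
  have "\<kappa> i - rho2 m i = (\<Sum>a\<in>Phi m. (s a - 1) * rt m a i)"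
    unfolding rho s(2) by (simp add: sum_subtractf[symmetric] left_diff_distrib)
  also have "even \<dots>"
  proof (rule dvd_sum)
    fix a
    show "even ((s a - 1) * rt m a i)" using s(1)[of a] by auto
  qed
  finally show "even (\<kappa> i - rho2 m i)" .
qed

section \<open>The Weyl denominator as an eigenfunction of the Laplacian\<close>

lemma sqn_invariant:
  shows "Suc k < m \<Longrightarrow> sqn m (swp k \<mu>) = sqn m \<mu>" "sqn m (flp k \<mu>) = sqn m \<mu>"
proof -
  show "sqn m (flp k \<mu>) = sqn m \<mu>"
    unfolding sqn_def by (intro sum.cong) (auto simp: flp_def)
  let ?s = "Transposition.transpose k (Suc k)"
  assume "Suc k < m"
  then have s: "?s permutes {..<m}" by (intro permutes_swap_id) auto
  show "sqn m (swp k \<mu>) = sqn m \<mu>"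
    using sum.permute[OF s, of "\<lambda>i. (\<mu> i)\<^sup>2"] by (simp add: sqn_def swp_def o_def)
qed

lemma alternating_Lap:
  assumes "alternating m f"
  shows "alternating m (Lap m f - of_int c * f)"
proof -
  have "lk f (w \<mu>) = - lk f \<mu>" if "twist w f = - f" "invo w" for w \<mu>
    by (metis lk_twist lookup_uminus that)
  then have "twist w (Lap m f - of_int c * f) = - (Lap m f - of_int c * f)"
    if "twist w f = - f" "invo w" "\<And>\<mu>. sqn m (w \<mu>) = sqn m \<mu>" for w
    using that by (intro poly_mapping_eqI) (simp add: lk_twist lookup_minus lk_Lap lk_of_int_mult)
  then show ?thesis
    using assms by (simp add: alternating_def invo_swp invo_flp sqn_invariant)
qed

text \<open>Going up from the last coordinate, which is odd and positive, the entries must increase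
  strictly, and by parity in steps of at least 2.\<close>

lemma sdom_rho2_le:
  assumes "sdom m \<nu>" "\<And>i. even (\<nu> i - rho2 m i)" "i < m"
  shows "rho2 m i \<le> \<nu> i"
proof -
  have "rho2 m (m - Suc j) \<le> \<nu> (m - Suc j)" if "j < m" for j
    using that
  proof (induction j)
    case 0
    then show ?case using assms(1) by (auto simp: sdom_def rho2_def of_nat_diff)
  next
    case (Suc j)
    define k where "k = m - Suc (Suc j)"
    have k: "Suc k < m" "m - Suc j = Suc k" "k < m" using Suc.prems by (auto simp: k_def)
    have "\<nu> (Suc k) < \<nu> k" using assms(1) k by (simp add: sdom_def)
    moreover have "even (\<nu> (Suc k) - \<nu> k)"
      using assms(2)[of k] assms(2)[of "Suc k"] k by (simp add: rho2_def)
    ultimately have "\<nu> (Suc k) + 2 \<le> \<nu> k" by presburger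
    moreover have "rho2 m (Suc k) \<le> \<nu> (Suc k)" using Suc.IH Suc.prems k(2) by simp
    ultimately have "rho2 m k \<le> \<nu> k" using k by (simp add: rho2_def)
    then show ?case by (simp only: k_def)
  qed
  from this[of "m - Suc i"] show ?thesis using assms(3) by simp
qed

text \<open>A strictly dominant exponent is at least 2\<rho> in every coordinate while its
  coordinate sum is at most that of 2\<rho>. So only 2\<rho> can occur in the dominant chamber, and
  there the eigenvalue is right.\<close>

lemma Lap_Delta: "Lap m (Delta m) = of_int (sqn m (rho2 m)) * Delta m"
proof -
  have "Lap m (Delta m) - of_int (sqn m (rho2 m)) * Delta m = 0" (is "?B = 0")
  proof (rule alternating_eq_0[OF alternating_Lap[OF alternating_Delta]])
    fix \<nu> assume \<nu>: "sdom m \<nu>"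
    show "lk ?B \<nu> = 0"
    proof (cases "\<nu> \<in> ks (Delta m)")
      case True
      note K = keys_Delta[OF True]
      have le: "rho2 m i \<le> \<nu> i" if "i < m" for i
        using sdom_rho2_le[OF \<nu> K(3) that] .
      have "\<nu> = rho2 m"
      proof (rule wts_eqI[OF K(1)])
        show "rho2 m \<in> wts m" by (simp add: wts_def rho2_def)
        fix i assume i: "i < m"
        have "(\<Sum>i<m. \<nu> i - rho2 m i) \<le> 0"
          using K(2)[of m] by (simp add: psum_def sum_subtractf)
        moreover have "\<nu> i - rho2 m i \<le> (\<Sum>i<m. \<nu> i - rho2 m i)"
          using i le by (intro member_le_sum) auto
        ultimately show "\<nu> i = rho2 m i" using le[OF i] by linarith
      qed
      then show ?thesis by (simp add: lookup_minus lk_Lap lk_of_int_mult)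
    qed (simp add: lookup_minus lk_Lap lk_of_int_mult in_keys_iff)
  qed
  then show ?thesis by simp
qed

lemma hgt_rt_pos:
  assumes "a \<in> Phi m"
  shows "0 < hgt m (rt m a)"
proof -
  have e: "hgt m (ew i) = int m - int i" if "i < m" for i
  proof -
    have "hgt m (ew i) = (\<Sum>j<m. if j = i then int m - int i else 0)"
      unfolding hgt_def ew_def by (intro sum.cong) auto
    then show ?thesis using that by simp
  qed
  obtain i j where ij: "a = (i, j)" "i < j" "i + j < 2 * m" using assms by (auto simp: Phi_def)
  have "hgt m (rt m a) + hgt m (wtv m j) = hgt m (wtv m i)"
    by (simp add: hgt_add[symmetric] rt_def ij(1))
  moreover have "hgt m (0 :: wt) = 0" by (simp add: hgt_def)
  ultimately show ?thesis using ij by (auto simp: wtv_def e hgt_uminus of_nat_diff split: if_splits)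
qed

lemma topp_Delta: "topp m (Delta m) (rho2 m)"
  unfolding Delta_def sum_rt[symmetric] by (intro topp_prod topp_bin hgt_rt_pos)

subsection \<open>Alternants\<close>

definition smw :: "int \<Rightarrow> nat \<Rightarrow> wt" where
  "smw c i = (\<lambda>k. if k = i then c else 0)"

text \<open>Its determinant is the alternant of type B, with entries x_i^{l_j} - x_i^{-l_j}.\<close>

definition altm :: "nat \<Rightarrow> wt \<Rightarrow> laur mat" where
  "altm m l = mat m m (\<lambda>(i, j). bin (smw (l j) i))"

lemma swp_smw: "swp k (smw c i) = smw c (Transposition.transpose k (Suc k) i)"
  by (auto simp: swp_def smw_def fun_eq_iff Transposition.transpose_def)

lemma flp_smw: "flp k (smw c i) = (if i = k then - smw c i else smw c i)"
  by (auto simp: flp_def smw_def fun_eq_iff)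

text \<open>Simple reflections act on the matrix by row operations: a swap exchanges two rows, the
  flip negates the last one.\<close>

lemma alternating_alt: "alternating m (det (altm m l))"
  unfolding alternating_def
proof (intro conjI allI impI)
  fix k assume k: "Suc k < m"
  interpret comm_ring_hom "twist (swp k)" by (rule twist_hom[OF invo_swp])
  have "map_mat (twist (swp k)) (altm m l) = swaprows k (Suc k) (altm m l)"
    using k by (intro eq_matI) (auto simp: altm_def twist_bin[OF invo_swp] swp_smw Transposition.transpose_def)
  then show "twist (swp k) (det (altm m l)) = - det (altm m l)"
    using k det_swaprows[of k m "Suc k" "altm m l"] by (simp add: hom_det[symmetric] altm_def)
next
  assume m: "0 < m"
  interpret comm_ring_hom "twist (flp (m - 1))" by (rule twist_hom[OF invo_flp])
  have "map_mat (twist (flp (m - 1))) (altm m l) = multrow (m - 1) (- 1) (altm m l)"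
    using m by (intro eq_matI) (auto simp: altm_def twist_bin[OF invo_flp] flp_smw bin_uminus)
  moreover have "det (multrow (m - 1) (- 1) (altm m l)) = - det (altm m l)"
    using m det_multrow[of "m - 1" m "altm m l" "- 1"] by (simp add: altm_def)
  ultimately show "twist (flp (m - 1)) (det (altm m l)) = - det (altm m l)"
    unfolding hom_det[symmetric] by simp
qed

lemma det_altm:
  "det (altm m l) = (\<Sum>p\<in>{p. p permutes {0..<m}}. signof p * (\<Prod>i = 0..<m. bin (smw (l (p i)) i)))"
proof -
  have "altm m l \<in> carrier_mat m m" by (simp add: altm_def)
  then show ?thesis
    unfolding det_def'[OF \<open>altm m l \<in> carrier_mat m m\<close>]
    by (intro sum.cong arg_cong2[where f = "(*)"] prod.cong) (auto simp: altm_def permutes_in_image)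
qed

lemma keys_prod_smw:
  assumes "\<kappa> \<in> ks (\<Prod>i = 0..<m. bin (smw (c i) i))"
  shows "\<kappa> \<in> wts m" "i < m \<Longrightarrow> \<kappa> i = c i \<or> \<kappa> i = - c i"
proof -
  obtain s where "\<forall>a. s a = 1 \<or> s a = - 1" "\<forall>k. \<kappa> k = (\<Sum>i = 0..<m. s i * smw (c i) i k)"
    using keys_prod_bin[OF finite_atLeastLessThan assms] by (elim exE conjE)
  note s = this[rule_format]
  have "\<kappa> k = (if k < m then s k * c k else 0)" for k
    by (simp add: s(2) smw_def if_distrib cong: if_cong)
  then show "\<kappa> \<in> wts m" "i < m \<Longrightarrow> \<kappa> i = c i \<or> \<kappa> i = - c i"
    using s(1)[of i] by (auto simp: wts_def)
qed

lemma lk_signof: "lk (signof p * f) \<nu> = signof p * lk f \<nu>"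
  by (simp add: sign_def)

lemma sdom_pos: "sdom m \<nu> \<Longrightarrow> i < m \<Longrightarrow> 0 < \<nu> i"
proof -
  assume \<nu>: "sdom m \<nu>" and i: "i < m"
  have "0 < \<nu> (m - Suc j)" if "j < m" for j
    using that
  proof (induction j)
    case 0
    then show ?case using \<nu> by (simp add: sdom_def)
  next
    case (Suc j)
    then have "\<nu> (Suc (m - Suc (Suc j))) < \<nu> (m - Suc (Suc j))" using \<nu> by (simp add: sdom_def)
    then show ?case using Suc by (simp add: Suc_diff_Suc)
  qed
  from this[of "m - Suc i"] show ?thesis using i by simp
qed

lemma sdom_strict: "sdom m \<nu> \<Longrightarrow> i < j \<Longrightarrow> j < m \<Longrightarrow> \<nu> j < \<nu> i"
proof (induction j)
  case (Suc j)
  then have "\<nu> (Suc j) < \<nu> j" by (simp add: sdom_def)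
  then show ?case using Suc by (cases "i = j") auto
qed simp

text \<open>An increasing map satisfies p i \<ge> i, and a permutation preserves the sum of all
  indices, so equality holds throughout.\<close>

lemma permutes_increasing_id:
  fixes m :: nat
  assumes p: "p permutes {0..<m}" and inc: "\<And>i j. i < j \<Longrightarrow> j < m \<Longrightarrow> p i < p j"
  shows "p = id"
proof -
  have ge: "i \<le> p i" if "i < m" for i
    using that
  proof (induction i)
    case (Suc i)
    then show ?case using inc[of i "Suc i"] by simp
  qed simp
  have "(\<Sum>i = 0..<m. p i) = (\<Sum>i = 0..<m. i)"
    using sum.permute[OF p, of "\<lambda>i. i"] by (simp add: o_def)
  then have "\<not> (\<exists>i\<in>{0..<m}. i < p i)"
    using ge by (metis (no_types, lifting) atLeastLessThan_iff finite_atLeastLessThan less_irrefl sum_strict_mono_ex1)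
  then have "p i = i" if "i < m" for i using ge[OF that] that by (meson atLeastLessThan_iff le_less_linear order_antisym zero_le)
  then show ?thesis using p by (auto simp: fun_eq_iff permutes_def)
qed

text \<open>Positivity of the coordinates excludes the sign changes and strict decrease excludes the
  permutation: a Weyl group orbit meets the open chamber at most once.\<close>

lemma sdom_rearrange:
  assumes "sdom m \<nu>" "sdom m l" "p permutes {0..<m}" "\<And>i. i < m \<Longrightarrow> \<nu> i = l (p i) \<or> \<nu> i = - l (p i)"
  shows "p = id" "\<And>i. i < m \<Longrightarrow> \<nu> i = l i"
proof -
  have lt: "p i < m" if "i < m" for i using assms(3) that by (metis atLeastLessThan_iff permutes_in_image zero_le)
  have eq: "\<nu> i = l (p i)" if "i < m" for i
    using assms(4)[OF that] sdom_pos[OF assms(1) that] sdom_pos[OF assms(2) lt[OF that]] by linarith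
  show "p = id"
  proof (rule permutes_increasing_id[OF assms(3)])
    fix i j assume ij: "i < j" "j < m"
    then have "l (p j) < l (p i)" using sdom_strict[OF assms(1) ij] eq by simp
    then show "p i < p j"
      using sdom_strict[OF assms(2), of "p j" "p i"] lt ij by (metis less_trans not_less_iff_gr_or_eq)
  qed
  then show "\<And>i. i < m \<Longrightarrow> \<nu> i = l i" using eq by simp
qed

text \<open>In the Leibniz expansion every exponent is a signed rearrangement of l; a strictly
  dominant one must be l itself and arises from the identity permutation only.\<close>

lemma lk_alt:
  assumes l: "sdom m l" "l \<in> wts m" and \<nu>: "sdom m \<nu>"
  shows "lk (det (altm m l)) \<nu> = (if \<nu> = l then 1 else 0)"
proof -
  let ?T = "\<lambda>p. \<Prod>i = 0..<m. bin (smw (l (p i)) i)"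
  have t: "topp m (?T id) (\<Sum>i = 0..<m. smw (l i) i)"
  proof (simp, intro topp_prod topp_bin)
    fix i assume i: "i \<in> {0..<m}"
    have "hgt m (smw (l i) i) = (\<Sum>j<m. if j = i then (int m - int i) * l i else 0)"
      unfolding hgt_def smw_def by (intro sum.cong) auto
    then show "0 < hgt m (smw (l i) i)" using i sdom_pos[OF l(1)] by simp
  qed
  have "(\<Sum>i = 0..<m. smw (l i) i) = l"
  proof
    fix k
    show "(\<Sum>i = 0..<m. smw (l i) i) k = l k"
      using l(2) unfolding sum_wt_apply smw_def by (simp add: wts_def)
  qed
  with t have one: "lk (?T id) l = 1" by (simp add: topp_def)
  have z: "lk (?T p) \<nu> = 0" if p: "p permutes {0..<m}" and np: "p \<noteq> id \<or> \<nu> \<noteq> l" for p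
  proof (rule ccontr)
    assume "lk (?T p) \<nu> \<noteq> 0"
    then have k: "\<nu> \<in> ks (?T p)" by (simp add: in_keys_iff)
    note sr = sdom_rearrange[OF \<nu> l(1) p, OF keys_prod_smw(2)[OF k]]
    have "\<nu> = l" by (rule wts_eqI[OF keys_prod_smw(1)[OF k] l(2)]) (rule sr(2))
    then show False using np sr(1) by simp
  qed
  have "lk (det (altm m l)) \<nu> = (\<Sum>p\<in>{p. p permutes {0..<m}}. signof p * lk (?T p) \<nu>)"
    by (simp add: det_altm lookup_sum lk_signof)
  also have "\<dots> = (\<Sum>p\<in>{p. p permutes {0..<m}}. if p = id then (if \<nu> = l then 1 else 0) else 0)"
  proof (rule sum.cong)
    fix p assume p: "p \<in> {p. p permutes {0..<m}}"
    show "signof p * lk (?T p) \<nu> = (if p = id then (if \<nu> = l then 1 else 0) else 0)"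
    proof (cases "p = id \<and> \<nu> = l")
      case True
      then show ?thesis using one by simp
    next
      case False
      then have "lk (?T p) \<nu> = 0" using p by (intro z) auto
      then show ?thesis using False by auto
    qed
  qed simp
  also have "\<dots> = (if \<nu> = l then 1 else 0)"
    by (simp add: permutes_id finite_permutations)
  finally show ?thesis .
qed

text \<open>Abel summation: the partial sums of \<open>l - \<nu>\<close> are paired with the decreasing sequence \<open>l + \<nu>\<close>.\<close>

lemma sdom_sqn_eq:
  assumes \<nu>: "sdom m \<nu>" and l: "sdom m l" and ps: "\<And>k. k \<le> m \<Longrightarrow> psum k \<nu> \<le> psum k l"
    and sq: "sqn m \<nu> = sqn m l" and i: "i < m"
  shows "\<nu> i = l i"
proof -
  define d where "d i = l i - \<nu> i" for i
  define b where "b i = (if i < m then l i + \<nu> i else 0)" for i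
  define D where "D k = (\<Sum>i<k. d i)" for k
  have D: "D k = psum k l - psum k \<nu>" for k by (simp add: D_def d_def psum_def sum_subtractf)
  have D0: "D k \<ge> 0" if "k \<le> m" for k using ps[OF that] by (simp add: D)
  have bb: "b (Suc k) < b k" if "k < m" for k
    using that \<nu> l sdom_pos[OF \<nu> that] sdom_pos[OF l that] by (auto simp: b_def sdom_def intro!: add_strict_mono)
  have abel: "(\<Sum>i<k. d i * b i) = (\<Sum>i<k. D (Suc i) * (b i - b (Suc i))) + D k * b k" for k
    by (induction k) (simp_all add: D_def algebra_simps)
  have "(\<Sum>i<m. d i * b i) = sqn m l - sqn m \<nu>"
    unfolding sqn_def sum_subtractf[symmetric]
    by (intro sum.cong) (simp_all add: d_def b_def power2_eq_square algebra_simps)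
  then have s0: "(\<Sum>i<m. D (Suc i) * (b i - b (Suc i))) = 0"
    using sq abel[of m] by (simp add: b_def)
  have "D (Suc k) * (b k - b (Suc k)) = 0" if "k < m" for k
    using s0 that bb D0 by (subst (asm) sum_nonneg_eq_0_iff) (auto simp: less_imp_le intro!: mult_nonneg_nonneg)
  then have "D (Suc k) = 0" if "k < m" for k using bb[OF that] that by fastforce
  then have Dz: "D k = 0" if "k \<le> m" for k using that by (cases k) (auto simp: D_def)
  have "D (Suc i) = D i + d i" by (simp add: D_def)
  then have "d i = 0" using Dz[of "Suc i"] Dz[of i] i by simp
  then show ?thesis by (simp add: d_def)
qed

text \<open>An alternating polynomial is determined by its strictly dominant coefficients, and a
  strictly dominant exponent below l in the dominance order with the same norm as l is l. Both the
  denominator identity and the character formula are instances.\<close>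

theorem alternating_eq_alt:
  assumes A: "alternating m A" and keys: "ks A \<subseteq> wts m" and l: "sdom m l" "l \<in> wts m"
    and ps: "\<And>\<kappa> k. \<kappa> \<in> ks A \<Longrightarrow> k \<le> m \<Longrightarrow> psum k \<kappa> \<le> psum k l"
    and sq: "\<And>\<kappa>. \<kappa> \<in> ks A \<Longrightarrow> sqn m \<kappa> = sqn m l"
    and one: "lk A l = 1"
  shows "A = det (altm m l)"
proof -
  have "A - det (altm m l) = 0"
  proof (rule alternating_eq_0[OF alternating_diff[OF A alternating_alt]])
    fix \<nu> assume \<nu>: "sdom m \<nu>"
    have "lk A \<nu> = (if \<nu> = l then 1 else 0)"
    proof (cases "\<nu> \<in> ks A")
      case True
      have "\<nu> = l"
        using sdom_sqn_eq[OF \<nu> l(1) ps[OF True] sq[OF True]] True keys l(2) by (intro wts_eqI[where m = m]) auto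
      then show ?thesis using one by simp
    next
      case False
      then show ?thesis using one by (auto simp: in_keys_iff)
    qed
    then show "lk (A - det (altm m l)) \<nu> = 0" by (simp add: lookup_minus lk_alt[OF l \<nu>])
  qed
  then show ?thesis by simp
qed

lemma sdom_rho2: "sdom m (rho2 m)" and rho2_wts: "rho2 m \<in> wts m"
  by (auto simp: sdom_def rho2_def wts_def of_nat_diff)

text \<open>Weyl's denominator identity; all exponents have the norm of 2\<rho> because the
  denominator is an eigenfunction of the Laplacian.\<close>

lemma Delta_eq_alt: "Delta m = det (altm m (rho2 m))"
proof (rule alternating_eq_alt[OF alternating_Delta _ sdom_rho2 rho2_wts])
  show "ks (Delta m) \<subseteq> wts m" using keys_Delta(1) by blast
  show "psum k \<kappa> \<le> psum k (rho2 m)" if "\<kappa> \<in> ks (Delta m)" "k \<le> m" for \<kappa> k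
    using keys_Delta(2) that by blast
  show "lk (Delta m) (rho2 m) = 1" using topp_Delta by (simp add: topp_def)
  show "sqn m \<kappa> = sqn m (rho2 m)" if "\<kappa> \<in> ks (Delta m)" for \<kappa>
  proof -
    have "lk (Lap m (Delta m)) \<kappa> = of_int (sqn m (rho2 m)) * lk (Delta m) \<kappa>"
      by (simp add: Lap_Delta lk_of_int_mult)
    then show ?thesis using that by (simp add: lk_Lap in_keys_iff)
  qed
qed

section \<open>The special orthogonal group\<close>

lemma mat_mult_entry:
  "A \<in> carrier_mat n k \<Longrightarrow> B \<in> carrier_mat k p \<Longrightarrow> i < n \<Longrightarrow> j < p \<Longrightarrow>
    (A * B) $$ (i, j) = (\<Sum>l<k. A $$ (i, l) * B $$ (l, j))"
  by (simp add: scalar_prod_def atLeast0LessThan)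

lemma mat_vec_entry:
  "A \<in> carrier_mat n k \<Longrightarrow> v \<in> carrier_vec k \<Longrightarrow> i < n \<Longrightarrow>
    (A *\<^sub>v v) $ i = (\<Sum>l<k. A $$ (i, l) * v $ l)"
  by (simp add: scalar_prod_def atLeast0LessThan)

text \<open>The dimension 2m + 1 as a constant of its own, so that index bounds normalise to
  \<open>i \<le> 2 * m\<close> and matrix dimensions keep one form.\<close>

definition nn :: "nat \<Rightarrow> nat" where
  "nn m = 2 * m + 1"

lemma less_nn [simp]: "i < nn m \<longleftrightarrow> i \<le> 2 * m"
  by (auto simp: nn_def)

lemma sum_reflect: "(\<Sum>k<nn m. f (2 * m - k)) = (\<Sum>k<nn m. f k)"
  for f :: "nat \<Rightarrow> 'a :: comm_monoid_add"
  by (rule sum.reindex_bij_witness[of _ "\<lambda>k. 2 * m - k" "\<lambda>k. 2 * m - k"]) auto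

text \<open>The adjoint with respect to the antidiagonal form.\<close>

definition star :: "nat \<Rightarrow> complex mat \<Rightarrow> complex mat" where
  "star m A = mat (nn m) (nn m) (\<lambda>(i, j). A $$ (2 * m - j, 2 * m - i))"

lemma star_carrier [simp]: "star m A \<in> carrier_mat (nn m) (nn m)"
  by (simp add: star_def)

lemma star_entry: "i < nn m \<Longrightarrow> j < nn m \<Longrightarrow> star m A $$ (i, j) = A $$ (2 * m - j, 2 * m - i)"
  by (simp add: star_def)

lemma star_star: "A \<in> carrier_mat (nn m) (nn m) \<Longrightarrow> star m (star m A) = A"
  by (intro eq_matI) (auto simp: star_def)

lemma star_mult:
  assumes A: "A \<in> carrier_mat (nn m) (nn m)" and B: "B \<in> carrier_mat (nn m) (nn m)"
  shows "star m (A * B) = star m B * star m A"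
proof (rule eq_matI)
  fix i j assume "i < dim_row (star m B * star m A)" "j < dim_col (star m B * star m A)"
  then have ij: "i < nn m" "j < nn m" by (auto simp: star_def)
  have "star m (A * B) $$ (i, j) = (\<Sum>k<nn m. A $$ (2 * m - j, k) * B $$ (k, 2 * m - i))"
    using ij by (simp add: star_entry mat_mult_entry[OF A B] del: index_mult_mat)
  also have "\<dots> = (\<Sum>k<nn m. A $$ (2 * m - j, 2 * m - k) * B $$ (2 * m - k, 2 * m - i))"
    by (rule sum_reflect[symmetric])
  also have "\<dots> = (star m B * star m A) $$ (i, j)"
    unfolding mat_mult_entry[OF star_carrier star_carrier ij]
    by (intro sum.cong) (use ij in \<open>auto simp: star_entry\<close>)
  finally show "star m (A * B) $$ (i, j) = (star m B * star m A) $$ (i, j)" .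
qed (auto simp: star_def)

lemma star_one: "star m (1\<^sub>m (nn m)) = 1\<^sub>m (nn m)"
  by (intro eq_matI) (auto simp: star_def)

lemma antidiag_carrier: "antidiag n \<in> carrier_mat n n"
  by (simp add: antidiag_def)

lemma antidiag_entry:
  "a < nn m \<Longrightarrow> b < nn m \<Longrightarrow> antidiag (nn m) $$ (a, b) = (if a + b = 2 * m then 1 else 0)"
  by (simp add: antidiag_def) (simp add: nn_def)

lemma antidiag_square: "antidiag (nn m) * antidiag (nn m) = 1\<^sub>m (nn m)"
proof (rule eq_matI)
  fix i j assume "i < dim_row (1\<^sub>m (nn m))" "j < dim_col (1\<^sub>m (nn m))"
  then have ij: "i < nn m" "j < nn m" by auto
  have "(antidiag (nn m) * antidiag (nn m)) $$ (i, j) =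
      (\<Sum>k<nn m. if k = 2 * m - i then (if i = j then 1 else 0) else 0)"
    unfolding mat_mult_entry[OF antidiag_carrier antidiag_carrier ij]
    by (intro sum.cong) (use ij in \<open>auto simp: antidiag_entry\<close>)
  then show "(antidiag (nn m) * antidiag (nn m)) $$ (i, j) = 1\<^sub>m (nn m) $$ (i, j)"
    using ij by simp
qed (auto simp: antidiag_def)

text \<open>With the involutive antidiagonal matrix J this reads J g^T J, so the defining equation
  g^T J g = J becomes \<open>star m g * g = 1\<close>: on the group, \<open>star\<close> is
  inversion.\<close>

lemma star_eq:
  assumes g: "g \<in> carrier_mat (nn m) (nn m)"
  shows "star m g = antidiag (nn m) * (transpose_mat g * antidiag (nn m))"
proof (rule eq_matI)
  let ?J = "antidiag (nn m)"
  fix i j assume "i < dim_row (?J * (transpose_mat g * ?J))" "j < dim_col (?J * (transpose_mat g * ?J))"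
  then have ij: "i < nn m" "j < nn m" by (auto simp: antidiag_def)
  have c: "transpose_mat g * ?J \<in> carrier_mat (nn m) (nn m)" "transpose_mat g \<in> carrier_mat (nn m) (nn m)"
    using g antidiag_carrier by (metis mult_carrier_mat transpose_carrier_mat)+
  have J: "?J $$ (a, b) = (if b = 2 * m - a then 1 else 0)" "?J $$ (a, b) = (if a = 2 * m - b then 1 else 0)"
    if "a < nn m" "b < nn m" for a b
    using that by (auto simp: antidiag_entry)
  have "(?J * (transpose_mat g * ?J)) $$ (i, j) =
     (\<Sum>k<nn m. if k = 2 * m - i then (transpose_mat g * ?J) $$ (k, j) else 0)"
    unfolding mat_mult_entry[OF antidiag_carrier c(1) ij]
    by (intro sum.cong) (use ij in \<open>auto simp: J(1)\<close>)
  also have "\<dots> = (transpose_mat g * ?J) $$ (2 * m - i, j)" by simp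
  also have "\<dots> = (\<Sum>k<nn m. if k = 2 * m - j then transpose_mat g $$ (2 * m - i, k) else 0)"
  proof -
    have "2 * m - i < nn m" by simp
    from mat_mult_entry[OF c(2) antidiag_carrier this ij(2)]
    show ?thesis by (simp only:) (intro sum.cong, use ij in \<open>auto simp: J(2)\<close>)
  qed
  also have "\<dots> = star m g $$ (i, j)"
    using ij g by (simp add: star_entry)
  finally show "star m g $$ (i, j) = (?J * (transpose_mat g * ?J)) $$ (i, j)" by simp
qed (auto simp: antidiag_def star_def)

text \<open>The full orthogonal group, which contains the single reflections; these have determinant
  -1.\<close>

definition Og :: "nat \<Rightarrow> complex mat set" where
  "Og m = {g \<in> carrier_mat (nn m) (nn m). star m g * g = 1\<^sub>m (nn m)}"

lemma SO_odd_iff: "g \<in> SO_odd m \<longleftrightarrow> g \<in> Og m \<and> det g = 1"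
proof -
  let ?J = "antidiag (nn m)" and ?n = "nn m"
  have "transpose_mat g * ?J * g = ?J \<longleftrightarrow> star m g * g = 1\<^sub>m ?n" if g: "g \<in> carrier_mat ?n ?n"
  proof -
    have gT: "transpose_mat g \<in> carrier_mat ?n ?n" using g by simp
    have J: "?J \<in> carrier_mat ?n ?n" by (rule antidiag_carrier)
    have c: "transpose_mat g * ?J \<in> carrier_mat ?n ?n" "transpose_mat g * ?J * g \<in> carrier_mat ?n ?n"
      using gT J g by (metis mult_carrier_mat)+
    have *: "star m g * g = ?J * (transpose_mat g * ?J * g)"
      unfolding star_eq[OF g] by (rule assoc_mult_mat[OF J c(1) g])
    show ?thesis
    proof
      assume "transpose_mat g * ?J * g = ?J"
      then show "star m g * g = 1\<^sub>m ?n" using * antidiag_square by simp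
    next
      assume "star m g * g = 1\<^sub>m ?n"
      then have "?J * (?J * (transpose_mat g * ?J * g)) = ?J" using * J by simp
      then have "(?J * ?J) * (transpose_mat g * ?J * g) = ?J"
        using assoc_mult_mat[OF J J c(2)] by simp
      then show "transpose_mat g * ?J * g = ?J" using c(2) by (simp only: antidiag_square left_mult_one_mat)
    qed
  qed
  then show ?thesis by (auto simp: SO_odd_def[folded nn_def] Og_def)
qed

lemma Og_carrier: "g \<in> Og m \<Longrightarrow> g \<in> carrier_mat (nn m) (nn m)"
  by (simp add: Og_def)

lemma SO_carrier: "g \<in> SO_odd m \<Longrightarrow> g \<in> carrier_mat (nn m) (nn m)"
  by (simp add: SO_odd_def nn_def)

lemma Og_star: "g \<in> Og m \<Longrightarrow> star m g * g = 1\<^sub>m (nn m)" "g \<in> Og m \<Longrightarrow> g * star m g = 1\<^sub>m (nn m)"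
  by (auto simp: Og_def intro: mat_mult_left_right_inverse[OF star_carrier])

lemma Og_mult:
  assumes "g \<in> Og m" "h \<in> Og m"
  shows "g * h \<in> Og m"
proof -
  let ?n = "nn m"
  note c = Og_carrier[OF assms(1)] Og_carrier[OF assms(2)]
  have "star m (g * h) * (g * h) = star m h * (star m g * g) * h"
    unfolding star_mult[OF c] using c
    by (smt (verit) assoc_mult_mat mult_carrier_mat star_carrier)
  also have "\<dots> = star m h * h" using assms(1) c by (simp add: Og_def right_mult_one_mat[OF star_carrier])
  finally show ?thesis using assms c by (auto simp: Og_def)
qed

lemma Og_one: "1\<^sub>m (nn m) \<in> Og m"
  by (simp add: Og_def star_one)

lemma Og_inverse: "g \<in> Og m \<Longrightarrow> star m g \<in> Og m"
  using Og_star(2)[of g m] Og_carrier[of g m] by (simp add: Og_def star_star)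

lemma SO_mult: "g \<in> SO_odd m \<Longrightarrow> h \<in> SO_odd m \<Longrightarrow> g * h \<in> SO_odd m"
  by (auto simp: SO_odd_iff Og_mult det_mult[OF Og_carrier Og_carrier])

lemma SO_one: "1\<^sub>m (nn m) \<in> SO_odd m"
  by (simp add: SO_odd_iff Og_one)

lemma SO_inverse: "g \<in> SO_odd m \<Longrightarrow> star m g \<in> SO_odd m"
  using det_mult[OF star_carrier[of m g] Og_carrier[of g m]] Og_star(1)[of g m]
  by (auto simp: SO_odd_iff Og_inverse)

lemma SO_star: "g \<in> SO_odd m \<Longrightarrow> star m g * g = 1\<^sub>m (nn m)" "g \<in> SO_odd m \<Longrightarrow> g * star m g = 1\<^sub>m (nn m)"
  by (auto simp: SO_odd_iff Og_star)

subsection \<open>Reflections\<close>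

text \<open>The complex bilinear form with antidiagonal Gram matrix. It has isotropic vectors, so a
  reflection requires a check that its vector is not one of them.\<close>

definition bil :: "nat \<Rightarrow> complex vec \<Rightarrow> complex vec \<Rightarrow> complex" where
  "bil m v w = (\<Sum>k<nn m. v $ k * w $ (2 * m - k))"

definition rfl :: "nat \<Rightarrow> complex vec \<Rightarrow> complex mat" where
  "rfl m a = mat (nn m) (nn m)
     (\<lambda>(i, j). (if i = j then 1 else 0) - 2 / bil m a a * a $ i * a $ (2 * m - j))"

lemma rfl_carrier [simp]: "rfl m a \<in> carrier_mat (nn m) (nn m)"
  by (simp add: rfl_def)

lemma bil_sym: "bil m v w = bil m w v"
  unfolding bil_def by (subst sum_reflect[symmetric], rule sum.cong) auto

lemma bil_add:
  "v \<in> carrier_vec (nn m) \<Longrightarrow> w \<in> carrier_vec (nn m) \<Longrightarrow> bil m (v + w) x = bil m v x + bil m w x"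
  by (simp add: bil_def distrib_right sum.distrib)

lemma bil_minus:
  "v \<in> carrier_vec (nn m) \<Longrightarrow> w \<in> carrier_vec (nn m) \<Longrightarrow> bil m (v - w) x = bil m v x - bil m w x"
  by (simp add: bil_def left_diff_distrib sum_subtractf)

lemma bil_add_right:
  "v \<in> carrier_vec (nn m) \<Longrightarrow> w \<in> carrier_vec (nn m) \<Longrightarrow> bil m x (v + w) = bil m x v + bil m x w"
  by (simp add: bil_sym[of m x] bil_add)

lemma bil_minus_right:
  "v \<in> carrier_vec (nn m) \<Longrightarrow> w \<in> carrier_vec (nn m) \<Longrightarrow> bil m x (v - w) = bil m x v - bil m x w"
  by (simp add: bil_sym[of m x] bil_minus)

lemma rfl_apply:
  assumes w: "w \<in> carrier_vec (nn m)" and i: "i < nn m"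
  shows "(rfl m a *\<^sub>v w) $ i = w $ i - 2 / bil m a a * bil m a w * a $ i"
proof -
  have "(rfl m a *\<^sub>v w) $ i =
      (\<Sum>l<nn m. (if l = i then w $ i else 0) - 2 / bil m a a * a $ i * (a $ (2 * m - l) * w $ l))"
    unfolding mat_vec_entry[OF rfl_carrier w i]
    by (intro sum.cong) (use i in \<open>auto simp: rfl_def algebra_simps\<close>)
  also have "\<dots> = w $ i - 2 / bil m a a * a $ i * (\<Sum>l<nn m. a $ (2 * m - l) * w $ l)"
    using i by (simp only: sum_subtractf sum_distrib_left[symmetric]) simp
  also have "(\<Sum>l<nn m. a $ (2 * m - l) * w $ l) = bil m w a"
    by (simp add: bil_def mult.commute)
  finally show ?thesis by (simp add: bil_sym mult.commute mult.left_commute)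
qed

lemma rfl_fix:
  assumes "w \<in> carrier_vec (nn m)" "bil m a w = 0"
  shows "rfl m a *\<^sub>v w = w"
  using assms by (intro eq_vecI) (auto simp: rfl_apply simp del: index_mult_mat_vec, simp add: rfl_def)

lemma star_rfl: "star m (rfl m a) = rfl m a"
  by (intro eq_matI) (auto simp: star_def rfl_def)

lemma rfl_square:
  assumes a: "a \<in> carrier_vec (nn m)" "bil m a a \<noteq> 0"
  shows "rfl m a * rfl m a = 1\<^sub>m (nn m)"
proof (rule eq_matI)
  fix i j assume "i < dim_row (1\<^sub>m (nn m))" "j < dim_col (1\<^sub>m (nn m))"
  then have ij: "i < nn m" "j < nn m" by auto
  have col: "col (rfl m a) j \<in> carrier_vec (nn m)" using ij by (metis col_dim carrier_matD(1) rfl_carrier)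
  have "(rfl m a * rfl m a) $$ (i, j) = (rfl m a *\<^sub>v col (rfl m a) j) $ i"
    using ij by (simp add: rfl_def)
  also have "\<dots> = rfl m a $$ (i, j) - 2 / bil m a a * bil m a (col (rfl m a) j) * a $ i"
    using rfl_apply[OF col ij(1), of a] ij by (simp add: rfl_def)
  also have "bil m a (col (rfl m a) j) = - a $ (2 * m - j)"
  proof -
    have "bil m a (col (rfl m a) j) = (\<Sum>k<nn m. (if k = 2 * m - j then a $ (2 * m - j) else 0)
        - 2 / bil m a a * a $ (2 * m - j) * (a $ k * a $ (2 * m - k)))"
      unfolding bil_def[of m a "col (rfl m a) j"]
      by (intro sum.cong) (use ij in \<open>auto simp: rfl_def algebra_simps\<close>)
    also have "\<dots> = a $ (2 * m - j) - 2 / bil m a a * a $ (2 * m - j) * bil m a a"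
      by (simp only: sum_subtractf sum_distrib_left[symmetric] bil_def[symmetric]) simp
    finally show ?thesis using a by simp
  qed
  finally show "(rfl m a * rfl m a) $$ (i, j) = 1\<^sub>m (nn m) $$ (i, j)"
    using ij by (simp add: rfl_def)
qed (auto simp: rfl_def)

lemma rfl_Og: "a \<in> carrier_vec (nn m) \<Longrightarrow> bil m a a \<noteq> 0 \<Longrightarrow> rfl m a \<in> Og m"
  by (simp add: Og_def star_rfl rfl_square)

text \<open>The matrix determinant lemma: the bordered block matrix M is cleared by the unipotent L
  once from the left and once from the right, which yields the two sides.\<close>

lemma det_rank_one_update:
  fixes u v :: "nat \<Rightarrow> 'a :: idom"
  shows "det (mat n n (\<lambda>(i, j). (if i = j then 1 else 0) - u i * v j)) = 1 - (\<Sum>i<n. v i * u i)"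
proof -
  define U where "U = mat n 1 (\<lambda>(i, j). u i)"
  define V where "V = mat 1 n (\<lambda>(i, j). v j)"
  define X where "X = mat n n (\<lambda>(i, j). (if i = j then 1 else 0) - u i * v j)"
  define L where "L = four_block_mat (1\<^sub>m 1) (0\<^sub>m 1 n) (- U) (1\<^sub>m n)"
  define M where "M = four_block_mat (1\<^sub>m 1) V U (1\<^sub>m n)"
  have c: "U \<in> carrier_mat n 1" "V \<in> carrier_mat 1 n" "X \<in> carrier_mat n n" "- U \<in> carrier_mat n 1"
    by (auto simp: U_def V_def X_def)
  have L: "L \<in> carrier_mat (1 + n) (1 + n)" and M: "M \<in> carrier_mat (1 + n) (1 + n)"
    unfolding L_def M_def by (rule four_block_carrier_mat; simp)+
  have dL: "det L = 1"
    unfolding L_def using c by (subst det_four_block_mat_upper_right_zero[where n = 1 and m = n]) auto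
  have X: "- U * V + 1\<^sub>m n * 1\<^sub>m n = X"
    by (intro eq_matI) (auto simp: U_def V_def X_def scalar_prod_def)
  have LM: "L * M = four_block_mat (1\<^sub>m 1) V (0\<^sub>m n 1) X"
    unfolding L_def M_def
    by (subst mult_four_block_mat[where ?nr1.0 = 1 and ?n1.0 = 1 and ?n2.0 = n and ?nr2.0 = n and ?nc1.0 = 1 and ?nc2.0 = n])
      (use c X in \<open>auto intro!: cong_four_block_mat eq_matI\<close>)
  have "det (L * M) = det X"
    unfolding LM using c by (subst det_four_block_mat_lower_left_zero[where n = 1 and m = n]) auto
  then have 1: "det M = det X" using det_mult[OF L M] dL by simp
  define Y where "Y = 1\<^sub>m 1 * 1\<^sub>m 1 + V * (- U)"
  have Yc: "Y \<in> carrier_mat 1 1" using c by (auto simp: Y_def)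
  have RL: "M * L = four_block_mat Y V (0\<^sub>m n 1) (1\<^sub>m n)"
    unfolding L_def M_def
    by (subst mult_four_block_mat[where ?nr1.0 = 1 and ?n1.0 = 1 and ?n2.0 = n and ?nr2.0 = n and ?nc1.0 = 1 and ?nc2.0 = n])
      (use c in \<open>auto simp: Y_def intro!: cong_four_block_mat eq_matI\<close>)
  have "det (M * L) = det Y"
    unfolding RL using c Yc by (subst det_four_block_mat_lower_left_zero[where n = 1 and m = n]) auto
  then have "det M = det Y" using det_mult[OF M L] dL by simp
  also have "det Y = Y $$ (0, 0)" by (rule det_single[OF Yc])
  also have "\<dots> = 1 - (\<Sum>i<n. v i * u i)"
    by (simp add: Y_def U_def V_def scalar_prod_def sum_negf atLeast0LessThan)
  finally show ?thesis using 1 by (simp add: X_def)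
qed

lemma det_rfl:
  assumes a: "bil m a a \<noteq> 0"
  shows "det (rfl m a) = - 1"
proof -
  have "(\<Sum>i<nn m. a $ (2 * m - i) * (2 / bil m a a * a $ i)) = 2 / bil m a a * bil m a a"
    unfolding bil_def[of m a a] sum_distrib_left by (intro sum.cong) auto
  then show ?thesis
    using det_rank_one_update[of "nn m" "\<lambda>i. 2 / bil m a a * a $ i" "\<lambda>j. a $ (2 * m - j)"] a
    by (simp add: rfl_def)
qed

fun rprod :: "nat \<Rightarrow> complex vec list \<Rightarrow> complex mat" where
  "rprod m [] = 1\<^sub>m (nn m)"
| "rprod m (a # as) = rfl m a * rprod m as"

definition nonisos :: "nat \<Rightarrow> complex vec list \<Rightarrow> bool" where
  "nonisos m as \<longleftrightarrow> (\<forall>a\<in>set as. a \<in> carrier_vec (nn m) \<and> bil m a a \<noteq> 0)"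

lemma rprod_carrier [simp]: "rprod m as \<in> carrier_mat (nn m) (nn m)"
  by (induction as) (auto intro: mult_carrier_mat[OF rfl_carrier])

lemma rprod_snoc: "rprod m (as @ [a]) = rprod m as * rfl m a"
proof (induction as)
  case (Cons b as)
  then show ?case using assoc_mult_mat[OF rfl_carrier rprod_carrier rfl_carrier, of m b as a] by simp
qed (simp add: left_mult_one_mat[OF rfl_carrier] right_mult_one_mat[OF rfl_carrier])

lemma det_rprod: "nonisos m as \<Longrightarrow> det (rprod m as) = (- 1) ^ length as"
  by (induction as) (auto simp: nonisos_def det_mult[OF rfl_carrier rprod_carrier] det_rfl)

section \<open>The Cartan-Dieudonne theorem\<close>

lemma bil_Og:
  assumes h: "h \<in> Og m" and v: "v \<in> carrier_vec (nn m)" "w \<in> carrier_vec (nn m)"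
  shows "bil m (h *\<^sub>v v) (h *\<^sub>v w) = bil m v w"
proof -
  let ?n = "nn m"
  note hc = Og_carrier[OF h]
  have "bil m (h *\<^sub>v v) (h *\<^sub>v w) = (\<Sum>k<?n. (\<Sum>i<?n. h $$ (k, i) * v $ i) * (\<Sum>j<?n. h $$ (2 * m - k, j) * w $ j))"
    unfolding bil_def by (intro sum.cong arg_cong2[where f = "(*)"]) (auto simp: mat_vec_entry[OF hc v(1)] mat_vec_entry[OF hc v(2)] simp del: index_mult_mat_vec)
  also have "\<dots> = (\<Sum>i<?n. \<Sum>j<?n. v $ i * w $ j * (\<Sum>k<?n. h $$ (k, i) * h $$ (2 * m - k, j)))"
  proof -
    have "(\<Sum>k<nn m. (\<Sum>i<nn m. h $$ (k, i) * v $ i) * (\<Sum>j<nn m. h $$ (2 * m - k, j) * w $ j)) =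
        (\<Sum>k<nn m. \<Sum>i<nn m. \<Sum>j<nn m. v $ i * w $ j * (h $$ (k, i) * h $$ (2 * m - k, j)))"
      unfolding sum_product by (intro sum.cong) (auto simp: ac_simps)
    also have "\<dots> = (\<Sum>i<nn m. \<Sum>k<nn m. \<Sum>j<nn m. v $ i * w $ j * (h $$ (k, i) * h $$ (2 * m - k, j)))"
      by (rule sum.swap)
    also have "\<dots> = (\<Sum>i<nn m. \<Sum>j<nn m. \<Sum>k<nn m. v $ i * w $ j * (h $$ (k, i) * h $$ (2 * m - k, j)))"
      by (rule sum.cong[OF HOL.refl], rule sum.swap)
    finally show ?thesis by (simp only: sum_distrib_left)
  qed
  also have "\<dots> = (\<Sum>i<?n. \<Sum>j<?n. if j = 2 * m - i then v $ i * w $ j else 0)"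
  proof (intro sum.cong)
    fix i j assume ij: "i \<in> {..<?n}" "j \<in> {..<?n}"
    have "(\<Sum>k<?n. h $$ (k, i) * h $$ (2 * m - k, j)) = (\<Sum>k<?n. h $$ (2 * m - k, i) * h $$ (k, j))"
      by (subst sum_reflect[symmetric], intro sum.cong) auto
    also have "\<dots> = (star m h * h) $$ (2 * m - i, j)"
      using ij mat_mult_entry[OF star_carrier hc, of "2 * m - i" j] by (simp add: star_entry del: index_mult_mat)
    also have "\<dots> = (if 2 * m - i = j then 1 else 0)" using Og_star(1)[OF h] ij by simp
    finally show "v $ i * w $ j * (\<Sum>k<?n. h $$ (k, i) * h $$ (2 * m - k, j)) = (if j = 2 * m - i then v $ i * w $ j else 0)"
      by simp
  qed auto
  also have "\<dots> = bil m v w" by (simp add: bil_def)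
  finally show ?thesis .
qed

text \<open>An orthogonal basis of non-isotropic vectors.\<close>

definition ob :: "nat \<Rightarrow> nat \<Rightarrow> complex vec" where
  "ob m i = vec (nn m) (\<lambda>k. (if k = i then 1 else 0) +
     (if i < m \<and> k = 2 * m - i then 1 else if i > m \<and> k = 2 * m - i then - 1 else 0))"

lemma ob_carrier [simp]: "ob m i \<in> carrier_vec (nn m)"
  by (simp add: ob_def)

lemma bil_ob:
  assumes "i < nn m" and v: "v \<in> carrier_vec (nn m)"
  shows "bil m v (ob m i) = v $ (2 * m - i) + (if i < m then v $ i else if i > m then - v $ i else 0)"
proof -
  have "bil m v (ob m i) = (\<Sum>k<nn m. (if k = 2 * m - i then v $ (2 * m - i) else 0) +
      (if k = i then (if i < m then v $ i else if i > m then - v $ i else 0) else 0))"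
    unfolding bil_def by (intro sum.cong) (use assms in \<open>auto simp: ob_def\<close>)
  then show ?thesis using assms by (simp add: sum.distrib)
qed

lemma bil_ob_ob:
  assumes "i < nn m" "j < nn m" "i \<noteq> j"
  shows "bil m (ob m i) (ob m j) = 0"
proof (cases "j = 2 * m - i")
  case True
  then show ?thesis using assms unfolding bil_ob[OF assms(2) ob_carrier]
    by (cases i m rule: linorder_cases) (auto simp: ob_def)
next
  case False
  then have "2 * m - j \<noteq> i" "2 * m - j \<noteq> 2 * m - i" using assms by auto
  then show ?thesis using assms False unfolding bil_ob[OF assms(2) ob_carrier]
    by (simp add: ob_def)
qed

lemma bil_ob_self:
  assumes "i < nn m"
  shows "bil m (ob m i) (ob m i) \<noteq> 0"
proof (cases "i = m")
  case True
  then show ?thesis unfolding bil_ob[OF assms ob_carrier] by (simp add: ob_def)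
next
  case False
  then have "i \<noteq> 2 * m - i" "2 * m - (2 * m - i) = i" using assms by auto
  then show ?thesis using False assms unfolding bil_ob[OF assms ob_carrier]
    by (cases "i < m") (simp_all add: ob_def)
qed

lemma fix_basis_imp_one:
  assumes h: "h \<in> carrier_mat (nn m) (nn m)" and fixb: "\<And>i. i < nn m \<Longrightarrow> h *\<^sub>v ob m i = ob m i"
  shows "h = 1\<^sub>m (nn m)"
proof (rule eq_matI)
  fix k j assume "k < dim_row (1\<^sub>m (nn m))" "j < dim_col (1\<^sub>m (nn m))"
  then have kj: "k < nn m" "j < nn m" by auto
  have e: "ob m i $ k = h $$ (k, i) + (if i < m then h $$ (k, 2 * m - i) else if i > m then - h $$ (k, 2 * m - i) else 0)"
    if i: "i < nn m" for i
  proof -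
    have "ob m i $ k = (h *\<^sub>v ob m i) $ k" using fixb[OF i] by simp
    also have "\<dots> = (\<Sum>l<nn m. (if l = i then h $$ (k, i) else 0) +
        (if l = 2 * m - i then (if i < m then h $$ (k, 2 * m - i) else if i > m then - h $$ (k, 2 * m - i) else 0) else 0))"
      unfolding mat_vec_entry[OF h ob_carrier kj(1)]
      by (intro sum.cong) (use i in \<open>auto simp: ob_def\<close>)
    finally show ?thesis using i by (simp add: sum.distrib)
  qed
  show "h $$ (k, j) = 1\<^sub>m (nn m) $$ (k, j)"
  proof -
    consider "j < m" | "j = m" | "j > m" by linarith
    then show ?thesis
    proof cases
      case 1
      then have j': "m < 2 * m - j" "2 * m - (2 * m - j) = j" by auto
      with 1 have "2 * h $$ (k, j) = ob m j $ k - ob m (2 * m - j) $ k"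
        using e[OF kj(2)] e[of "2 * m - j"] by simp
      then show ?thesis using 1 kj j' by (auto simp: ob_def split: if_splits)
    next
      case 2
      then show ?thesis using e[OF kj(2)] kj by (auto simp: ob_def)
    next
      case 3
      then have j': "2 * m - j < m" "2 * m - (2 * m - j) = j" using kj by auto
      with 3 have "2 * h $$ (k, j) = ob m j $ k + ob m (2 * m - j) $ k"
        using e[OF kj(2)] e[of "2 * m - j"] kj by simp
      then show ?thesis using 3 kj j' by (auto simp: ob_def split: if_splits)
    qed
  qed
qed (use h in auto)

text \<open>Let c = h b with b the next basis vector. The norms of c - b and c + b add up to 4
  bil(b, b), so one of them is not isotropic. Reflecting in c - b sends c to b; otherwise reflecting
  in c + b and then in b does. All these vectors are orthogonal to the basis vectors already
  fixed.\<close>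

lemma cartan_dieudonne_step:
  assumes h: "h \<in> Og m" and k: "k < nn m" and fixb: "\<And>i. i < k \<Longrightarrow> h *\<^sub>v ob m i = ob m i"
  shows "\<exists>as. nonisos m as \<and> (\<forall>i\<le>k. (rprod m (rev as) * h) *\<^sub>v ob m i = ob m i)"
proof -
  let ?n = "nn m"
  define b where "b = ob m k"
  define c where "c = h *\<^sub>v b"
  have hc: "h \<in> carrier_mat ?n ?n" using Og_carrier[OF h] .
  have b: "b \<in> carrier_vec ?n" and c: "c \<in> carrier_vec ?n" using hc by (auto simp: b_def c_def)
  define q where "q = bil m b b"
  have q: "q \<noteq> 0" "bil m c c = q" using bil_Og[OF h b b] bil_ob_self[OF k] by (auto simp: q_def c_def b_def)
  have ortho: "bil m b (ob m i) = 0" "bil m c (ob m i) = 0" if "i < k" for i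
  proof -
    show "bil m b (ob m i) = 0" using that k bil_ob_ob[of k m i] by (simp add: b_def)
    then show "bil m c (ob m i) = 0" using bil_Og[OF h b ob_carrier, of i] fixb[OF that] by (simp add: c_def)
  qed
  have two: "bil m (c - b) (c - b) = 2 * q - 2 * bil m b c" "bil m (c + b) (c + b) = 2 * q + 2 * bil m b c"
    using b c q(2) bil_sym[of m c b]
    by (simp_all add: bil_minus bil_add bil_minus_right bil_add_right q_def[symmetric])
  show ?thesis
  proof (cases "bil m (c - b) (c - b) = 0")
    case False
    let ?a = "c - b"
    have "rfl m ?a *\<^sub>v c = b"
    proof (rule eq_vecI)
      fix i assume "i < dim_vec b"
      then have i: "i < ?n" using b by simp
      have "bil m ?a c = q - bil m b c" using b c q by (simp add: bil_minus)
      then have "bil m ?a ?a = 2 * bil m ?a c" using two by simp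
      then have "2 / bil m ?a ?a * bil m ?a c = 1" using False by simp
      then show "(rfl m ?a *\<^sub>v c) $ i = b $ i" using rfl_apply[OF c i, of ?a] b c i by (simp del: index_mult_mat_vec)
    qed (use b in \<open>auto simp: rfl_def\<close>)
    then have "(rprod m (rev [?a]) * h) *\<^sub>v ob m k = ob m k"
      using assoc_mult_mat_vec[OF rfl_carrier hc b, of ?a] by (simp add: b_def c_def right_mult_one_mat[OF rfl_carrier])
    moreover have "(rprod m (rev [?a]) * h) *\<^sub>v ob m i = ob m i" if "i < k" for i
      using assoc_mult_mat_vec[OF rfl_carrier hc ob_carrier, of ?a i] fixb[OF that] rfl_fix[OF ob_carrier, of m ?a i] ortho[OF that] b c
      by (simp add: right_mult_one_mat[OF rfl_carrier] bil_minus)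
    ultimately have "\<forall>i\<le>k. (rprod m (rev [?a]) * h) *\<^sub>v ob m i = ob m i" using le_neq_implies_less by blast
    then show ?thesis using False b c by (intro exI[of _ "[?a]"]) (auto simp: nonisos_def)
  next
    case True
    then have Q: "bil m (c + b) (c + b) \<noteq> 0" using two q by auto
    let ?a = "c + b"
    have s1: "rfl m ?a *\<^sub>v c = - b"
    proof (rule eq_vecI)
      fix i assume "i < dim_vec (- b)"
      then have i: "i < ?n" using b by simp
      have "bil m ?a c = q + bil m b c" using b c q by (simp add: bil_add)
      then have "bil m ?a ?a = 2 * bil m ?a c" using two by simp
      then have "2 / bil m ?a ?a * bil m ?a c = 1" using Q by simp
      then show "(rfl m ?a *\<^sub>v c) $ i = (- b) $ i" using rfl_apply[OF c i, of ?a] b c i by (simp del: index_mult_mat_vec)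
    qed (use b in \<open>auto simp: rfl_def\<close>)
    have mb: "- b \<in> carrier_vec ?n" using b by simp
    have s2: "rfl m b *\<^sub>v (- b) = b"
    proof (rule eq_vecI)
      fix i assume "i < dim_vec b"
      then have i: "i < ?n" using b by simp
      have "bil m b (- b) = - q" using b by (simp add: q_def bil_def sum_negf)
      then have "2 / bil m b b * bil m b (- b) = - 2" using q by (simp add: q_def)
      then show "(rfl m b *\<^sub>v (- b)) $ i = b $ i" using rfl_apply[OF mb i, of b] b i by (simp del: index_mult_mat_vec)
    qed (use b in \<open>auto simp: rfl_def\<close>)
    have ac: "rfl m b * rfl m ?a * h *\<^sub>v v = rfl m b *\<^sub>v (rfl m ?a *\<^sub>v (h *\<^sub>v v))" if "v \<in> carrier_vec ?n" for v
      using that hc rfl_carrier[of m b] rfl_carrier[of m ?a] by (smt (verit) assoc_mult_mat_vec mult_carrier_mat mult_mat_vec_carrier)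
    have rp: "rprod m (rev [?a, b]) = rfl m b * rfl m ?a" by (simp add: right_mult_one_mat[OF rfl_carrier])
    have "(rprod m (rev [?a, b]) * h) *\<^sub>v ob m k = ob m k"
      unfolding rp using ac[OF b] s1 s2 by (simp add: b_def c_def)
    moreover have "(rprod m (rev [?a, b]) * h) *\<^sub>v ob m i = ob m i" if "i < k" for i
      unfolding rp ac[OF ob_carrier] using fixb[OF that] rfl_fix[OF ob_carrier, of m ?a i] rfl_fix[OF ob_carrier, of m b i] ortho[OF that] b c
      by (simp add: bil_add)
    ultimately have "\<forall>i\<le>k. (rprod m (rev [?a, b]) * h) *\<^sub>v ob m i = ob m i" using le_neq_implies_less by blast
    then show ?thesis using Q q b c by (intro exI[of _ "[?a, b]"]) (auto simp: nonisos_def q_def)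
  qed
qed

lemma rprod_append: "rprod m (as @ bs) = rprod m as * rprod m bs"
proof (induction as)
  case (Cons a as)
  then show ?case using assoc_mult_mat[OF rfl_carrier rprod_carrier rprod_carrier, of m a as bs] by simp
qed (simp add: left_mult_one_mat[OF rprod_carrier])

lemma rprod_rev: "nonisos m as \<Longrightarrow> rprod m as * rprod m (rev as) = 1\<^sub>m (nn m)"
proof (induction as)
  case (Cons a as)
  let ?n = "nn m"
  have "rprod m (a # as) * rprod m (rev (a # as)) = rfl m a * (rprod m as * rprod m (rev as)) * rfl m a"
    by (simp add: rprod_snoc) (smt (verit) assoc_mult_mat mult_carrier_mat rfl_carrier rprod_carrier)
  then show ?case using Cons by (simp add: nonisos_def right_mult_one_mat[OF rfl_carrier] rfl_square)
qed (simp add: nonisos_def)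

lemma rprod_Og: "nonisos m as \<Longrightarrow> rprod m as \<in> Og m"
  by (induction as) (auto simp: nonisos_def Og_one intro: Og_mult rfl_Og)

theorem cartan_dieudonne:
  assumes g: "g \<in> Og m"
  obtains as where "nonisos m as" "g = rprod m as"
proof -
  let ?n = "nn m"
  have "\<exists>as h. nonisos m as \<and> h \<in> Og m \<and> g = rprod m as * h \<and> (\<forall>i<k. h *\<^sub>v ob m i = ob m i)" if "k \<le> ?n" for k
    using that
  proof (induction k)
    case 0
    show ?case using g Og_carrier[OF g]
      by (intro exI[of _ "[]"] exI[of _ g]) (auto simp: nonisos_def)
  next
    case (Suc k)
    then obtain as h where ih: "nonisos m as" "h \<in> Og m" "g = rprod m as * h" "\<forall>i<k. h *\<^sub>v ob m i = ob m i"
      by auto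
    obtain bs where bs: "nonisos m bs" "\<forall>i\<le>k. (rprod m (rev bs) * h) *\<^sub>v ob m i = ob m i"
      using cartan_dieudonne_step[OF ih(2), of k] Suc.prems ih(4) by (auto simp: nn_def)
    have hc: "h \<in> carrier_mat ?n ?n" using Og_carrier[OF ih(2)] .
    have "rprod m (as @ bs) * (rprod m (rev bs) * h) = rprod m as * (rprod m bs * rprod m (rev bs)) * h"
      unfolding rprod_append using hc by (smt (verit) assoc_mult_mat mult_carrier_mat rprod_carrier)
    also have "\<dots> = g" using ih(3) rprod_rev[OF bs(1)] by (simp add: right_mult_one_mat[OF rprod_carrier])
    finally have "g = rprod m (as @ bs) * (rprod m (rev bs) * h)" by simp
    moreover have "nonisos m (as @ bs)" "nonisos m (rev bs)" using ih(1) bs(1) by (auto simp: nonisos_def)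
    ultimately show ?case using bs(2) Og_mult[OF rprod_Og ih(2)] by (metis less_Suc_eq_le)
  qed
  then obtain as h where *: "nonisos m as" "h \<in> Og m" "g = rprod m as * h" "\<forall>i<?n. h *\<^sub>v ob m i = ob m i"
    by blast
  then have "h = 1\<^sub>m ?n" using fix_basis_imp_one[OF Og_carrier] by blast
  then show thesis using * that[of as] by (simp add: right_mult_one_mat[OF rprod_carrier])
qed

section \<open>Density of the big cell\<close>

lemma polyfun_sum: "(\<And>i. i \<in> I \<Longrightarrow> polyfun n (f i)) \<Longrightarrow> polyfun n (\<lambda>g. \<Sum>i\<in>I. f i g)"
  by (induction I rule: infinite_finite_induct) (auto intro: polyfun.intros)

lemma polyfun_prod: "(\<And>i. i \<in> I \<Longrightarrow> polyfun n (f i)) \<Longrightarrow> polyfun n (\<lambda>g. \<Prod>i\<in>I. f i g)"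
  by (induction I rule: infinite_finite_induct) (auto intro: polyfun.intros)

lemma polyfun_mult_left:
  assumes "polyfun n f" and A: "A \<in> carrier_mat n n"
  shows "\<exists>f'. polyfun n f' \<and> (\<forall>g\<in>carrier_mat n n. f' g = f (A * g))"
  using assms(1)
proof induction
  case (polyfun_const c)
  then show ?case by (intro exI[of _ "\<lambda>_. c"]) (auto intro: polyfun.intros)
next
  case (polyfun_entry i j)
  have "polyfun n (\<lambda>g. \<Sum>l<n. A $$ (i, l) * g $$ (l, j))"
    using polyfun_entry by (intro polyfun_sum polyfun.intros) auto
  then show ?case using polyfun_entry
    by (intro exI[of _ "\<lambda>g. \<Sum>l<n. A $$ (i, l) * g $$ (l, j)"]) (auto simp: mat_mult_entry[OF A] simp del: index_mult_mat)
next
  case (polyfun_add f h)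
  then obtain f' h' where "polyfun n f'" "polyfun n h'" "\<forall>g\<in>carrier_mat n n. f' g = f (A * g)"
    "\<forall>g\<in>carrier_mat n n. h' g = h (A * g)" by auto
  then show ?case by (intro exI[of _ "\<lambda>g. f' g + h' g"]) (auto intro: polyfun.intros)
next
  case (polyfun_mult f h)
  then obtain f' h' where "polyfun n f'" "polyfun n h'" "\<forall>g\<in>carrier_mat n n. f' g = f (A * g)"
    "\<forall>g\<in>carrier_mat n n. h' g = h (A * g)" by auto
  then show ?case by (intro exI[of _ "\<lambda>g. f' g * h' g"]) (auto intro: polyfun.intros)
qed

definition lead :: "nat \<Rightarrow> complex mat \<Rightarrow> complex mat" where
  "lead k g = mat k k (\<lambda>(i, j). g $$ (i, j))"

text \<open>If this product of all leading principal minors is nonzero, the matrix factors as lower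
  unipotent times diagonal times upper unipotent.\<close>

definition minors :: "nat \<Rightarrow> complex mat \<Rightarrow> complex" where
  "minors n g = (\<Prod>k\<in>{1..n}. det (lead k g))"

lemma polyfun_minors: "polyfun n (minors n)"
proof -
  have *: "minors n g = (\<Prod>k\<in>{1..n}. \<Sum>p\<in>{p. p permutes {0..<k}}. signof p * (\<Prod>i\<in>{0..<k}. g $$ (i, p i)))" for g
    unfolding minors_def
  proof (rule prod.cong)
    fix k
    have "lead k g \<in> carrier_mat k k" by (simp add: lead_def)
    then show "det (lead k g) = (\<Sum>p\<in>{p. p permutes {0..<k}}. signof p * (\<Prod>i\<in>{0..<k}. g $$ (i, p i)))"
      by (subst det_def') (auto simp: lead_def permutes_in_image intro!: sum.cong prod.cong)
  qed simp
  show ?thesis unfolding *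
  proof (intro polyfun_prod polyfun_sum polyfun_mult polyfun_const)
    fix k p i assume k: "k \<in> {1..n}" and p: "p \<in> {p. p permutes {0..<k}}" and i: "i \<in> {0..<k}"
    then have "p i < k" using permutes_in_image[of p "{0..<k}" i] by auto
    then show "polyfun n (\<lambda>g. g $$ (i, p i))" using k i by (intro polyfun_entry) auto
  qed
qed

text \<open>Clearing denominators: the entries of M are rational functions with common denominator
  q, so a high enough power of q makes f(M z) a polynomial in z.\<close>

lemma polyfun_rational_curve:
  assumes "polyfun n f"
    and "\<And>i j z. i < n \<Longrightarrow> j < n \<Longrightarrow> poly q z \<noteq> 0 \<Longrightarrow> poly q z * M z $$ (i, j) = poly (r i j) z"
  shows "\<exists>D p. \<forall>z. poly q z \<noteq> 0 \<longrightarrow> poly q z ^ D * f (M z) = poly p z"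
  using assms(1)
proof induction
  case (polyfun_const c)
  show ?case by (intro exI[of _ 0] exI[of _ "[:c:]"]) simp
next
  case (polyfun_entry i j)
  then show ?case using assms(2)[of i j] by (intro exI[of _ 1] exI[of _ "r i j"]) simp
next
  case (polyfun_add f h)
  then obtain D p E s where *: "\<forall>z. poly q z \<noteq> 0 \<longrightarrow> poly q z ^ D * f (M z) = poly p z"
    "\<forall>z. poly q z \<noteq> 0 \<longrightarrow> poly q z ^ E * h (M z) = poly s z" by auto
  have "\<forall>z. poly q z \<noteq> 0 \<longrightarrow> poly q z ^ (D + E) * (f (M z) + h (M z)) = poly (p * q ^ E + s * q ^ D) z"
    using * by (auto simp: power_add algebra_simps poly_power)
  then show ?case by blast
next
  case (polyfun_mult f h)
  then obtain D p E s where *: "\<forall>z. poly q z \<noteq> 0 \<longrightarrow> poly q z ^ D * f (M z) = poly p z"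
    "\<forall>z. poly q z \<noteq> 0 \<longrightarrow> poly q z ^ E * h (M z) = poly s z" by auto
  have "\<forall>z. poly q z \<noteq> 0 \<longrightarrow> poly q z ^ (D + E) * (f (M z) * h (M z)) = poly (p * s) z"
    using * by (auto simp: power_add algebra_simps)
  then show ?case by blast
qed

text \<open>
  The rational curve $z \mapsto s_a s_{a + z (b - a)} g$ joins \<open>g\<close> to $s_a s_b g$ inside the
  group and starts in the big cell, so it meets the big cell generically.
\<close>

lemma vanish_translate:
  assumes f: "polyfun (nn m) f" and van: "\<And>g. g \<in> SO_odd m \<Longrightarrow> minors (nn m) g \<noteq> 0 \<Longrightarrow> f g = 0"
    and a: "a \<in> carrier_vec (nn m)" "bil m a a \<noteq> 0" and b: "b \<in> carrier_vec (nn m)" "bil m b b \<noteq> 0"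
    and g: "g \<in> SO_odd m" "minors (nn m) g \<noteq> 0"
  shows "f (rfl m a * rfl m b * g) = 0"
proof -
  let ?n = "nn m"
  \<comment> \<open>The line from a at z = 0 to b at z = 1; \<open>bp\<close> gives its coordinates
    as polynomials in z and \<open>q\<close> its norm, the denominator of the reflection.\<close>
  define bz where "bz z = vec ?n (\<lambda>i. a $ i + z * (b $ i - a $ i))" for z
  define bp where "bp i = [:a $ i, b $ i - a $ i:]" for i
  define q where "q = (\<Sum>k<?n. bp k * bp (2 * m - k))"
  have bzc: "bz z \<in> carrier_vec ?n" for z by (simp add: bz_def)
  have bpz: "poly (bp i) z = bz z $ i" if "i < ?n" for i z using that by (simp add: bp_def bz_def)
  have q: "poly q z = bil m (bz z) (bz z)" for z
    by (simp add: q_def bil_def poly_sum bpz)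
  have bz0: "bz 0 = a" using a by (intro eq_vecI) (auto simp: bz_def)
  have bz1: "bz 1 = b" using b by (intro eq_vecI) (auto simp: bz_def)
  define N where "N z = rfl m (bz z) * g" for z
  define M where "M z = rfl m a * N z" for z
  have gc: "g \<in> carrier_mat ?n ?n" by (rule SO_carrier[OF g(1)])
  have Nc: "N z \<in> carrier_mat ?n ?n" for z unfolding N_def by (rule mult_carrier_mat[OF rfl_carrier gc])
  have Mc: "M z \<in> carrier_mat ?n ?n" for z unfolding M_def by (rule mult_carrier_mat[OF rfl_carrier Nc])
  define rN where "rN i j = q * [:g $$ (i, j):] - [:2:] * (\<Sum>k<?n. bp k * [:g $$ (2 * m - k, j):]) * bp i" for i j
  have rN: "poly q z * N z $$ (i, j) = poly (rN i j) z" if "i < ?n" "j < ?n" "poly q z \<noteq> 0" for i j z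
  proof -
    have col: "col g j \<in> carrier_vec ?n" by (rule col_carrier_vec[OF that(2) gc])
    have "N z $$ (i, j) = (rfl m (bz z) *\<^sub>v col g j) $ i"
      using that gc by (simp add: N_def rfl_def)
    also have "\<dots> = g $$ (i, j) - 2 / bil m (bz z) (bz z) * bil m (bz z) (col g j) * bz z $ i"
      using rfl_apply[OF col that(1)] that gc by (simp del: index_mult_mat_vec)
    finally have "poly q z * N z $$ (i, j) = poly q z * g $$ (i, j) - 2 * bil m (bz z) (col g j) * bz z $ i"
      using that(3) by (simp add: q field_simps)
    moreover have "bil m (bz z) (col g j) = (\<Sum>k<?n. bz z $ k * g $$ (2 * m - k, j))"
      unfolding bil_def by (intro sum.cong) (use that gc in auto)
    ultimately show ?thesis using that by (simp add: rN_def poly_sum bpz mult.commute)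
  qed
  define r where "r i j = (\<Sum>l<?n. [:rfl m a $$ (i, l):] * rN l j)" for i j
  have r: "poly q z * M z $$ (i, j) = poly (r i j) z" if "i < ?n" "j < ?n" "poly q z \<noteq> 0" for i j z
  proof -
    have "poly q z * M z $$ (i, j) = (\<Sum>l<?n. rfl m a $$ (i, l) * (poly q z * N z $$ (l, j)))"
      using that unfolding M_def mat_mult_entry[OF rfl_carrier Nc that(1,2)] sum_distrib_left by (simp only: ac_simps)
    also have "\<dots> = poly (r i j) z"
      unfolding r_def poly_sum by (intro sum.cong) (use that rN in auto)
    finally show ?thesis .
  qed
  obtain D p where p: "\<And>z. poly q z \<noteq> 0 \<Longrightarrow> poly q z ^ D * f (M z) = poly p z"
    using polyfun_rational_curve[OF f r] by blast
  obtain E s where s: "\<And>z. poly q z \<noteq> 0 \<Longrightarrow> poly q z ^ E * minors ?n (M z) = poly s z"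
    using polyfun_rational_curve[OF polyfun_minors r] by blast
  \<comment> \<open>Where q is nonzero the curve lies in the group, so f or the minors vanish there.
    The product of three polynomials is thus zero; q and s are nonzero at z = 0, so p = 0, and
    evaluation at z = 1 gives the claim.\<close>
  have "poly (q * p * s) z = 0" for z
  proof (cases "poly q z = 0")
    case False
    then have bzn: "bil m (bz z) (bz z) \<noteq> 0" by (simp add: q)
    have "rfl m a * (rfl m (bz z)) \<in> SO_odd m"
      using rfl_Og[OF a] rfl_Og[OF bzc bzn] det_rfl[OF a(2)] det_rfl[OF bzn]
      by (simp add: SO_odd_iff Og_mult det_mult[OF rfl_carrier rfl_carrier])
    then have "rfl m a * (rfl m (bz z)) * g \<in> SO_odd m" by (rule SO_mult[OF _ g(1)])
    then have "M z \<in> SO_odd m" unfolding M_def N_def using assoc_mult_mat[OF rfl_carrier rfl_carrier gc] by metis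
    then have "f (M z) = 0 \<or> minors ?n (M z) = 0" using van by blast
    then show ?thesis using p[OF False] s[OF False] by auto
  qed simp
  then have z: "q * p * s = 0" using poly_all_0_iff_0 by blast
  have q0: "poly q 0 \<noteq> 0" "poly q 1 \<noteq> 0" using a b by (simp_all add: q bz0 bz1)
  have "M 0 = g"
    unfolding M_def N_def bz0 using assoc_mult_mat[OF rfl_carrier rfl_carrier gc, of a a] rfl_square[OF a] gc by simp
  then have "poly s 0 \<noteq> 0" using s[OF q0(1)] q0 g(2) by auto
  then have "s \<noteq> 0" "q \<noteq> 0" using q0 by auto
  then have "p = 0" using z by simp
  then have "f (M 1) = 0" using p[OF q0(2)] q0 by simp
  then show ?thesis
    unfolding M_def N_def bz1 using assoc_mult_mat[OF rfl_carrier rfl_carrier gc, of a b] by simp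
qed

text \<open>Reflections are peeled off in pairs, which keeps the determinant equal to 1: f is
  replaced by its left translate by the first two, which vanishes on the big cell as well.\<close>

lemma vanish_rprod:
  assumes "polyfun (nn m) f" and "\<And>g. g \<in> SO_odd m \<Longrightarrow> minors (nn m) g \<noteq> 0 \<Longrightarrow> f g = 0"
    and "nonisos m as" "even (length as)" and "g \<in> SO_odd m" "minors (nn m) g \<noteq> 0"
  shows "f (rprod m as * g) = 0"
  using assms
proof (induction as arbitrary: f rule: induct_list012)
  case 1
  then show ?case using SO_carrier[of g m] by simp
next
  case (3 a b as)
  have gc: "g \<in> carrier_mat (nn m) (nn m)" by (rule SO_carrier[OF 3(7)])
  let ?A = "rfl m a * rfl m b"
  have A: "?A \<in> carrier_mat (nn m) (nn m)" by (rule mult_carrier_mat[OF rfl_carrier rfl_carrier])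
  obtain f' where f': "polyfun (nn m) f'" "\<forall>g\<in>carrier_mat (nn m) (nn m). f' g = f (?A * g)"
    using polyfun_mult_left[OF 3(3) A] by blast
  have van': "f' h = 0" if h: "h \<in> SO_odd m" "minors (nn m) h \<noteq> 0" for h
  proof -
    have "f (?A * h) = 0"
      using 3(5) by (intro vanish_translate[OF 3(3) _ _ _ _ _ h] 3(4)) (auto simp: nonisos_def)
    then show ?thesis using f'(2) SO_carrier[OF h(1)] by simp
  qed
  have "nonisos m as" "even (length as)" using 3(5,6) by (auto simp: nonisos_def)
  from 3(1)[OF f'(1) van' this 3(7,8)] have "f' (rprod m as * g) = 0" .
  moreover have "rprod m (a # b # as) * g = ?A * (rprod m as * g)"
    using gc A by simp (smt (verit) assoc_mult_mat mult_carrier_mat rfl_carrier rprod_carrier)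
  ultimately show ?case using f'(2) mult_carrier_mat[OF rprod_carrier gc] by simp
qed auto

lemma minors_one: "minors n (1\<^sub>m n) = 1"
proof -
  have "lead k (1\<^sub>m n) = 1\<^sub>m k" if "k \<le> n" for k using that by (intro eq_matI) (auto simp: lead_def)
  then show ?thesis by (simp add: minors_def)
qed

text \<open>The element is a product of reflections, an even number of them because its determinant
  is 1, applied to the identity, which lies in the big cell.\<close>

theorem vanish_SO:
  assumes f: "polyfun (nn m) f" and van: "\<And>g. g \<in> SO_odd m \<Longrightarrow> minors (nn m) g \<noteq> 0 \<Longrightarrow> f g = 0"
    and g: "g \<in> SO_odd m"
  shows "f g = 0"
proof -
  have gO: "g \<in> Og m" and d: "det g = 1" using g by (auto simp: SO_odd_iff)
  obtain as where as: "nonisos m as" "g = rprod m as" using cartan_dieudonne[OF gO] by blast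
  have "(- 1 :: complex) ^ length as = 1" using d det_rprod[OF as(1)] as(2) by simp
  then have "even (length as)" by (cases "even (length as)") auto
  then have "f (rprod m as * 1\<^sub>m (nn m)) = 0"
    using vanish_rprod[OF f van as(1) _ SO_one] by (simp add: minors_one)
  then show ?thesis using as(2) right_mult_one_mat[OF rprod_carrier] by simp
qed

subsection \<open>Triangular factorisation\<close>

definition lower_uni :: "nat \<Rightarrow> complex mat \<Rightarrow> bool" where
  "lower_uni n L \<longleftrightarrow> L \<in> carrier_mat n n \<and> (\<forall>i<n. L $$ (i, i) = 1) \<and> (\<forall>i j. i < j \<and> j < n \<longrightarrow> L $$ (i, j) = 0)"

definition upper_uni :: "nat \<Rightarrow> complex mat \<Rightarrow> bool" where
  "upper_uni n U \<longleftrightarrow> U \<in> carrier_mat n n \<and> (\<forall>i<n. U $$ (i, i) = 1) \<and> (\<forall>i j. j < i \<and> i < n \<longrightarrow> U $$ (i, j) = 0)"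

lemma prod_list_diag: "A \<in> carrier_mat n n \<Longrightarrow> prod_list (diag_mat A) = (\<Prod>i<n. A $$ (i, i))"
  by (simp add: prod_list_diag_prod atLeast0LessThan)

lemma det_lower_uni: "lower_uni n L \<Longrightarrow> det L = 1"
  by (subst det_lower_triangular[of n]) (auto simp: lower_uni_def prod_list_diag)

lemma det_upper_uni: "upper_uni n U \<Longrightarrow> det U = 1"
  by (subst det_upper_triangular[of _ n]) (auto simp: upper_uni_def prod_list_diag)

lemma det_nonzero_inverse:
  assumes "A \<in> carrier_mat n n" "det A \<noteq> (0 :: complex)"
  obtains B where "B \<in> carrier_mat n n" "A * B = 1\<^sub>m n" "B * A = 1\<^sub>m n"
  using det_non_zero_imp_unit[OF assms, of undefined] by (auto simp: Units_def ring_mat_simps)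

lemma triangular_factorisation:
  assumes "A \<in> carrier_mat n n" "\<And>k. k \<in> {1..n} \<Longrightarrow> det (lead k A) \<noteq> 0"
  shows "\<exists>L d U. lower_uni n L \<and> upper_uni n U \<and> A = L * mat_diag n d * U"
  using assms
proof (induction n arbitrary: A)
  case 0
  then show ?case
    by (intro exI[of _ "1\<^sub>m 0"] exI[of _ "\<lambda>_. 1"]) (auto simp: lower_uni_def upper_uni_def)
next
  case (Suc n)
  obtain A1 b c s where sp: "split_block A n n = (A1, b, c, s)" by (metis prod_cases4)
  have sc: "A1 \<in> carrier_mat n n" "b \<in> carrier_mat n 1" "c \<in> carrier_mat 1 n" "s \<in> carrier_mat 1 1"
    and A: "A = four_block_mat A1 b c s"
    using split_block[OF sp, of 1 1] Suc.prems(1) by auto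
  have lead: "lead k A1 = lead k A" if "k \<le> n" for k
    using that sc by (intro eq_matI) (auto simp: lead_def A)
  then have "\<And>k. k \<in> {1..n} \<Longrightarrow> det (lead k A1) \<noteq> 0" using Suc.prems(2) by auto
  then obtain L d U where ih: "lower_uni n L" "upper_uni n U" "A1 = L * mat_diag n d * U"
    using Suc.IH[OF sc(1)] by blast
  let ?D = "mat_diag n d"
  have LU: "L \<in> carrier_mat n n" "U \<in> carrier_mat n n" "?D \<in> carrier_mat n n"
    using ih by (auto simp: lower_uni_def upper_uni_def)
  have "det A1 \<noteq> 0"
  proof (cases "n = 0")
    case True
    then show ?thesis using sc by simp
  next
    case False
    have "lead n A1 = A1" using sc by (intro eq_matI) (auto simp: lead_def)
    then show ?thesis using Suc.prems(2)[of n] lead[of n] False by simp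
  qed
  moreover have "det A1 = det ?D"
    unfolding ih(3) using LU det_mult[OF mult_carrier_mat[OF LU(1,3)] LU(2)] det_mult[OF LU(1,3)]
    by (simp only: det_lower_uni[OF ih(1)] det_upper_uni[OF ih(2)] mult_1 mult_1_right)
  ultimately have dD: "det ?D \<noteq> 0" by simp
  obtain P where P: "P \<in> carrier_mat n n" "(L * ?D) * P = 1\<^sub>m n"
    using det_nonzero_inverse[of "L * ?D" n] LU dD det_mult[OF LU(1,3)] ih by (metis det_lower_uni mult_1 mult_carrier_mat)
  obtain Q where Q: "Q \<in> carrier_mat n n" "Q * (?D * U) = 1\<^sub>m n"
    using det_nonzero_inverse[of "?D * U" n] LU dD det_mult[OF LU(3,2)] ih by (metis det_upper_uni mult.right_neutral mult_carrier_mat)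
  define Y where "Y = P * b"
  define Z where "Z = c * Q"
  have YZ: "Y \<in> carrier_mat n 1" "Z \<in> carrier_mat 1 n" using P Q sc by (auto simp: Y_def Z_def)
  have LDY: "L * ?D * Y = b"
  proof -
    have "L * ?D * Y = (L * ?D * P) * b" unfolding Y_def using LU P(1) sc by (smt (verit) assoc_mult_mat mult_carrier_mat)
    then show ?thesis using P sc by simp
  qed
  have ZDU: "Z * (?D * U) = c"
  proof -
    have "Z * (?D * U) = c * (Q * (?D * U))" unfolding Z_def using LU Q(1) sc by (smt (verit) assoc_mult_mat mult_carrier_mat)
    then show ?thesis using Q sc by simp
  qed
  \<comment> \<open>The Schur complement: since L D Y = b and Z D U = c, the product Z D Y is the
    correction to be subtracted from the corner entry.\<close>
  define e where "e = s $$ (0, 0) - (Z * ?D * Y) $$ (0, 0)"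
  define L2 where "L2 = four_block_mat L (0\<^sub>m n 1) Z (1\<^sub>m 1)"
  define U2 where "U2 = four_block_mat U Y (0\<^sub>m 1 n) (1\<^sub>m 1)"
  define D2 where "D2 = four_block_mat ?D (0\<^sub>m n 1) (0\<^sub>m 1 n) (mat 1 1 (\<lambda>_. e))"
  have D2: "D2 = mat_diag (Suc n) (\<lambda>i. if i < n then d i else e)"
    unfolding D2_def mat_diag_def by (intro eq_matI) auto
  have e1: "mat 1 1 (\<lambda>_. e) \<in> carrier_mat 1 1" by simp
  have "L2 * D2 = four_block_mat (L * ?D) (0\<^sub>m n 1) (Z * ?D) (mat 1 1 (\<lambda>_. e))"
    unfolding L2_def D2_def
    by (subst mult_four_block_mat[OF LU(1) _ YZ(2) _ LU(3)]) (use LU YZ in \<open>auto intro!: cong_four_block_mat\<close>)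
  moreover have LD: "L * ?D \<in> carrier_mat n n" "Z * ?D \<in> carrier_mat 1 n" using LU YZ by auto
  ultimately have "L2 * D2 * U2 = four_block_mat (L * ?D * U) (L * ?D * Y) (Z * ?D * U) (Z * ?D * Y + mat 1 1 (\<lambda>_. e))"
    unfolding U2_def
    by (simp only:) (subst mult_four_block_mat[OF LD(1) _ LD(2) e1 LU(2) YZ(1)], use LD LU YZ in \<open>auto intro!: cong_four_block_mat\<close>)
  moreover have "Z * ?D * U = c" using ZDU LU YZ by (metis assoc_mult_mat)
  moreover have "Z * ?D * Y + mat 1 1 (\<lambda>_. e) = s"
    using sc YZ LD by (intro eq_matI) (auto simp: e_def simp del: index_mult_mat(1))
  ultimately have "A = L2 * D2 * U2" using A LDY ih(3) by simp
  moreover have "lower_uni (Suc n) L2" using ih(1) YZ by (auto simp: lower_uni_def L2_def)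
  moreover have "upper_uni (Suc n) U2" using ih(2) YZ by (auto simp: upper_uni_def U2_def)
  ultimately show ?case using D2 by metis
qed

text \<open>Y inverts an upper unipotent matrix and so is upper unipotent, while it is also lower
  triangular. The columns are compared from left to right.\<close>

lemma lower_upper_eq_one:
  assumes Y: "Y \<in> carrier_mat n n" "\<And>i j. i < j \<Longrightarrow> j < n \<Longrightarrow> Y $$ (i, j) = 0"
    and T: "upper_uni n T" and eq: "Y * T = (1\<^sub>m n :: complex mat)"
  shows "Y = 1\<^sub>m n" "T = 1\<^sub>m n"
proof -
  have Tc: "T \<in> carrier_mat n n" and T1: "\<And>i. i < n \<Longrightarrow> T $$ (i, i) = 1" and T0: "\<And>i j. j < i \<Longrightarrow> i < n \<Longrightarrow> T $$ (i, j) = 0"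
    using T by (auto simp: upper_uni_def)
  have col: "\<forall>i<n. Y $$ (i, j) = 1\<^sub>m n $$ (i, j)" if "j < n" for j
    using that
  proof (induction j rule: less_induct)
    case (less j)
    have Yk: "Y $$ (i, k) = (if i = k then 1 else 0)" if "k < j" "i < n" for i k using less that by simp
    have e: "(if i = j then 1 else 0) = (if i < j then T $$ (i, j) else 0) + Y $$ (i, j)" if i: "i < n" for i
    proof -
      have "(Y * T) $$ (i, j) = (\<Sum>k<n. Y $$ (i, k) * T $$ (k, j))" using mat_mult_entry[OF Y(1) Tc i less.prems] .
      also have "\<dots> = (\<Sum>k<n. (if k = i then (if i < j then T $$ (i, j) else 0) else 0) + (if k = j then Y $$ (i, j) else 0))"
      proof (rule sum.cong)
        fix k assume k: "k \<in> {..<n}"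
        show "Y $$ (i, k) * T $$ (k, j) = (if k = i then (if i < j then T $$ (i, j) else 0) else 0) + (if k = j then Y $$ (i, j) else 0)"
          using k i Yk[of k i] T0[of j k] T1[of j] less.prems by (cases k j rule: linorder_cases) auto
      qed simp
      also have "\<dots> = (if i < j then T $$ (i, j) else 0) + Y $$ (i, j)" using i less.prems by (simp add: sum.distrib)
      finally show ?thesis using eq i less.prems by simp
    qed
    show ?case
    proof (intro allI impI)
      fix i assume i: "i < n"
      show "Y $$ (i, j) = 1\<^sub>m n $$ (i, j)"
        using e[OF i] Y(2)[of i j] i less.prems by (cases "i < j") auto
    qed
  qed
  then show Y1: "Y = 1\<^sub>m n" using Y(1) by (intro eq_matI) auto
  then show "T = 1\<^sub>m n" using eq Tc by simp
qed

definition unipotent_lower :: "nat \<Rightarrow> complex mat set" where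
  "unipotent_lower m = {g \<in> SO_odd m. lower_uni (nn m) g}"

lemma unipotent_upper_iff: "g \<in> unipotent_upper m \<longleftrightarrow> g \<in> SO_odd m \<and> upper_uni (nn m) g"
proof -
  have "g \<in> SO_odd m \<Longrightarrow> upper_triangular g \<longleftrightarrow> (\<forall>i j. j < i \<and> i < nn m \<longrightarrow> g $$ (i, j) = 0)"
    using SO_carrier[of g m] by (auto simp: upper_triangular_def)
  then show ?thesis
    using SO_carrier[of g m] by (auto simp: unipotent_upper_def[folded nn_def] upper_uni_def)
qed

lemma star_lower_uni: "lower_uni (nn m) L \<Longrightarrow> lower_uni (nn m) (star m L)"
  by (auto simp: lower_uni_def star_entry)

lemma star_upper_uni: "upper_uni (nn m) L \<Longrightarrow> upper_uni (nn m) (star m L)"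
  by (auto simp: upper_uni_def star_entry)

lemma lower_uni_mult:
  assumes "lower_uni n A" "lower_uni n B"
  shows "lower_uni n (A * B)"
proof -
  have c: "A \<in> carrier_mat n n" "B \<in> carrier_mat n n" using assms by (auto simp: lower_uni_def)
  have "(A * B) $$ (i, j) = (if i = j then 1 else 0)" if "i \<le> j" "j < n" for i j
  proof -
    have "(A * B) $$ (i, j) = (\<Sum>k<n. A $$ (i, k) * B $$ (k, j))" using mat_mult_entry[OF c] that by simp
    also have "\<dots> = (\<Sum>k<n. if k = i then (if i = j then 1 else 0) else 0)"
    proof (rule sum.cong)
      fix k assume "k \<in> {..<n}"
      then show "A $$ (i, k) * B $$ (k, j) = (if k = i then (if i = j then 1 else 0) else 0)"
        using assms that by (cases k i rule: linorder_cases) (auto simp: lower_uni_def)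
    qed simp
    finally show ?thesis using that by simp
  qed
  then show ?thesis using c by (simp add: lower_uni_def del: index_mult_mat(1))
qed

lemma upper_uni_mult:
  assumes "upper_uni n A" "upper_uni n B"
  shows "upper_uni n (A * B)"
proof -
  have T: "lower_uni n (transpose_mat A) \<longleftrightarrow> upper_uni n A" if "A \<in> carrier_mat n n" for A
    using that by (auto simp: lower_uni_def upper_uni_def)
  have c: "A \<in> carrier_mat n n" "B \<in> carrier_mat n n" using assms by (auto simp: upper_uni_def)
  have "lower_uni n (transpose_mat B * transpose_mat A)" using assms c T by (intro lower_uni_mult) auto
  then show ?thesis using transpose_mult[OF c] T[of "A * B"] c by simp
qed

lemma prod_nn: "(\<Prod>i<nn m. f i) = f m * (\<Prod>i<m. f i * f (2 * m - i))" for f :: "nat \<Rightarrow> 'a :: comm_monoid_mult"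
proof -
  have "{..<nn m} = {..<m} \<union> ({m} \<union> (\<lambda>i. 2 * m - i) ` {..<m})"
  proof (rule equalityI; rule subsetI)
    fix k assume k: "k \<in> {..<nn m}"
    show "k \<in> {..<m} \<union> ({m} \<union> (\<lambda>i. 2 * m - i) ` {..<m})"
    proof (cases "m < k")
      case True
      then have "k = 2 * m - (2 * m - k)" "2 * m - k \<in> {..<m}" using k by auto
      then show ?thesis by blast
    qed auto
  qed auto
  then have "(\<Prod>i<nn m. f i) = (\<Prod>i<m. f i) * (f m * (\<Prod>i\<in>(\<lambda>i. 2 * m - i) ` {..<m}. f i))"
    by (simp only:) (subst prod.union_disjoint, simp, simp, force, subst prod.union_disjoint, simp, simp, force, simp)
  also have "(\<Prod>i\<in>(\<lambda>i. 2 * m - i) ` {..<m}. f i) = (\<Prod>i<m. f (2 * m - i))"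
    by (subst prod.reindex) (auto simp: inj_on_def)
  finally show ?thesis by (simp add: prod.distrib ac_simps)
qed

text \<open>Inserting g = L D U into \<open>star m g * g = 1\<close> exhibits a lower triangular
  matrix as the inverse of the upper unipotent U \<open>star m\<close> U. Both are therefore 1, and
  L, D and U are orthogonal separately.\<close>

theorem big_cell_factorisation:
  assumes g: "g \<in> SO_odd m" and mi: "minors (nn m) g \<noteq> 0"
  obtains l x u where "l \<in> unipotent_lower m" "unitvals m x" "u \<in> unipotent_upper m" "g = l * torus_elt m x * u"
proof -
  let ?n = "nn m"
  have gc: "g \<in> carrier_mat ?n ?n" by (rule SO_carrier[OF g])
  have "det (lead k g) \<noteq> 0" if "k \<in> {1..?n}" for k
    using mi that unfolding minors_def by (metis finite_atLeastAtMost prod_zero_iff)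
  then obtain L d U where L: "lower_uni ?n L" and U: "upper_uni ?n U" and gLU: "g = L * mat_diag ?n d * U"
    using triangular_factorisation[OF gc] by blast
  let ?D = "mat_diag ?n d" and ?Ds = "mat_diag ?n (\<lambda>i. d (2 * m - i))"
  have c: "L \<in> carrier_mat ?n ?n" "U \<in> carrier_mat ?n ?n" "?D \<in> carrier_mat ?n ?n" "?Ds \<in> carrier_mat ?n ?n"
    using L U by (auto simp: lower_uni_def upper_uni_def)
  have sD: "star m ?D = ?Ds" by (intro eq_matI) (auto simp: star_def mat_diag_def)
  let ?X = "star m L * L"
  have X: "lower_uni ?n ?X" using L by (intro lower_uni_mult star_lower_uni)
  have Xc: "?X \<in> carrier_mat ?n ?n" using X by (simp add: lower_uni_def)
  let ?Y = "?Ds * ?X * ?D"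
  have Yc: "?Y \<in> carrier_mat ?n ?n" using c Xc by (metis mult_carrier_mat)
  have Yent: "?Y $$ (i, j) = d (2 * m - i) * ?X $$ (i, j) * d j" if "i < ?n" "j < ?n" for i j
  proof -
    have "?Ds * ?X \<in> carrier_mat ?n ?n" using c Xc by (metis mult_carrier_mat)
    from mat_diag_mult_right[OF this, of d] have "?Y $$ (i, j) = (?Ds * ?X) $$ (i, j) * d j" using that by simp
    moreover from mat_diag_mult_left[OF Xc, of "\<lambda>i. d (2 * m - i)"]
    have "(?Ds * ?X) $$ (i, j) = d (2 * m - i) * ?X $$ (i, j)" using that by simp
    ultimately show ?thesis by simp
  qed
  have "star m U * ?Y * U = star m g * g"
  proof -
    have "star m g = star m U * (?Ds * star m L)"
      unfolding gLU using star_mult[OF mult_carrier_mat[OF c(1,3)] c(2)] star_mult[OF c(1,3)] sD by (simp only:)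
    then have "star m g * g = star m U * (?Ds * star m L) * (L * ?D * U)" using gLU by simp
    also have "\<dots> = star m U * ?Y * U"
      using c star_carrier[of m U] star_carrier[of m L] by (smt (verit) assoc_mult_mat mult_carrier_mat)
    finally show ?thesis by simp
  qed
  also have "\<dots> = 1\<^sub>m ?n" by (rule SO_star(1)[OF g])
  finally have "star m U * (?Y * U) = 1\<^sub>m ?n" using assoc_mult_mat[OF star_carrier Yc c(2)] by simp
  then have "(?Y * U) * star m U = 1\<^sub>m ?n"
    using Yc c by (intro mat_mult_left_right_inverse[OF star_carrier]) auto
  then have YT: "?Y * (U * star m U) = 1\<^sub>m ?n" using assoc_mult_mat[OF Yc c(2) star_carrier] by simp
  have "?Y $$ (i, j) = 0" if "i < j" "j < ?n" for i j
    using that X Yent[of i j] by (auto simp: lower_uni_def)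
  from lower_upper_eq_one[OF Yc this upper_uni_mult[OF U star_upper_uni[OF U]] YT]
  have Y1: "?Y = 1\<^sub>m ?n" and T1: "U * star m U = 1\<^sub>m ?n" by auto
  have dd: "d (2 * m - i) * d i = 1" if "i < ?n" for i
    using Yent[OF that that] Y1 X that by (simp add: lower_uni_def del: index_mult_mat(1))
  have "?X = 1\<^sub>m ?n"
  proof (rule eq_matI)
    fix i j assume "i < dim_row (1\<^sub>m ?n)" "j < dim_col (1\<^sub>m ?n)"
    then have ij: "i < ?n" "j < ?n" by auto
    have "d (2 * m - i) \<noteq> 0" "d j \<noteq> 0" using dd[OF ij(1)] dd[OF ij(2)] by auto
    then show "?X $$ (i, j) = 1\<^sub>m ?n $$ (i, j)"
      using Yent[OF ij] Y1 ij X by (auto simp: lower_uni_def simp del: index_mult_mat(1) split: if_splits)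
  qed (use Xc in auto)
  then have LS: "L \<in> SO_odd m" using c det_lower_uni[OF L] by (simp add: SO_odd_iff Og_def)
  have "star m U * U = 1\<^sub>m ?n" using mat_mult_left_right_inverse[OF c(2) star_carrier T1] .
  then have US: "U \<in> SO_odd m" using c det_upper_uni[OF U] by (simp add: SO_odd_iff Og_def)
  \<comment> \<open>All diagonal entries but the middle one cancel in mirrored pairs, so det g = 1
    forces the middle entry to be 1, as \<open>torus_elt\<close> demands.\<close>
  have "det g = det ?D"
    unfolding gLU using c det_mult[of "L * ?D" ?n U] det_mult[of L ?n ?D] det_lower_uni[OF L] det_upper_uni[OF U] by simp
  then have dD: "det ?D = 1" using g by (simp add: SO_odd_iff)
  have "det ?D = (\<Prod>i<?n. d i)"
    by (subst det_upper_triangular[of _ ?n]) (auto simp: prod_list_diag[of _ ?n] mat_diag_def)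
  also have "(\<Prod>i<?n. d i) = d m * (\<Prod>i<m. d i * d (2 * m - i))"
    by (rule prod_nn)
  also have "(\<Prod>i<m. d i * d (2 * m - i)) = 1" using dd by (intro prod.neutral) (auto simp: mult.commute)
  finally have dm: "d m = 1" using dD by simp
  have "?D = torus_elt m d"
  proof (rule eq_matI)
    fix i j assume "i < dim_row (torus_elt m d)" "j < dim_col (torus_elt m d)"
    then have ij: "i \<le> 2 * m" "j \<le> 2 * m" by (auto simp: torus_elt_def)
    show "?D $$ (i, j) = torus_elt m d $$ (i, j)"
      using ij dm dd[of i] by (auto simp: torus_elt_def mat_diag_def inverse_unique)
  qed (auto simp: torus_elt_def nn_def mat_diag_def)
  moreover have "unitvals m d" unfolding unitvals_def using dd by (metis less_nn mult_zero_right zero_neq_one less_imp_le less_le_trans mult_2 le_add1)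
  ultimately show thesis
    using that[of L d U] LS US L U gLU by (simp add: unipotent_lower_def unipotent_upper_iff)
qed

theorem SO_dense:
  assumes "polyfun (nn m) f"
    and "\<And>l x u. l \<in> unipotent_lower m \<Longrightarrow> unitvals m x \<Longrightarrow> u \<in> unipotent_upper m \<Longrightarrow> f (l * torus_elt m x * u) = 0"
    and "g \<in> SO_odd m"
  shows "f g = 0"
  using vanish_SO[OF assms(1) _ assms(3)] big_cell_factorisation assms(2) by metis

section \<open>Operators\<close>

text \<open>
  Operators on \<open>\<complex>\<^sup>d\<close> are functions of two indices, so that associativity, distributivity and
  the trace identity hold without carrier conditions.
\<close>

type_synonym opr = "nat \<Rightarrow> nat \<Rightarrow> complex"

definition mm :: "nat \<Rightarrow> opr \<Rightarrow> opr \<Rightarrow> opr" where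
  "mm d A B = (\<lambda>i k. \<Sum>j<d. A i j * B j k)"

definition mv :: "nat \<Rightarrow> opr \<Rightarrow> (nat \<Rightarrow> complex) \<Rightarrow> nat \<Rightarrow> complex" where
  "mv d A v = (\<lambda>i. \<Sum>j<d. A i j * v j)"

definition trc :: "nat \<Rightarrow> opr \<Rightarrow> complex" where
  "trc d A = (\<Sum>i<d. A i i)"

definition idop :: "nat \<Rightarrow> opr" where
  "idop d = (\<lambda>i j. if i = j \<and> i < d then 1 else 0)"

definition sc :: "complex \<Rightarrow> opr \<Rightarrow> opr" where
  "sc c A = (\<lambda>i j. c * A i j)"

text \<open>Vanishing outside the d by d block makes equality of functions the same as equality of
  operators; the identity laws of \<open>mm\<close> rely on it.\<close>

definition sup :: "nat \<Rightarrow> opr \<Rightarrow> bool" where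
  "sup d A \<longleftrightarrow> (\<forall>i j. \<not> (i < d \<and> j < d) \<longrightarrow> A i j = 0)"

definition Eb :: "nat \<Rightarrow> nat \<Rightarrow> opr" where
  "Eb i j = (\<lambda>a b. if a = i \<and> b = j then 1 else 0)"

lemma mm_assoc: "mm d (mm d A B) C = mm d A (mm d B C)"
proof (intro ext)
  fix i k
  have "mm d (mm d A B) C i k = (\<Sum>j<d. \<Sum>l<d. A i l * B l j * C j k)"
    by (simp add: mm_def sum_distrib_right)
  also have "\<dots> = (\<Sum>l<d. \<Sum>j<d. A i l * B l j * C j k)" by (rule sum.swap)
  also have "\<dots> = mm d A (mm d B C) i k" by (simp add: mm_def sum_distrib_left mult.assoc)
  finally show "mm d (mm d A B) C i k = mm d A (mm d B C) i k" .
qed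

lemma mv_mm: "mv d (mm d A B) v = mv d A (mv d B v)"
proof
  fix i
  have "mv d (mm d A B) v i = (\<Sum>j<d. \<Sum>l<d. A i l * B l j * v j)"
    by (simp add: mm_def mv_def sum_distrib_right)
  also have "\<dots> = (\<Sum>l<d. \<Sum>j<d. A i l * B l j * v j)" by (rule sum.swap)
  also have "\<dots> = mv d A (mv d B v) i" by (simp add: mv_def sum_distrib_left mult.assoc)
  finally show "mv d (mm d A B) v i = mv d A (mv d B v) i" .
qed

lemma mm_add: "mm d (A + B) C = mm d A C + mm d B C" "mm d C (A + B) = mm d C A + mm d C B"
  by (simp_all add: mm_def fun_eq_iff distrib_left distrib_right sum.distrib)

lemma mm_diff: "mm d (A - B) C = mm d A C - mm d B C" "mm d C (A - B) = mm d C A - mm d C B"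
  by (simp_all add: mm_def fun_eq_iff left_diff_distrib right_diff_distrib sum_subtractf)

lemma mm_zero [simp]: "mm d 0 C = 0" "mm d C 0 = 0"
  by (simp_all add: mm_def fun_eq_iff)

lemma mm_uminus: "mm d (- A) C = - mm d A C" "mm d C (- A) = - mm d C A"
  by (simp_all add: mm_def fun_eq_iff sum_negf)

lemma mm_sc: "mm d (sc c A) B = sc c (mm d A B)" "mm d A (sc c B) = sc c (mm d A B)"
  by (simp_all add: mm_def sc_def fun_eq_iff sum_distrib_left ac_simps)

lemma mm_sum: "mm d (\<Sum>x\<in>I. f x) B = (\<Sum>x\<in>I. mm d (f x) B)" "mm d B (\<Sum>x\<in>I. f x) = (\<Sum>x\<in>I. mm d B (f x))"
  by (induction I rule: infinite_finite_induct) (simp_all add: mm_add)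

lemma sc_sc: "sc a (sc b A) = sc (a * b) A"
  by (simp add: sc_def mult.assoc)

lemma sc_1 [simp]: "sc 1 A = A"
  by (simp add: sc_def)

lemma sc_0 [simp]: "sc 0 A = 0"
  by (simp add: sc_def fun_eq_iff)

lemma sc_zero [simp]: "sc c 0 = 0"
  by (simp add: sc_def fun_eq_iff)

lemma sc_add: "sc c (A + B) = sc c A + sc c B" "sc (a + b) A = sc a A + sc b A"
  by (simp_all add: sc_def fun_eq_iff distrib_left distrib_right)

lemma sc_sum: "sc c (\<Sum>x\<in>I. f x) = (\<Sum>x\<in>I. sc c (f x))" "sc (\<Sum>x\<in>I. h x) A = (\<Sum>x\<in>I. sc (h x) A)"
  by (induction I rule: infinite_finite_induct) (simp_all add: sc_add)

lemma opr_sum_apply: "(\<Sum>x\<in>I. f x) i j = (\<Sum>x\<in>I. (f x :: opr) i j)"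
  by (induction I rule: infinite_finite_induct) simp_all

lemma mm_id: "sup d A \<Longrightarrow> mm d (idop d) A = A" "sup d A \<Longrightarrow> mm d A (idop d) = A"
proof -
  assume A: "sup d A"
  have "(\<Sum>j<d. (if i = j \<and> i < d then 1 else 0) * A j k) = (\<Sum>j<d. if j = i then A i k else 0)" for i k
    by (intro sum.cong) auto
  then show "mm d (idop d) A = A"
    using A by (auto simp: mm_def idop_def fun_eq_iff sup_def)
  have "(\<Sum>j<d. A i j * (if j = k \<and> j < d then 1 else 0)) = (\<Sum>j<d. if j = k then A i k else 0)" for i k
    by (intro sum.cong) auto
  then show "mm d A (idop d) = A"
    using A by (auto simp: mm_def idop_def fun_eq_iff sup_def)
qed

lemma sup_mm: "sup d A \<Longrightarrow> sup d B \<Longrightarrow> sup d (mm d A B)"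
  by (auto simp: sup_def mm_def)

lemma sup_idop [simp]: "sup d (idop d)"
  by (simp add: sup_def idop_def)

lemma trc_comm: "trc d (mm d A B) = trc d (mm d B A)"
proof -
  have "trc d (mm d A B) = (\<Sum>i<d. \<Sum>j<d. A i j * B j i)" by (simp add: trc_def mm_def)
  also have "\<dots> = (\<Sum>j<d. \<Sum>i<d. A i j * B j i)" by (rule sum.swap)
  finally show ?thesis by (simp add: trc_def mm_def mult.commute)
qed

lemma trc_diff: "trc d (A - B) = trc d A - trc d B"
  and trc_sc: "trc d (sc c A) = c * trc d A"
  and trc_zero [simp]: "trc d 0 = 0"
  by (simp_all add: trc_def sum.distrib sum_subtractf sc_def sum_distrib_left)

lemma trc_sum: "trc d (\<Sum>x\<in>I. f x) = (\<Sum>x\<in>I. trc d (f x))"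
  unfolding trc_def opr_sum_apply by (rule sum.swap)

lemma mm_Eb: "mm d (Eb i j) (Eb k l) = (if j = k \<and> j < d then Eb i l else 0)"
proof (intro ext)
  fix a b
  have "mm d (Eb i j) (Eb k l) a b = (\<Sum>c<d. if c = j then (if a = i \<and> j = k \<and> b = l then 1 else 0) else 0)"
    unfolding mm_def Eb_def by (intro sum.cong) auto
  then show "mm d (Eb i j) (Eb k l) a b = (if j = k \<and> j < d then Eb i l else 0) a b"
    by (auto simp: Eb_def)
qed

lemma sup_Eb: "i < d \<Longrightarrow> j < d \<Longrightarrow> sup d (Eb i j)"
  by (auto simp: sup_def Eb_def)

lemma sup_add: "sup d A \<Longrightarrow> sup d B \<Longrightarrow> sup d (A + B)"
  and sup_diff: "sup d A \<Longrightarrow> sup d B \<Longrightarrow> sup d (A - B)"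
  and sup_zero [simp]: "sup d 0"
  by (auto simp: sup_def sc_def)

lemma sup_sum: "(\<And>x. x \<in> I \<Longrightarrow> sup d (f x)) \<Longrightarrow> sup d (\<Sum>x\<in>I. f x)"
  by (induction I rule: infinite_finite_induct) (auto intro: sup_add)

section \<open>Passage between matrices and operators\<close>

definition mo :: "nat \<Rightarrow> opr \<Rightarrow> complex mat" where
  "mo n A = mat n n (\<lambda>(a, b). A a b)"

definition ent :: "nat \<Rightarrow> complex mat \<Rightarrow> opr" where
  "ent n g = (\<lambda>a b. if a < n \<and> b < n then g $$ (a, b) else 0)"

lemma mo_mult: "mo n A * mo n B = mo n (mm n A B)"
  by (intro eq_matI) (auto simp: mo_def mm_def scalar_prod_def atLeast0LessThan)

lemma mo_id: "mo n (idop n) = 1\<^sub>m n"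
  by (intro eq_matI) (auto simp: mo_def idop_def)

lemma mo_carrier [simp]: "mo n A \<in> carrier_mat n n"
  by (simp add: mo_def)

lemma ent_mult:
  assumes "g \<in> carrier_mat n n" "h \<in> carrier_mat n n"
  shows "ent n (g * h) = mm n (ent n g) (ent n h)"
proof (intro ext)
  fix i j
  show "ent n (g * h) i j = mm n (ent n g) (ent n h) i j"
  proof (cases "i < n \<and> j < n")
    case True
    then show ?thesis using mat_mult_entry[OF assms, of i j]
      by (auto simp: ent_def mm_def simp del: index_mult_mat(1) intro!: sum.cong)
  qed (auto simp: ent_def mm_def)
qed

lemma sup_ent [simp]: "sup n (ent n g)"
  by (auto simp: sup_def ent_def)

lemma ent_one: "ent n (1\<^sub>m n) = idop n"
  by (auto simp: ent_def idop_def fun_eq_iff)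

section \<open>Curves in the orthogonal group\<close>

definition curve :: "nat \<Rightarrow> (complex \<Rightarrow> complex mat) \<Rightarrow> opr \<Rightarrow> bool" where
  "curve m \<gamma> X \<longleftrightarrow> (\<forall>s. \<gamma> s \<in> SO_odd m) \<and> \<gamma> 0 = 1\<^sub>m (nn m) \<and>
     (\<forall>i<nn m. \<forall>j<nn m. ((\<lambda>s. \<gamma> s $$ (i, j)) has_field_derivative X i j) (at 0))"

text \<open>A matrix unit minus its mirror image in the antidiagonal: these span the Lie algebra of
  the group. For i \<noteq> j the result is zero or a root vector of weight
  \<open>rt m (i, j)\<close>, for i = j it lies in the Cartan subalgebra.\<close>

definition Fb :: "nat \<Rightarrow> nat \<Rightarrow> nat \<Rightarrow> opr" where
  "Fb m i j = Eb i j - Eb (2 * m - j) (2 * m - i)"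

lemma torus_carrier [simp]: "torus_elt m x \<in> carrier_mat (nn m) (nn m)"
  by (simp add: torus_elt_def nn_def)

lemma torus_entry:
  "i \<le> 2 * m \<Longrightarrow> j \<le> 2 * m \<Longrightarrow> torus_elt m x $$ (i, j) = (if i = j then mon m x (wtv m i) else 0)"
proof -
  assume ij: "i \<le> 2 * m" "j \<le> 2 * m"
  have e: "mon m x (smw c k) = x k powi c" if "k < m" for k c
  proof -
    have "mon m x (smw c k) = (\<Prod>l<m. if l = k then x k powi c else 1)"
      unfolding mon_def smw_def by (intro prod.cong) auto
    then show ?thesis using that by simp
  qed
  have "ew k = smw 1 k" "- ew k = smw (- 1) k" for k by (auto simp: ew_def smw_def)
  then show ?thesis using ij e by (auto simp: torus_elt_def wtv_def)
qed

lemma torus_SO: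
  assumes x: "unitvals m x"
  shows "torus_elt m x \<in> SO_odd m"
proof -
  have e: "mon m x (wtv m (2 * m - i)) * mon m x (wtv m i) = 1" if "i \<le> 2 * m" for i
  proof -
    have "wtv m (2 * m - i) + wtv m i = 0" using that by (auto simp: wtv_def)
    then show ?thesis by (metis mon_0 mon_add[OF x])
  qed
  have "star m (torus_elt m x) * torus_elt m x = 1\<^sub>m (nn m)"
  proof (rule eq_matI)
    fix i j assume "i < dim_row (1\<^sub>m (nn m))" "j < dim_col (1\<^sub>m (nn m))"
    then have ij: "i < nn m" "j < nn m" by auto
    have "(star m (torus_elt m x) * torus_elt m x) $$ (i, j) =
        (\<Sum>k<nn m. if k = i then (if i = j then 1 else 0) else 0)"
      unfolding mat_mult_entry[OF star_carrier torus_carrier ij]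
    proof (rule sum.cong)
      fix k assume k: "k \<in> {..<nn m}"
      have "2 * m - k = 2 * m - i \<longleftrightarrow> k = i" using k ij by auto
      then show "star m (torus_elt m x) $$ (i, k) * torus_elt m x $$ (k, j) = (if k = i then (if i = j then 1 else 0) else 0)"
        using k ij e[of i] by (auto simp: star_entry torus_entry)
    qed simp
    then show "(star m (torus_elt m x) * torus_elt m x) $$ (i, j) = 1\<^sub>m (nn m) $$ (i, j)" using ij by simp
  qed (auto simp: torus_elt_def star_def nn_def)
  moreover have "det (torus_elt m x) = 1"
  proof -
    have "upper_triangular (torus_elt m x)" by (auto simp: torus_elt_def)
    then have "det (torus_elt m x) = (\<Prod>i<nn m. torus_elt m x $$ (i, i))"
      by (subst det_upper_triangular[OF _ torus_carrier]) (auto simp: prod_list_diag[OF torus_carrier])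
    also have "\<dots> = (\<Prod>i<nn m. mon m x (wtv m i))" by (intro prod.cong) (auto simp: torus_entry)
    also have "\<dots> = 1"
    proof -
      have "(\<Prod>i<m. mon m x (wtv m i) * mon m x (wtv m (2 * m - i))) = 1"
        using e by (intro prod.neutral) (auto simp: mult.commute)
      moreover have "mon m x (wtv m m) = 1" by (simp add: wtv_def)
      ultimately show ?thesis unfolding prod_nn by simp
    qed
    finally show ?thesis .
  qed
  ultimately show ?thesis by (simp add: SO_odd_iff Og_def)
qed

lemma torus_mult:
  assumes "unitvals m x" "unitvals m y"
  shows "torus_elt m x * torus_elt m y = torus_elt m (\<lambda>i. x i * y i)"
proof (rule eq_matI)
  fix i j assume "i < dim_row (torus_elt m (\<lambda>i. x i * y i))" "j < dim_col (torus_elt m (\<lambda>i. x i * y i))"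
  then have ij: "i < nn m" "j < nn m" by (auto simp: torus_elt_def)
  have "(torus_elt m x * torus_elt m y) $$ (i, j) = (\<Sum>k<nn m. if k = i then (if i = j then mon m x (wtv m i) * mon m y (wtv m i) else 0) else 0)"
    unfolding mat_mult_entry[OF torus_carrier torus_carrier ij]
    by (intro sum.cong) (use ij in \<open>auto simp: torus_entry\<close>)
  then show "(torus_elt m x * torus_elt m y) $$ (i, j) = torus_elt m (\<lambda>i. x i * y i) $$ (i, j)"
    using ij by (simp add: torus_entry mon_mult)
qed (auto simp: torus_elt_def)

lemma torus_one: "torus_elt m (\<lambda>_. 1) = 1\<^sub>m (nn m)"
  by (intro eq_matI) (auto simp: torus_elt_def nn_def)

text \<open>The exponential $1 + s F + s^2 F^2 / 2$ of a root vector \<open>F\<close>, for which $F^3 = 0$.\<close>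

definition uc :: "nat \<Rightarrow> nat \<Rightarrow> nat \<Rightarrow> complex \<Rightarrow> opr" where
  "uc m i j s = idop (nn m) + sc s (Fb m i j)
     - sc (s\<^sup>2 / 2) ((if j = m then Eb i (2 * m - i) else 0) + (if i = m then Eb (2 * m - j) j else 0))"

lemma star_mo: "star m (mo (nn m) A) = mo (nn m) (\<lambda>a b. A (2 * m - b) (2 * m - a))"
  by (intro eq_matI) (auto simp: star_def mo_def)

lemma sup_Fb: "i \<le> 2 * m \<Longrightarrow> j \<le> 2 * m \<Longrightarrow> sup (nn m) (Fb m i j)"
  unfolding Fb_def by (intro sup_diff sup_Eb) auto

text \<open>The primed indices stand for the mirror images 2m - i and 2m - j. The square survives
  only for short roots, where i or j is its own mirror image.\<close>

lemma root_vector_cube: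
  fixes i j i' j' n :: nat
  assumes ne: "i \<noteq> j" "i \<noteq> j'" "i' \<noteq> j'" "j \<noteq> i'" "\<not> (i = i' \<and> j = j')" and lt: "i < n" "j < n" "i' < n" "j' < n"
  defines "F \<equiv> Eb i j - Eb j' i'" and "F2 \<equiv> - ((if j = j' then Eb i i' else 0) + (if i = i' then Eb j' j else 0))"
  shows "mm n F F = F2" "mm n F F2 = 0" "mm n F2 F = 0" "mm n F2 F2 = 0"
proof -
  have ne': "j \<noteq> i" "j' \<noteq> i" "j' \<noteq> i'" "i' \<noteq> j" using ne by auto
  show "mm n F F = F2"
    unfolding F_def F2_def mm_diff mm_Eb using ne lt by auto
  consider "j = j'" "i \<noteq> i'" | "i = i'" "j \<noteq> j'" | "i \<noteq> i'" "j \<noteq> j'" using ne by blast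
  then show "mm n F F2 = 0" "mm n F2 F = 0" "mm n F2 F2 = 0"
    by (cases; use ne ne' lt in \<open>simp add: F_def F2_def mm_diff mm_Eb mm_uminus\<close>)+
qed

lemma uc_mult:
  assumes ij: "i \<le> 2 * m" "j \<le> 2 * m" "i \<noteq> j" "i \<noteq> 2 * m - j"
  shows "mm (nn m) (uc m i j (- s)) (uc m i j s) = idop (nn m)"
proof -
  let ?n = "nn m"
  define F2 where "F2 = - ((if j = m then Eb i (2 * m - i) else 0) + (if i = m then Eb (2 * m - j) j else 0))"
  have neq: "2 * m - i \<noteq> 2 * m - j" "j \<noteq> 2 * m - i" using ij by auto
  have e: "(i = 2 * m - i) = (i = m)" "(2 * m - i = i) = (i = m)" "(j = 2 * m - j) = (j = m)" "(2 * m - j = j) = (j = m)"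
    using ij by auto
  have F2': "F2 = - ((if j = 2 * m - j then Eb i (2 * m - i) else 0) + (if i = 2 * m - i then Eb (2 * m - j) j else 0))"
    unfolding F2_def e ..
  have c: "\<not> (i = 2 * m - i \<and> j = 2 * m - j)" "i < ?n" "j < ?n" "2 * m - i < ?n" "2 * m - j < ?n"
    using ij by auto
  note cube = root_vector_cube[OF ij(3,4) neq c, folded F2', folded Fb_def]
  have FF: "mm ?n (Fb m i j) (Fb m i j) = F2" and F3: "mm ?n (Fb m i j) F2 = 0" "mm ?n F2 (Fb m i j) = 0" "mm ?n F2 F2 = 0"
    by (rule cube)+
  have s1: "sup ?n (Fb m i j)" by (rule sup_Fb[OF ij(1,2)])
  have s2: "sup ?n F2" unfolding FF[symmetric] by (rule sup_mm[OF s1 s1])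
  have u: "uc m i j s = idop ?n + sc s (Fb m i j) + sc (s\<^sup>2 / 2) F2" for s
    unfolding uc_def F2_def by (auto simp: sc_def fun_eq_iff)
  show ?thesis
    unfolding u mm_add mm_sc mm_id(1)[OF s1] mm_id(2)[OF s1] mm_id(1)[OF s2] mm_id(2)[OF s2] FF F3
      mm_id(1)[OF sup_idop]
    by (simp add: sc_def fun_eq_iff power2_eq_square right_diff_distrib mult.assoc)
qed

lemma uc_star:
  assumes "i \<le> 2 * m" "j \<le> 2 * m"
  shows "star m (mo (nn m) (uc m i j s)) = mo (nn m) (uc m i j (- s))"
proof -
  have "uc m i j s (2 * m - b) (2 * m - a) = uc m i j (- s) a b" if ab: "a < nn m" "b < nn m" for a b
  proof -
    have e: "2 * m - x = y \<longleftrightarrow> x = 2 * m - y" if "x \<le> 2 * m" "y \<le> 2 * m" for x y :: nat using that by auto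
    have "Eb k l (2 * m - b) (2 * m - a) = Eb (2 * m - l) (2 * m - k) a b" if "k \<le> 2 * m" "l \<le> 2 * m" for k l
      using ab that e[of b k] e[of a l] by (auto simp: Eb_def)
    moreover have "idop (nn m) (2 * m - b) (2 * m - a) = idop (nn m) a b" using ab by (auto simp: idop_def)
    ultimately show ?thesis using assms by (simp add: uc_def Fb_def sc_def right_diff_distrib)
  qed
  then show ?thesis unfolding star_mo by (intro eq_matI) (auto simp: mo_def)
qed

lemma uc_triangular:
  assumes "i \<le> 2 * m" "j \<le> 2 * m" "i \<noteq> 2 * m - j"
  shows "i < j \<Longrightarrow> upper_uni (nn m) (mo (nn m) (uc m i j s))"
    and "j < i \<Longrightarrow> lower_uni (nn m) (mo (nn m) (uc m i j s))"
proof -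
  have z: "Eb k l a b = 0" if "k < l \<and> b \<le> a \<or> l < k \<and> a \<le> b" for k l a b
    using that by (auto simp: Eb_def)
  have u: "uc m i j s a b = idop (nn m) a b" if "i < j \<and> b \<le> a \<or> j < i \<and> a \<le> b" for a b
  proof -
    have "Eb i j a b = 0" using that by (intro z) auto
    moreover have "Eb (2 * m - j) (2 * m - i) a b = 0" using that assms by (intro z) auto
    moreover have "Eb i (2 * m - i) a b = 0" if "j = m"
      using that \<open>i < j \<and> b \<le> a \<or> j < i \<and> a \<le> b\<close> assms by (intro z) auto
    moreover have "Eb (2 * m - j) j a b = 0" if "i = m"
      using that \<open>i < j \<and> b \<le> a \<or> j < i \<and> a \<le> b\<close> assms by (intro z) auto
    ultimately show ?thesis unfolding uc_def Fb_def sc_def by simp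
  qed
  show "i < j \<Longrightarrow> upper_uni (nn m) (mo (nn m) (uc m i j s))"
    by (simp add: upper_uni_def mo_def u idop_def)
  show "j < i \<Longrightarrow> lower_uni (nn m) (mo (nn m) (uc m i j s))"
    by (simp add: lower_uni_def mo_def u idop_def)
qed

lemma uc_SO:
  assumes ij: "i \<le> 2 * m" "j \<le> 2 * m" "i \<noteq> j" "i \<noteq> 2 * m - j"
  shows "mo (nn m) (uc m i j s) \<in> SO_odd m"
proof -
  have "det (mo (nn m) (uc m i j s)) = 1"
    using ij det_upper_uni[OF uc_triangular(1)[OF ij(1,2,4)]] det_lower_uni[OF uc_triangular(2)[OF ij(1,2,4)]]
    by (cases "i < j") auto
  then show ?thesis
    by (simp add: SO_odd_iff Og_def uc_star[OF ij(1,2)] mo_mult uc_mult[OF ij] mo_id)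
qed

lemma curve_uc:
  assumes ij: "i \<le> 2 * m" "j \<le> 2 * m" "i \<noteq> j" "i \<noteq> 2 * m - j"
  shows "curve m (\<lambda>s. mo (nn m) (uc m i j s)) (Fb m i j)"
  unfolding curve_def
proof (intro conjI allI impI)
  show "mo (nn m) (uc m i j s) \<in> SO_odd m" for s by (rule uc_SO[OF ij])
  have "uc m i j 0 = idop (nn m)" by (simp add: uc_def fun_eq_iff)
  then show "mo (nn m) (uc m i j 0) = 1\<^sub>m (nn m)" by (simp add: mo_id)
  fix a b assume "a < nn m" "b < nn m"
  then have e: "mo (nn m) (uc m i j s) $$ (a, b) = idop (nn m) a b + s * Fb m i j a b
      - s\<^sup>2 / 2 * ((if j = m then Eb i (2 * m - i) else 0) + (if i = m then Eb (2 * m - j) j else 0)) a b" for s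
    by (simp add: mo_def uc_def sc_def)
  show "((\<lambda>s. mo (nn m) (uc m i j s) $$ (a, b)) has_field_derivative Fb m i j a b) (at 0)"
    unfolding e by (auto intro!: derivative_eq_intros)
qed

definition tcv :: "nat \<Rightarrow> complex \<Rightarrow> nat \<Rightarrow> complex" where
  "tcv i z = (\<lambda>k. if k = i then exp z else 1)"

lemma mon_tcv: "i < m \<Longrightarrow> mon m (tcv i z) \<mu> = exp z powi \<mu> i"
proof -
  assume "i < m"
  have "mon m (tcv i z) \<mu> = (\<Prod>k<m. if k = i then exp z powi \<mu> i else 1)"
    unfolding mon_def tcv_def by (intro prod.cong) auto
  then show ?thesis using \<open>i < m\<close> by simp
qed

lemma unitvals_tcv [simp]: "unitvals m (tcv i z)"
  by (simp add: unitvals_def tcv_def)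

lemma deriv_exp_powi: "((\<lambda>s. exp (c * s) powi k) has_field_derivative c * of_int k) (at (0 :: complex))"
proof -
  have "(\<lambda>s. exp (c * s) powi k) = (\<lambda>s. exp (of_int k * (c * s)))"
    by (simp add: exp_power_int)
  then show ?thesis by (auto intro!: derivative_eq_intros)
qed

lemma curve_torus:
  assumes i: "i < m"
  shows "curve m (\<lambda>s. torus_elt m (tcv i (c * s))) (sc c (Fb m i i))"
  unfolding curve_def
proof (intro conjI allI impI)
  show "torus_elt m (tcv i (c * s)) \<in> SO_odd m" for s by (rule torus_SO) simp
  have "tcv i (c * 0) = (\<lambda>_. 1)" by (simp add: tcv_def fun_eq_iff)
  then show "torus_elt m (tcv i (c * 0)) = 1\<^sub>m (nn m)" by (simp add: torus_one)
  fix a b assume ab: "a < nn m" "b < nn m"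
  have e: "torus_elt m (tcv i (c * s)) $$ (a, b) = (if a = b then exp (c * s) powi (wtv m a i) else 0)" for s
    using ab by (simp add: torus_entry mon_tcv[OF i])
  have w: "sc c (Fb m i i) a b = (if a = b then c * of_int (wtv m a i) else 0)"
  proof -
    have "wtv m a i = (if a = i then 1 else if a = 2 * m - i then - 1 else 0)"
      using ab i by (cases a m rule: linorder_cases) (auto simp: wtv_def ew_def)
    then show ?thesis using i by (auto simp: sc_def Fb_def Eb_def)
  qed
  show "((\<lambda>s. torus_elt m (tcv i (c * s)) $$ (a, b)) has_field_derivative sc c (Fb m i i) a b) (at 0)"
    unfolding e w using deriv_exp_powi[of c "wtv m a i"] by auto
qed

lemma Fb_antisym: "i \<le> 2 * m \<Longrightarrow> j \<le> 2 * m \<Longrightarrow> Fb m (2 * m - j) (2 * m - i) = - Fb m i j"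
  by (simp add: Fb_def fun_eq_iff)

lemma curve_Fb:
  assumes ij: "i \<le> 2 * m" "j \<le> 2 * m"
  shows "\<exists>\<gamma>. curve m \<gamma> (Fb m i j)"
proof -
  consider "i = 2 * m - j" | "i \<noteq> 2 * m - j" "i \<noteq> j" | "i = j" "i < m" | "i = j" "i > m" using ij by linarith
  then show ?thesis
  proof cases
    case 1
    then have "Fb m i j = 0" using ij by (simp add: Fb_def fun_eq_iff)
    then have "curve m (\<lambda>s. 1\<^sub>m (nn m)) (Fb m i j)" by (simp add: curve_def SO_one)
    then show ?thesis by blast
  next
    case 2
    then show ?thesis using curve_uc[OF ij] by blast
  next
    case 3
    then show ?thesis using curve_torus[of i m 1] by auto
  next
    case 4
    then have i: "2 * m - i < m" using ij by auto
    have "sc (- 1) (Fb m (2 * m - i) (2 * m - i)) = Fb m i j"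
      using 4 Fb_antisym[OF ij(1) ij(1)] by (simp add: sc_def fun_eq_iff)
    then show ?thesis using curve_torus[OF i, of "- 1"] by auto
  qed
qed

lemma deriv_mm:
  assumes "\<And>j. j < d \<Longrightarrow> ((\<lambda>s. A s i j) has_field_derivative A' i j) (at z)"
    and "\<And>j. j < d \<Longrightarrow> ((\<lambda>s. B s j k) has_field_derivative B' j k) (at z)"
  shows "((\<lambda>s. mm d (A s) (B s) i k) has_field_derivative (mm d A' (B z) + mm d (A z) B') i k) (at z)"
proof -
  have "((\<lambda>s. \<Sum>j<d. A s i j * B s j k) has_field_derivative (\<Sum>j<d. A' i j * B z j k + B' j k * A z i j)) (at z)"
    using assms by (intro DERIV_sum DERIV_mult) auto
  then show ?thesis by (simp add: mm_def sum.distrib ac_simps)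
qed

lemma curve_conj:
  assumes c: "curve m \<gamma> X" and g: "g \<in> SO_odd m"
  shows "curve m (\<lambda>s. g * \<gamma> s * star m g) (mm (nn m) (mm (nn m) (ent (nn m) g) X) (ent (nn m) (star m g)))"
  unfolding curve_def
proof (intro conjI allI impI)
  let ?n = "nn m"
  have \<gamma>: "\<gamma> s \<in> SO_odd m" for s using c by (simp add: curve_def)
  note carr = SO_carrier[OF g] SO_carrier[OF \<gamma>]
  show "g * \<gamma> s * star m g \<in> SO_odd m" for s by (intro SO_mult g \<gamma> SO_inverse)
  show "g * \<gamma> 0 * star m g = 1\<^sub>m ?n" using c carr SO_star(2)[OF g] by (simp add: curve_def)
  fix a b assume ab: "a < ?n" "b < ?n"
  have e: "(g * \<gamma> s * star m g) $$ (a, b) = mm ?n (mm ?n (ent ?n g) (ent ?n (\<gamma> s))) (ent ?n (star m g)) a b" for s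
  proof -
    have "ent ?n (g * \<gamma> s * star m g) = mm ?n (mm ?n (ent ?n g) (ent ?n (\<gamma> s))) (ent ?n (star m g))"
      using carr ent_mult[OF mult_carrier_mat[OF carr(1) carr(2)] star_carrier] ent_mult[OF carr(1) carr(2)] by simp
    then have "ent ?n (g * \<gamma> s * star m g) a b = mm ?n (mm ?n (ent ?n g) (ent ?n (\<gamma> s))) (ent ?n (star m g)) a b" by simp
    then show ?thesis using ab by (simp only: ent_def) (simp add: ab)
  qed
  have d1: "((\<lambda>s. ent ?n (\<gamma> s) i j) has_field_derivative X i j) (at 0)" if "i < ?n" "j < ?n" for i j
    using c that by (simp add: curve_def ent_def)
  have d2: "((\<lambda>s. mm ?n (ent ?n g) (ent ?n (\<gamma> s)) a j) has_field_derivative mm ?n (ent ?n g) X a j) (at 0)" if "j < ?n" for j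
  proof -
    have "((\<lambda>s. mm ?n (ent ?n g) (ent ?n (\<gamma> s)) a j) has_field_derivative
       (mm ?n 0 (ent ?n (\<gamma> 0)) + mm ?n (ent ?n g) X) a j) (at 0)"
      by (rule deriv_mm[where A = "\<lambda>s. ent ?n g" and A' = 0]) (use d1 that in auto)
    then show ?thesis by simp
  qed
  have "((\<lambda>s. mm ?n (mm ?n (ent ?n g) (ent ?n (\<gamma> s))) (ent ?n (star m g)) a b) has_field_derivative
     (mm ?n (mm ?n (ent ?n g) X) (ent ?n (star m g)) + mm ?n (mm ?n (ent ?n g) (ent ?n (\<gamma> 0))) 0) a b) (at 0)"
    by (rule deriv_mm[where B = "\<lambda>s. ent ?n (star m g)" and B' = 0]) (use d2 in auto)
  then show "((\<lambda>s. (g * \<gamma> s * star m g) $$ (a, b)) has_field_derivative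
      mm ?n (mm ?n (ent ?n g) X) (ent ?n (star m g)) a b) (at 0)"
    unfolding e by simp
qed

text \<open>On the group \<open>star\<close> is inversion, so this is the inverse curve, with the
  tangent vector reflected in the antidiagonal.\<close>

lemma curve_star:
  assumes c: "curve m \<gamma> X"
  shows "curve m (\<lambda>s. star m (\<gamma> s)) (\<lambda>a b. X (2 * m - b) (2 * m - a))"
  using c unfolding curve_def by (auto simp: SO_inverse star_one star_entry)

section \<open>Differentiation of a rational representation\<close>

text \<open>The chain rule in the form used here: one linear functional L serves all curves through
  g, so the derivative depends on the tangent vector only.\<close>

lemma polyfun_gradient:
  assumes "polyfun n f"
  shows "\<exists>L. \<forall>\<gamma> X. \<gamma> 0 = g \<longrightarrow> (\<forall>i<n. \<forall>j<n. ((\<lambda>s. \<gamma> s $$ (i, j)) has_field_derivative X i j) (at (0::complex)))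
    \<longrightarrow> ((\<lambda>s. f (\<gamma> s)) has_field_derivative (\<Sum>i<n. \<Sum>j<n. L i j * X i j)) (at 0)"
  using assms
proof induction
  case (polyfun_const c)
  show ?case by (intro exI[of _ "\<lambda>i j. 0"]) simp
next
  case (polyfun_entry k l)
  have "(\<Sum>i<n. \<Sum>j<n. Eb k l i j * X i j) = X k l" for X :: opr
  proof -
    have "(\<Sum>i<n. \<Sum>j<n. Eb k l i j * X i j) = (\<Sum>i<n. if i = k then X k l else 0)"
    proof (rule sum.cong)
      fix i
      have "(\<Sum>j<n. Eb k l i j * X i j) = (\<Sum>j<n. if j = l then (if i = k then X k l else 0) else 0)"
        by (intro sum.cong) (auto simp: Eb_def)
      then show "(\<Sum>j<n. Eb k l i j * X i j) = (if i = k then X k l else 0)" using polyfun_entry by simp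
    qed simp
    then show ?thesis using polyfun_entry by simp
  qed
  then show ?case using polyfun_entry by (intro exI[of _ "Eb k l"]) simp
next
  case (polyfun_add f h)
  then obtain L M where *:
    "\<forall>\<gamma> X. \<gamma> 0 = g \<longrightarrow> (\<forall>i<n. \<forall>j<n. ((\<lambda>s. \<gamma> s $$ (i, j)) has_field_derivative X i j) (at (0::complex)))
      \<longrightarrow> ((\<lambda>s. f (\<gamma> s)) has_field_derivative (\<Sum>i<n. \<Sum>j<n. L i j * X i j)) (at 0)"
    "\<forall>\<gamma> X. \<gamma> 0 = g \<longrightarrow> (\<forall>i<n. \<forall>j<n. ((\<lambda>s. \<gamma> s $$ (i, j)) has_field_derivative X i j) (at (0::complex)))
      \<longrightarrow> ((\<lambda>s. h (\<gamma> s)) has_field_derivative (\<Sum>i<n. \<Sum>j<n. M i j * X i j)) (at 0)" by auto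
  show ?case
  proof (intro exI[of _ "\<lambda>i j. L i j + M i j"] allI impI)
    fix \<gamma> X assume "\<gamma> 0 = g" "\<forall>i<n. \<forall>j<n. ((\<lambda>s. \<gamma> s $$ (i, j)) has_field_derivative X i j) (at (0::complex))"
    then have "((\<lambda>s. f (\<gamma> s) + h (\<gamma> s)) has_field_derivative (\<Sum>i<n. \<Sum>j<n. L i j * X i j) + (\<Sum>i<n. \<Sum>j<n. M i j * X i j)) (at 0)"
      using * by (intro DERIV_add) blast+
    then show "((\<lambda>s. f (\<gamma> s) + h (\<gamma> s)) has_field_derivative (\<Sum>i<n. \<Sum>j<n. (L i j + M i j) * X i j)) (at 0)"
      by (simp add: distrib_right sum.distrib)
  qed
next
  case (polyfun_mult f h)
  then obtain L M where *:
    "\<forall>\<gamma> X. \<gamma> 0 = g \<longrightarrow> (\<forall>i<n. \<forall>j<n. ((\<lambda>s. \<gamma> s $$ (i, j)) has_field_derivative X i j) (at (0::complex)))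
      \<longrightarrow> ((\<lambda>s. f (\<gamma> s)) has_field_derivative (\<Sum>i<n. \<Sum>j<n. L i j * X i j)) (at 0)"
    "\<forall>\<gamma> X. \<gamma> 0 = g \<longrightarrow> (\<forall>i<n. \<forall>j<n. ((\<lambda>s. \<gamma> s $$ (i, j)) has_field_derivative X i j) (at (0::complex)))
      \<longrightarrow> ((\<lambda>s. h (\<gamma> s)) has_field_derivative (\<Sum>i<n. \<Sum>j<n. M i j * X i j)) (at 0)" by auto
  show ?case
  proof (intro exI[of _ "\<lambda>i j. L i j * h g + M i j * f g"] allI impI)
    fix \<gamma> X assume a: "\<gamma> 0 = g" "\<forall>i<n. \<forall>j<n. ((\<lambda>s. \<gamma> s $$ (i, j)) has_field_derivative X i j) (at (0::complex))"
    then have "((\<lambda>s. f (\<gamma> s) * h (\<gamma> s)) has_field_derivative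
        (\<Sum>i<n. \<Sum>j<n. L i j * X i j) * h (\<gamma> 0) + (\<Sum>i<n. \<Sum>j<n. M i j * X i j) * f (\<gamma> 0)) (at 0)"
      using * by (intro DERIV_mult) blast+
    then show "((\<lambda>s. f (\<gamma> s) * h (\<gamma> s)) has_field_derivative (\<Sum>i<n. \<Sum>j<n. (L i j * h g + M i j * f g) * X i j)) (at 0)"
      unfolding a(1) by (simp add: sum.distrib sum_distrib_right sum_distrib_left algebra_simps)
  qed
qed

locale ratrep =
  fixes m d :: nat and \<pi> :: "complex mat \<Rightarrow> complex mat"
  assumes rep: "rational_rep m d \<pi>"
begin

abbreviation "n \<equiv> nn m"

definition p :: "complex mat \<Rightarrow> opr" where
  "p g = ent d (\<pi> g)"

lemma sup_p [simp]: "sup d (p g)"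
  by (simp add: p_def)

lemma p_mult: "g \<in> SO_odd m \<Longrightarrow> h \<in> SO_odd m \<Longrightarrow> p (g * h) = mm d (p g) (p h)"
  using rep ent_mult[of "\<pi> g" d "\<pi> h"] by (simp add: p_def rational_rep_def)

lemma p_one: "p (1\<^sub>m n) = idop d"
  using rep ent_one[of d] by (simp add: p_def rational_rep_def nn_def)

lemma p_inverse: "g \<in> SO_odd m \<Longrightarrow> mm d (p g) (p (star m g)) = idop d" "g \<in> SO_odd m \<Longrightarrow> mm d (p (star m g)) (p g) = idop d"
  by (simp_all add: p_mult[symmetric] SO_inverse SO_star p_one)

lemma p_polyfun: "\<exists>f. polyfun n f \<and> (\<forall>g\<in>SO_odd m. p g a b = f g)"
proof (cases "a < d \<and> b < d")
  case True
  then show ?thesis using rep by (simp add: rational_rep_def nn_def p_def ent_def)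
next
  case False
  then show ?thesis by (intro exI[of _ "\<lambda>_. 0"]) (auto simp: p_def ent_def intro: polyfun_const)
qed

lemma ex_gradient:
  "\<exists>L. \<forall>\<gamma> X. curve m \<gamma> X \<longrightarrow> ((\<lambda>s. p (\<gamma> s) a b) has_field_derivative (\<Sum>i<n. \<Sum>j<n. L i j * X i j)) (at 0)"
proof -
  obtain f where f: "polyfun n f" "\<And>g. g \<in> SO_odd m \<Longrightarrow> p g a b = f g" using p_polyfun[of a b] by auto
  obtain L where L: "\<forall>\<gamma> X. \<gamma> 0 = 1\<^sub>m n \<longrightarrow> (\<forall>i<n. \<forall>j<n. ((\<lambda>s. \<gamma> s $$ (i, j)) has_field_derivative X i j) (at (0::complex)))
    \<longrightarrow> ((\<lambda>s. f (\<gamma> s)) has_field_derivative (\<Sum>i<n. \<Sum>j<n. L i j * X i j)) (at 0)"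
    using polyfun_gradient[OF f(1), of "1\<^sub>m n"] by blast
  have "((\<lambda>s. p (\<gamma> s) a b) has_field_derivative (\<Sum>i<n. \<Sum>j<n. L i j * X i j)) (at 0)" if c: "curve m \<gamma> X" for \<gamma> X
  proof -
    have "(\<lambda>s. p (\<gamma> s) a b) = (\<lambda>s. f (\<gamma> s))" using c f(2) by (simp add: curve_def)
    then show ?thesis using c L by (simp add: curve_def)
  qed
  then show ?thesis by blast
qed

definition gr :: "nat \<Rightarrow> nat \<Rightarrow> opr" where
  "gr a b = (SOME L. \<forall>\<gamma> X. curve m \<gamma> X \<longrightarrow> ((\<lambda>s. p (\<gamma> s) a b) has_field_derivative (\<Sum>i<n. \<Sum>j<n. L i j * X i j)) (at 0))"

text \<open>The differential of \<pi> at the identity. The fixed choice of gradients makes it linear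
  on all operators; on tangent vectors of curves it is the actual derivative.\<close>

definition dp :: "opr \<Rightarrow> opr" where
  "dp X = (\<lambda>a b. if a < d \<and> b < d then \<Sum>i<n. \<Sum>j<n. gr a b i j * X i j else 0)"

lemma dp_deriv:
  assumes "curve m \<gamma> X"
  shows "((\<lambda>s. p (\<gamma> s) a b) has_field_derivative dp X a b) (at 0)"
proof (cases "a < d \<and> b < d")
  case True
  then show ?thesis using someI_ex[OF ex_gradient[of a b]] assms by (simp add: dp_def gr_def)
next
  case False
  then have "(\<lambda>s. p (\<gamma> s) a b) = (\<lambda>s. 0)" by (auto simp: p_def ent_def)
  moreover have "dp X a b = 0" using False by (auto simp: dp_def)
  ultimately show ?thesis by simp
qed

lemma sup_dp [simp]: "sup d (dp X)"
  by (auto simp: sup_def dp_def)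

lemma dp_add: "dp (X + Y) = dp X + dp Y"
  by (auto simp: dp_def fun_eq_iff distrib_left sum.distrib)

lemma dp_diff: "dp (X - Y) = dp X - dp Y"
  by (auto simp: dp_def fun_eq_iff right_diff_distrib sum_subtractf)

lemma dp_uminus: "dp (- X) = - dp X"
  by (auto simp: dp_def fun_eq_iff sum_negf)

lemma dp_sc: "dp (sc c X) = sc c (dp X)"
  by (auto simp: dp_def sc_def fun_eq_iff sum_distrib_left ac_simps)

lemma dp_zero [simp]: "dp 0 = 0"
  by (simp add: dp_def fun_eq_iff)

lemma dp_sum: "dp (\<Sum>x\<in>I. f x) = (\<Sum>x\<in>I. dp (f x))"
proof (induction I rule: infinite_finite_induct)
  case (insert x F)
  have "dp (\<Sum>x\<in>insert x F. f x) = dp (f x + (\<Sum>x\<in>F. f x))" by (simp only: sum.insert[OF insert.hyps])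
  also have "\<dots> = dp (f x) + (\<Sum>x\<in>F. dp (f x))" by (simp only: dp_add insert.IH)
  finally show ?case by (simp only: sum.insert[OF insert.hyps])
qed (simp_all only: sum.infinite sum.empty dp_zero not_False_eq_True)

lemma dp_cong: "(\<And>i j. i < n \<Longrightarrow> j < n \<Longrightarrow> X i j = Y i j) \<Longrightarrow> dp X = dp Y"
  by (auto simp: dp_def fun_eq_iff intro!: sum.cong)

text \<open>The two sides are the derivative at 0 of s \<mapsto> \<pi>(g \<gamma>(s) g^{-1}), once
  via the conjugated curve and once via multiplicativity.\<close>

lemma dp_conj:
  assumes c: "curve m \<gamma> X" and g: "g \<in> SO_odd m"
  shows "dp (mm n (mm n (ent n g) X) (ent n (star m g))) = mm d (mm d (p g) (dp X)) (p (star m g))"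
proof (intro ext)
  fix a b
  have \<gamma>: "\<gamma> s \<in> SO_odd m" for s using c by (simp add: curve_def)
  have e: "p (g * \<gamma> s * star m g) = mm d (mm d (p g) (p (\<gamma> s))) (p (star m g))" for s
    by (simp add: p_mult SO_mult SO_inverse g \<gamma>)
  have d2: "((\<lambda>s. mm d (p g) (p (\<gamma> s)) a j) has_field_derivative mm d (p g) (dp X) a j) (at 0)" for j
  proof -
    have "((\<lambda>s. mm d (p g) (p (\<gamma> s)) a j) has_field_derivative
       (mm d 0 (p (\<gamma> 0)) + mm d (p g) (dp X)) a j) (at 0)"
      by (rule deriv_mm[where A = "\<lambda>s. p g" and A' = 0]) (use dp_deriv[OF c] in auto)
    then show ?thesis by simp
  qed
  have "((\<lambda>s. mm d (mm d (p g) (p (\<gamma> s))) (p (star m g)) a b) has_field_derivative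
     (mm d (mm d (p g) (dp X)) (p (star m g)) + mm d (mm d (p g) (p (\<gamma> 0))) 0) a b) (at 0)"
    by (rule deriv_mm[where B = "\<lambda>s. p (star m g)" and B' = 0]) (use d2 in auto)
  then have 1: "((\<lambda>s. p (g * \<gamma> s * star m g) a b) has_field_derivative
      mm d (mm d (p g) (dp X)) (p (star m g)) a b) (at 0)"
    unfolding e by simp
  show "dp (mm n (mm n (ent n g) X) (ent n (star m g))) a b = mm d (mm d (p g) (dp X)) (p (star m g)) a b"
    by (rule DERIV_unique[OF dp_deriv[OF curve_conj[OF c g]] 1])
qed

text \<open>Put g = \<gamma>(s) in \<open>dp_conj\<close> for the curve of Y and differentiate in s:
  the left side gives \<open>dp\<close> of the commutator by linearity, the right side the
  commutator of the images.\<close>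

lemma dp_bracket:
  assumes c: "curve m \<gamma> X" and cY: "curve m \<gamma>' Y"
    and X: "\<And>a b. a < n \<Longrightarrow> b < n \<Longrightarrow> X (2 * m - b) (2 * m - a) = - X a b" and sX: "sup n X" and sY: "sup n Y"
  shows "dp (mm n X Y - mm n Y X) = mm d (dp X) (dp Y) - mm d (dp Y) (dp X)"
proof (intro ext)
  fix a b
  have \<gamma>: "\<gamma> s \<in> SO_odd m" "\<gamma> 0 = 1\<^sub>m n" for s using c by (simp_all add: curve_def)
  note cs = curve_star[OF c]
  let ?Z = "\<lambda>s. mm n (mm n (ent n (\<gamma> s)) Y) (ent n (star m (\<gamma> s)))"
  have s0: "ent n (\<gamma> 0) = idop n" "ent n (star m (\<gamma> 0)) = idop n" by (simp_all add: \<gamma>(2) star_one ent_one)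
  have Zd: "((\<lambda>s. ?Z s i j) has_field_derivative (mm n X Y - mm n Y X) i j) (at 0)" if ij: "i < n" "j < n" for i j
  proof -
    have 1: "((\<lambda>s. mm n (ent n (\<gamma> s)) Y i k) has_field_derivative mm n X Y i k) (at 0)" for k
    proof -
      have "((\<lambda>s. mm n (ent n (\<gamma> s)) Y i k) has_field_derivative (mm n X Y + mm n (ent n (\<gamma> 0)) 0) i k) (at 0)"
        by (rule deriv_mm[where B = "\<lambda>s. Y" and B' = 0]) (use c ij in \<open>auto simp: curve_def ent_def\<close>)
      then show ?thesis by simp
    qed
    have 2: "((\<lambda>s. ent n (star m (\<gamma> s)) k j) has_field_derivative (- X) k j) (at 0)" if "k < n" for k
    proof -
      have "((\<lambda>s. star m (\<gamma> s) $$ (k, j)) has_field_derivative X (2 * m - j) (2 * m - k)) (at 0)"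
        using cs ij that by (simp add: curve_def)
      then show ?thesis using X[OF that ij(2)] ij that by (simp add: ent_def)
    qed
    have "((\<lambda>s. ?Z s i j) has_field_derivative (mm n (mm n X Y) (ent n (star m (\<gamma> 0))) + mm n (mm n (ent n (\<gamma> 0)) Y) (- X)) i j) (at 0)"
      by (rule deriv_mm) (use 1 2 in auto)
    then show ?thesis
      unfolding s0 mm_id(1)[OF sY] mm_id(2)[OF sup_mm[OF sX sY]] by (simp add: mm_uminus)
  qed
  have d1: "((\<lambda>s. dp (?Z s) a b) has_field_derivative dp (mm n X Y - mm n Y X) a b) (at 0)"
  proof (cases "a < d \<and> b < d")
    case True
    have "((\<lambda>s. \<Sum>i<n. \<Sum>j<n. gr a b i j * ?Z s i j) has_field_derivative
        (\<Sum>i<n. \<Sum>j<n. gr a b i j * (mm n X Y - mm n Y X) i j)) (at 0)"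
      using Zd by (intro DERIV_sum DERIV_cmult) auto
    then show ?thesis using True by (simp add: dp_def)
  qed (auto simp: dp_def)
  have e: "dp (?Z s) = mm d (mm d (p (\<gamma> s)) (dp Y)) (p (star m (\<gamma> s)))" for s
    by (rule dp_conj[OF cY \<gamma>(1)])
  have dpn: "dp (\<lambda>a b. X (2 * m - b) (2 * m - a)) = - dp X"
  proof -
    have "dp (\<lambda>a b. X (2 * m - b) (2 * m - a)) = dp (- X)" by (rule dp_cong) (simp add: X)
    then show ?thesis by (simp add: dp_uminus)
  qed
  have p0: "p (\<gamma> 0) = idop d" "p (star m (\<gamma> 0)) = idop d" by (simp_all add: \<gamma>(2) star_one p_one)
  have 1: "((\<lambda>s. mm d (p (\<gamma> s)) (dp Y) a k) has_field_derivative mm d (dp X) (dp Y) a k) (at 0)" for k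
  proof -
    have "((\<lambda>s. mm d (p (\<gamma> s)) (dp Y) a k) has_field_derivative (mm d (dp X) (dp Y) + mm d (p (\<gamma> 0)) 0) a k) (at 0)"
      by (rule deriv_mm[where B = "\<lambda>s. dp Y" and B' = 0]) (use dp_deriv[OF c] in auto)
    then show ?thesis by simp
  qed
  have 2: "((\<lambda>s. p (star m (\<gamma> s)) k b) has_field_derivative (- dp X) k b) (at 0)" for k
    using dp_deriv[OF cs, of k b] by (simp add: dpn)
  have "((\<lambda>s. dp (?Z s) a b) has_field_derivative (mm d (mm d (dp X) (dp Y)) (p (star m (\<gamma> 0))) + mm d (mm d (p (\<gamma> 0)) (dp Y)) (- dp X)) a b) (at 0)"
    unfolding e by (rule deriv_mm) (use 1 2 in auto)
  then have d2: "((\<lambda>s. dp (?Z s) a b) has_field_derivative (mm d (dp X) (dp Y) - mm d (dp Y) (dp X)) a b) (at 0)"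
    unfolding p0 mm_id(1)[OF sup_dp] mm_id(2)[OF sup_mm[OF sup_dp sup_dp]] by (simp add: mm_uminus)
  show "dp (mm n X Y - mm n Y X) a b = (mm d (dp X) (dp Y) - mm d (dp Y) (dp X)) a b"
    by (rule DERIV_unique[OF d1 d2])
qed

section \<open>Root operators and the Casimir operator\<close>

definition E :: "nat \<Rightarrow> nat \<Rightarrow> opr" where
  "E i j = dp (Fb m i j)"

lemma sup_E [simp]: "sup d (E i j)"
  by (simp add: E_def)

lemma E_antisym: "i \<le> 2 * m \<Longrightarrow> j \<le> 2 * m \<Longrightarrow> E (2 * m - j) (2 * m - i) = - E i j"
  by (simp add: E_def Fb_antisym dp_uminus)

lemma E_zero: "i \<le> 2 * m \<Longrightarrow> E i (2 * m - i) = 0"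
proof -
  assume "i \<le> 2 * m"
  then have "Fb m i (2 * m - i) = 0" by (simp add: Fb_def fun_eq_iff)
  then show ?thesis by (simp add: E_def)
qed

lemma Fb_reflect: "i \<le> 2 * m \<Longrightarrow> j \<le> 2 * m \<Longrightarrow> a < n \<Longrightarrow> b < n \<Longrightarrow> Fb m i j (2 * m - b) (2 * m - a) = - Fb m i j a b"
proof -
  assume *: "i \<le> 2 * m" "j \<le> 2 * m" "a < n" "b < n"
  have e: "2 * m - x = y \<longleftrightarrow> x = 2 * m - y" if "x \<le> 2 * m" "y \<le> 2 * m" for x y :: nat using that by auto
  have "Eb k l (2 * m - b) (2 * m - a) = Eb (2 * m - l) (2 * m - k) a b" if "k \<le> 2 * m" "l \<le> 2 * m" for k l
    using * that e[of b k] e[of a l] by (auto simp: Eb_def)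
  then show ?thesis using * by (simp add: Fb_def)
qed

lemma E_bracket:
  assumes ij: "i \<le> 2 * m" "j \<le> 2 * m" "i \<noteq> j" "i \<noteq> 2 * m - j"
  shows "mm d (E i j) (E j i) - mm d (E j i) (E i j) = E i i - E j j"
proof -
  have neq: "2 * m - i \<noteq> 2 * m - j" "j \<noteq> 2 * m - i" using ij by auto
  obtain \<gamma> \<gamma>' where c: "curve m \<gamma> (Fb m i j)" "curve m \<gamma>' (Fb m j i)" using curve_Fb ij by metis
  have "mm n (Fb m i j) (Fb m j i) - mm n (Fb m j i) (Fb m i j) = Fb m i i - Fb m j j"
    using ij neq unfolding Fb_def mm_diff mm_Eb by (auto simp: fun_eq_iff)
  then show ?thesis
    using dp_bracket[OF c Fb_reflect[OF ij(1,2)] sup_Fb[OF ij(1,2)] sup_Fb[OF ij(2,1)]] by (simp add: E_def dp_diff)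
qed

text \<open>Conjugating a matrix unit expands it in all matrix units; subtracting the mirror image
  commutes with conjugation by g and turns the expansion into one in the \<open>Fb\<close>.\<close>

lemma conj_Fb:
  assumes g: "g \<in> SO_odd m" and ij: "i < n" "j < n" and ab: "a < n" "b < n"
  shows "mm n (mm n (ent n g) (Fb m i j)) (ent n (star m g)) a b =
    (\<Sum>x\<in>{..<n} \<times> {..<n}. sc (g $$ (fst x, i) * star m g $$ (j, snd x)) (Fb m (fst x) (snd x))) a b"
proof -
  have e: "mm n (ent n g) (Eb k l) u v = (if v = l then ent n g u k else 0)" if "k < n" for k l u v
  proof -
    have "mm n (ent n g) (Eb k l) u v = (\<Sum>c<n. if c = k then (if v = l then ent n g u k else 0) else 0)"
      unfolding mm_def Eb_def by (intro sum.cong) auto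
    then show ?thesis using that by simp
  qed
  have e2: "mm n (mm n (ent n g) (Eb k l)) (ent n (star m g)) a b = g $$ (a, k) * star m g $$ (l, b)" if "k < n" "l < n" for k l
  proof -
    have "mm n (mm n (ent n g) (Eb k l)) (ent n (star m g)) a b = (\<Sum>c<n. if c = l then g $$ (a, k) * star m g $$ (l, b) else 0)"
      unfolding mm_def[of n "mm n (ent n g) (Eb k l)"] e[OF that(1)] by (intro sum.cong) (use ab that in \<open>auto simp: ent_def\<close>)
    then show ?thesis using that by simp
  qed
  have L: "mm n (mm n (ent n g) (Fb m i j)) (ent n (star m g)) a b =
     g $$ (a, i) * star m g $$ (j, b) - g $$ (a, 2 * m - j) * star m g $$ (2 * m - i, b)"
    using ij by (simp add: Fb_def mm_diff e2)
  have q: "2 * m - x = y \<longleftrightarrow> x = 2 * m - y" if "x \<le> 2 * m" "y \<le> 2 * m" for x y :: nat using that by auto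
  have "(\<Sum>x\<in>{..<n} \<times> {..<n}. sc (g $$ (fst x, i) * star m g $$ (j, snd x)) (Fb m (fst x) (snd x))) a b =
    (\<Sum>x\<in>{..<n} \<times> {..<n}. (if x = (a, b) then g $$ (a, i) * star m g $$ (j, b) else 0) -
       (if x = (2 * m - b, 2 * m - a) then g $$ (2 * m - b, i) * star m g $$ (j, 2 * m - a) else 0))"
    unfolding opr_sum_apply
  proof (rule sum.cong)
    fix x assume x: "x \<in> {..<n} \<times> {..<n}"
    obtain k l where kl: "x = (k, l)" "k \<le> 2 * m" "l \<le> 2 * m" using x by auto
    have "(a = 2 * m - l) = (l = 2 * m - a)" "(b = 2 * m - k) = (k = 2 * m - b)"
      using ab kl(2,3) by auto
    then have c: "(a = k \<and> b = l) = (k = a \<and> l = b)" "(a = 2 * m - l \<and> b = 2 * m - k) = (k = 2 * m - b \<and> l = 2 * m - a)"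
      by auto
    have F: "Fb m k l a b = (if k = a \<and> l = b then 1 else 0) - (if k = 2 * m - b \<and> l = 2 * m - a then 1 else 0)"
      unfolding Fb_def Eb_def minus_apply c ..
    have "u * ((if k = a \<and> l = b then 1 else 0) - (if k = b' \<and> l = a' then 1 else 0)) =
        (if k = a \<and> l = b then u else 0) - (if k = b' \<and> l = a' then u else 0)" for u :: complex and a' b'
      by simp
    then show "sc (g $$ (fst x, i) * star m g $$ (j, snd x)) (Fb m (fst x) (snd x)) a b =
      (if x = (a, b) then g $$ (a, i) * star m g $$ (j, b) else 0) -
       (if x = (2 * m - b, 2 * m - a) then g $$ (2 * m - b, i) * star m g $$ (j, 2 * m - a) else 0)"
      unfolding sc_def kl(1) fst_conv snd_conv F prod.inject by (simp cong: if_cong)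
  qed simp
  also have "\<dots> = g $$ (a, i) * star m g $$ (j, b) - g $$ (2 * m - b, i) * star m g $$ (j, 2 * m - a)"
    using ab by (simp add: sum_subtractf)
  also have "\<dots> = g $$ (a, i) * star m g $$ (j, b) - g $$ (a, 2 * m - j) * star m g $$ (2 * m - i, b)"
    using ab ij by (simp add: star_entry)
  finally show ?thesis using L by simp
qed

lemma p_conj_E:
  assumes g: "g \<in> SO_odd m" and ij: "i < n" "j < n"
  shows "mm d (mm d (p g) (E i j)) (p (star m g)) =
    (\<Sum>x\<in>{..<n} \<times> {..<n}. sc (g $$ (fst x, i) * star m g $$ (j, snd x)) (E (fst x) (snd x)))"
proof -
  obtain \<gamma> where c: "curve m \<gamma> (Fb m i j)" using curve_Fb ij by (metis less_nn)
  have "mm d (mm d (p g) (E i j)) (p (star m g)) = dp (mm n (mm n (ent n g) (Fb m i j)) (ent n (star m g)))"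
    unfolding E_def by (rule dp_conj[OF c g, symmetric])
  also have "\<dots> = dp (\<Sum>x\<in>{..<n} \<times> {..<n}. sc (g $$ (fst x, i) * star m g $$ (j, snd x)) (Fb m (fst x) (snd x)))"
    by (rule dp_cong[OF conj_Fb[OF g ij]])
  finally show ?thesis by (simp add: dp_sum dp_sc E_def)
qed

text \<open>The Casimir operator in an unusual normalisation: the sum runs over all index pairs, so
  a pair and its mirror image contribute the same term twice, and pairs on the antidiagonal
  contribute zero.\<close>

definition Cs :: opr where
  "Cs = (\<Sum>x\<in>{..<n} \<times> {..<n}. mm d (E (fst x) (snd x)) (E (snd x) (fst x)))"

lemma sum_SO_inverse:
  assumes g: "g \<in> SO_odd m" and ab: "a < n" "b < n"
  shows "(\<Sum>i<n. g $$ (a, i) * star m g $$ (i, b)) = (if a = b then 1 else 0)"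
  using mat_mult_entry[OF SO_carrier[OF g] star_carrier[of m g] ab] ab unfolding SO_star(2)[OF g] by simp

text \<open>Conjugation by g expands both factors of each summand in root operators. Summing the
  products of the coefficients over the original index pair gives entries of g g^{-1} = 1, which
  leaves only the terms where the second pair is the first one reversed.\<close>

lemma Cs_invariant:
  assumes g: "g \<in> SO_odd m"
  shows "mm d (p g) Cs = mm d Cs (p g)"
proof -
  let ?I = "{..<n} \<times> {..<n}"
  let ?gs = "star m g"
  define u where "u x y = g $$ (fst x, fst y) * ?gs $$ (snd y, snd x)" for x y :: "nat \<times> nat"
  define w where "w x y = g $$ (fst x, snd y) * ?gs $$ (fst y, snd x)" for x y :: "nat \<times> nat"
  define Ex where "Ex x = E (fst x) (snd x)" for x :: "nat \<times> nat"
  define Cx where "Cx A = mm d (mm d (p g) A) (p ?gs)" for A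
  have Cm: "Cx (mm d A B) = mm d (Cx A) (Cx B)" if "sup d B" for A B
  proof -
    have "mm d (Cx A) (Cx B) = mm d (mm d (p g) A) (mm d (mm d (p ?gs) (p g)) (mm d B (p ?gs)))"
      by (simp add: Cx_def mm_assoc)
    also have "\<dots> = Cx (mm d A B)"
      using mm_id(1)[OF sup_mm[OF that sup_p]] by (simp add: p_inverse[OF g] Cx_def mm_assoc)
    finally show ?thesis by simp
  qed
  have C1: "Cx (E (fst y) (snd y)) = (\<Sum>x\<in>?I. sc (u x y) (Ex x))" if "y \<in> ?I" for y
    using p_conj_E[OF g, of "fst y" "snd y"] that unfolding Cx_def u_def Ex_def by auto
  have C2: "Cx (E (snd y) (fst y)) = (\<Sum>x\<in>?I. sc (w x y) (Ex x))" if "y \<in> ?I" for y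
    using p_conj_E[OF g, of "snd y" "fst y"] that unfolding Cx_def w_def Ex_def by auto
  have "Cx Cs = (\<Sum>y\<in>?I. Cx (mm d (E (fst y) (snd y)) (E (snd y) (fst y))))"
    by (simp add: Cs_def Cx_def mm_sum)
  also have "\<dots> = (\<Sum>y\<in>?I. \<Sum>x\<in>?I. \<Sum>z\<in>?I. sc (u x y * w z y) (mm d (Ex x) (Ex z)))"
  proof (rule sum.cong[OF HOL.refl])
    fix y assume y: "y \<in> ?I"
    have "Cx (mm d (E (fst y) (snd y)) (E (snd y) (fst y))) = mm d (\<Sum>x\<in>?I. sc (u x y) (Ex x)) (\<Sum>x\<in>?I. sc (w x y) (Ex x))"
      unfolding Cm[OF sup_E] C1[OF y] C2[OF y] ..
    also have "\<dots> = (\<Sum>x\<in>?I. \<Sum>z\<in>?I. mm d (sc (u x y) (Ex x)) (sc (w z y) (Ex z)))"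
      by (subst mm_sum(1)) (simp only: mm_sum(2))
    also have "\<dots> = (\<Sum>x\<in>?I. \<Sum>z\<in>?I. sc (u x y * w z y) (mm d (Ex x) (Ex z)))"
      unfolding mm_sc sc_sc by (intro sum.cong HOL.refl) (simp only: mult.commute)
    finally show "Cx (mm d (E (fst y) (snd y)) (E (snd y) (fst y))) = (\<Sum>x\<in>?I. \<Sum>z\<in>?I. sc (u x y * w z y) (mm d (Ex x) (Ex z)))" .
  qed
  also have "\<dots> = (\<Sum>x\<in>?I. \<Sum>z\<in>?I. sc (\<Sum>y\<in>?I. u x y * w z y) (mm d (Ex x) (Ex z)))"
    unfolding sc_sum by (subst sum.swap, rule sum.cong[OF HOL.refl], rule sum.swap)
  also have "\<dots> = (\<Sum>x\<in>?I. \<Sum>z\<in>?I. if z = (snd x, fst x) then mm d (Ex x) (Ex z) else 0)"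
  proof (intro sum.cong HOL.refl)
    fix x z assume xz: "x \<in> ?I" "z \<in> ?I"
    have "(\<Sum>y\<in>?I. u x y * w z y) = (\<Sum>i<n. \<Sum>j<n. (g $$ (fst x, i) * ?gs $$ (i, snd z)) * (g $$ (fst z, j) * ?gs $$ (j, snd x)))"
      unfolding u_def w_def by (subst sum.cartesian_product) (auto intro!: sum.cong)
    also have "\<dots> = (\<Sum>i<n. g $$ (fst x, i) * ?gs $$ (i, snd z)) * (\<Sum>j<n. g $$ (fst z, j) * ?gs $$ (j, snd x))"
      by (simp only: sum_product)
    also have "\<dots> = (if z = (snd x, fst x) then 1 else 0)"
      using xz sum_SO_inverse[OF g] by (auto simp: prod_eq_iff)
    finally show "sc (\<Sum>y\<in>?I. u x y * w z y) (mm d (Ex x) (Ex z)) = (if z = (snd x, fst x) then mm d (Ex x) (Ex z) else 0)"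
      by simp
  qed
  also have "\<dots> = Cs"
    unfolding Cs_def Ex_def by (intro sum.cong) (auto simp: sum.delta)
  finally have C: "Cx Cs = Cs" .
  have sC: "sup d Cs"
    unfolding Cs_def by (rule sup_sum) (simp add: sup_mm)
  have "mm d Cs (p g) = mm d (mm d (p g) Cs) (mm d (p ?gs) (p g))"
    using C by (simp add: Cx_def mm_assoc[symmetric]) 
  then show ?thesis using mm_id(2)[OF sup_mm[OF sup_p sC]] by (simp add: p_inverse[OF g])
qed

end

section \<open>Weights and the Casimir operator\<close>

lemma wtv_wts: "i \<le> 2 * m \<Longrightarrow> wtv m i \<in> wts m"
  by (auto simp: wtv_def wts_def ew_def)

lemma wtv_reflect: "i \<le> 2 * m \<Longrightarrow> wtv m (2 * m - i) = - wtv m i"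
  by (cases i m rule: linorder_cases) (auto simp: wtv_def)

lemma keys_mult_wts: "ks f \<subseteq> wts m \<Longrightarrow> ks g \<subseteq> wts m \<Longrightarrow> ks (f * g) \<subseteq> wts m"
  using keys_mult[of f g] wts_add by blast

lemma keys_add_wts: "ks f \<subseteq> wts m \<Longrightarrow> ks g \<subseteq> wts m \<Longrightarrow> ks (f + g) \<subseteq> wts m"
  using Poly_Mapping.keys_add[of f g] by blast

lemma polyfun_torus:
  assumes "polyfun (nn m) f"
  shows "\<exists>q. ks q \<subseteq> wts m \<and> (\<forall>x. unitvals m x \<longrightarrow> f (torus_elt m x) = ev m x q)"
  using assms
proof induction
  case (polyfun_const c)
  show ?case by (intro exI[of _ "sg 0 c"]) (auto simp: ev_single)
next
  case (polyfun_entry i j)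
  then show ?case
    by (intro exI[of _ "if i = j then xp (wtv m i) else 0"]) (auto simp: torus_entry ev_single wtv_wts)
next
  case (polyfun_add f h)
  then obtain q r where "ks q \<subseteq> wts m" "\<forall>x. unitvals m x \<longrightarrow> f (torus_elt m x) = ev m x q"
    "ks r \<subseteq> wts m" "\<forall>x. unitvals m x \<longrightarrow> h (torus_elt m x) = ev m x r" by blast
  then show ?case by (intro exI[of _ "q + r"]) (simp add: ev_add keys_add_wts)
next
  case (polyfun_mult f h)
  then obtain q r where "ks q \<subseteq> wts m" "\<forall>x. unitvals m x \<longrightarrow> f (torus_elt m x) = ev m x q"
    "ks r \<subseteq> wts m" "\<forall>x. unitvals m x \<longrightarrow> h (torus_elt m x) = ev m x r" by blast
  then show ?case by (intro exI[of _ "q * r"]) (simp add: ev_mult keys_mult_wts)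
qed

definition pair :: "nat \<Rightarrow> wt \<Rightarrow> wt \<Rightarrow> int" where
  "pair m \<alpha> \<kappa> = (\<Sum>k<m. \<alpha> k * \<kappa> k)"

lemma pair_add: "pair m (\<alpha> + \<beta>) \<kappa> = pair m \<alpha> \<kappa> + pair m \<beta> \<kappa>"
  and pair_diff: "pair m (\<alpha> - \<beta>) \<kappa> = pair m \<alpha> \<kappa> - pair m \<beta> \<kappa>"
  and pair_uminus: "pair m (- \<alpha>) \<kappa> = - pair m \<alpha> \<kappa>"
  by (simp_all add: pair_def distrib_right left_diff_distrib sum.distrib sum_subtractf sum_negf)

lemma pair_zero [simp]: "pair m 0 \<kappa> = 0"
  by (simp add: pair_def)

lemma pair_sum: "pair m (\<Sum>a\<in>A. f a) \<kappa> = (\<Sum>a\<in>A. pair m (f a) \<kappa>)"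
  by (simp add: pair_def sum_wt_apply sum_distrib_right) (rule sum.swap)

lemma pair_ew: "i < m \<Longrightarrow> pair m (ew i) \<kappa> = \<kappa> i"
proof -
  assume i: "i < m"
  have "pair m (ew i) \<kappa> = (\<Sum>k<m. if k = i then \<kappa> i else 0)"
    unfolding pair_def ew_def by (intro sum.cong) auto
  then show ?thesis using i by simp
qed

text \<open>The mirror map exchanges the two triangles beside the antidiagonal, on which f vanishes.
  The remaining triangle consists of \<open>Phi m\<close>, its transpose and the first m diagonal
  places.\<close>

lemma sum_pairs:
  fixes f :: "nat \<Rightarrow> nat \<Rightarrow> complex"
  assumes r: "\<And>i j. i \<le> 2 * m \<Longrightarrow> j \<le> 2 * m \<Longrightarrow> f (2 * m - j) (2 * m - i) = f i j"
    and z: "\<And>i. i \<le> 2 * m \<Longrightarrow> f i (2 * m - i) = 0"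
  shows "(\<Sum>x\<in>{..<nn m} \<times> {..<nn m}. f (fst x) (snd x)) =
    2 * (\<Sum>x\<in>Phi m. f (fst x) (snd x) + f (snd x) (fst x)) + 2 * (\<Sum>i<m. f i i)"
proof -
  let ?g = "\<lambda>x. f (fst x) (snd x)"
  define A where "A = {x. fst x + snd x < 2 * m}"
  define B where "B = {x \<in> {..<nn m} \<times> {..<nn m}. 2 * m < fst x + snd x}"
  define C where "C = (\<lambda>i. (i, 2 * m - i)) ` {..<nn m}"
  have fin: "finite A" "finite B" "finite C"
    by (auto simp: A_def B_def C_def intro: finite_subset[of _ "{..2*m} \<times> {..2*m}"])
  have U: "{..<nn m} \<times> {..<nn m} = A \<union> (B \<union> C)"
  proof (rule equalityI; rule subsetI)
    fix x assume x: "x \<in> {..<nn m} \<times> {..<nn m}"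
    obtain i j where ij: "x = (i, j)" "i \<le> 2 * m" "j \<le> 2 * m" using x by auto
    consider "i + j < 2 * m" | "i + j > 2 * m" | "j = 2 * m - i" using ij by linarith
    then show "x \<in> A \<union> (B \<union> C)" using ij by cases (auto simp: A_def B_def C_def)
  qed (auto simp: A_def B_def C_def)
  have d: "A \<inter> (B \<union> C) = {}" "B \<inter> C = {}" by (auto simp: A_def B_def C_def)
  have "sum ?g B = sum ?g A"
    by (rule sum.reindex_bij_witness[of _ "\<lambda>x. (2 * m - snd x, 2 * m - fst x)" "\<lambda>x. (2 * m - snd x, 2 * m - fst x)"])
      (auto simp: A_def B_def r)
  moreover have "sum ?g C = 0" by (rule sum.neutral) (auto simp: C_def z)
  ultimately have 1: "sum ?g ({..<nn m} \<times> {..<nn m}) = 2 * sum ?g A"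
    unfolding U using fin d by (simp add: sum.union_disjoint)
  define D where "D = (\<lambda>x. (snd x, fst x)) ` Phi m"
  define G where "G = (\<lambda>i. (i, i)) ` {..<m}"
  have UA: "A = Phi m \<union> (D \<union> G)"
  proof (rule equalityI; rule subsetI)
    fix x assume x: "x \<in> A"
    obtain i j where ij: "x = (i, j)" "i + j < 2 * m" using x by (cases x) (auto simp: A_def)
    consider "i < j" | "j < i" | "i = j" by linarith
    then show "x \<in> Phi m \<union> (D \<union> G)"
    proof cases
      case 2
      then have "(j, i) \<in> Phi m" using ij by (auto simp: Phi_def)
      then show ?thesis using ij by (force simp: D_def)
    qed (use ij in \<open>auto simp: Phi_def G_def\<close>)
  qed (auto simp: A_def Phi_def D_def G_def)
  have d': "Phi m \<inter> (D \<union> G) = {}" "D \<inter> G = {}" by (auto simp: Phi_def D_def G_def)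
  have "sum ?g D = (\<Sum>x\<in>Phi m. f (snd x) (fst x))"
    unfolding D_def by (subst sum.reindex) (auto simp: inj_on_def prod_eq_iff)
  moreover have "sum ?g G = (\<Sum>i<m. f i i)"
    unfolding G_def by (subst sum.reindex) (auto simp: inj_on_def)
  moreover have "finite D" "finite G" by (simp_all add: D_def G_def)
  ultimately have "sum ?g A = (\<Sum>x\<in>Phi m. ?g x) + ((\<Sum>x\<in>Phi m. f (snd x) (fst x)) + (\<Sum>i<m. f i i))"
    unfolding UA using d' by (simp add: sum.union_disjoint)
  then show ?thesis unfolding 1 by (simp add: sum.distrib algebra_simps)
qed

lemma opr_indep:
  assumes "finite T" "T \<subseteq> wts m" "\<And>x. unitvals m x \<Longrightarrow> (\<Sum>\<mu>\<in>T. sc (mon m x \<mu>) (A \<mu>)) = 0" "\<mu> \<in> T"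
  shows "A \<mu> = 0"
proof (intro ext)
  fix a b
  have "(\<Sum>\<mu>\<in>T. A \<mu> a b * mon m x \<mu>) = 0" if "unitvals m x" for x
    using arg_cong[OF assms(3)[OF that], of "\<lambda>f. f a b"] by (simp add: opr_sum_apply sc_def mult.commute)
  then show "A \<mu> a b = 0 a b" using mon_indep[OF assms(1,2), of "\<lambda>\<mu>. A \<mu> a b"] assms(4) by simp
qed

lemma sc_diff: "sc c (A - B) = sc c A - sc c B"
  by (simp add: sc_def fun_eq_iff right_diff_distrib)

context ratrep
begin

section \<open>Projections onto the weight spaces\<close>

lemma ex_q: "\<exists>q. ks q \<subseteq> wts m \<and> (\<forall>x. unitvals m x \<longrightarrow> p (torus_elt m x) a b = ev m x q) \<and> (\<not> (a < d \<and> b < d) \<longrightarrow> q = 0)"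
proof (cases "a < d \<and> b < d")
  case True
  obtain f where f: "polyfun n f" "\<forall>g\<in>SO_odd m. p g a b = f g" using p_polyfun by blast
  then show ?thesis using polyfun_torus[OF f(1)] torus_SO True by metis
next
  case False
  then show ?thesis by (intro exI[of _ 0]) (auto simp: p_def ent_def)
qed

definition q :: "nat \<Rightarrow> nat \<Rightarrow> laur" where
  "q a b = (SOME q. ks q \<subseteq> wts m \<and> (\<forall>x. unitvals m x \<longrightarrow> p (torus_elt m x) a b = ev m x q) \<and> (\<not> (a < d \<and> b < d) \<longrightarrow> q = 0))"

lemma q: "ks (q a b) \<subseteq> wts m" "unitvals m x \<Longrightarrow> p (torus_elt m x) a b = ev m x (q a b)" "\<not> (a < d \<and> b < d) \<Longrightarrow> q a b = 0"
  using someI_ex[OF ex_q[of a b]] by (auto simp: q_def)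

definition S :: "wt set" where
  "S = (\<Union>a<d. \<Union>b<d. ks (q a b))"

lemma S: "finite S" "S \<subseteq> wts m"
  using q(1) by (auto simp: S_def)

text \<open>The projection onto the weight space of \<mu>, read off as the operator coefficient of
  the monomial \<mu> in the restriction of the representation to the torus.\<close>

definition P :: "wt \<Rightarrow> opr" where
  "P \<mu> = (\<lambda>a b. lk (q a b) \<mu>)"

lemma sup_P [simp]: "sup d (P \<mu>)"
  using q(3) by (auto simp: sup_def P_def)

lemma P_zero: "\<mu> \<notin> S \<Longrightarrow> P \<mu> = 0"
proof (intro ext)
  fix a b assume "\<mu> \<notin> S"
  then show "P \<mu> a b = 0 a b"
    using q(3)[of a b] by (cases "a < d \<and> b < d") (auto simp: P_def S_def in_keys_iff)
qed

lemma p_torus: "unitvals m x \<Longrightarrow> p (torus_elt m x) = (\<Sum>\<mu>\<in>S. sc (mon m x \<mu>) (P \<mu>))"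
proof (intro ext)
  fix a b assume x: "unitvals m x"
  have "ks (q a b) \<subseteq> S" using q(3)[of a b] by (cases "a < d \<and> b < d") (auto simp: S_def)
  then show "p (torus_elt m x) a b = (\<Sum>\<mu>\<in>S. sc (mon m x \<mu>) (P \<mu>)) a b"
    by (simp add: q(2)[OF x] ev_superset[OF S(1)] opr_sum_apply sc_def P_def mult.commute)
qed

text \<open>Compare the coefficients of the monomials \<mu> in x and \<nu> in y on the two sides of
  \<pi>(x) \<pi>(y) = \<pi>(xy).\<close>

lemma P_orth: "mm d (P \<mu>) (P \<nu>) = (if \<mu> = \<nu> then P \<mu> else 0)"
proof (cases "\<mu> \<in> S \<and> \<nu> \<in> S")
  case True
  let ?A = "\<lambda>\<mu> \<nu>. mm d (P \<mu>) (P \<nu>) - (if \<mu> = \<nu> then P \<mu> else 0)"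
  have "(\<Sum>\<nu>\<in>S. sc (mon m y \<nu>) (?A \<mu> \<nu>)) = 0" if y: "unitvals m y" and \<mu>: "\<mu> \<in> S" for y \<mu>
  proof (rule opr_indep[OF S _ \<mu>])
    fix x assume x: "unitvals m x"
    have xy: "unitvals m (\<lambda>i. x i * y i)" using x y by (simp add: unitvals_def)
    have e: "(\<Sum>\<nu>\<in>S. sc (mon m y \<nu>) (if \<mu> = \<nu> then P \<mu> else 0)) = sc (mon m y \<mu>) (P \<mu>)" if "\<mu> \<in> S" for \<mu>
    proof -
      have "(\<Sum>\<nu>\<in>S. sc (mon m y \<nu>) (if \<mu> = \<nu> then P \<mu> else 0)) = (\<Sum>\<nu>\<in>S. if \<nu> = \<mu> then sc (mon m y \<mu>) (P \<mu>) else 0)"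
        by (intro sum.cong) auto
      then show ?thesis using S(1) that by simp
    qed
    have inner: "(\<Sum>\<nu>\<in>S. sc (mon m y \<nu>) (?A \<mu> \<nu>)) =
        (\<Sum>\<nu>\<in>S. sc (mon m y \<nu>) (mm d (P \<mu>) (P \<nu>))) - sc (mon m y \<mu>) (P \<mu>)" if "\<mu> \<in> S" for \<mu>
      unfolding sc_diff sum_subtractf e[OF that] ..
    have "(\<Sum>\<mu>\<in>S. sc (mon m x \<mu>) (\<Sum>\<nu>\<in>S. sc (mon m y \<nu>) (?A \<mu> \<nu>))) =
        (\<Sum>\<mu>\<in>S. sc (mon m x \<mu>) ((\<Sum>\<nu>\<in>S. sc (mon m y \<nu>) (mm d (P \<mu>) (P \<nu>))) - sc (mon m y \<mu>) (P \<mu>)))"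
      by (intro sum.cong HOL.refl) (simp only: inner)
    also have "\<dots> =
        (\<Sum>\<mu>\<in>S. \<Sum>\<nu>\<in>S. mm d (sc (mon m x \<mu>) (P \<mu>)) (sc (mon m y \<nu>) (P \<nu>))) -
        (\<Sum>\<mu>\<in>S. sc (mon m x \<mu> * mon m y \<mu>) (P \<mu>))"
      by (simp only: sc_diff sum_subtractf sc_sum sc_sc mm_sc) (simp only: mult.commute)
    also have "(\<Sum>\<mu>\<in>S. \<Sum>\<nu>\<in>S. mm d (sc (mon m x \<mu>) (P \<mu>)) (sc (mon m y \<nu>) (P \<nu>))) =
        mm d (p (torus_elt m x)) (p (torus_elt m y))"
      unfolding p_torus[OF x] p_torus[OF y] by (subst mm_sum(1)) (simp only: mm_sum(2))
    also have "\<dots> = p (torus_elt m (\<lambda>i. x i * y i))"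
      by (simp add: p_mult[symmetric] torus_SO x y torus_mult)
    also have "\<dots> = (\<Sum>\<mu>\<in>S. sc (mon m x \<mu> * mon m y \<mu>) (P \<mu>))"
      unfolding p_torus[OF xy] mon_mult ..
    finally show "(\<Sum>\<mu>\<in>S. sc (mon m x \<mu>) (\<Sum>\<nu>\<in>S. sc (mon m y \<nu>) (?A \<mu> \<nu>))) = 0"
      by (simp only: diff_self)
  qed
  then have "?A \<mu> \<nu> = 0" using True by (intro opr_indep[OF S, where \<mu> = \<nu> and A = "?A \<mu>"]) auto
  then show ?thesis by simp
qed (auto simp: P_zero)

lemma P_p_torus: "unitvals m x \<Longrightarrow> mm d (P \<mu>) (p (torus_elt m x)) = sc (mon m x \<mu>) (P \<mu>)"
proof -
  assume x: "unitvals m x"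
  have "mm d (P \<mu>) (p (torus_elt m x)) = (\<Sum>\<nu>\<in>S. sc (mon m x \<nu>) (mm d (P \<mu>) (P \<nu>)))"
    by (simp add: p_torus[OF x] mm_sum mm_sc)
  also have "\<dots> = (\<Sum>\<nu>\<in>S. if \<nu> = \<mu> then sc (mon m x \<mu>) (P \<mu>) else 0)"
    by (intro sum.cong) (auto simp: P_orth)
  also have "\<dots> = sc (mon m x \<mu>) (P \<mu>)" using S(1) by (auto simp: P_zero)
  finally show ?thesis .
qed

lemma torus_E:
  assumes x: "unitvals m x" and ij: "i \<le> 2 * m" "j \<le> 2 * m"
  shows "mm d (p (torus_elt m x)) (E i j) = sc (mon m x (rt m (i, j))) (mm d (E i j) (p (torus_elt m x)))"
proof -
  let ?t = "torus_elt m x"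
  have t: "?t \<in> SO_odd m" by (rule torus_SO[OF x])
  have "mm d (mm d (p ?t) (E i j)) (p (star m ?t)) =
    (\<Sum>y\<in>{..<n} \<times> {..<n}. sc (?t $$ (fst y, i) * star m ?t $$ (j, snd y)) (E (fst y) (snd y)))"
    using p_conj_E[OF t] ij by simp
  also have "\<dots> = (\<Sum>y\<in>{..<n} \<times> {..<n}. if y = (i, j) then sc (mon m x (rt m (i, j))) (E i j) else 0)"
  proof (rule sum.cong)
    fix y assume y: "y \<in> {..<n} \<times> {..<n}"
    obtain k l where kl: "y = (k, l)" "k \<le> 2 * m" "l \<le> 2 * m" using y by auto
    have "mon m x (rt m (i, j)) = mon m x (wtv m i) * mon m x (wtv m (2 * m - j))"
      using ij by (simp add: mon_add[OF x, symmetric] wtv_reflect rt_def)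
    moreover have "2 * m - l = 2 * m - j \<longleftrightarrow> l = j" using kl ij by auto
    ultimately show "sc (?t $$ (fst y, i) * star m ?t $$ (j, snd y)) (E (fst y) (snd y)) =
        (if y = (i, j) then sc (mon m x (rt m (i, j))) (E i j) else 0)"
      using kl ij by (auto simp: torus_entry star_entry)
  qed simp
  also have "\<dots> = sc (mon m x (rt m (i, j))) (E i j)" using ij by simp
  finally have "mm d (mm d (mm d (p ?t) (E i j)) (p (star m ?t))) (p ?t) = sc (mon m x (rt m (i, j))) (mm d (E i j) (p ?t))"
    by (simp add: mm_sc)
  then show ?thesis by (simp add: mm_assoc p_inverse[OF t] mm_id)
qed

text \<open>Root operators shift weights by their root: compare coefficients of monomials in
  \<open>torus_E\<close>.\<close>

lemma P_E:
  assumes ij: "i \<le> 2 * m" "j \<le> 2 * m"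
  shows "mm d (P \<kappa>) (E i j) = mm d (E i j) (P (\<kappa> - rt m (i, j)))"
proof -
  let ?\<alpha> = "rt m (i, j)"
  \<comment> \<open>Large enough for both sides: the exponents on the right are those on the left
    translated by the root.\<close>
  let ?T = "S \<union> (\<lambda>\<mu>. \<mu> + ?\<alpha>) ` S"
  let ?A = "\<lambda>\<kappa>. mm d (P \<kappa>) (E i j) - mm d (E i j) (P (\<kappa> - ?\<alpha>))"
  have T: "finite ?T" "?T \<subseteq> wts m" using S rt_wts[OF ij] wts_add by auto
  have "?A \<kappa> = 0"
  proof (cases "\<kappa> \<in> ?T")
    case True
    show ?thesis
    proof (rule opr_indep[OF T _ True])
      fix x assume x: "unitvals m x"
      have "(\<Sum>\<kappa>\<in>?T. sc (mon m x \<kappa>) (mm d (P \<kappa>) (E i j))) = (\<Sum>\<kappa>\<in>S. sc (mon m x \<kappa>) (mm d (P \<kappa>) (E i j)))"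
        using S(1) by (intro sum.mono_neutral_right) (auto simp: P_zero)
      also have "\<dots> = mm d (p (torus_elt m x)) (E i j)" by (simp add: p_torus[OF x] mm_sum mm_sc)
      also have "\<dots> = sc (mon m x ?\<alpha>) (mm d (E i j) (p (torus_elt m x)))" by (rule torus_E[OF x ij])
      also have "\<dots> = (\<Sum>\<mu>\<in>S. sc (mon m x (\<mu> + ?\<alpha>)) (mm d (E i j) (P \<mu>)))"
        by (simp add: p_torus[OF x] mm_sum mm_sc sc_sum sc_sc mon_add[OF x] mult.commute)
      also have "\<dots> = (\<Sum>\<kappa>\<in>(\<lambda>\<mu>. \<mu> + ?\<alpha>) ` S. sc (mon m x \<kappa>) (mm d (E i j) (P (\<kappa> - ?\<alpha>))))"
        by (subst sum.reindex) (auto simp: inj_on_def)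
      also have "\<dots> = (\<Sum>\<kappa>\<in>?T. sc (mon m x \<kappa>) (mm d (E i j) (P (\<kappa> - ?\<alpha>))))"
      proof (rule sum.mono_neutral_left)
        show "\<forall>\<kappa>\<in>?T - (\<lambda>\<mu>. \<mu> + ?\<alpha>) ` S. sc (mon m x \<kappa>) (mm d (E i j) (P (\<kappa> - ?\<alpha>))) = 0"
        proof
          fix \<kappa> assume \<kappa>: "\<kappa> \<in> ?T - (\<lambda>\<mu>. \<mu> + ?\<alpha>) ` S"
          have "\<kappa> - ?\<alpha> \<notin> S"
          proof
            assume "\<kappa> - ?\<alpha> \<in> S"
            then have "\<kappa> - ?\<alpha> + ?\<alpha> \<in> (\<lambda>\<mu>. \<mu> + ?\<alpha>) ` S" by (rule imageI)
            then show False using \<kappa> by simp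
          qed
          then show "sc (mon m x \<kappa>) (mm d (E i j) (P (\<kappa> - ?\<alpha>))) = 0" by (simp add: P_zero)
        qed
      qed (use S(1) in auto)
      finally show "(\<Sum>\<kappa>\<in>?T. sc (mon m x \<kappa>) (?A \<kappa>)) = 0" by (simp add: sc_diff sum_subtractf)
    qed
  next
    case False
    have "\<kappa> - ?\<alpha> \<notin> S"
    proof
      assume "\<kappa> - ?\<alpha> \<in> S"
      then have "\<kappa> - ?\<alpha> + ?\<alpha> \<in> (\<lambda>\<mu>. \<mu> + ?\<alpha>) ` S" by (rule imageI)
      then show False using False by simp
    qed
    then show ?thesis using False by (simp add: P_zero)
  qed
  then show ?thesis by simp
qed

text \<open>Differentiate the monomial expansion of \<pi> along the curve whose i-th torus
  coordinate is exp s.\<close>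

lemma E_diag: "i < m \<Longrightarrow> E i i = (\<Sum>\<mu>\<in>S. sc (of_int (\<mu> i)) (P \<mu>))"
proof (intro ext)
  fix a b assume i: "i < m"
  have c: "curve m (\<lambda>s. torus_elt m (tcv i (1 * s))) (Fb m i i)" using curve_torus[OF i, of 1] by simp
  have e: "p (torus_elt m (tcv i (1 * s))) a b = (\<Sum>\<mu>\<in>S. exp (1 * s) powi \<mu> i * P \<mu> a b)" for s
    unfolding p_torus[OF unitvals_tcv] by (simp add: opr_sum_apply sc_def mon_tcv[OF i])
  have "((\<lambda>s. \<Sum>\<mu>\<in>S. exp (1 * s) powi \<mu> i * P \<mu> a b) has_field_derivative (\<Sum>\<mu>\<in>S. 1 * of_int (\<mu> i) * P \<mu> a b)) (at 0)"
    by (intro DERIV_sum DERIV_cmult_right deriv_exp_powi)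
  then have "((\<lambda>s. p (torus_elt m (tcv i (1 * s))) a b) has_field_derivative (\<Sum>\<mu>\<in>S. 1 * of_int (\<mu> i) * P \<mu> a b)) (at 0)"
    unfolding e .
  from DERIV_unique[OF dp_deriv[OF c] this]
  show "E i i a b = (\<Sum>\<mu>\<in>S. sc (of_int (\<mu> i)) (P \<mu>)) a b" by (simp add: E_def opr_sum_apply sc_def)
qed

lemma P_E_diag:
  assumes "i \<le> 2 * m"
  shows "mm d (P \<kappa>) (E i i) = sc (of_int (pair m (wtv m i) \<kappa>)) (P \<kappa>)"
proof -
  have 1: "mm d (P \<kappa>) (E i i) = sc (of_int (\<kappa> i)) (P \<kappa>)" if "i < m" for i
  proof -
    have "mm d (P \<kappa>) (E i i) = (\<Sum>\<mu>\<in>S. if \<mu> = \<kappa> then sc (of_int (\<kappa> i)) (P \<kappa>) else 0)"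
      unfolding E_diag[OF that] mm_sum by (intro sum.cong) (auto simp: mm_sc P_orth)
    then show ?thesis using S(1) by (auto simp: P_zero)
  qed
  consider "i < m" | "i = m" | "i > m" by linarith
  then show ?thesis
  proof cases
    case 1
    then show ?thesis using \<open>\<And>i. i < m \<Longrightarrow> mm d (P \<kappa>) (E i i) = sc (of_int (\<kappa> i)) (P \<kappa>)\<close>[of i] by (simp add: wtv_def pair_ew)
  next
    case 2
    then show ?thesis using E_zero[of m] by (simp add: wtv_def)
  next
    case 3
    then have i: "2 * m - i < m" "2 * m - (2 * m - i) = i" using assms by auto
    have "E i i = - E (2 * m - i) (2 * m - i)" using E_antisym[of "2 * m - i" "2 * m - i"] i by simp
    then have "mm d (P \<kappa>) (E i i) = - sc (of_int (\<kappa> (2 * m - i))) (P \<kappa>)"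
      using \<open>\<And>i. i < m \<Longrightarrow> mm d (P \<kappa>) (E i i) = sc (of_int (\<kappa> i)) (P \<kappa>)\<close>[OF i(1)] by (simp add: mm_uminus)
    then show ?thesis using 3 i by (simp add: wtv_def pair_uminus pair_ew sc_def fun_eq_iff)
  qed
qed

section \<open>Traces on weight spaces\<close>

definition nw :: "wt \<Rightarrow> complex" where
  "nw \<kappa> = trc d (P \<kappa>)"

text \<open>The trace of E_ij E_ji on the weight space of \<kappa>; these are the unknowns in the
  recursion of Freudenthal for the multiplicities \<open>nw\<close>.\<close>

definition tt :: "nat \<Rightarrow> nat \<Rightarrow> wt \<Rightarrow> complex" where
  "tt i j \<kappa> = trc d (mm d (P \<kappa>) (mm d (E i j) (E j i)))"

text \<open>Cyclicity of the trace moves E_ij to the other end, and passing it through the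
  projection changes the weight by its root.\<close>

lemma tt_shift:
  assumes "i \<le> 2 * m" "j \<le> 2 * m"
  shows "tt i j \<kappa> = tt j i (\<kappa> - rt m (i, j))"
proof -
  let ?P = "P (\<kappa> - rt m (i, j))"
  have "tt i j \<kappa> = trc d (mm d (mm d (E i j) ?P) (E j i))"
    by (simp add: tt_def mm_assoc[symmetric] P_E[OF assms])
  also have "\<dots> = trc d (mm d (E i j) (mm d ?P (E j i)))" by (simp only: mm_assoc)
  also have "\<dots> = trc d (mm d (mm d ?P (E j i)) (E i j))" by (rule trc_comm)
  finally show ?thesis by (simp add: tt_def mm_assoc)
qed

lemma tt_diff:
  assumes ij: "i \<le> 2 * m" "j \<le> 2 * m" "i \<noteq> j" "i \<noteq> 2 * m - j"
  shows "tt i j \<kappa> - tt j i \<kappa> = of_int (pair m (rt m (i, j)) \<kappa>) * nw \<kappa>"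
proof -
  have "tt i j \<kappa> - tt j i \<kappa> = trc d (mm d (P \<kappa>) (E i i - E j j))"
    unfolding E_bracket[OF ij, symmetric] mm_diff trc_diff tt_def ..
  then show ?thesis
    using ij by (simp add: mm_diff trc_diff P_E_diag trc_sc nw_def rt_def pair_diff left_diff_distrib)
qed

lemma tt_zero: "\<kappa> \<notin> S \<Longrightarrow> tt i j \<kappa> = 0" "\<kappa> \<notin> S \<Longrightarrow> nw \<kappa> = 0"
  by (simp_all add: tt_def nw_def P_zero)

lemma trace_Casimir:
  "trc d (mm d (P \<kappa>) Cs) =
    2 * (\<Sum>x\<in>Phi m. tt (fst x) (snd x) \<kappa> + tt (snd x) (fst x) \<kappa>) + 2 * of_int (sqn m \<kappa>) * nw \<kappa>"
proof -
  have "trc d (mm d (P \<kappa>) Cs) = (\<Sum>x\<in>{..<n} \<times> {..<n}. tt (fst x) (snd x) \<kappa>)"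
    by (simp add: Cs_def mm_sum trc_sum tt_def)
  also have "\<dots> = 2 * (\<Sum>x\<in>Phi m. tt (fst x) (snd x) \<kappa> + tt (snd x) (fst x) \<kappa>) + 2 * (\<Sum>i<m. tt i i \<kappa>)"
    by (rule sum_pairs) (simp_all add: tt_def E_antisym E_zero mm_uminus)
  also have "(\<Sum>i<m. tt i i \<kappa>) = (\<Sum>i<m. of_int ((\<kappa> i)\<^sup>2) * nw \<kappa>)"
  proof (rule sum.cong)
    fix i assume i: "i \<in> {..<m}"
    have "tt i i \<kappa> = trc d (mm d (mm d (P \<kappa>) (E i i)) (E i i))" by (simp add: tt_def mm_assoc)
    then show "tt i i \<kappa> = of_int ((\<kappa> i)\<^sup>2) * nw \<kappa>"
      using i by (simp add: P_E_diag mm_sc trc_sc nw_def wtv_def pair_ew power2_eq_square)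
  qed simp
  finally show ?thesis by (simp add: sqn_def sum_distrib_right[symmetric])
qed

subsection \<open>Invariance of the weight multiplicities under the Weyl group\<close>

definition ch0 :: laur where
  "ch0 = (\<Sum>a<d. q a a)"

lemma ev_ch0: "unitvals m x \<Longrightarrow> ev m x ch0 = trc d (p (torus_elt m x))"
  by (simp add: ch0_def ev_sum trc_def q(2))

lemma lk_ch0: "lk ch0 \<kappa> = nw \<kappa>"
  by (simp add: ch0_def lookup_sum nw_def trc_def P_def)

lemma keys_ch0: "ks ch0 \<subseteq> wts m"
  using tt_zero(2) S(2) by (metis in_keys_iff lk_ch0 subsetD subsetI)

lemma ev_conj_torus:
  assumes s: "s \<in> SO_odd m" and x: "unitvals m x" "unitvals m y" and eq: "s * torus_elt m x = torus_elt m y * s"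
  shows "ev m x ch0 = ev m y ch0"
proof -
  have "mm d (p s) (p (torus_elt m x)) = mm d (p (torus_elt m y)) (p s)"
    using arg_cong[OF eq, of p] s torus_SO[OF x(1)] torus_SO[OF x(2)] by (simp add: p_mult)
  then have "mm d (p (star m s)) (mm d (p s) (p (torus_elt m x))) = mm d (p (star m s)) (mm d (p (torus_elt m y)) (p s))"
    by simp
  then have "p (torus_elt m x) = mm d (p (star m s)) (mm d (p (torus_elt m y)) (p s))"
    by (simp add: mm_assoc[symmetric] p_inverse[OF s] mm_id)
  then have "trc d (p (torus_elt m x)) = trc d (mm d (mm d (p (torus_elt m y)) (p s)) (p (star m s)))"
    by (metis trc_comm)
  then show ?thesis by (simp add: ev_ch0 x mm_assoc p_inverse[OF s] mm_id)
qed

end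

lemma mon_wtv:
  "i \<le> 2 * m \<Longrightarrow> mon m x (wtv m i) = (if i < m then x i else if i = m then 1 else inverse (x (2 * m - i)))"
  using torus_entry[of i m i x] by (simp add: torus_elt_def)

lemma ev_swp:
  assumes k: "Suc k < m"
  shows "ev m x (twist (swp k) f) = ev m (x \<circ> Transposition.transpose k (Suc k)) f"
proof (induction f rule: laur_induct)
  case (single \<mu> c)
  let ?s = "Transposition.transpose k (Suc k)"
  have s: "?s permutes {..<m}" using k by (intro permutes_swap_id) auto
  have "mon m x (swp k \<mu>) = (\<Prod>i<m. x (?s (?s i)) powi \<mu> (?s i))" by (simp add: mon_def swp_def)
  also have "\<dots> = mon m (x \<circ> ?s) \<mu>"
    using prod.permute[OF s, of "\<lambda>i. x (?s i) powi \<mu> i"] by (simp add: mon_def o_def)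
  finally show ?case by (simp only: twist_single[OF invo_swp] ev_single)
qed (simp only: twist_add[OF invo_swp] ev_add)

lemma ev_flp: "ev m x (twist (flp k) f) = ev m (x(k := inverse (x k))) f"
proof (induction f rule: laur_induct)
  case (single \<mu> c)
  have "mon m x (flp k \<mu>) = mon m (x(k := inverse (x k))) \<mu>"
    unfolding mon_def by (intro prod.cong) (auto simp: flp_def power_int_minus power_int_inverse)
  then show ?case by (simp only: twist_single[OF invo_flp] ev_single)
qed (simp only: twist_add[OF invo_flp] ev_add)

lemma keys_twist:
  assumes "invo w" "\<And>\<mu>. \<mu> \<in> wts m \<Longrightarrow> w \<mu> \<in> wts m" "ks f \<subseteq> wts m"
  shows "ks (twist w f) \<subseteq> wts m"
proof
  fix \<mu> assume "\<mu> \<in> ks (twist w f)"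
  then have "w \<mu> \<in> ks f" using assms(1) by (simp add: in_keys_iff lk_twist)
  then have "w (w \<mu>) \<in> wts m" using assms(2,3) by blast
  then show "\<mu> \<in> wts m" using assms(1) by (simp add: invo_def)
qed

lemma swp_wts: "Suc k < m \<Longrightarrow> \<mu> \<in> wts m \<Longrightarrow> swp k \<mu> \<in> wts m"
  by (auto simp: wts_def swp_def Transposition.transpose_def)

lemma flp_wts: "\<mu> \<in> wts m \<Longrightarrow> flp k \<mu> \<in> wts m"
  by (auto simp: wts_def flp_def)

lemma twist_eq_if_ev:
  assumes "invo w" "\<And>\<mu>. \<mu> \<in> wts m \<Longrightarrow> w \<mu> \<in> wts m" "ks f \<subseteq> wts m"
    and "\<And>x. unitvals m x \<Longrightarrow> ev m x (twist w f) = ev m x f"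
  shows "twist w f = f"
proof -
  have "ks (twist w f - f) \<subseteq> wts m"
    using keys_diff[of "twist w f" f] keys_twist[OF assms(1-3)] assms(3) by blast
  then have "twist w f - f = 0" by (rule ev_eq_0_imp) (simp add: ev_diff assms(4))
  then show ?thesis by simp
qed

subsection \<open>Signed permutation matrices\<close>

definition pmat :: "nat \<Rightarrow> (nat \<Rightarrow> nat) \<Rightarrow> (nat \<Rightarrow> complex) \<Rightarrow> complex mat" where
  "pmat n \<sigma> e = mat n n (\<lambda>(i, j). if j = \<sigma> i then e i else 0)"

lemma pmat_carrier [simp]: "pmat n \<sigma> e \<in> carrier_mat n n"
  by (simp add: pmat_def)

lemma pmat_Og:
  assumes \<sigma>: "\<sigma> permutes {..<nn m}" and r: "\<And>i. i \<le> 2 * m \<Longrightarrow> \<sigma> (2 * m - i) = 2 * m - \<sigma> i"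
    and e: "\<And>i. i \<le> 2 * m \<Longrightarrow> e (2 * m - i) * e i = 1"
  shows "pmat (nn m) \<sigma> e \<in> Og m"
proof -
  have lt: "\<sigma> i \<le> 2 * m" if "i \<le> 2 * m" for i using permutes_in_image[OF \<sigma>, of i] that by simp
  have "star m (pmat (nn m) \<sigma> e) * pmat (nn m) \<sigma> e = 1\<^sub>m (nn m)"
  proof (rule eq_matI)
    fix i j assume "i < dim_row (1\<^sub>m (nn m))" "j < dim_col (1\<^sub>m (nn m))"
    then have ij: "i < nn m" "j < nn m" by auto
    obtain l where l: "l < nn m" "\<sigma> l = i"
      using ij(1) permutes_image[OF \<sigma>] by (metis imageE lessThan_iff)
    have "(star m (pmat (nn m) \<sigma> e) * pmat (nn m) \<sigma> e) $$ (i, j) = (\<Sum>k<nn m. if k = l then (if i = j then 1 else 0) else 0)"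
      unfolding mat_mult_entry[OF star_carrier pmat_carrier ij]
    proof (rule sum.cong)
      fix k assume k: "k \<in> {..<nn m}"
      have "2 * m - i = \<sigma> (2 * m - k) \<longleftrightarrow> \<sigma> l = \<sigma> k"
        using k ij l r[of k] lt[of k] by auto
      then have "2 * m - i = \<sigma> (2 * m - k) \<longleftrightarrow> k = l"
        using permutes_inj[OF \<sigma>] by (auto simp: inj_eq)
      then show "star m (pmat (nn m) \<sigma> e) $$ (i, k) * pmat (nn m) \<sigma> e $$ (k, j) = (if k = l then (if i = j then 1 else 0) else 0)"
        using k ij e[of k] l by (auto simp: star_entry pmat_def)
    qed simp
    then show "(star m (pmat (nn m) \<sigma> e) * pmat (nn m) \<sigma> e) $$ (i, j) = 1\<^sub>m (nn m) $$ (i, j)"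
      using ij l by simp
  qed (auto simp: pmat_def star_def)
  then show ?thesis by (simp add: Og_def)
qed

lemma pmat_torus:
  assumes \<sigma>: "\<sigma> permutes {..<nn m}" and y: "\<And>i. i \<le> 2 * m \<Longrightarrow> mon m y (wtv m i) = mon m x (wtv m (\<sigma> i))"
  shows "pmat (nn m) \<sigma> e * torus_elt m x = torus_elt m y * pmat (nn m) \<sigma> e"
proof (rule eq_matI)
  have lt: "\<sigma> i \<le> 2 * m" if "i \<le> 2 * m" for i using permutes_in_image[OF \<sigma>, of i] that by simp
  fix i j assume "i < dim_row (torus_elt m y * pmat (nn m) \<sigma> e)" "j < dim_col (torus_elt m y * pmat (nn m) \<sigma> e)"
  then have ij: "i < nn m" "j < nn m" by (auto simp: torus_elt_def pmat_def nn_def)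
  have "(pmat (nn m) \<sigma> e * torus_elt m x) $$ (i, j) =
      (\<Sum>k<nn m. if k = \<sigma> i then (if j = \<sigma> i then e i * mon m x (wtv m (\<sigma> i)) else 0) else 0)"
    unfolding mat_mult_entry[OF pmat_carrier torus_carrier ij]
    by (intro sum.cong) (use ij in \<open>auto simp: pmat_def torus_entry\<close>)
  moreover have "(torus_elt m y * pmat (nn m) \<sigma> e) $$ (i, j) =
      (\<Sum>k<nn m. if k = i then (if j = \<sigma> i then e i * mon m y (wtv m i) else 0) else 0)"
    unfolding mat_mult_entry[OF torus_carrier pmat_carrier ij]
    by (intro sum.cong) (use ij in \<open>auto simp: pmat_def torus_entry\<close>)
  ultimately show "(pmat (nn m) \<sigma> e * torus_elt m x) $$ (i, j) = (torus_elt m y * pmat (nn m) \<sigma> e) $$ (i, j)"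
    using ij lt[of i] y[of i] by simp
qed (auto simp: torus_elt_def pmat_def nn_def)

lemma det_pmat_one:
  assumes "\<sigma> permutes {..<n}"
  shows "det (pmat n \<sigma> (\<lambda>_. 1)) = of_int (sign \<sigma>)"
proof -
  have \<sigma>: "\<sigma> permutes {0..<n}" using assms by (simp add: atLeast0LessThan)
  have "pmat n \<sigma> (\<lambda>_. 1) = mat n n (\<lambda>(i, j). 1\<^sub>m n $$ (\<sigma> i, j))"
    using permutes_in_image[OF \<sigma>] by (intro eq_matI) (auto simp: pmat_def)
  then show ?thesis using det_permute_rows[OF one_carrier_mat \<sigma>] by simp
qed

lemma transpose_pair:
  assumes "a \<noteq> c" "a \<noteq> d" "b \<noteq> c" "b \<noteq> d"
  shows "(Transposition.transpose a b \<circ> Transposition.transpose c d) i =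
    (if i = a then b else if i = b then a else if i = c then d else if i = d then c else i)"
  using assms by (auto simp: Transposition.transpose_def)

context ratrep
begin

text \<open>The reflection is realised inside the group: exchanging k with k+1 and simultaneously
  their mirror images is a product of two transpositions, so it has determinant 1. Conjugating the
  torus by it preserves the trace.\<close>

lemma nw_swp:
  assumes k: "Suc k < m"
  shows "nw (swp k \<kappa>) = nw \<kappa>"
proof -
  define \<tau>1 \<tau>2 where "\<tau>1 = Transposition.transpose k (Suc k)" and "\<tau>2 = Transposition.transpose (2 * m - k) (2 * m - Suc k)"
  define \<sigma> where "\<sigma> = \<tau>1 \<circ> \<tau>2"
  have t: "\<tau>1 permutes {..<n}" "\<tau>2 permutes {..<n}"
    unfolding \<tau>1_def \<tau>2_def using k by (auto intro!: permutes_swap_id)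
  have \<sigma>: "\<sigma> permutes {..<n}" unfolding \<sigma>_def by (rule permutes_compose[OF t(2,1)])
  have ne: "2 * m - k \<noteq> k" "2 * m - k \<noteq> Suc k" "2 * m - Suc k \<noteq> k" "2 * m - Suc k \<noteq> Suc k"
    "2 * m - k \<noteq> 2 * m - Suc k" "2 * m - (2 * m - k) = k" "2 * m - (2 * m - Suc k) = Suc k" using k by auto
  have s: "\<sigma> i = (if i = k then Suc k else if i = Suc k then k else if i = 2 * m - k then 2 * m - Suc k else if i = 2 * m - Suc k then 2 * m - k else i)" for i
    unfolding \<sigma>_def \<tau>1_def \<tau>2_def using ne by (intro transpose_pair) auto
  have r: "\<sigma> (2 * m - i) = 2 * m - \<sigma> i" if "i \<le> 2 * m" for i
  proof -
    have e: "(2 * m - i = k) = (i = 2 * m - k)" "(2 * m - i = Suc k) = (i = 2 * m - Suc k)"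
      "(2 * m - i = 2 * m - k) = (i = k)" "(2 * m - i = 2 * m - Suc k) = (i = Suc k)" using k that by auto
    show ?thesis unfolding s e using ne by auto
  qed
  have "sign \<sigma> = sign \<tau>1 * sign \<tau>2"
    unfolding \<sigma>_def by (rule sign_compose) (use t permutation_permutes in \<open>blast intro: finite_lessThan\<close>)+
  then have "sign \<sigma> = 1" using k by (simp add: \<tau>1_def \<tau>2_def sign_swap_id)
  then have SO: "pmat n \<sigma> (\<lambda>_. 1) \<in> SO_odd m"
    using pmat_Og[OF \<sigma> r, of "\<lambda>_. 1"] det_pmat_one[OF \<sigma>] by (simp add: SO_odd_iff)
  have "twist (swp k) ch0 = ch0"
  proof (rule twist_eq_if_ev[OF invo_swp swp_wts[OF k] keys_ch0])
    fix x assume x: "unitvals m x"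
    let ?y = "x \<circ> Transposition.transpose k (Suc k)"
    have y: "unitvals m ?y" using x k by (auto simp: unitvals_def Transposition.transpose_def)
    have "mon m ?y (wtv m i) = mon m x (wtv m (\<sigma> i))" if i: "i \<le> 2 * m" for i
    proof -
      have "\<sigma> i \<le> 2 * m" using permutes_in_image[OF \<sigma>, of i] i by simp
      then show ?thesis using i k unfolding s
        by (cases i m rule: linorder_cases) (auto simp: mon_wtv Transposition.transpose_def)
    qed
    from ev_conj_torus[OF SO x y pmat_torus[OF \<sigma> this]] show "ev m x (twist (swp k) ch0) = ev m x ch0"
      by (simp add: ev_swp[OF k])
  qed
  then have "lk (twist (swp k) ch0) \<kappa> = lk ch0 \<kappa>" by simp
  then show ?thesis by (simp add: lk_twist[OF invo_swp] lk_ch0)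
qed

text \<open>Exchanging k with its mirror image inverts one torus coordinate. A single transposition
  has determinant -1, and the entry -1 in the middle place m restores determinant 1.\<close>

lemma nw_flp:
  assumes k: "k < m"
  shows "nw (flp k \<kappa>) = nw \<kappa>"
proof -
  define \<sigma> where "\<sigma> = Transposition.transpose k (2 * m - k)"
  define e where "e i = (if i = m then - 1 else 1 :: complex)" for i
  have \<sigma>: "\<sigma> permutes {..<n}"
    unfolding \<sigma>_def using k by (auto intro!: permutes_swap_id)
  have s: "\<sigma> i = (if i = k then 2 * m - k else if i = 2 * m - k then k else i)" for i
    by (auto simp: \<sigma>_def Transposition.transpose_def)
  have r: "\<sigma> (2 * m - i) = 2 * m - \<sigma> i" if "i \<le> 2 * m" for i
    using k that unfolding s by auto
  have "pmat n \<sigma> e = multrow m (- 1) (pmat n \<sigma> (\<lambda>_. 1))"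
    by (intro eq_matI) (auto simp: pmat_def e_def)
  then have "det (pmat n \<sigma> e) = - of_int (sign \<sigma>)"
    using det_multrow[of m n "pmat n \<sigma> (\<lambda>_. 1)" "- 1"] det_pmat_one[OF \<sigma>] by simp
  also have "sign \<sigma> = - 1" using k by (simp add: \<sigma>_def sign_swap_id)
  finally have "det (pmat n \<sigma> e) = 1" by simp
  moreover have "e (2 * m - i) * e i = 1" if "i \<le> 2 * m" for i using that by (auto simp: e_def)
  ultimately have SO: "pmat n \<sigma> e \<in> SO_odd m"
    using pmat_Og[OF \<sigma> r] by (simp add: SO_odd_iff)
  have "twist (flp k) ch0 = ch0"
  proof (rule twist_eq_if_ev[OF invo_flp flp_wts keys_ch0])
    fix x assume x: "unitvals m x"
    let ?y = "x(k := inverse (x k))"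
    have y: "unitvals m ?y" using x k by (auto simp: unitvals_def)
    have "mon m ?y (wtv m i) = mon m x (wtv m (\<sigma> i))" if i: "i \<le> 2 * m" for i
    proof -
      have "\<sigma> i \<le> 2 * m" using permutes_in_image[OF \<sigma>, of i] i by simp
      then show ?thesis using i k unfolding s
        by (cases i m rule: linorder_cases) (auto simp: mon_wtv)
    qed
    from ev_conj_torus[OF SO x y pmat_torus[OF \<sigma> this]] show "ev m x (twist (flp k) ch0) = ev m x ch0"
      by (simp add: ev_flp)
  qed
  then have "lk (twist (flp k) ch0) \<kappa> = lk ch0 \<kappa>" by simp
  then show ?thesis by (simp add: lk_twist[OF invo_flp] lk_ch0)
qed

definition sv :: "(nat \<Rightarrow> complex) \<Rightarrow> bool" where
  "sv x \<longleftrightarrow> (\<forall>i\<ge>d. x i = 0)"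

definition ofv :: "complex vec \<Rightarrow> nat \<Rightarrow> complex" where
  "ofv u = (\<lambda>i. if i < d then u $ i else 0)"

lemma rep_carrier: "g \<in> SO_odd m \<Longrightarrow> \<pi> g \<in> carrier_mat d d"
  using rep by (simp add: rational_rep_def)

lemma ofv_mult: "g \<in> SO_odd m \<Longrightarrow> u \<in> carrier_vec d \<Longrightarrow> ofv (\<pi> g *\<^sub>v u) = mv d (p g) (ofv u)"
proof
  fix i assume g: "g \<in> SO_odd m" and u: "u \<in> carrier_vec d"
  show "ofv (\<pi> g *\<^sub>v u) i = mv d (p g) (ofv u) i"
  proof (cases "i < d")
    case True
    then show ?thesis
      using mat_vec_entry[OF rep_carrier[OF g] u True] by (auto simp: ofv_def mv_def p_def ent_def intro!: sum.cong)
  qed (auto simp: ofv_def mv_def p_def ent_def)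
qed

lemma mv_add: "mv d A (\<lambda>i. x i + y i) = (\<lambda>i. mv d A x i + mv d A y i)"
  and mv_scale: "mv d A (\<lambda>i. c * x i) = (\<lambda>i. c * mv d A x i)"
  by (simp_all add: mv_def fun_eq_iff distrib_left sum.distrib sum_distrib_left ac_simps)

lemma mv_opr_sum: "mv d (\<Sum>a\<in>A. f a) x i = (\<Sum>a\<in>A. mv d (f a) x i)"
  unfolding mv_def opr_sum_apply sum_distrib_right by (rule sum.swap)

lemma mv_sc: "mv d (sc c A) x i = c * mv d A x i"
  by (simp add: mv_def sc_def sum_distrib_left ac_simps)

lemma mv_idop: "sv x \<Longrightarrow> mv d (idop d) x = x"
proof
  fix i assume "sv x"
  have "mv d (idop d) x i = (\<Sum>j<d. if j = i then x i else 0)"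
    unfolding mv_def idop_def by (intro sum.cong) auto
  then show "mv d (idop d) x i = x i" using \<open>sv x\<close> by (auto simp: sv_def)
qed

end

section \<open>Irreducible representations with a highest weight vector\<close>

locale hwrep = ratrep +
  fixes v :: "complex vec" and \<eta> :: wt
  assumes irr: "irreducible_rep m d \<pi>"
    and v: "v \<in> carrier_vec d" "v \<noteq> 0\<^sub>v d"
    and upp: "\<And>g. g \<in> unipotent_upper m \<Longrightarrow> \<pi> g *\<^sub>v v = v"
    and tor: "\<And>x. unitvals m x \<Longrightarrow> \<pi> (torus_elt m x) *\<^sub>v v = mon m x \<eta> \<cdot>\<^sub>v v"
    and eta: "\<eta> \<in> wts m"
begin

definition w :: "nat \<Rightarrow> complex" where
  "w = ofv v"

lemma w_nonzero: obtains k where "k < d" "w k \<noteq> 0"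
proof -
  have "\<exists>k<d. v $ k \<noteq> 0" using v by (metis carrier_vecD eq_vecI index_zero_vec(1) index_zero_vec(2))
  then show thesis using that by (auto simp: w_def ofv_def)
qed

lemma p_upp: "g \<in> unipotent_upper m \<Longrightarrow> mv d (p g) w = w"
  using ofv_mult[OF _ v(1), of g] upp[of g] by (simp add: w_def unipotent_upper_iff)

lemma p_tor: "unitvals m x \<Longrightarrow> mv d (p (torus_elt m x)) w = (\<lambda>i. mon m x \<eta> * w i)"
proof -
  assume x: "unitvals m x"
  have "mv d (p (torus_elt m x)) w = ofv (mon m x \<eta> \<cdot>\<^sub>v v)"
    using ofv_mult[OF torus_SO[OF x] v(1)] tor[OF x] by (simp add: w_def)
  then show ?thesis using v(1) by (auto simp: ofv_def w_def fun_eq_iff)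
qed

text \<open>Irreducibility as an induction principle: the vectors with property Q form an invariant
  subspace, and it contains the nonzero highest weight vector.\<close>

lemma irreducible_induct:
  assumes Q0: "Q (\<lambda>_. 0)" and add: "\<And>x y. Q x \<Longrightarrow> Q y \<Longrightarrow> Q (\<lambda>i. x i + y i)"
    and scal: "\<And>c x. Q x \<Longrightarrow> Q (\<lambda>i. c * x i)"
    and act: "\<And>g x. g \<in> SO_odd m \<Longrightarrow> sv x \<Longrightarrow> Q x \<Longrightarrow> Q (mv d (p g) x)"
    and Qw: "Q w" and x: "sv x"
  shows "Q x"
proof -
  let ?W = "{u \<in> carrier_vec d. Q (ofv u)}"
  have svo: "sv (ofv u)" for u by (simp add: sv_def ofv_def)
  have "invariant_subspace m d \<pi> ?W"
    unfolding invariant_subspace_def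
  proof (intro conjI ballI allI)
    have "ofv (0\<^sub>v d) = (\<lambda>_. 0)" by (auto simp: ofv_def)
    then show "0\<^sub>v d \<in> ?W" using Q0 by simp
    fix u u' assume u: "u \<in> ?W" "u' \<in> ?W"
    have "ofv (u + u') = (\<lambda>i. ofv u i + ofv u' i)" using u by (auto simp: ofv_def)
    then show "u + u' \<in> ?W" using u add by simp
  next
    fix c u assume u: "u \<in> ?W"
    have "ofv (c \<cdot>\<^sub>v u) = (\<lambda>i. c * ofv u i)" using u by (auto simp: ofv_def)
    then show "c \<cdot>\<^sub>v u \<in> ?W" using u scal by simp
  next
    fix g u assume g: "g \<in> SO_odd m" and u: "u \<in> ?W"
    then show "\<pi> g *\<^sub>v u \<in> ?W" using act[OF g svo] ofv_mult[OF g] rep_carrier[OF g] by auto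
  qed auto
  then have "?W = {0\<^sub>v d} \<or> ?W = carrier_vec d" using irr by (simp add: irreducible_rep_def)
  moreover have "v \<in> ?W" using v Qw by (simp add: w_def)
  ultimately have "?W = carrier_vec d" using v(2) by auto
  then have "vec d x \<in> ?W" by simp
  moreover have "ofv (vec d x) = x" using x by (auto simp: ofv_def sv_def)
  ultimately show ?thesis by simp
qed

text \<open>The vectors whose whole orbit is annihilated by \<phi> form an invariant subspace; if it
  contains w, it contains the unit vectors, on which \<phi> takes its coefficients as
  values.\<close>

lemma annihilator_orbit:
  assumes \<phi>: "\<And>g. g \<in> SO_odd m \<Longrightarrow> (\<Sum>i<d. \<phi> i * mv d (p g) w i) = 0" and i: "i < d"
  shows "\<phi> i = 0"
proof -
  let ?Q = "\<lambda>x. \<forall>g\<in>SO_odd m. (\<Sum>i<d. \<phi> i * mv d (p g) x i) = 0"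
  let ?x = "\<lambda>j. if j = i then 1 else 0"
  have "?Q ?x"
  proof (rule irreducible_induct[where Q = ?Q and x = ?x])
    show "?Q (\<lambda>_. 0)" by (simp add: mv_def)
    show "?Q (\<lambda>i. x i + y i)" if "?Q x" "?Q y" for x y
      using that by (simp add: mv_add distrib_left sum.distrib)
    show "?Q (\<lambda>i. c * x i)" if "?Q x" for c x
    proof
      fix g assume "g \<in> SO_odd m"
      then have "c * (\<Sum>i<d. \<phi> i * mv d (p g) x i) = 0" using that by simp
      then show "(\<Sum>i<d. \<phi> i * mv d (p g) (\<lambda>i. c * x i) i) = 0"
        by (simp add: mv_scale sum_distrib_left ac_simps)
    qed
    show "?Q (mv d (p g) x)" if "g \<in> SO_odd m" "?Q x" for g x
      using that SO_mult by (simp add: mv_mm[symmetric] p_mult[symmetric])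
    show "?Q w" using \<phi> by simp
    show "sv ?x" using i by (simp add: sv_def)
  qed
  then have "(\<Sum>j<d. \<phi> j * mv d (p (1\<^sub>m n)) ?x j) = 0" using SO_one by blast
  moreover have "sv ?x" using i by (simp add: sv_def)
  ultimately have "(\<Sum>j<d. \<phi> j * ?x j) = 0" by (simp add: p_one mv_idop)
  moreover have "(\<Sum>j<d. \<phi> j * ?x j) = (\<Sum>j<d. if j = i then \<phi> i else 0)"
    by (intro sum.cong) auto
  ultimately show ?thesis using i by simp
qed

text \<open>The lower unipotent orbit of w already spans the space: on the big cell the upper factor
  fixes w and the torus factor scales it, and density extends the vanishing from the big cell to the
  group.\<close>

lemma annihilator_lower:
  assumes \<phi>: "\<And>u. u \<in> unipotent_lower m \<Longrightarrow> (\<Sum>i<d. \<phi> i * mv d (p u) w i) = 0" and i: "i < d"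
  shows "\<phi> i = 0"
proof (rule annihilator_orbit[OF _ i])
  fix g assume g: "g \<in> SO_odd m"
  have "\<forall>i j. \<exists>f. polyfun n f \<and> (\<forall>g\<in>SO_odd m. p g i j = f g)" using p_polyfun by blast
  then obtain f where f: "\<And>i j. polyfun n (f i j)" "\<And>i j g. g \<in> SO_odd m \<Longrightarrow> p g i j = f i j g" by metis
  define F where "F g = (\<Sum>i<d. \<phi> i * (\<Sum>j<d. f i j g * w j))" for g
  have F: "F g = (\<Sum>i<d. \<phi> i * mv d (p g) w i)" if "g \<in> SO_odd m" for g
    using that by (simp add: F_def mv_def f(2))
  have "polyfun n F"
    unfolding F_def by (intro polyfun_sum polyfun_mult polyfun_const f(1))
  moreover have "F (l * torus_elt m x * u) = 0"
    if "l \<in> unipotent_lower m" "unitvals m x" "u \<in> unipotent_upper m" for l x u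
  proof -
    have so: "l \<in> SO_odd m" "torus_elt m x \<in> SO_odd m" "u \<in> SO_odd m"
      using that by (auto simp: unipotent_lower_def unipotent_upper_iff torus_SO)
    have "F (l * torus_elt m x * u) = (\<Sum>i<d. \<phi> i * mv d (p l) (mv d (p (torus_elt m x)) (mv d (p u) w)) i)"
      using so by (simp add: F SO_mult p_mult mv_mm)
    also have "\<dots> = mon m x \<eta> * (\<Sum>i<d. \<phi> i * mv d (p l) w i)"
      unfolding p_upp[OF that(3)] p_tor[OF that(2)] mv_scale sum_distrib_left
      by (intro sum.cong HOL.refl) (simp only: ac_simps)
    finally show ?thesis using \<phi>[OF that(1)] by simp
  qed
  ultimately have "F g = 0" using g by (rule SO_dense)
  then show "(\<Sum>i<d. \<phi> i * mv d (p g) w i) = 0" using F[OF g] by simp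
qed

lemma P_w: "mv d (P \<kappa>) w = (if \<kappa> = \<eta> then w else (\<lambda>_. 0))"
proof
  fix i
  let ?T = "insert \<eta> S"
  have T: "finite ?T" "?T \<subseteq> wts m" using S eta by auto
  let ?c = "\<lambda>\<kappa>. mv d (P \<kappa>) w i - (if \<kappa> = \<eta> then w i else 0)"
  have "\<forall>\<kappa>\<in>?T. ?c \<kappa> = 0"
  proof (rule mon_indep[OF T])
    fix x assume x: "unitvals m x"
    have "(\<Sum>\<kappa>\<in>?T. mv d (P \<kappa>) w i * mon m x \<kappa>) = (\<Sum>\<kappa>\<in>S. mv d (P \<kappa>) w i * mon m x \<kappa>)"
      using S(1) by (intro sum.mono_neutral_right) (auto simp: P_zero mv_def)
    also have "\<dots> = mv d (p (torus_elt m x)) w i"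
      by (simp add: p_torus[OF x] mv_opr_sum mv_sc mult.commute)
    also have "\<dots> = mon m x \<eta> * w i" by (simp add: p_tor[OF x])
    finally have 1: "(\<Sum>\<kappa>\<in>?T. mv d (P \<kappa>) w i * mon m x \<kappa>) = mon m x \<eta> * w i" .
    have "(\<Sum>\<kappa>\<in>?T. (if \<kappa> = \<eta> then w i else 0) * mon m x \<kappa>) = (\<Sum>\<kappa>\<in>?T. if \<kappa> = \<eta> then w i * mon m x \<eta> else 0)"
      by (intro sum.cong) auto
    also have "\<dots> = w i * mon m x \<eta>" using T(1) by simp
    finally show "(\<Sum>\<kappa>\<in>?T. ?c \<kappa> * mon m x \<kappa>) = 0" using 1 by (simp add: left_diff_distrib sum_subtractf)
  qed
  then show "mv d (P \<kappa>) w i = (if \<kappa> = \<eta> then w else (\<lambda>_. 0)) i"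
    by (cases "\<kappa> \<in> ?T") (auto simp: P_zero mv_def)
qed

end

lemma hgt_eq_sum_psum: "hgt m \<nu> = (\<Sum>k\<in>{1..m}. psum k \<nu>)"
proof (induction m)
  case (Suc m)
  have "hgt (Suc m) \<nu> = (\<Sum>i<m. (int m - int i) * \<nu> i + \<nu> i) + \<nu> m"
    by (simp add: hgt_def algebra_simps)
  also have "\<dots> = hgt m \<nu> + psum (Suc m) \<nu>" by (simp add: hgt_def psum_def sum.distrib)
  finally show ?case using Suc by simp
qed (simp add: hgt_def)

text \<open>The height is the sum of the partial sums, so equal heights would make all partial sums
  and hence all coordinates agree.\<close>

lemma hgt_less_if_psum_le:
  assumes "\<And>k. k \<le> m \<Longrightarrow> psum k \<mu> \<le> psum k \<nu>" and \<mu>: "\<mu> \<in> wts m" and \<nu>: "\<nu> \<in> wts m" and ne: "\<mu> \<noteq> \<nu>"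
  shows "hgt m \<mu> < hgt m \<nu>"
proof (rule ccontr)
  assume "\<not> ?thesis"
  then have le: "(\<Sum>k\<in>{1..m}. psum k \<nu> - psum k \<mu>) \<le> 0" by (simp add: hgt_eq_sum_psum sum_subtractf)
  have eq: "psum k \<nu> = psum k \<mu>" if "k \<le> m" for k
  proof (cases "k = 0")
    case False
    then have "psum k \<nu> - psum k \<mu> \<le> (\<Sum>k\<in>{1..m}. psum k \<nu> - psum k \<mu>)"
      using that assms(1) by (intro member_le_sum) auto
    then show ?thesis using le assms(1)[OF that] by linarith
  qed (simp add: psum_def)
  have "\<mu> i = \<nu> i" if "i < m" for i
    using eq[of i] eq[of "Suc i"] that by (simp add: psum_def)
  then show False using wts_eqI[OF \<mu> \<nu>] ne by blast
qed

section \<open>Contraction along dominant coweights\<close>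

lemma polyfun_isCont:
  assumes "polyfun n f" and "\<And>i j. i < n \<Longrightarrow> j < n \<Longrightarrow> isCont (\<lambda>z. M z $$ (i, j)) z0"
  shows "isCont (\<lambda>z :: complex. f (M z)) z0"
  using assms(1) by induction (auto intro: assms(2) continuous_intros)

lemma power_int_sum: "finite A \<Longrightarrow> (z :: complex) \<noteq> 0 \<Longrightarrow> (\<Prod>i\<in>A. z powi f i) = z powi (\<Sum>i\<in>A. f i)"
  by (induction A rule: finite_induct) (simp_all add: power_int_add)

lemma mon_inverse: "mon m (\<lambda>i. inverse (x i)) \<mu> = inverse (mon m x \<mu>)"
  by (simp add: mon_def power_int_inverse prod_inversef[symmetric] o_def)

definition dcow :: "nat \<Rightarrow> wt \<Rightarrow> bool" where
  "dcow m a \<longleftrightarrow> (\<forall>i j. i \<le> j \<longrightarrow> j < m \<longrightarrow> a j \<le> a i) \<and> (\<forall>i<m. 0 \<le> a i)"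

text \<open>
  Conjugation by the one-parameter subgroup of a dominant coweight \<open>a\<close>, extended to \<open>z = 0\<close>,
  where it contracts the lower unipotent group.
\<close>

definition contract :: "nat \<Rightarrow> wt \<Rightarrow> complex mat \<Rightarrow> complex \<Rightarrow> complex mat" where
  "contract m a u z = mat (nn m) (nn m) (\<lambda>(i, j). z ^ nat (pair m (wtv m j) a - pair m (wtv m i) a) * u $$ (i, j))"

lemma pair_wtv:
  "i \<le> 2 * m \<Longrightarrow> pair m (wtv m i) a = (if i < m then a i else if i = m then 0 else - a (2 * m - i))"
  by (simp add: wtv_def pair_ew pair_uminus)

lemma pair_wtv_mono:
  assumes "dcow m a" "i \<le> j" "j \<le> 2 * m"
  shows "pair m (wtv m j) a \<le> pair m (wtv m i) a"
proof -
  have a: "\<And>i j. i \<le> j \<Longrightarrow> j < m \<Longrightarrow> a j \<le> a i" "\<And>i. i < m \<Longrightarrow> 0 \<le> a i"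
    using assms(1) by (auto simp: dcow_def)
  have i: "i \<le> 2 * m" using assms by simp
  have "2 * m - j < m" if "m < j" using that assms by auto
  then show ?thesis
    unfolding pair_wtv[OF i] pair_wtv[OF assms(3)]
    using assms(2) a(1)[of i j] a(1)[of "2 * m - j" "2 * m - i"] a(2)[of i] a(2)[of "2 * m - j"] by (auto simp: diff_le_mono2)
qed

text \<open>The torus element is z^{-a}. At a place i \<ge> j the conjugation factor is a
  nonnegative power of z because a is dominant, so \<open>contract\<close> makes sense at z = 0; the
  truncation by \<open>nat\<close> can matter only for i < j, where u has the entry 0.\<close>

lemma contract_eq_conj:
  assumes a: "dcow m a" and u: "u \<in> unipotent_lower m" and z: "z \<noteq> 0"
  defines "x \<equiv> (\<lambda>i. inverse z powi a i)"
  shows "contract m a u z = torus_elt m x * u * torus_elt m (\<lambda>i. inverse (x i))" "unitvals m x"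
    "mon m x \<mu> = z powi (- pair m a \<mu>)"
proof -
  show ux: "unitvals m x" using z by (simp add: unitvals_def x_def)
  have mon: "mon m x \<mu> = z powi (- pair m a \<mu>)" for \<mu>
  proof -
    have "mon m x \<mu> = (\<Prod>i<m. inverse z powi (a i * \<mu> i))" by (simp add: mon_def x_def power_int_mult)
    also have "\<dots> = inverse z powi pair m a \<mu>" using z by (simp add: power_int_sum pair_def)
    finally show ?thesis by (simp add: power_int_minus power_int_inverse)
  qed
  then show "mon m x \<mu> = z powi (- pair m a \<mu>)" .
  have us: "u \<in> SO_odd m" "lower_uni (nn m) u" using u by (auto simp: unipotent_lower_def)
  have uc: "u \<in> carrier_mat (nn m) (nn m)" by (rule SO_carrier[OF us(1)])
  let ?y = "\<lambda>i. inverse (x i)"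
  have tc: "torus_elt m x * u \<in> carrier_mat (nn m) (nn m)" by (rule mult_carrier_mat[OF torus_carrier uc])
  show "contract m a u z = torus_elt m x * u * torus_elt m ?y"
  proof (rule eq_matI)
    fix i j assume "i < dim_row (torus_elt m x * u * torus_elt m ?y)" "j < dim_col (torus_elt m x * u * torus_elt m ?y)"
    then have ij: "i < nn m" "j < nn m" by (auto simp: torus_elt_def nn_def)
    have 1: "(torus_elt m x * u) $$ (i, k) = mon m x (wtv m i) * u $$ (i, k)" if "k < nn m" for k
    proof -
      have "(torus_elt m x * u) $$ (i, k) = (\<Sum>l<nn m. if l = i then mon m x (wtv m i) * u $$ (i, k) else 0)"
        unfolding mat_mult_entry[OF torus_carrier uc ij(1) that]
        by (intro sum.cong) (use ij in \<open>auto simp: torus_entry\<close>)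
      then show ?thesis using ij by simp
    qed
    have "(torus_elt m x * u * torus_elt m ?y) $$ (i, j) =
        (\<Sum>k<nn m. if k = j then mon m x (wtv m i) * u $$ (i, j) * mon m ?y (wtv m j) else 0)"
      unfolding mat_mult_entry[OF tc torus_carrier ij]
      by (intro sum.cong) (use ij 1 in \<open>auto simp: torus_entry\<close>)
    also have "\<dots> = mon m x (wtv m i) * u $$ (i, j) * mon m ?y (wtv m j)" using ij by simp
    also have "\<dots> = contract m a u z $$ (i, j)"
    proof (cases "i < j")
      case True
      then have "u $$ (i, j) = 0" using us(2) ij by (simp add: lower_uni_def)
      then show ?thesis using ij by (simp add: contract_def)
    next
      case False
      have comm: "pair m a \<mu> = pair m \<mu> a" for \<mu> by (simp add: pair_def mult.commute)
      have ge: "0 \<le> pair m (wtv m j) a - pair m (wtv m i) a"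
        using pair_wtv_mono[OF a, of j i] False ij by simp
      have "mon m x (wtv m i) * mon m ?y (wtv m j) = z powi (- pair m (wtv m i) a) * inverse (z powi (- pair m (wtv m j) a))"
        by (simp add: mon_inverse mon comm)
      also have "\<dots> = z powi (pair m (wtv m j) a - pair m (wtv m i) a)"
        using z by (simp add: power_int_minus power_int_diff field_simps)
      also have "\<dots> = z ^ nat (pair m (wtv m j) a - pair m (wtv m i) a)"
        using ge by (metis power_int_of_nat int_nat_eq)
      finally show ?thesis using ij by (simp add: contract_def)
    qed
    finally show "contract m a u z $$ (i, j) = (torus_elt m x * u * torus_elt m ?y) $$ (i, j)" by simp
  qed (auto simp: contract_def torus_elt_def nn_def)
qed

lemma pair_commute: "pair m \<alpha> \<beta> = pair m \<beta> \<alpha>"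
  by (simp add: pair_def mult.commute)

lemma sqn_add: "sqn m (\<mu> + \<nu>) = sqn m \<mu> + 2 * pair m \<mu> \<nu> + sqn m \<nu>"
  by (simp add: sqn_def pair_def power2_sum sum.distrib sum_distrib_left algebra_simps)

text \<open>Exponents are doubled because $\rho$ is only half-integral.\<close>

definition dbl :: "wt \<Rightarrow> wt" where
  "dbl \<kappa> = (\<lambda>k. 2 * \<kappa> k)"

lemma dbl_apply: "dbl \<kappa> k = 2 * \<kappa> k"
  by (simp add: dbl_def)

lemma dbl_inj: "dbl \<kappa> = dbl \<mu> \<longleftrightarrow> \<kappa> = \<mu>"
  by (simp add: dbl_def fun_eq_iff)

lemma dbl_eq_add: "dbl \<kappa> = \<kappa> + \<kappa>"
  by (simp add: dbl_def fun_eq_iff)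

lemma dbl_add: "dbl (\<kappa> + \<mu>) = dbl \<kappa> + dbl \<mu>"
  and dbl_diff: "dbl (\<kappa> - \<mu>) = dbl \<kappa> - dbl \<mu>"
  by (simp_all add: dbl_def fun_eq_iff)

lemma dbl_wts: "\<kappa> \<in> wts m \<Longrightarrow> dbl \<kappa> \<in> wts m"
  by (simp add: wts_def dbl_def)

lemma psum_dbl: "psum k (dbl \<kappa>) = 2 * psum k \<kappa>"
  and hgt_dbl: "hgt m (dbl \<kappa>) = 2 * hgt m \<kappa>"
  and sqn_dbl: "sqn m (dbl \<kappa>) = 4 * sqn m \<kappa>"
  and pair_dbl: "pair m \<alpha> (dbl \<kappa>) = 2 * pair m \<alpha> \<kappa>" "pair m (dbl \<kappa>) \<alpha> = 2 * pair m \<kappa> \<alpha>"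
  by (simp_all add: psum_def hgt_def sqn_def pair_def dbl_def sum_distrib_left power_mult_distrib ac_simps)

lemma invo_dbl:
  assumes "invo u"
  shows "u (dbl \<kappa>) = dbl (u \<kappa>)"
  using assms by (simp only: dbl_eq_add invo_def)

context hwrep
begin

section \<open>The Casimir eigenvalue and Freudenthal's identity\<close>

lemma P_eta_nonzero: "\<eta> \<in> S"
proof (rule ccontr)
  assume "\<eta> \<notin> S"
  then have "mv d (P \<eta>) w = (\<lambda>_. 0)" by (simp add: P_zero mv_def)
  then have "w = (\<lambda>_. 0)" by (simp add: P_w)
  then show False using w_nonzero by metis
qed

text \<open>The exponential of a positive root vector is upper unipotent and fixes w, so the
  derivative of a constant appears.\<close>

lemma E_w_upper:
  assumes ij: "i < j" "j \<le> 2 * m"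
  shows "mv d (E i j) w = (\<lambda>_. 0)"
proof (cases "i = 2 * m - j")
  case True
  then have "E i j = 0" using E_zero[of i] ij by simp
  then show ?thesis by (simp add: mv_def)
next
  case False
  have i: "i \<le> 2 * m" "i \<noteq> j" using ij by auto
  have c: "curve m (\<lambda>s. mo n (uc m i j s)) (Fb m i j)" by (rule curve_uc[OF i(1) ij(2) i(2) False])
  show ?thesis
  proof
    fix r
    have "mo n (uc m i j s) \<in> unipotent_upper m" for s
      using uc_SO[OF i(1) ij(2) i(2) False] uc_triangular(1)[OF i(1) ij(2) False ij(1)] by (simp add: unipotent_upper_iff)
    then have const: "(\<Sum>k<d. p (mo n (uc m i j s)) r k * w k) = w r" for s
      using p_upp[of "mo n (uc m i j s)"] by (metis mv_def)
    have "((\<lambda>s. \<Sum>k<d. p (mo n (uc m i j s)) r k * w k) has_field_derivative (\<Sum>k<d. dp (Fb m i j) r k * w k)) (at 0)"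
      by (intro DERIV_sum DERIV_cmult_right dp_deriv[OF c])
    then have "((\<lambda>s. w r) has_field_derivative (\<Sum>k<d. dp (Fb m i j) r k * w k)) (at (0 :: complex))"
      unfolding const .
    then have "(\<Sum>k<d. dp (Fb m i j) r k * w k) = 0" by (rule DERIV_unique) simp
    then show "mv d (E i j) w r = 0" by (simp add: mv_def E_def)
  qed
qed

lemma E_w_diag:
  assumes "i \<le> 2 * m"
  shows "mv d (E i i) w = (\<lambda>r. of_int (pair m (wtv m i) \<eta>) * w r)"
proof -
  have 1: "mv d (E i i) w = (\<lambda>r. of_int (\<eta> i) * w r)" if "i < m" for i
  proof
    fix r
    have "mv d (E i i) w r = (\<Sum>\<kappa>\<in>S. if \<kappa> = \<eta> then of_int (\<eta> i) * w r else 0)"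
      unfolding E_diag[OF that] mv_opr_sum by (intro sum.cong) (auto simp: mv_sc P_w)
    then show "mv d (E i i) w r = of_int (\<eta> i) * w r" using S(1) P_eta_nonzero by simp
  qed
  consider "i < m" | "i = m" | "i > m" by linarith
  then show ?thesis
  proof cases
    case 1
    then show ?thesis using \<open>\<And>i. i < m \<Longrightarrow> mv d (E i i) w = (\<lambda>r. of_int (\<eta> i) * w r)\<close>[of i] by (simp add: wtv_def pair_ew)
  next
    case 2
    then show ?thesis using E_zero[of m] by (simp add: wtv_def mv_def)
  next
    case 3
    then have i: "2 * m - i < m" "2 * m - (2 * m - i) = i" using assms by auto
    have "E i i = - E (2 * m - i) (2 * m - i)" using E_antisym[of "2 * m - i" "2 * m - i"] i by simp
    then have "mv d (E i i) w = (\<lambda>r. - mv d (E (2 * m - i) (2 * m - i)) w r)" by (simp add: mv_def sum_negf)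
    then show ?thesis using \<open>\<And>i. i < m \<Longrightarrow> mv d (E i i) w = (\<lambda>r. of_int (\<eta> i) * w r)\<close>[OF i(1)] 3 i
      by (simp add: wtv_def pair_uminus pair_ew)
  qed
qed

text \<open>The number <\<eta>, \<eta> + 2\<rho>>; the Casimir eigenvalue is twice this, since
  \<open>Cs\<close> counts each pair together with its mirror image.\<close>

definition cz :: int where
  "cz = sqn m \<eta> + (\<Sum>x\<in>Phi m. pair m (rt m x) \<eta>)"

text \<open>A product whose right factor is a raising operator kills w. In the opposite order the
  product may be replaced by the commutator, which acts on w by the pairing of the root with \<eta>;
  f collects these scalars.\<close>

lemma Cs_w: "mv d Cs w = (\<lambda>r. 2 * of_int cz * w r)"
proof
  fix r
  define f where "f i j = (if i = 2 * m - j then 0 else if i < j then of_int (pair m (rt m (i, j)) \<eta>)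
      else if i = j then of_int ((pair m (wtv m i) \<eta>)\<^sup>2) else 0 :: complex)" for i j
  have EE: "mv d (mm d (E i j) (E j i)) w r = f i j * w r" if ij: "i \<le> 2 * m" "j \<le> 2 * m" for i j
  proof (cases "i = 2 * m - j")
    case True
    then have "E i j = 0" using E_zero[of i] ij by simp
    then show ?thesis using True by (simp add: f_def mv_def)
  next
    case False
    consider "i < j" | "j < i" | "i = j" by linarith
    then show ?thesis
    proof cases
      case 1
      have "mm d (E i j) (E j i) = (E i i - E j j) + mm d (E j i) (E i j)"
        using E_bracket[OF ij _ False] 1 by (simp add: algebra_simps)
      then have "mv d (mm d (E i j) (E j i)) w r = mv d (E i i) w r - mv d (E j j) w r + mv d (mm d (E j i) (E i j)) w r"
        by (simp add: mv_def left_diff_distrib distrib_right sum.distrib sum_subtractf)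
      also have "mv d (mm d (E j i) (E i j)) w r = 0"
        using E_w_upper[OF 1 ij(2)] by (simp add: mv_mm) (simp add: mv_def)
      finally show ?thesis
        using 1 False ij by (simp add: E_w_diag f_def rt_def pair_diff left_diff_distrib)
    next
      case 2
      then show ?thesis using E_w_upper[OF 2 ij(1)] False by (simp add: mv_mm f_def) (simp add: mv_def)
    next
      case 3
      then show ?thesis using False ij by (simp add: mv_mm E_w_diag mv_scale f_def power2_eq_square)
    qed
  qed
  have "mv d Cs w r = (\<Sum>x\<in>{..<n} \<times> {..<n}. mv d (mm d (E (fst x) (snd x)) (E (snd x) (fst x))) w r)"
    by (simp add: Cs_def mv_opr_sum)
  also have "\<dots> = (\<Sum>x\<in>{..<n} \<times> {..<n}. f (fst x) (snd x)) * w r"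
    unfolding sum_distrib_right by (intro sum.cong) (auto simp: EE)
  also have "(\<Sum>x\<in>{..<n} \<times> {..<n}. f (fst x) (snd x)) = 2 * (\<Sum>x\<in>Phi m. f (fst x) (snd x) + f (snd x) (fst x)) + 2 * (\<Sum>i<m. f i i)"
  proof (rule sum_pairs)
    fix i j assume ij: "i \<le> 2 * m" "j \<le> 2 * m"
    then show "f i (2 * m - i) = 0" by (simp add: f_def)
    have e: "2 * m - j = 2 * m - (2 * m - i) \<longleftrightarrow> i = 2 * m - j" "2 * m - j < 2 * m - i \<longleftrightarrow> i < j" "2 * m - j = 2 * m - i \<longleftrightarrow> i = j"
      using ij by auto
    show "f (2 * m - j) (2 * m - i) = f i j"
      unfolding f_def e using ij by (auto simp: rt_def wtv_reflect pair_diff pair_uminus)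
  qed
  also have "(\<Sum>x\<in>Phi m. f (fst x) (snd x) + f (snd x) (fst x)) = of_int (\<Sum>x\<in>Phi m. pair m (rt m x) \<eta>)"
    unfolding of_int_sum by (intro sum.cong) (auto simp: f_def Phi_def)
  also have "(\<Sum>i<m. f i i) = of_int (sqn m \<eta>)"
    unfolding sqn_def of_int_sum by (intro sum.cong) (auto simp: f_def pair_wtv)
  finally show "mv d Cs w r = 2 * of_int cz * w r" by (simp add: cz_def)
qed

text \<open>The vectors on which \<open>Cs\<close> acts by this scalar form an invariant subspace,
  because \<open>Cs\<close> commutes with the group, and w is one of them.\<close>

lemma Cs_scalar: "sup d Cs \<Longrightarrow> Cs = sc (2 * of_int cz) (idop d)"
proof -
  assume sC: "sup d Cs"
  let ?Q = "\<lambda>x. mv d Cs x = (\<lambda>r. 2 * of_int cz * x r)"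
  have all: "?Q x" if "sv x" for x
  proof (rule irreducible_induct[where Q = ?Q, OF _ _ _ _ Cs_w that])
    show "?Q (\<lambda>_. 0)" by (simp add: mv_def)
    show "?Q (\<lambda>i. x i + y i)" if "?Q x" "?Q y" for x y
      using that by (simp add: mv_add distrib_left)
    show "?Q (\<lambda>i. c * x i)" if "?Q x" for c x
      using that by (simp add: mv_scale ac_simps)
    show "?Q (mv d (p g) x)" if "g \<in> SO_odd m" "?Q x" for g x
      using Cs_invariant[OF that(1)] that(2) by (metis mv_mm mv_scale)
  qed
  show ?thesis
  proof (intro ext)
    fix a b
    show "Cs a b = sc (2 * of_int cz) (idop d) a b"
    proof (cases "a < d \<and> b < d")
      case True
      let ?e = "\<lambda>j. if j = b then 1 else 0 :: complex"
      have "sv ?e" using True by (simp add: sv_def)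
      then have "mv d Cs ?e a = 2 * of_int cz * ?e a" by (simp add: all)
      moreover have "mv d Cs ?e a = Cs a b"
      proof -
        have "mv d Cs ?e a = (\<Sum>j<d. if j = b then Cs a b else 0)" unfolding mv_def by (intro sum.cong) auto
        then show ?thesis using True by simp
      qed
      ultimately show ?thesis using True by (simp add: sc_def idop_def)
    qed (use sC in \<open>auto simp: sup_def sc_def idop_def\<close>)
  qed
qed

text \<open>The trace of the Casimir operator on a weight space, computed from its scalar value and
  from its expansion in root operators.\<close>

lemma freudenthal:
  "of_int cz * nw \<kappa> = of_int (sqn m \<kappa>) * nw \<kappa> + (\<Sum>x\<in>Phi m. tt (fst x) (snd x) \<kappa> + tt (snd x) (fst x) \<kappa>)"
proof -
  have sC: "sup d Cs" unfolding Cs_def by (rule sup_sum) (simp add: sup_mm)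
  have "trc d (mm d (P \<kappa>) Cs) = 2 * of_int cz * nw \<kappa>"
    unfolding Cs_scalar[OF sC] by (simp add: mm_sc mm_id trc_sc nw_def)
  then have "2 * (of_int cz * nw \<kappa>) =
      2 * (of_int (sqn m \<kappa>) * nw \<kappa> + (\<Sum>x\<in>Phi m. tt (fst x) (snd x) \<kappa> + tt (snd x) (fst x) \<kappa>))"
    using trace_Casimir[of \<kappa>] by (simp only: distrib_left ac_simps)
  then show ?thesis by (simp only: mult_cancel_left) simp
qed

subsection \<open>All weights lie below the highest weight\<close>

lemma ex_matrix_coefficient:
  "\<exists>F. polyfun n F \<and> (\<forall>g\<in>SO_odd m. F g = mv d (mm d (P \<kappa>) (p g)) w r)"
proof -
  have "\<forall>i j. \<exists>f. polyfun n f \<and> (\<forall>g\<in>SO_odd m. p g i j = f g)" using p_polyfun by blast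
  then obtain f where f: "\<And>i j. polyfun n (f i j)" "\<And>i j g. g \<in> SO_odd m \<Longrightarrow> p g i j = f i j g" by metis
  have "polyfun n (\<lambda>g. \<Sum>j<d. (\<Sum>i<d. P \<kappa> r i * f i j g) * w j)"
    by (intro polyfun_sum polyfun_mult polyfun_const f(1))
  then show ?thesis using f(2) by (intro exI[of _ "\<lambda>g. \<Sum>j<d. (\<Sum>i<d. P \<kappa> r i * f i j g) * w j"]) (simp add: mv_def mm_def)
qed

lemma lower_SO: "u \<in> unipotent_lower m \<Longrightarrow> u \<in> SO_odd m"
  by (simp add: unipotent_lower_def)

text \<open>Of the two torus factors of the contraction, the left one acts through
  \<open>P \<kappa>\<close> by the weight \<kappa> and the right one on w by \<eta>; together they
  give the power of z.\<close>

lemma contract_coefficient: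
  assumes a: "dcow m a" and u: "u \<in> unipotent_lower m" and z: "z \<noteq> 0"
  shows "contract m a u z \<in> SO_odd m"
    "mv d (mm d (P \<kappa>) (p (contract m a u z))) w r = z powi (pair m a \<eta> - pair m a \<kappa>) * mv d (mm d (P \<kappa>) (p u)) w r"
proof -
  obtain x where c: "contract m a u z = torus_elt m x * u * torus_elt m (\<lambda>i. inverse (x i))" "unitvals m x"
      "\<And>\<mu>. mon m x \<mu> = z powi (- pair m a \<mu>)"
    using contract_eq_conj[OF a u z] by blast
  let ?y = "\<lambda>i. inverse (x i)"
  have y: "unitvals m ?y" using c(2) by (simp add: unitvals_def)
  note so = torus_SO[OF c(2)] lower_SO[OF u] torus_SO[OF y]
  show "contract m a u z \<in> SO_odd m" unfolding c(1) by (intro SO_mult so)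
  have "p (contract m a u z) = mm d (p (torus_elt m x)) (mm d (p u) (p (torus_elt m ?y)))"
    unfolding c(1) by (simp only: p_mult[OF SO_mult[OF so(1,2)] so(3)] p_mult[OF so(1,2)] mm_assoc)
  then have "mm d (P \<kappa>) (p (contract m a u z)) = mm d (mm d (P \<kappa>) (p (torus_elt m x))) (mm d (p u) (p (torus_elt m ?y)))"
    by (simp only: mm_assoc)
  also have "\<dots> = sc (mon m x \<kappa>) (mm d (mm d (P \<kappa>) (p u)) (p (torus_elt m ?y)))"
    by (simp only: P_p_torus[OF c(2)] mm_sc mm_assoc)
  finally have "mv d (mm d (P \<kappa>) (p (contract m a u z))) w r = mon m x \<kappa> * (mon m ?y \<eta> * mv d (mm d (P \<kappa>) (p u)) w r)"
    by (simp add: mv_sc mv_mm[of d "mm d (P \<kappa>) (p u)"] p_tor[OF y] mv_scale)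
  moreover have "mon m x \<kappa> * mon m ?y \<eta> = z powi (pair m a \<eta> - pair m a \<kappa>)"
  proof -
    have "mon m x \<kappa> * mon m ?y \<eta> = z powi (- pair m a \<kappa>) * inverse (z powi (- pair m a \<eta>))"
      by (simp only: mon_inverse c(3))
    then show ?thesis using z by (simp add: power_int_minus power_int_diff field_simps)
  qed
  ultimately show "mv d (mm d (P \<kappa>) (p (contract m a u z))) w r = z powi (pair m a \<eta> - pair m a \<kappa>) * mv d (mm d (P \<kappa>) (p u)) w r"
    by (simp add: mult.assoc[symmetric])
qed

lemma isCont_contract: "polyfun n F \<Longrightarrow> isCont (\<lambda>z. F (contract m a u z)) 0"
  by (erule polyfun_isCont) (simp add: contract_def)

text \<open>Along the contraction the matrix coefficient is its value at u times z^{-K} with K = <a,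
  \<kappa> - \<eta>> > 0, and yet it is continuous at z = 0. So the value at u is zero, and the rows
  of \<open>P \<kappa>\<close> annihilate the lower unipotent orbit of w.\<close>

lemma weight_zero:
  assumes a: "dcow m a" and gt: "pair m a \<eta> < pair m a \<kappa>"
  shows "P \<kappa> = 0"
proof -
  have "(\<Sum>i<d. P \<kappa> r i * mv d (p u) w i) = 0" if u: "u \<in> unipotent_lower m" for u r
  proof -
    obtain F where F: "polyfun n F" "\<And>g. g \<in> SO_odd m \<Longrightarrow> F g = mv d (mm d (P \<kappa>) (p g)) w r"
      using ex_matrix_coefficient by blast
    define K where "K = nat (pair m a \<kappa> - pair m a \<eta>)"
    have K: "K > 0" "pair m a \<kappa> - pair m a \<eta> = int K" using gt by (auto simp: K_def)
    let ?L = "mv d (mm d (P \<kappa>) (p u)) w r"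
    have "z ^ K * F (contract m a u z) = ?L" if z: "z \<noteq> 0" for z
    proof -
      have e: "pair m a \<eta> - pair m a \<kappa> = - int K" using K(2) by linarith
      have "F (contract m a u z) = z powi (- int K) * ?L"
        using F(2)[OF contract_coefficient(1)[OF a u z]] contract_coefficient(2)[OF a u z, of \<kappa> r] unfolding e by simp
      then show ?thesis using z by (simp add: power_int_minus)
    qed
    then have "((\<lambda>z. z ^ K * F (contract m a u z)) \<longlongrightarrow> ?L) (at 0)"
      by (intro tendsto_eventually) (auto simp: eventually_at_filter)
    moreover have "((\<lambda>z. z ^ K * F (contract m a u z)) \<longlongrightarrow> 0 ^ K * F (contract m a u 0)) (at 0)"
      using isCont_contract[OF F(1)] by (intro tendsto_intros) (auto simp: isCont_def)
    ultimately have "?L = 0 ^ K * F (contract m a u 0)" by (rule LIM_unique)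
    then have "?L = 0" using K(1) by simp
    then show ?thesis by (simp add: mv_mm) (simp add: mv_def)
  qed
  then have "P \<kappa> r i = 0" if "i < d" for r i using annihilator_lower[of "P \<kappa> r" i] that by blast
  then show ?thesis
    using sup_P[of \<kappa>] by (auto simp: fun_eq_iff sup_def)
qed

lemma weight_psum:
  assumes "nw \<kappa> \<noteq> 0" "k \<le> m"
  shows "psum k \<kappa> \<le> psum k \<eta>"
proof (rule ccontr)
  assume n: "\<not> ?thesis"
  let ?a = "\<lambda>i. if i < k then 1 else 0 :: int"
  have p: "pair m ?a \<mu> = psum k \<mu>" for \<mu>
  proof -
    have "pair m ?a \<mu> = (\<Sum>i<m. if i < k then \<mu> i else 0)" unfolding pair_def by (intro sum.cong) auto
    also have "\<dots> = (\<Sum>i<k. \<mu> i)" using assms(2) by (intro sum.mono_neutral_cong_right) auto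
    finally show ?thesis by (simp add: psum_def)
  qed
  have "P \<kappa> = 0" using n by (intro weight_zero[of ?a]) (auto simp: dcow_def p)
  then show False using assms(1) by (simp add: nw_def)
qed

text \<open>For the weight \<eta> itself the contracted coefficient is constant in z, and its value
  at z = 0 is the value at the identity. Hence \<open>P \<eta>\<close> sends the lower unipotent
  orbit of w to the single vector w; it has rank one, fixes w, and so has trace 1.\<close>

lemma nw_eta: "nw \<eta> = 1"
proof -
  \<comment> \<open>A regular coweight: every place below the diagonal gets a positive power of z,
    so the contraction of u reaches the identity at z = 0.\<close>
  let ?a = "\<lambda>i. if i < m then int m - int i else 0"
  have a: "dcow m ?a" by (auto simp: dcow_def)
  have strict: "pair m (wtv m i) ?a < pair m (wtv m j) ?a" if "j < i" "i \<le> 2 * m" for i j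
    using that by (auto simp: pair_wtv)
  have low: "mv d (mm d (P \<eta>) (p u)) w r = w r" if u: "u \<in> unipotent_lower m" for u r
  proof -
    obtain F where F: "polyfun n F" "\<And>g. g \<in> SO_odd m \<Longrightarrow> F g = mv d (mm d (P \<eta>) (p g)) w r"
      using ex_matrix_coefficient by blast
    let ?L = "mv d (mm d (P \<eta>) (p u)) w r"
    have "F (contract m ?a u z) = ?L" if z: "z \<noteq> 0" for z
      using F(2)[OF contract_coefficient(1)[OF a u z]] contract_coefficient(2)[OF a u z, of \<eta> r] by simp
    then have "((\<lambda>z. F (contract m ?a u z)) \<longlongrightarrow> ?L) (at 0)"
      by (intro tendsto_eventually) (auto simp: eventually_at_filter)
    moreover have "((\<lambda>z. F (contract m ?a u z)) \<longlongrightarrow> F (contract m ?a u 0)) (at 0)"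
      using isCont_contract[OF F(1)] by (auto simp: isCont_def)
    ultimately have L: "?L = F (contract m ?a u 0)" by (rule LIM_unique)
    have "contract m ?a u 0 = 1\<^sub>m n"
    proof (rule eq_matI)
      fix i j assume "i < dim_row (1\<^sub>m n)" "j < dim_col (1\<^sub>m n)"
      then have ij: "i < n" "j < n" by auto
      show "contract m ?a u 0 $$ (i, j) = 1\<^sub>m n $$ (i, j)"
        using ij u strict[of j i] by (cases i j rule: linorder_cases) (auto simp: contract_def unipotent_lower_def lower_uni_def)
    qed (auto simp: contract_def)
    then have "?L = mv d (P \<eta>) w r" using L F(2)[OF SO_one] by (simp add: p_one mm_id)
    then show ?thesis by (simp add: P_w)
  qed
  \<comment> \<open>A functional \<psi> that vanishes at w vanishes on the whole image of
    \<open>P \<eta>\<close>, since it does so on the image of a spanning orbit.\<close>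
  have orth: "(\<Sum>r<d. \<psi> r * P \<eta> r i) = 0" if \<psi>: "(\<Sum>r<d. \<psi> r * w r) = 0" and i: "i < d" for \<psi> i
  proof (rule annihilator_lower[OF _ i])
    fix u assume u: "u \<in> unipotent_lower m"
    have "(\<Sum>i<d. (\<Sum>r<d. \<psi> r * P \<eta> r i) * mv d (p u) w i) = (\<Sum>r<d. \<psi> r * (\<Sum>i<d. P \<eta> r i * mv d (p u) w i))"
      unfolding sum_distrib_right sum_distrib_left by (subst sum.swap) (simp only: mult.assoc)
    also have "\<dots> = (\<Sum>r<d. \<psi> r * mv d (mm d (P \<eta>) (p u)) w r)"
      unfolding mv_mm by (intro sum.cong HOL.refl) (simp add: mv_def[of d "P \<eta>"])
    also have "\<dots> = 0" using \<psi> low[OF u] by simp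
    finally show "(\<Sum>i<d. (\<Sum>r<d. \<psi> r * P \<eta> r i) * mv d (p u) w i) = 0" .
  qed
  obtain k where k: "k < d" "w k \<noteq> 0" using w_nonzero by blast
  have col: "w k * P \<eta> r i = w r * P \<eta> k i" if "r < d" "i < d" for r i
  proof -
    \<comment> \<open>The functional w_k x_r - w_r x_k vanishes at w; applied to the columns of
      \<open>P \<eta>\<close> it shows that they are proportional to w.\<close>
    let ?\<psi> = "\<lambda>s. (if s = r then w k else 0) - (if s = k then w r else 0)"
    have s: "(\<Sum>s<d. ?\<psi> s * f s) = w k * f r - w r * f k" for f
    proof -
      have "(\<Sum>s<d. ?\<psi> s * f s) = (\<Sum>s<d. (if s = r then w k * f r else 0) - (if s = k then w r * f k else 0))"
        by (intro sum.cong) auto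
      then show ?thesis using that k(1) by (simp add: sum_subtractf)
    qed
    have "(\<Sum>s<d. ?\<psi> s * w s) = 0" unfolding s by simp
    from orth[OF this that(2)] show ?thesis unfolding s by simp
  qed
  have "w k * nw \<eta> = (\<Sum>i<d. w i * P \<eta> k i)"
    unfolding nw_def trc_def sum_distrib_left by (intro sum.cong) (auto simp: col)
  also have "\<dots> = mv d (P \<eta>) w k" by (simp add: mv_def mult.commute)
  also have "\<dots> = w k" by (simp add: P_w)
  finally show ?thesis using k(2) by simp
qed

subsection \<open>The Weyl character formula\<close>

definition gen :: "(wt \<Rightarrow> complex) \<Rightarrow> laur" where
  "gen f = (\<Sum>\<kappa>\<in>S. sg (dbl \<kappa>) (f \<kappa>))"

lemma lk_gen: "lk (gen f) (dbl \<kappa>) = (if \<kappa> \<in> S then f \<kappa> else 0)"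
proof -
  have "lk (gen f) (dbl \<kappa>) = (\<Sum>\<mu>\<in>S. if \<mu> = \<kappa> then f \<kappa> else 0)"
    unfolding gen_def lookup_sum by (intro sum.cong) (auto simp: lookup_single when_def dbl_inj)
  then show ?thesis using S(1) by simp
qed

lemma lk_gen_0: "(\<And>\<kappa>. \<nu> \<noteq> dbl \<kappa>) \<Longrightarrow> lk (gen f) \<nu> = 0"
  unfolding gen_def lookup_sum by (rule sum.neutral) (auto simp: lookup_single when_def)

definition chd :: laur where
  "chd = gen nw"

definition Tx :: "nat \<times> nat \<Rightarrow> laur" where
  "Tx x = gen (tt (fst x) (snd x)) + gen (tt (snd x) (fst x))"

lemma lk_chd: "lk chd (dbl \<kappa>) = nw \<kappa>"
  using tt_zero(2) by (simp add: chd_def lk_gen)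

text \<open>For the generating functions T1 and T2 of the two orders, \<open>tt_shift\<close> gives
  T1 = x^{2\<alpha>} T2 and \<open>tt_diff\<close> expresses 2 (T1 - T2) by derivatives of the
  character. The first relation yields (x^\<alpha> - x^{-\<alpha>}) (T1 + T2) = (x^\<alpha> +
  x^{-\<alpha>}) (T1 - T2).\<close>

lemma Tx_relation:
  assumes x: "x \<in> Phi m"
  defines "\<alpha> \<equiv> rt m x"
  shows "2 * (bin \<alpha> * Tx x) = (xp \<alpha> + xp (- \<alpha>)) * (\<Sum>k<m. of_int (\<alpha> k) * Dv k chd)"
proof -
  obtain i j where ij: "x = (i, j)" "i \<le> 2 * m" "j \<le> 2 * m" "i \<noteq> j" "i \<noteq> 2 * m - j"
    using x by (auto simp: Phi_def)
  define T1 T2 where "T1 = gen (tt i j)" and "T2 = gen (tt j i)"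
  define D where "D = (\<Sum>k<m. of_int (\<alpha> k) * Dv k chd)"
  have \<alpha>: "\<alpha> = rt m (i, j)" by (simp add: \<alpha>_def ij(1))
  have lkt: "lk (gen (tt a b)) (dbl \<kappa>) = tt a b \<kappa>" for a b \<kappa> using tt_zero(1) by (simp add: lk_gen)
  have 1: "T1 = xp (dbl \<alpha>) * T2"
  proof (rule poly_mapping_eqI)
    fix \<nu>
    show "lk T1 \<nu> = lk (xp (dbl \<alpha>) * T2) \<nu>"
    proof (cases "\<exists>\<kappa>. \<nu> = dbl \<kappa>")
      case True
      then obtain \<kappa> where \<kappa>: "\<nu> = dbl \<kappa>" by blast
      show ?thesis using tt_shift[OF ij(2,3), of \<kappa>]
        by (simp only: T1_def T2_def lk_mult_single \<kappa> lkt \<alpha>[symmetric] mult_1 dbl_diff[symmetric])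
    next
      case False
      have "\<nu> - (dbl \<alpha>) \<noteq> dbl \<kappa>" for \<kappa>
      proof
        assume "\<nu> - (dbl \<alpha>) = dbl \<kappa>"
        then have "\<nu> = dbl (\<kappa> + \<alpha>)" by (simp add: dbl_add diff_eq_eq)
        then show False using False by blast
      qed
      then have "lk T2 (\<nu> - (dbl \<alpha>)) = 0" unfolding T2_def by (rule lk_gen_0)
      moreover have "lk T1 \<nu> = 0" unfolding T1_def using False by (intro lk_gen_0) blast
      ultimately show ?thesis by (simp add: lk_mult_single)
    qed
  qed
  have 2: "2 * (T1 - T2) = D"
  proof (rule poly_mapping_eqI)
    fix \<nu>
    have two: "lk (2 * f) \<nu> = 2 * lk f \<nu>" for f :: laur using lk_of_int_mult[of 2 f \<nu>] by simp
    have D: "lk D \<nu> = (\<Sum>k<m. of_int (\<alpha> k) * of_int (\<nu> k)) * lk chd \<nu>"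
      unfolding D_def lookup_sum sum_distrib_right by (intro sum.cong) (auto simp: lk_of_int_mult lk_Dv)
    show "lk (2 * (T1 - T2)) \<nu> = lk D \<nu>"
    proof (cases "\<exists>\<kappa>. \<nu> = dbl \<kappa>")
      case True
      then obtain \<kappa> where \<kappa>: "\<nu> = dbl \<kappa>" by blast
      have "(\<Sum>k<m. of_int (\<alpha> k) * of_int (\<nu> k)) = 2 * (of_int (pair m \<alpha> \<kappa>) :: complex)"
        by (simp add: \<kappa> pair_def dbl_apply sum_distrib_left algebra_simps)
      then have "lk D \<nu> = 2 * (of_int (pair m \<alpha> \<kappa>) * nw \<kappa>)" using D lk_chd[of \<kappa>] by (simp add: \<kappa>)
      also have "\<dots> = 2 * (tt i j \<kappa> - tt j i \<kappa>)" using tt_diff[OF ij(2-5), of \<kappa>] by (simp add: \<alpha>)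
      finally show ?thesis unfolding two lookup_minus T1_def T2_def unfolding \<kappa> lkt by simp
    next
      case False
      then have "lk (gen f) \<nu> = 0" for f by (intro lk_gen_0) blast
      then show ?thesis unfolding D two lookup_minus T1_def T2_def chd_def by simp
    qed
  qed
  have 3: "xp (- \<alpha>) * T1 = xp \<alpha> * T2"
  proof -
    have "- \<alpha> + dbl \<alpha> = \<alpha>" by (simp add: dbl_eq_add)
    then have "xp (- \<alpha>) * xp (dbl \<alpha>) = xp \<alpha>" by (simp only: mult_single mult_1)
    then show ?thesis unfolding 1 mult.assoc[symmetric] by (rule arg_cong)
  qed
  have T: "Tx x = T1 + T2" by (simp add: Tx_def T1_def T2_def ij(1))
  have "bin \<alpha> * Tx x = (xp \<alpha> + xp (- \<alpha>)) * (T1 - T2)"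
  proof -
    have "bin \<alpha> * Tx x = xp \<alpha> * T1 + xp \<alpha> * T2 - xp (- \<alpha>) * T1 - xp (- \<alpha>) * T2"
      unfolding T bin_def by (simp add: algebra_simps)
    also have "\<dots> = xp \<alpha> * T1 - xp \<alpha> * T2 + xp (- \<alpha>) * T1 - xp (- \<alpha>) * T2"
      unfolding 3 by simp
    finally show ?thesis by (simp add: algebra_simps)
  qed
  then show ?thesis unfolding D_def[symmetric] 2[symmetric] by (simp only: mult.left_commute)
qed

text \<open>Freudenthal's identity for all weights at once. The factors 4 come from the doubled
  exponents, whose squared norm is four times that of the weight.\<close>

lemma Lap_chd: "Lap m chd + 4 * (\<Sum>x\<in>Phi m. Tx x) = of_int (4 * cz) * chd"
proof (rule poly_mapping_eqI)
  fix \<nu>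
  have four: "lk (4 * f) \<nu> = 4 * lk f \<nu>" for f :: laur using lk_of_int_mult[of 4 f \<nu>] by simp
  show "lk (Lap m chd + 4 * (\<Sum>x\<in>Phi m. Tx x)) \<nu> = lk (of_int (4 * cz) * chd) \<nu>"
  proof (cases "\<exists>\<kappa>. \<nu> = dbl \<kappa>")
    case True
    then obtain \<kappa> where \<kappa>: "\<nu> = dbl \<kappa>" by blast
    have lkt: "lk (gen (tt a b)) (dbl \<kappa>) = tt a b \<kappa>" for a b \<kappa> using tt_zero(1) by (simp add: lk_gen)
    have "sqn m \<nu> = 4 * sqn m \<kappa>" by (simp add: \<kappa> sqn_dbl)
    then have "lk (Lap m chd + 4 * (\<Sum>x\<in>Phi m. Tx x)) \<nu> = of_int (4 * sqn m \<kappa>) * nw \<kappa> +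
        4 * (\<Sum>x\<in>Phi m. tt (fst x) (snd x) \<kappa> + tt (snd x) (fst x) \<kappa>)"
      unfolding lookup_add lk_Lap four lookup_sum Tx_def unfolding \<kappa> lk_chd by (simp only: lookup_add lkt sqn_dbl)
    also have "\<dots> = 4 * (of_int cz * nw \<kappa>)"
      unfolding freudenthal by (simp add: algebra_simps)
    finally show ?thesis unfolding lk_of_int_mult unfolding \<kappa> lk_chd by simp
  next
    case False
    then have "lk (gen f) \<nu> = 0" for f by (intro lk_gen_0) blast
    then show ?thesis unfolding lookup_add four lk_Lap lk_of_int_mult lookup_sum Tx_def chd_def by simp
  qed
qed

lemma symmetric_chd: "symmetric m chd"
proof -
  have *: "twist u chd = chd" if u: "invo u" and inv: "\<And>\<kappa>. nw (u \<kappa>) = nw \<kappa>" for u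
  proof (rule poly_mapping_eqI)
    fix \<nu>
    show "lk (twist u chd) \<nu> = lk chd \<nu>"
    proof (cases "\<exists>\<kappa>. \<nu> = dbl \<kappa>")
      case True
      then obtain \<kappa> where \<kappa>: "\<nu> = dbl \<kappa>" by blast
      then show ?thesis by (simp only: lk_twist[OF u] invo_dbl[OF u] lk_chd inv)
    next
      case False
      have "u \<nu> \<noteq> dbl \<kappa>" for \<kappa>
      proof
        assume "u \<nu> = dbl \<kappa>"
        then have "u (u \<nu>) = dbl (u \<kappa>)" using invo_dbl[OF u] by simp
        then have "\<nu> = dbl (u \<kappa>)" using u by (simp add: invo_def)
        then show False using False by blast
      qed
      then have "lk chd (u \<nu>) = 0" unfolding chd_def by (rule lk_gen_0)
      moreover have "lk chd \<nu> = 0" unfolding chd_def using False by (intro lk_gen_0) blast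
      ultimately show ?thesis by (simp add: lk_twist[OF u])
    qed
  qed
  show ?thesis
    unfolding symmetric_def using *[OF invo_swp nw_swp] *[OF invo_flp nw_flp] by auto
qed

lemma keys_chd:
  assumes "\<nu> \<in> ks chd"
  obtains \<kappa> where "\<nu> = dbl \<kappa>" "nw \<kappa> \<noteq> 0" "\<kappa> \<in> wts m"
proof -
  have nz: "lk chd \<nu> \<noteq> 0" using assms by (simp add: in_keys_iff)
  then obtain \<kappa> where \<kappa>: "\<nu> = dbl \<kappa>" unfolding chd_def using lk_gen_0 by blast
  have "nw \<kappa> \<noteq> 0" using nz lk_chd[of \<kappa>] unfolding \<kappa> by simp
  moreover have "\<kappa> \<in> wts m" using tt_zero(2)[of \<kappa>] \<open>nw \<kappa> \<noteq> 0\<close> S(2) by blast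
  ultimately show thesis using that \<kappa> by blast
qed

theorem weyl_character_formula:
  assumes dom: "\<And>k. Suc k < m \<Longrightarrow> \<eta> (Suc k) \<le> \<eta> k" "0 < m \<Longrightarrow> 0 \<le> \<eta> (m - 1)"
  shows "Delta m * chd = det (altm m (dbl \<eta> + rho2 m))"
proof (rule alternating_eq_alt)
  let ?l = "dbl \<eta> + rho2 m"
  show "alternating m (Delta m * chd)" by (rule alternating_mult[OF alternating_Delta symmetric_chd])
  show "sdom m ?l"
    unfolding sdom_def
  proof (intro conjI allI impI)
    fix k assume k: "Suc k < m"
    then have "rho2 m (Suc k) < rho2 m k" using sdom_rho2 by (simp add: sdom_def)
    then show "?l (Suc k) < ?l k" using dom(1)[OF k] by (simp add: dbl_apply)
  next
    assume "0 < m"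
    then have "0 < rho2 m (m - 1)" using sdom_rho2 by (simp add: sdom_def)
    then show "0 < ?l (m - 1)" using dom(2)[OF \<open>0 < m\<close>] by (simp add: dbl_apply)
  qed
  show "?l \<in> wts m" by (intro wts_add dbl_wts eta rho2_wts)
  have keys: "\<exists>\<delta> \<kappa>. \<nu> = \<delta> + (dbl \<kappa>) \<and> \<delta> \<in> ks (Delta m) \<and> nw \<kappa> \<noteq> 0 \<and> \<kappa> \<in> wts m" if k: "\<nu> \<in> ks (Delta m * chd)" for \<nu>
  proof -
    have "\<nu> \<in> {a + b |a b. a \<in> ks (Delta m) \<and> b \<in> ks chd}" using k keys_mult[of "Delta m" chd] by blast
    then obtain \<delta> \<kappa>' where "\<nu> = \<delta> + \<kappa>'" "\<delta> \<in> ks (Delta m)" "\<kappa>' \<in> ks chd" by blast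
    then show ?thesis using keys_chd[of \<kappa>'] by blast
  qed
  show "ks (Delta m * chd) \<subseteq> wts m"
  proof
    fix \<nu> assume "\<nu> \<in> ks (Delta m * chd)"
    then obtain \<delta> \<kappa> where *: "\<nu> = \<delta> + (dbl \<kappa>)" "\<delta> \<in> ks (Delta m)" "\<kappa> \<in> wts m" using keys by blast
    show "\<nu> \<in> wts m" unfolding *(1) using *(2,3) keys_Delta(1) by (intro wts_add dbl_wts) auto
  qed
  show "psum k \<nu> \<le> psum k ?l" if \<nu>: "\<nu> \<in> ks (Delta m * chd)" "k \<le> m" for \<nu> k
  proof -
    obtain \<delta> \<kappa> where "\<nu> = \<delta> + (dbl \<kappa>)" "\<delta> \<in> ks (Delta m)" "nw \<kappa> \<noteq> 0" using keys[OF \<nu>(1)] by blast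
    then show ?thesis using keys_Delta(2)[of \<delta> m k] weight_psum[of \<kappa> k] \<nu>(2) by (simp add: psum_add psum_dbl)
  qed
  have L: "Lap m (Delta m * chd) = of_int (sqn m (rho2 m) + 4 * cz) * (Delta m * chd)"
  proof -
    have "Lap m (Delta m * chd) = Lap m (Delta m) * chd + Delta m * (Lap m chd + 4 * (\<Sum>x\<in>Phi m. Tx x))"
      unfolding Delta_def by (rule Lap_prod_bin[OF finite_Phi Tx_relation])
    then show ?thesis by (simp add: Lap_Delta Lap_chd algebra_simps)
  qed
  \<comment> \<open>Completing the square: |2\<eta> + 2\<rho>|^2 = |2\<rho>|^2 + 4 <\<eta>, \<eta> +
    2\<rho>>.\<close>
  have sl: "sqn m ?l = sqn m (rho2 m) + 4 * cz"
  proof -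
    have "pair m (dbl \<eta>) (rho2 m) = 2 * (\<Sum>x\<in>Phi m. pair m (rt m x) \<eta>)"
      by (simp add: pair_dbl pair_commute[of m \<eta>] sum_rt[symmetric] pair_sum)
    then show ?thesis by (simp add: sqn_add[of m "dbl \<eta>"] sqn_dbl cz_def)
  qed
  show "sqn m \<nu> = sqn m ?l" if "\<nu> \<in> ks (Delta m * chd)" for \<nu>
  proof -
    have "lk (Lap m (Delta m * chd)) \<nu> = of_int (sqn m ?l) * lk (Delta m * chd) \<nu>"
      unfolding L sl lk_of_int_mult ..
    then have "of_int (sqn m \<nu>) = (of_int (sqn m ?l) :: complex)" using that by (simp add: lk_Lap in_keys_iff)
    then show ?thesis by (simp only: of_int_eq_iff)
  qed
  have "topp m chd (dbl \<eta>)"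
    unfolding topp_def
  proof (intro conjI ballI impI)
    show "lk chd (dbl \<eta>) = 1" by (simp only: lk_chd nw_eta)
    fix \<nu> assume \<nu>: "\<nu> \<in> ks chd" "\<nu> \<noteq> dbl \<eta>"
    obtain \<kappa> where \<kappa>: "\<nu> = dbl \<kappa>" "nw \<kappa> \<noteq> 0" "\<kappa> \<in> wts m" using keys_chd[OF \<nu>(1)] by blast
    have "hgt m \<kappa> < hgt m \<eta>" using \<nu>(2) \<kappa> dbl_inj weight_psum[OF \<kappa>(2)] eta by (intro hgt_less_if_psum_le) auto
    then show "hgt m \<nu> < hgt m (dbl \<eta>)" by (simp add: \<kappa>(1) hgt_dbl)
  qed
  from topp_mult[OF topp_Delta this] show "lk (Delta m * chd) ?l = 1"
    by (simp add: topp_def add.commute)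
qed

lemma ev_chd:
  assumes y: "unitvals m y"
  shows "ev m y chd = trc d (p (torus_elt m (\<lambda>i. (y i)\<^sup>2)))"
proof -
  have x: "unitvals m (\<lambda>i. (y i)\<^sup>2)" using y by (simp add: unitvals_def)
  have "mon m y (dbl \<kappa>) = mon m (\<lambda>i. (y i)\<^sup>2) \<kappa>" for \<kappa>
    unfolding dbl_eq_add mon_add[OF y] mon_mult[symmetric] by (simp only: power2_eq_square)
  then have "ev m y chd = (\<Sum>\<kappa>\<in>S. mon m (\<lambda>i. (y i)\<^sup>2) \<kappa> * nw \<kappa>)"
    by (simp add: chd_def gen_def ev_sum ev_single mult.commute)
  also have "\<dots> = trc d (p (torus_elt m (\<lambda>i. (y i)\<^sup>2)))"
    by (simp add: p_torus[OF x] trc_sum trc_sc nw_def)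
  finally show ?thesis .
qed

end

section \<open>Existence of irreducible representations\<close>

definition hwr :: "nat \<Rightarrow> nat \<Rightarrow> (complex mat \<Rightarrow> complex mat) \<Rightarrow> wt \<Rightarrow> bool" where
  "hwr m d \<pi> \<eta> \<longleftrightarrow> (\<exists>v\<in>carrier_vec d. v \<noteq> 0\<^sub>v d \<and> (\<forall>g\<in>unipotent_upper m. \<pi> g *\<^sub>v v = v) \<and>
     (\<forall>x. unitvals m x \<longrightarrow> \<pi> (torus_elt m x) *\<^sub>v v = mon m x \<eta> \<cdot>\<^sub>v v))"

text \<open>If d < k, padding A and B with zeros to k by k matrices would produce an invertible
  matrix with a zero row.\<close>

lemma left_inverse_dim_le:
  assumes A: "A \<in> carrier_mat d k" and B: "B \<in> carrier_mat k d" and BA: "B * A = (1\<^sub>m k :: complex mat)"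
  shows "k \<le> d"
proof (rule ccontr)
  assume "\<not> k \<le> d"
  then have kd: "d < k" by simp
  define A' where "A' = mat k k (\<lambda>(i, j). if i < d then A $$ (i, j) else 0)"
  define B' where "B' = mat k k (\<lambda>(i, j). if j < d then B $$ (i, j) else 0)"
  have c: "A' \<in> carrier_mat k k" "B' \<in> carrier_mat k k" by (auto simp: A'_def B'_def)
  have "B' * A' = 1\<^sub>m k"
  proof (rule eq_matI)
    fix i j assume "i < dim_row (1\<^sub>m k)" "j < dim_col (1\<^sub>m k)"
    then have ij: "i < k" "j < k" by auto
    have "(B' * A') $$ (i, j) = (\<Sum>l<d. B $$ (i, l) * A $$ (l, j))"
      unfolding mat_mult_entry[OF c(2,1) ij]
      by (rule sum.mono_neutral_cong_right) (use ij kd in \<open>auto simp: A'_def B'_def\<close>)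
    then show "(B' * A') $$ (i, j) = 1\<^sub>m k $$ (i, j)"
      using mat_mult_entry[OF B A ij] BA by simp
  qed (use c in auto)
  then have "A' * B' = 1\<^sub>m k" by (rule mat_mult_left_right_inverse[OF c(2,1)])
  moreover have "(A' * B') $$ (d, d) = 0"
    unfolding mat_mult_entry[OF c kd kd] by (rule sum.neutral) (use kd in \<open>auto simp: A'_def\<close>)
  ultimately show False using kd by simp
qed

definition lin_subspace :: "nat \<Rightarrow> complex vec set \<Rightarrow> bool" where
  "lin_subspace d W \<longleftrightarrow> W \<subseteq> carrier_vec d \<and> 0\<^sub>v d \<in> W \<and> (\<forall>v\<in>W. \<forall>w\<in>W. v + w \<in> W) \<and> (\<forall>c. \<forall>v\<in>W. c \<cdot>\<^sub>v v \<in> W)"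

text \<open>Every subspace is the image of an idempotent \<open>A B\<close> with \<open>B A = 1\<close>: take the inner dimension maximal.\<close>

lemma subspace_factor:
  assumes W: "lin_subspace d W"
  shows "\<exists>k A B. A \<in> carrier_mat d k \<and> B \<in> carrier_mat k d \<and> B * A = 1\<^sub>m k \<and>
    (\<forall>x\<in>carrier_vec k. A *\<^sub>v x \<in> W) \<and> (\<forall>w\<in>W. A *\<^sub>v (B *\<^sub>v w) = w)"
proof -
  let ?P = "\<lambda>k. \<exists>A B. A \<in> carrier_mat d k \<and> B \<in> carrier_mat k d \<and> B * A = 1\<^sub>m k \<and> (\<forall>x\<in>carrier_vec k. A *\<^sub>v x \<in> W)"
  have Wc: "W \<subseteq> carrier_vec d" and W0: "0\<^sub>v d \<in> W" and Wa: "\<And>v w. v \<in> W \<Longrightarrow> w \<in> W \<Longrightarrow> v + w \<in> W"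
    and Ws: "\<And>c v. v \<in> W \<Longrightarrow> c \<cdot>\<^sub>v v \<in> W" using W by (auto simp: lin_subspace_def)
  have P0: "?P 0"
  proof (intro exI conjI ballI)
    show "0\<^sub>m d 0 \<in> carrier_mat d 0" "0\<^sub>m 0 d \<in> carrier_mat 0 d" by auto
    show "0\<^sub>m 0 d * 0\<^sub>m d 0 = 1\<^sub>m 0" by (intro eq_matI) auto
    fix x :: "complex vec" assume "x \<in> carrier_vec 0"
    then have "0\<^sub>m d 0 *\<^sub>v x = 0\<^sub>v d" by (intro eq_vecI) (auto simp: scalar_prod_def)
    then show "0\<^sub>m d 0 *\<^sub>v x \<in> W" using W0 by simp
  qed
  have bound: "\<forall>k. ?P k \<longrightarrow> k \<le> d" using left_inverse_dim_le by blast
  define k where "k = (GREATEST k. ?P k)"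
  have "?P k" unfolding k_def by (rule GreatestI_nat[of ?P, OF P0]) (use bound in blast)
  then obtain A B where A: "A \<in> carrier_mat d k" and B: "B \<in> carrier_mat k d" and BA: "B * A = 1\<^sub>m k"
    and AW: "\<And>x. x \<in> carrier_vec k \<Longrightarrow> A *\<^sub>v x \<in> W" by blast
  have "A *\<^sub>v (B *\<^sub>v w) = w" if w: "w \<in> W" for w
  proof (rule ccontr)
    assume ne: "A *\<^sub>v (B *\<^sub>v w) \<noteq> w"
    have wc: "w \<in> carrier_vec d" using w Wc by auto
    have Bw: "B *\<^sub>v w \<in> carrier_vec k" using B wc by auto
    \<comment> \<open>The part of w missed by the projection A B; it stays in W, is killed by B, and
      serves as a further column of A.\<close>
    define u where "u = w + (- 1) \<cdot>\<^sub>v (A *\<^sub>v (B *\<^sub>v w))"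
    have uW: "u \<in> W" unfolding u_def by (intro Wa w Ws AW Bw)
    have uc: "u \<in> carrier_vec d" using uW Wc by auto
    have Bu: "B *\<^sub>v u = 0\<^sub>v k"
    proof -
      have "B *\<^sub>v u = B *\<^sub>v w + (- 1) \<cdot>\<^sub>v (B *\<^sub>v (A *\<^sub>v (B *\<^sub>v w)))"
        unfolding u_def using A B wc Bw by (simp add: mult_add_distrib_mat_vec[of _ k d] mult_mat_vec[of _ k d])
      also have "B *\<^sub>v (A *\<^sub>v (B *\<^sub>v w)) = (B * A) *\<^sub>v (B *\<^sub>v w)" using A B Bw by simp
      also have "\<dots> = B *\<^sub>v w" unfolding BA using Bw by simp
      finally have "B *\<^sub>v u = B *\<^sub>v w + (- 1) \<cdot>\<^sub>v (B *\<^sub>v w)" .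
      then show ?thesis using Bw B by (intro eq_vecI) (auto simp del: index_mult_mat_vec)
    qed
    have "\<exists>j<d. u $ j \<noteq> 0"
    proof (rule ccontr)
      assume n: "\<not> (\<exists>j<d. u $ j \<noteq> 0)"
      have "A *\<^sub>v (B *\<^sub>v w) = w"
      proof (rule eq_vecI)
        fix j assume j: "j < dim_vec w"
        then have "u $ j = 0" using n wc by auto
        then show "(A *\<^sub>v (B *\<^sub>v w)) $ j = w $ j" using j wc A by (simp add: u_def)
      qed (use A wc in auto)
      then show False using ne by simp
    qed
    then obtain j where j: "j < d" "u $ j \<noteq> 0" by blast
    define AB where "AB = A * B"
    have ABc: "AB \<in> carrier_mat d d" using A B by (auto simp: AB_def)
    have ABu: "(\<Sum>l<d. AB $$ (j, l) * u $ l) = 0"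
    proof -
      have "(AB *\<^sub>v u) $ j = (A *\<^sub>v (B *\<^sub>v u)) $ j" using A B uc by (simp add: AB_def)
      also have "\<dots> = 0" unfolding Bu using A j by (simp add: scalar_prod_def)
      finally show ?thesis using mat_vec_entry[OF ABc uc j(1)] by simp
    qed
    have ABA: "(\<Sum>l<d. AB $$ (j, l) * A $$ (l, c)) = A $$ (j, c)" if c: "c < k" for c
    proof -
      have "AB * A = A" using A B BA by (simp add: AB_def)
      then show ?thesis using mat_mult_entry[OF ABc A j(1) c] by simp
    qed
    have Bu0: "(\<Sum>l<d. B $$ (c, l) * u $ l) = 0" if c: "c < k" for c
      using mat_vec_entry[OF B uc c] Bu c by simp
    have BA0: "(\<Sum>l<d. B $$ (c, l) * A $$ (l, c')) = (if c = c' then 1 else 0)" if c: "c < k" "c' < k" for c c'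
      using mat_mult_entry[OF B A c] BA c by simp
    \<comment> \<open>The matching further row of B: it vanishes on the columns of A and takes the
      value 1 on u. It is the j-th row of 1 - A B, normalised by u_j.\<close>
    define b where "b l = ((if l = j then 1 else 0) - AB $$ (j, l)) / u $ j" for l
    have bsum: "(\<Sum>l<d. b l * f l) = (f j - (\<Sum>l<d. AB $$ (j, l) * f l)) / u $ j" for f
    proof -
      have "b l * f l = (if l = j then f j / u $ j else 0) - AB $$ (j, l) * f l / u $ j" for l
        by (simp add: b_def diff_divide_distrib left_diff_distrib)
      then have "(\<Sum>l<d. b l * f l) = (\<Sum>l<d. (if l = j then f j / u $ j else 0) - AB $$ (j, l) * f l / u $ j)"
        by simp
      also have "\<dots> = (\<Sum>l<d. if l = j then f j / u $ j else 0) - (\<Sum>l<d. AB $$ (j, l) * f l / u $ j)"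
        by (rule sum_subtractf)
      also have "\<dots> = f j / u $ j - (\<Sum>l<d. AB $$ (j, l) * f l) / u $ j"
        using j by (simp add: sum_divide_distrib)
      finally show ?thesis by (simp add: diff_divide_distrib)
    qed
    define A2 where "A2 = mat d (Suc k) (\<lambda>(i, c). if c < k then A $$ (i, c) else u $ i)"
    define B2 where "B2 = mat (Suc k) d (\<lambda>(c, l). if c < k then B $$ (c, l) else b l)"
    have c2: "A2 \<in> carrier_mat d (Suc k)" "B2 \<in> carrier_mat (Suc k) d" by (auto simp: A2_def B2_def)
    have "B2 * A2 = 1\<^sub>m (Suc k)"
    proof (rule eq_matI)
      fix r c assume "r < dim_row (1\<^sub>m (Suc k))" "c < dim_col (1\<^sub>m (Suc k))"
      then have rc: "r < Suc k" "c < Suc k" by auto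
      have "(B2 * A2) $$ (r, c) = (\<Sum>l<d. (if r < k then B $$ (r, l) else b l) * (if c < k then A $$ (l, c) else u $ l))"
        unfolding mat_mult_entry[OF c2(2,1) rc] by (intro sum.cong) (use rc in \<open>auto simp: A2_def B2_def\<close>)
      also have "\<dots> = (if r = c then 1 else 0)"
        using rc j(2) by (cases "r < k"; cases "c < k") (auto simp: Bu0 BA0 bsum ABu ABA)
      finally show "(B2 * A2) $$ (r, c) = 1\<^sub>m (Suc k) $$ (r, c)" using rc by simp
    qed (use c2 in auto)
    moreover have "A2 *\<^sub>v x \<in> W" if x: "x \<in> carrier_vec (Suc k)" for x
    proof -
      define x' where "x' = vec k (\<lambda>i. x $ i)"
      have x': "x' \<in> carrier_vec k" by (simp add: x'_def)
      have "A2 *\<^sub>v x = A *\<^sub>v x' + x $ k \<cdot>\<^sub>v u"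
      proof (rule eq_vecI)
        fix i assume "i < dim_vec (A *\<^sub>v x' + x $ k \<cdot>\<^sub>v u)"
        then have i: "i < d" using uc by simp
        have "(A2 *\<^sub>v x) $ i = (\<Sum>l<Suc k. (if l < k then A $$ (i, l) else u $ i) * x $ l)"
          unfolding mat_vec_entry[OF c2(1) x i] by (intro sum.cong) (use i in \<open>auto simp: A2_def\<close>)
        also have "\<dots> = (\<Sum>l<k. A $$ (i, l) * x' $ l) + u $ i * x $ k" by (simp add: x'_def)
        also have "\<dots> = (A *\<^sub>v x' + x $ k \<cdot>\<^sub>v u) $ i"
          using mat_vec_entry[OF A x' i] i uc A by (simp del: index_mult_mat_vec)
        finally show "(A2 *\<^sub>v x) $ i = (A *\<^sub>v x' + x $ k \<cdot>\<^sub>v u) $ i" .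
      qed (use c2 uc A in auto)
      then show ?thesis using AW[OF x'] Ws[OF uW] Wa by simp
    qed
    ultimately have "?P (Suc k)" using c2 by blast
    then have "Suc k \<le> k" unfolding k_def by (rule Greatest_le_nat) (use bound in blast)
    then show False by simp
  qed
  then show ?thesis using A B BA AW by blast
qed

lemma mat_eq_if_vec_eq:
  assumes "A \<in> carrier_mat n k" "B \<in> carrier_mat n k" "\<And>x. x \<in> carrier_vec k \<Longrightarrow> A *\<^sub>v x = B *\<^sub>v (x :: complex vec)"
  shows "A = B"
proof (rule eq_matI)
  fix i j assume "i < dim_row B" "j < dim_col B"
  then have ij: "i < n" "j < k" using assms by auto
  have e: "(C *\<^sub>v unit_vec k j) $ i = C $$ (i, j)" if "C \<in> carrier_mat n k" for C :: "complex mat"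
    using that ij by simp
  show "A $$ (i, j) = B $$ (i, j)"
    using e[OF assms(1)] e[OF assms(2)] assms(3)[of "unit_vec k j"] by simp
qed (use assms in auto)

text \<open>The first alternative says that the image of A is invariant and produces the
  subrepresentation on it; the second makes the kernel of B invariant and produces the quotient by
  it. Either one makes the compression multiplicative.\<close>

lemma compress_rep:
  assumes rep: "rational_rep m d \<pi>" and A: "A \<in> carrier_mat d k" and B: "B \<in> carrier_mat k d" and BA: "B * A = 1\<^sub>m k"
    and c: "(\<forall>g\<in>SO_odd m. A * (B * (\<pi> g * A)) = \<pi> g * A) \<or> (\<forall>g\<in>SO_odd m. B * \<pi> g * (A * B) = B * \<pi> g)"
  shows "rational_rep m k (\<lambda>g. B * \<pi> g * A)"
proof -
  have pc: "\<pi> g \<in> carrier_mat d d" if "g \<in> SO_odd m" for g using rep that by (simp add: rational_rep_def)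
  have pm: "\<pi> (g * h) = \<pi> g * \<pi> h" if "g \<in> SO_odd m" "h \<in> SO_odd m" for g h using rep that by (simp add: rational_rep_def)
  have "B * \<pi> (g * h) * A = B * \<pi> g * A * (B * \<pi> h * A)" if g: "g \<in> SO_odd m" and h: "h \<in> SO_odd m" for g h
    using c
  proof
    assume "\<forall>g\<in>SO_odd m. A * (B * (\<pi> g * A)) = \<pi> g * A"
    then have e: "A * (B * (\<pi> h * A)) = \<pi> h * A" using h by blast
    have "B * \<pi> g * A * (B * \<pi> h * A) = B * \<pi> g * (A * (B * (\<pi> h * A)))"
      using pc[OF g] pc[OF h] A B by (smt (verit) assoc_mult_mat mult_carrier_mat)
    also have "\<dots> = B * (\<pi> g * \<pi> h) * A"
      unfolding e using pc[OF g] pc[OF h] A B by (smt (verit) assoc_mult_mat mult_carrier_mat)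
    finally show ?thesis by (simp add: pm[OF g h])
  next
    assume "\<forall>g\<in>SO_odd m. B * \<pi> g * (A * B) = B * \<pi> g"
    then have e: "B * \<pi> g * (A * B) = B * \<pi> g" using g by blast
    have "B * \<pi> g * A * (B * \<pi> h * A) = B * \<pi> g * (A * B) * (\<pi> h * A)"
      using pc[OF g] pc[OF h] A B by (smt (verit) assoc_mult_mat mult_carrier_mat)
    also have "\<dots> = B * (\<pi> g * \<pi> h) * A"
      unfolding e using pc[OF g] pc[OF h] A B by (smt (verit) assoc_mult_mat mult_carrier_mat)
    finally show ?thesis by (simp add: pm[OF g h])
  qed
  moreover have "B * \<pi> (1\<^sub>m (2 * m + 1)) * A = 1\<^sub>m k"
    using rep B BA by (simp add: rational_rep_def)
  moreover have "\<exists>f. polyfun (2 * m + 1) f \<and> (\<forall>g\<in>SO_odd m. (B * \<pi> g * A) $$ (i, j) = f g)" if ij: "i < k" "j < k" for i j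
  proof -
    have "\<forall>a b. \<exists>f. a < d \<longrightarrow> b < d \<longrightarrow> polyfun (2 * m + 1) f \<and> (\<forall>g\<in>SO_odd m. \<pi> g $$ (a, b) = f g)"
      using rep by (simp add: rational_rep_def)
    then obtain f where f: "\<And>a b. a < d \<Longrightarrow> b < d \<Longrightarrow> polyfun (2 * m + 1) (f a b)"
      "\<And>a b g. a < d \<Longrightarrow> b < d \<Longrightarrow> g \<in> SO_odd m \<Longrightarrow> \<pi> g $$ (a, b) = f a b g" by metis
    have "polyfun (2 * m + 1) (\<lambda>g. \<Sum>b<d. (\<Sum>a<d. B $$ (i, a) * f a b g) * A $$ (b, j))"
      by (intro polyfun_sum polyfun_mult polyfun_const f(1)) auto
    moreover have "(B * \<pi> g * A) $$ (i, j) = (\<Sum>b<d. (\<Sum>a<d. B $$ (i, a) * f a b g) * A $$ (b, j))" if g: "g \<in> SO_odd m" for g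
    proof -
      have "B * \<pi> g \<in> carrier_mat k d" using B pc[OF g] by simp
      then show ?thesis
        using mat_mult_entry[OF _ A ij] mat_mult_entry[OF B pc[OF g] ij(1)] f(2)[OF _ _ g] by (simp del: index_mult_mat(1))
    qed
    ultimately show ?thesis by blast
  qed
  moreover have "B * \<pi> g * A \<in> carrier_mat k k" if "g \<in> SO_odd m" for g using A B pc[OF that] by simp
  ultimately show ?thesis by (simp add: rational_rep_def)
qed

lemma compress_hw:
  assumes rep: "rational_rep m d \<pi>" and A: "A \<in> carrier_mat d k" and B: "B \<in> carrier_mat k d"
    and v: "v \<in> carrier_vec d" "\<And>g. g \<in> SO_odd m \<Longrightarrow> (B * \<pi> g * A) *\<^sub>v (B *\<^sub>v v) = B *\<^sub>v (\<pi> g *\<^sub>v v)" "B *\<^sub>v v \<noteq> 0\<^sub>v k"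
    and upp: "\<forall>g\<in>unipotent_upper m. \<pi> g *\<^sub>v v = v"
    and tor: "\<forall>x. unitvals m x \<longrightarrow> \<pi> (torus_elt m x) *\<^sub>v v = mon m x \<eta> \<cdot>\<^sub>v v"
  shows "hwr m k (\<lambda>g. B * \<pi> g * A) \<eta>"
proof -
  have "(B * \<pi> g * A) *\<^sub>v (B *\<^sub>v v) = B *\<^sub>v v" if "g \<in> unipotent_upper m" for g
    using v(2)[of g] upp that by (simp add: unipotent_upper_iff)
  moreover have "(B * \<pi> (torus_elt m x) * A) *\<^sub>v (B *\<^sub>v v) = mon m x \<eta> \<cdot>\<^sub>v (B *\<^sub>v v)" if "unitvals m x" for x
    using v(2)[OF torus_SO[OF that]] tor that mult_mat_vec[OF B v(1)] by simp
  moreover have "B *\<^sub>v v \<in> carrier_vec k" using B v(1) by simp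
  ultimately show ?thesis using v(3) by (auto simp: hwr_def)
qed

text \<open>A representation of minimal dimension with a given highest weight vector is irreducible.\<close>

theorem exists_irreducible:
  assumes "rational_rep m d0 \<pi>0" "hwr m d0 \<pi>0 \<eta>"
  shows "\<exists>d \<pi>. irreducible_rep m d \<pi> \<and> hwr m d \<pi> \<eta>"
proof -
  let ?P = "\<lambda>d. \<exists>\<pi>. rational_rep m d \<pi> \<and> hwr m d \<pi> \<eta>"
  define d where "d = (LEAST d. ?P d)"
  have "?P d" unfolding d_def by (rule LeastI[of ?P d0]) (use assms in blast)
  then obtain \<pi> where rep: "rational_rep m d \<pi>" and hw: "hwr m d \<pi> \<eta>" by blast
  have min: "d \<le> k" if "rational_rep m k \<rho>" "hwr m k \<rho> \<eta>" for k \<rho>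
    unfolding d_def by (rule Least_le) (use that in blast)
  obtain v where v: "v \<in> carrier_vec d" "v \<noteq> 0\<^sub>v d" and upp: "\<forall>g\<in>unipotent_upper m. \<pi> g *\<^sub>v v = v"
    and tor: "\<forall>x. unitvals m x \<longrightarrow> \<pi> (torus_elt m x) *\<^sub>v v = mon m x \<eta> \<cdot>\<^sub>v v"
    using hw by (auto simp: hwr_def)
  have pc: "\<pi> g \<in> carrier_mat d d" if "g \<in> SO_odd m" for g using rep that by (simp add: rational_rep_def)
  have "d > 0" using v by (cases "d = 0") (auto intro: eq_vecI)
  moreover have "W = {0\<^sub>v d} \<or> W = carrier_vec d" if inv: "invariant_subspace m d \<pi> W" for W
  proof (rule ccontr)
    assume n: "\<not> ?thesis"
    have W: "lin_subspace d W" and Wg: "\<And>g w. g \<in> SO_odd m \<Longrightarrow> w \<in> W \<Longrightarrow> \<pi> g *\<^sub>v w \<in> W"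
      using inv by (auto simp: invariant_subspace_def lin_subspace_def)
    have Wc: "W \<subseteq> carrier_vec d" and W0: "0\<^sub>v d \<in> W" using W by (auto simp: lin_subspace_def)
    obtain k A B where A: "A \<in> carrier_mat d k" and B: "B \<in> carrier_mat k d" and BA: "B * A = 1\<^sub>m k"
      and AW: "\<And>x. x \<in> carrier_vec k \<Longrightarrow> A *\<^sub>v x \<in> W" and ABw: "\<And>w. w \<in> W \<Longrightarrow> A *\<^sub>v (B *\<^sub>v w) = w"
      using subspace_factor[OF W] by blast
    have ABW: "A *\<^sub>v (B *\<^sub>v x) \<in> W" if "x \<in> carrier_vec d" for x using AW B that by simp
    show False
    proof (cases "v \<in> W")
      \<comment> \<open>The highest weight vector lies in the proper subspace W, which therefore
        carries a smaller representation with the same highest weight vector.\<close>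
      case True
      have "k \<noteq> d"
      proof
        assume kd: "k = d"
        have "A * B = 1\<^sub>m d" using mat_mult_left_right_inverse[of B d A] A B BA kd by simp
        then have "A *\<^sub>v (B *\<^sub>v x) = x" if "x \<in> carrier_vec d" for x
          using assoc_mult_mat_vec[OF A B that] that by simp
        then have "W = carrier_vec d" using ABW Wc by (metis subsetI subset_antisym)
        then show False using n by simp
      qed
      then have kd: "k < d" using left_inverse_dim_le[OF A B BA] by simp
      have e: "A * (B * (\<pi> g * A)) = \<pi> g * A" if g: "g \<in> SO_odd m" for g
      proof (rule mat_eq_if_vec_eq)
        show "A * (B * (\<pi> g * A)) \<in> carrier_mat d k" "\<pi> g * A \<in> carrier_mat d k" using A B pc[OF g] by auto
        fix x :: "complex vec" assume x: "x \<in> carrier_vec k"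
        have "(A * (B * (\<pi> g * A))) *\<^sub>v x = A *\<^sub>v (B *\<^sub>v (\<pi> g *\<^sub>v (A *\<^sub>v x)))"
          using A B pc[OF g] x by (smt (verit) assoc_mult_mat_vec mult_carrier_mat mult_mat_vec_carrier)
        also have "\<dots> = \<pi> g *\<^sub>v (A *\<^sub>v x)" by (rule ABw[OF Wg[OF g AW[OF x]]])
        also have "\<dots> = (\<pi> g * A) *\<^sub>v x" using A pc[OF g] x by simp
        finally show "(A * (B * (\<pi> g * A))) *\<^sub>v x = (\<pi> g * A) *\<^sub>v x" .
      qed
      have "rational_rep m k (\<lambda>g. B * \<pi> g * A)" using compress_rep[OF rep A B BA] e by blast
      moreover have "hwr m k (\<lambda>g. B * \<pi> g * A) \<eta>"
      proof (rule compress_hw[OF rep A B v(1) _ _ upp tor])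
        show "B *\<^sub>v v \<noteq> 0\<^sub>v k"
        proof
          assume "B *\<^sub>v v = 0\<^sub>v k"
          then have "v = A *\<^sub>v 0\<^sub>v k" using ABw[OF True] by simp
          also have "\<dots> = 0\<^sub>v d" using A by (intro eq_vecI) (auto simp: scalar_prod_def)
          finally show False using v(2) by simp
        qed
        fix g assume g: "g \<in> SO_odd m"
        have "(B * \<pi> g * A) *\<^sub>v (B *\<^sub>v v) = B *\<^sub>v (\<pi> g *\<^sub>v (A *\<^sub>v (B *\<^sub>v v)))"
          using A B pc[OF g] v(1) by (smt (verit) assoc_mult_mat_vec mult_carrier_mat mult_mat_vec_carrier)
        then show "(B * \<pi> g * A) *\<^sub>v (B *\<^sub>v v) = B *\<^sub>v (\<pi> g *\<^sub>v v)" using ABw[OF True] by simp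
      qed
      ultimately show False using min kd by fastforce
    next
      case False
      \<comment> \<open>Here v survives in the quotient by W, which is smaller because W is nonzero.
        The quotient is modelled on the complement of W given by the kernel of the projection A
        B.\<close>
      define Wk where "Wk = {x \<in> carrier_vec d. A *\<^sub>v (B *\<^sub>v x) = 0\<^sub>v d}"
      have "lin_subspace d Wk"
        unfolding lin_subspace_def Wk_def
      proof (intro conjI ballI allI)
        have "A *\<^sub>v (B *\<^sub>v 0\<^sub>v d) = 0\<^sub>v d" by (rule ABw[OF W0])
        then show "0\<^sub>v d \<in> {x \<in> carrier_vec d. A *\<^sub>v (B *\<^sub>v x) = 0\<^sub>v d}" by simp
        fix x y assume "x \<in> {x \<in> carrier_vec d. A *\<^sub>v (B *\<^sub>v x) = 0\<^sub>v d}" "y \<in> {x \<in> carrier_vec d. A *\<^sub>v (B *\<^sub>v x) = 0\<^sub>v d}"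
        then show "x + y \<in> {x \<in> carrier_vec d. A *\<^sub>v (B *\<^sub>v x) = 0\<^sub>v d}"
          using A B by (simp add: mult_add_distrib_mat_vec[OF B] mult_add_distrib_mat_vec[OF A])
      next
        fix c x assume "x \<in> {x \<in> carrier_vec d. A *\<^sub>v (B *\<^sub>v x) = 0\<^sub>v d}"
        then show "c \<cdot>\<^sub>v x \<in> {x \<in> carrier_vec d. A *\<^sub>v (B *\<^sub>v x) = 0\<^sub>v d}"
          using A B by (auto simp: mult_mat_vec[OF B] mult_mat_vec[OF A])
      qed auto
      then obtain l R C where R: "R \<in> carrier_mat d l" and C: "C \<in> carrier_mat l d" and CR: "C * R = 1\<^sub>m l"
        and RW: "\<And>x. x \<in> carrier_vec l \<Longrightarrow> R *\<^sub>v x \<in> Wk" and RCw: "\<And>w. w \<in> Wk \<Longrightarrow> R *\<^sub>v (C *\<^sub>v w) = w"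
        using subspace_factor[of d Wk] by metis
      have "l \<noteq> d"
      proof
        assume ld: "l = d"
        have "R * C = 1\<^sub>m d" using mat_mult_left_right_inverse[of C d R] R C CR ld by simp
        then have RC: "R *\<^sub>v (C *\<^sub>v x) = x" if "x \<in> carrier_vec d" for x
          using assoc_mult_mat_vec[OF R C that] that by simp
        have "w = 0\<^sub>v d" if w: "w \<in> W" for w
        proof -
          have wc: "w \<in> carrier_vec d" using w Wc by auto
          then have "C *\<^sub>v w \<in> carrier_vec l" using C by simp
          then have "w \<in> Wk" using RW[of "C *\<^sub>v w"] RC[OF wc] by simp
          then show ?thesis using ABw[OF w] by (simp add: Wk_def)
        qed
        then have "W = {0\<^sub>v d}" using W0 by blast
        then show False using n by simp
      qed
      then have ld: "l < d" using left_inverse_dim_le[OF R C CR] by simp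
      \<comment> \<open>The projection onto \<open>Wk\<close> along W; Q below is this projection
        followed by coordinates on \<open>Wk\<close>.\<close>
      define pr where "pr x = x - A *\<^sub>v (B *\<^sub>v x)" for x
      have prc: "pr x \<in> carrier_vec d" if "x \<in> carrier_vec d" for x using that A B by (simp add: pr_def)
      have prk: "pr x \<in> Wk" if x: "x \<in> carrier_vec d" for x
      proof -
        have Bx: "B *\<^sub>v x \<in> carrier_vec k" and ABx: "A *\<^sub>v (B *\<^sub>v x) \<in> carrier_vec d" using A B x by auto
        have "A *\<^sub>v (B *\<^sub>v pr x) = A *\<^sub>v (B *\<^sub>v x) - A *\<^sub>v (B *\<^sub>v (A *\<^sub>v (B *\<^sub>v x)))"
          unfolding pr_def using A B x Bx ABx by (simp add: mult_minus_distrib_mat_vec[OF B] mult_minus_distrib_mat_vec[OF A])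
        also have "\<dots> = 0\<^sub>v d" using ABw[OF ABW[OF x]] ABx by simp
        finally show ?thesis using prc[OF x] by (simp add: Wk_def)
      qed
      define Q where "Q = C * (1\<^sub>m d - A * B)"
      have Qc: "Q \<in> carrier_mat l d" unfolding Q_def using A B C by (metis minus_carrier_mat mult_carrier_mat)
      have Qx: "Q *\<^sub>v x = C *\<^sub>v pr x" if x: "x \<in> carrier_vec d" for x
      proof -
        have "1\<^sub>m d - A * B \<in> carrier_mat d d" using A B by (metis minus_carrier_mat mult_carrier_mat)
        then have "Q *\<^sub>v x = C *\<^sub>v ((1\<^sub>m d - A * B) *\<^sub>v x)" unfolding Q_def using C x by simp
        also have "(1\<^sub>m d - A * B) *\<^sub>v x = pr x"
          unfolding pr_def using A B x by (subst minus_mult_distrib_mat_vec[of _ d d]) auto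
        finally show ?thesis .
      qed
      have RQ: "R *\<^sub>v (Q *\<^sub>v x) = pr x" if "x \<in> carrier_vec d" for x
        using Qx[OF that] RCw[OF prk[OF that]] by simp
      have QW: "Q *\<^sub>v w = 0\<^sub>v l" if w: "w \<in> W" for w
      proof -
        have wc: "w \<in> carrier_vec d" using w Wc by auto
        have "pr w = 0\<^sub>v d" using ABw[OF w] wc by (simp add: pr_def)
        then show ?thesis using Qx[OF wc] C by (auto intro!: eq_vecI simp: scalar_prod_def)
      qed
      have QR: "Q * R = 1\<^sub>m l"
      proof (rule mat_eq_if_vec_eq)
        fix x :: "complex vec" assume x: "x \<in> carrier_vec l"
        have Rx: "R *\<^sub>v x \<in> carrier_vec d" using R x by simp
        have "pr (R *\<^sub>v x) = R *\<^sub>v x" using RW[OF x] Rx by (simp add: pr_def Wk_def)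
        then have "Q *\<^sub>v (R *\<^sub>v x) = C *\<^sub>v (R *\<^sub>v x)" using Qx[OF Rx] by simp
        also have "\<dots> = (C * R) *\<^sub>v x" using C R x by simp
        finally show "(Q * R) *\<^sub>v x = 1\<^sub>m l *\<^sub>v x" using CR assoc_mult_mat_vec[OF Qc R x] by simp
      qed (use Qc R in auto)
      \<comment> \<open>Replacing x by \<open>pr x\<close> changes it by an element of W, which
        \<pi>(g) keeps in W and Q kills.\<close>
      have key: "Q *\<^sub>v (\<pi> g *\<^sub>v (R *\<^sub>v (Q *\<^sub>v x))) = Q *\<^sub>v (\<pi> g *\<^sub>v x)" if g: "g \<in> SO_odd m" and x: "x \<in> carrier_vec d" for g x
      proof -
        have ABx: "A *\<^sub>v (B *\<^sub>v x) \<in> carrier_vec d" using A B x by auto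
        have gc: "\<pi> g *\<^sub>v x \<in> carrier_vec d" "\<pi> g *\<^sub>v (A *\<^sub>v (B *\<^sub>v x)) \<in> carrier_vec d" using pc[OF g] x ABx by auto
        have "Q *\<^sub>v (\<pi> g *\<^sub>v pr x) = Q *\<^sub>v (\<pi> g *\<^sub>v x) - Q *\<^sub>v (\<pi> g *\<^sub>v (A *\<^sub>v (B *\<^sub>v x)))"
          unfolding pr_def using x ABx gc by (simp add: mult_minus_distrib_mat_vec[OF pc[OF g]] mult_minus_distrib_mat_vec[OF Qc])
        also have "Q *\<^sub>v (\<pi> g *\<^sub>v (A *\<^sub>v (B *\<^sub>v x))) = 0\<^sub>v l" by (rule QW[OF Wg[OF g ABW[OF x]]])
        finally show ?thesis using RQ[OF x] Qc gc by simp
      qed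
      have e: "Q * \<pi> g * (R * Q) = Q * \<pi> g" if g: "g \<in> SO_odd m" for g
      proof (rule mat_eq_if_vec_eq)
        show "Q * \<pi> g * (R * Q) \<in> carrier_mat l d" "Q * \<pi> g \<in> carrier_mat l d" using Qc R pc[OF g] by auto
        fix x :: "complex vec" assume x: "x \<in> carrier_vec d"
        have "(Q * \<pi> g * (R * Q)) *\<^sub>v x = Q *\<^sub>v (\<pi> g *\<^sub>v (R *\<^sub>v (Q *\<^sub>v x)))"
          using Qc R pc[OF g] x by (smt (verit) assoc_mult_mat_vec mult_carrier_mat mult_mat_vec_carrier)
        then show "(Q * \<pi> g * (R * Q)) *\<^sub>v x = (Q * \<pi> g) *\<^sub>v x" using key[OF g x] Qc pc[OF g] x by simp
      qed
      have "rational_rep m l (\<lambda>g. Q * \<pi> g * R)" using compress_rep[OF rep R Qc QR] e by blast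
      moreover have "hwr m l (\<lambda>g. Q * \<pi> g * R) \<eta>"
      proof (rule compress_hw[OF rep R Qc v(1) _ _ upp tor])
        show "Q *\<^sub>v v \<noteq> 0\<^sub>v l"
        proof
          assume "Q *\<^sub>v v = 0\<^sub>v l"
          then have "pr v = R *\<^sub>v 0\<^sub>v l" using RQ[OF v(1)] by simp
          also have "\<dots> = 0\<^sub>v d" using R by (intro eq_vecI) (auto simp: scalar_prod_def)
          finally have p0: "pr v = 0\<^sub>v d" .
          have "v = A *\<^sub>v (B *\<^sub>v v)"
          proof (rule eq_vecI)
            fix i assume "i < dim_vec (A *\<^sub>v (B *\<^sub>v v))"
            then have i: "i < d" using A by simp
            have "pr v $ i = 0" using p0 i by simp
            then show "v $ i = (A *\<^sub>v (B *\<^sub>v v)) $ i" using i A v(1) by (simp add: pr_def del: index_mult_mat_vec)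
          qed (use A v in auto)
          then show False using ABW[OF v(1)] False by simp
        qed
        fix g assume g: "g \<in> SO_odd m"
        have "(Q * \<pi> g * R) *\<^sub>v (Q *\<^sub>v v) = Q *\<^sub>v (\<pi> g *\<^sub>v (R *\<^sub>v (Q *\<^sub>v v)))"
          using Qc R pc[OF g] v(1) by (smt (verit) assoc_mult_mat_vec mult_carrier_mat mult_mat_vec_carrier)
        then show "(Q * \<pi> g * R) *\<^sub>v (Q *\<^sub>v v) = Q *\<^sub>v (\<pi> g *\<^sub>v v)" using key[OF g v(1)] by simp
      qed
      ultimately show False using min ld by fastforce
    qed
  qed
  ultimately have "irreducible_rep m d \<pi>" using rep by (simp add: irreducible_rep_def)
  then show ?thesis using hw by blast
qed

subsection \<open>Tensor products\<close>

definition kron :: "nat \<Rightarrow> nat \<Rightarrow> complex mat \<Rightarrow> complex mat \<Rightarrow> complex mat" where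
  "kron d1 d2 A B = mat (d1 * d2) (d1 * d2) (\<lambda>(i, j). A $$ (i div d2, j div d2) * B $$ (i mod d2, j mod d2))"

lemma sum_div_mod:
  "(\<Sum>k<d1 * d2. f (k div d2) (k mod d2)) = (\<Sum>a<d1. \<Sum>b<d2. f a b)" for f :: "nat \<Rightarrow> nat \<Rightarrow> 'a :: comm_monoid_add"
proof (cases "d2 = 0")
  case False
  have "(\<Sum>k<d1 * d2. f (k div d2) (k mod d2)) = (\<Sum>x\<in>{..<d1} \<times> {..<d2}. f (fst x) (snd x))"
  proof (rule sum.reindex_bij_witness[of _ "\<lambda>x. fst x * d2 + snd x" "\<lambda>k. (k div d2, k mod d2)"])
    fix x assume x: "x \<in> {..<d1} \<times> {..<d2}"
    then obtain a b where ab: "x = (a, b)" "a < d1" "b < d2" by auto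
    have "a * d2 + b < (a + 1) * d2" using ab by simp
    also have "\<dots> \<le> d1 * d2" using ab by (intro mult_le_mono1) simp
    finally show "fst x * d2 + snd x \<in> {..<d1 * d2}" using ab by simp
  qed (use False in \<open>auto simp: less_mult_imp_div_less\<close>)
  then show ?thesis by (simp add: sum.cartesian_product case_prod_unfold)
qed simp

lemma div_mod_less: "i < d1 * d2 \<Longrightarrow> i div d2 < d1 \<and> i mod d2 < d2" for i :: nat
  by (cases "d2 = 0") (auto simp: less_mult_imp_div_less)

lemma kron_mult:
  assumes "A \<in> carrier_mat d1 d1" "A' \<in> carrier_mat d1 d1" "B \<in> carrier_mat d2 d2" "B' \<in> carrier_mat d2 d2"
  shows "kron d1 d2 (A * A') (B * B') = kron d1 d2 A B * kron d1 d2 A' B'"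
proof (rule eq_matI)
  have kc: "kron d1 d2 X Y \<in> carrier_mat (d1 * d2) (d1 * d2)" for X Y by (simp add: kron_def)
  fix i j assume "i < dim_row (kron d1 d2 A B * kron d1 d2 A' B')" "j < dim_col (kron d1 d2 A B * kron d1 d2 A' B')"
  then have ij: "i < d1 * d2" "j < d1 * d2" by (auto simp: kron_def)
  note i = div_mod_less[OF ij(1)] and j = div_mod_less[OF ij(2)]
  have "(kron d1 d2 A B * kron d1 d2 A' B') $$ (i, j) =
    (\<Sum>k<d1 * d2. (A $$ (i div d2, k div d2) * B $$ (i mod d2, k mod d2)) * (A' $$ (k div d2, j div d2) * B' $$ (k mod d2, j mod d2)))"
    unfolding mat_mult_entry[OF kc kc ij] by (intro sum.cong) (use ij in \<open>auto simp: kron_def\<close>)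
  also have "\<dots> = (\<Sum>a<d1. \<Sum>b<d2. (A $$ (i div d2, a) * B $$ (i mod d2, b)) * (A' $$ (a, j div d2) * B' $$ (b, j mod d2)))"
    by (rule sum_div_mod)
  also have "\<dots> = (\<Sum>a<d1. A $$ (i div d2, a) * A' $$ (a, j div d2)) * (\<Sum>b<d2. B $$ (i mod d2, b) * B' $$ (b, j mod d2))"
    unfolding sum_product by (intro sum.cong HOL.refl) (simp only: ac_simps)
  also have "\<dots> = (A * A') $$ (i div d2, j div d2) * (B * B') $$ (i mod d2, j mod d2)"
    using i j mat_mult_entry[OF assms(1,2)] mat_mult_entry[OF assms(3,4)] by (simp del: index_mult_mat(1))
  finally show "kron d1 d2 (A * A') (B * B') $$ (i, j) = (kron d1 d2 A B * kron d1 d2 A' B') $$ (i, j)"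
    using ij by (simp add: kron_def)
qed (auto simp: kron_def)

lemma kron_one: "kron d1 d2 (1\<^sub>m d1) (1\<^sub>m d2) = 1\<^sub>m (d1 * d2)"
proof (rule eq_matI)
  fix i j assume "i < dim_row (1\<^sub>m (d1 * d2))" "j < dim_col (1\<^sub>m (d1 * d2))"
  then have ij: "i < d1 * d2" "j < d1 * d2" by auto
  have "i = j \<longleftrightarrow> i div d2 = j div d2 \<and> i mod d2 = j mod d2" by (metis div_mult_mod_eq)
  then show "kron d1 d2 (1\<^sub>m d1) (1\<^sub>m d2) $$ (i, j) = 1\<^sub>m (d1 * d2) $$ (i, j)"
    using ij div_mod_less[OF ij(1)] div_mod_less[OF ij(2)] by (simp add: kron_def)
qed (auto simp: kron_def)

lemma tensor_rep:
  assumes r1: "rational_rep m d1 \<pi>1" and r2: "rational_rep m d2 \<pi>2"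
  shows "rational_rep m (d1 * d2) (\<lambda>g. kron d1 d2 (\<pi>1 g) (\<pi>2 g))"
proof -
  have "\<exists>f. polyfun (2 * m + 1) f \<and> (\<forall>g\<in>SO_odd m. kron d1 d2 (\<pi>1 g) (\<pi>2 g) $$ (i, j) = f g)"
    if ij: "i < d1 * d2" "j < d1 * d2" for i j
  proof -
    note i = div_mod_less[OF ij(1)] and j = div_mod_less[OF ij(2)]
    obtain f1 f2 where f: "polyfun (2 * m + 1) f1" "\<forall>g\<in>SO_odd m. \<pi>1 g $$ (i div d2, j div d2) = f1 g"
      "polyfun (2 * m + 1) f2" "\<forall>g\<in>SO_odd m. \<pi>2 g $$ (i mod d2, j mod d2) = f2 g"
      using r1 r2 i j unfolding rational_rep_def by metis
    then show ?thesis using ij by (intro exI[of _ "\<lambda>g. f1 g * f2 g"]) (auto simp: kron_def intro: polyfun.intros)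
  qed
  moreover have "kron d1 d2 (\<pi>1 g) (\<pi>2 g) \<in> carrier_mat (d1 * d2) (d1 * d2)" for g by (simp add: kron_def)
  ultimately show ?thesis
    using r1 r2 by (simp add: rational_rep_def kron_one kron_mult)
qed

lemma tensor_hw:
  assumes r1: "rational_rep m d1 \<pi>1" and r2: "rational_rep m d2 \<pi>2" and h1: "hwr m d1 \<pi>1 \<eta>1" and h2: "hwr m d2 \<pi>2 \<eta>2"
  shows "hwr m (d1 * d2) (\<lambda>g. kron d1 d2 (\<pi>1 g) (\<pi>2 g)) (\<eta>1 + \<eta>2)"
proof -
  obtain v1 where v1: "v1 \<in> carrier_vec d1" "v1 \<noteq> 0\<^sub>v d1" "\<forall>g\<in>unipotent_upper m. \<pi>1 g *\<^sub>v v1 = v1"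
    "\<forall>x. unitvals m x \<longrightarrow> \<pi>1 (torus_elt m x) *\<^sub>v v1 = mon m x \<eta>1 \<cdot>\<^sub>v v1" using h1 by (auto simp: hwr_def)
  obtain v2 where v2: "v2 \<in> carrier_vec d2" "v2 \<noteq> 0\<^sub>v d2" "\<forall>g\<in>unipotent_upper m. \<pi>2 g *\<^sub>v v2 = v2"
    "\<forall>x. unitvals m x \<longrightarrow> \<pi>2 (torus_elt m x) *\<^sub>v v2 = mon m x \<eta>2 \<cdot>\<^sub>v v2" using h2 by (auto simp: hwr_def)
  define v where "v = vec (d1 * d2) (\<lambda>i. v1 $ (i div d2) * v2 $ (i mod d2))"
  have vc: "v \<in> carrier_vec (d1 * d2)" by (simp add: v_def)
  have act: "kron d1 d2 (\<pi>1 g) (\<pi>2 g) *\<^sub>v v = (a * b) \<cdot>\<^sub>v v"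
    if g: "g \<in> SO_odd m" and a: "\<pi>1 g *\<^sub>v v1 = a \<cdot>\<^sub>v v1" and b: "\<pi>2 g *\<^sub>v v2 = b \<cdot>\<^sub>v v2" for g a b
  proof (rule eq_vecI)
    have kc: "kron d1 d2 (\<pi>1 g) (\<pi>2 g) \<in> carrier_mat (d1 * d2) (d1 * d2)" by (simp add: kron_def)
    have pc: "\<pi>1 g \<in> carrier_mat d1 d1" "\<pi>2 g \<in> carrier_mat d2 d2" using r1 r2 g by (auto simp: rational_rep_def)
    fix i assume "i < dim_vec ((a * b) \<cdot>\<^sub>v v)"
    then have i: "i < d1 * d2" by (simp add: v_def)
    note im = div_mod_less[OF i]
    have "(kron d1 d2 (\<pi>1 g) (\<pi>2 g) *\<^sub>v v) $ i =
      (\<Sum>k<d1 * d2. (\<pi>1 g $$ (i div d2, k div d2) * \<pi>2 g $$ (i mod d2, k mod d2)) * (v1 $ (k div d2) * v2 $ (k mod d2)))"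
      unfolding mat_vec_entry[OF kc vc i] by (intro sum.cong) (use i in \<open>auto simp: kron_def v_def\<close>)
    also have "\<dots> = (\<Sum>x<d1. \<Sum>y<d2. (\<pi>1 g $$ (i div d2, x) * \<pi>2 g $$ (i mod d2, y)) * (v1 $ x * v2 $ y))"
      by (rule sum_div_mod)
    also have "\<dots> = (\<Sum>x<d1. \<pi>1 g $$ (i div d2, x) * v1 $ x) * (\<Sum>y<d2. \<pi>2 g $$ (i mod d2, y) * v2 $ y)"
      unfolding sum_product by (intro sum.cong HOL.refl) (simp only: ac_simps)
    also have "\<dots> = (\<pi>1 g *\<^sub>v v1) $ (i div d2) * (\<pi>2 g *\<^sub>v v2) $ (i mod d2)"
      using im mat_vec_entry[OF pc(1) v1(1)] mat_vec_entry[OF pc(2) v2(1)] by (simp del: index_mult_mat_vec)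
    also have "\<dots> = ((a * b) \<cdot>\<^sub>v v) $ i"
      unfolding a b using im v1(1) v2(1) i by (simp add: v_def)
    finally show "(kron d1 d2 (\<pi>1 g) (\<pi>2 g) *\<^sub>v v) $ i = ((a * b) \<cdot>\<^sub>v v) $ i" .
  qed (simp add: kron_def v_def)
  have "kron d1 d2 (\<pi>1 g) (\<pi>2 g) *\<^sub>v v = v" if "g \<in> unipotent_upper m" for g
    using act[of g 1 1] that v1(3) v2(3) by (simp add: unipotent_upper_iff)
  moreover have "kron d1 d2 (\<pi>1 (torus_elt m x)) (\<pi>2 (torus_elt m x)) *\<^sub>v v = mon m x (\<eta>1 + \<eta>2) \<cdot>\<^sub>v v" if "unitvals m x" for x
    using act[OF torus_SO[OF that]] v1(4) v2(4) that by (simp add: mon_add[OF that])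
  moreover have "v \<noteq> 0\<^sub>v (d1 * d2)"
  proof
    assume z: "v = 0\<^sub>v (d1 * d2)"
    obtain a b where ab: "a < d1" "v1 $ a \<noteq> 0" "b < d2" "v2 $ b \<noteq> 0"
      using v1(1,2) v2(1,2) by (metis carrier_vecD eq_vecI index_zero_vec(1) index_zero_vec(2))
    have "a * d2 + b < (a + 1) * d2" using ab by simp
    also have "\<dots> \<le> d1 * d2" using ab by (intro mult_le_mono1) simp
    finally have lt: "a * d2 + b < d1 * d2" .
    then have "v $ (a * d2 + b) = v1 $ a * v2 $ b" using ab by (simp add: v_def)
    then show False using z lt ab by simp
  qed
  ultimately show ?thesis using vc by (auto simp: hwr_def)
qed

subsection \<open>The fundamental weights\<close>

text \<open>The k-fold tensor power of the natural representation, with basis the maps from {..<k}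
  to {..<2m+1} enumerated by e. The highest weight vector is the antisymmetric tensor of the first k
  basis vectors; the representation itself may be reducible.\<close>

lemma exists_fundamental:
  assumes k: "k \<le> m"
  shows "\<exists>d \<pi>. rational_rep m d \<pi> \<and> hwr m d \<pi> (\<lambda>i. if i < k then 1 else 0)"
proof -
  let ?n = "nn m"
  let ?F = "PiE {..<k} (\<lambda>_. {..<?n})"
  define d where "d = card ?F"
  have "finite ?F" by (intro finite_PiE) auto
  then obtain e where e: "bij_betw e {..<d} ?F"
    unfolding d_def using ex_bij_betw_nat_finite by (metis atLeast0LessThan)
  have eF: "e i \<in> ?F" if "i < d" for i using e that by (auto simp: bij_betw_def)
  have elt: "e i q < ?n" if "i < d" "q < k" for i q using eF[OF that(1)] that(2) by (auto simp: PiE_def Pi_def)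
  have esum: "(\<Sum>j<d. \<Prod>q<k. f q (e j q)) = (\<Prod>q<k. \<Sum>b<?n. f q b)" for f :: "nat \<Rightarrow> nat \<Rightarrow> complex"
  proof -
    have "(\<Sum>j<d. \<Prod>q<k. f q (e j q)) = (\<Sum>a\<in>?F. \<Prod>q<k. f q (a q))"
      by (rule sum.reindex_bij_betw[OF e, of "\<lambda>a. \<Prod>q<k. f q (a q)"])
    then show ?thesis by (simp add: prod_sum_PiE)
  qed
  define \<pi> where "\<pi> g = mat d d (\<lambda>(i, j). \<Prod>q<k. g $$ (e i q, e j q))" for g :: "complex mat"
  have pc: "\<pi> g \<in> carrier_mat d d" for g by (simp add: \<pi>_def)
  have mult: "\<pi> (g * h) = \<pi> g * \<pi> h" if "g \<in> carrier_mat ?n ?n" "h \<in> carrier_mat ?n ?n" for g h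
  proof (rule eq_matI)
    fix i j assume "i < dim_row (\<pi> g * \<pi> h)" "j < dim_col (\<pi> g * \<pi> h)"
    then have ij: "i < d" "j < d" by (auto simp: \<pi>_def)
    have "(\<pi> g * \<pi> h) $$ (i, j) = (\<Sum>l<d. \<Prod>q<k. g $$ (e i q, e l q) * h $$ (e l q, e j q))"
      unfolding mat_mult_entry[OF pc pc ij] by (intro sum.cong) (use ij in \<open>auto simp: \<pi>_def prod.distrib\<close>)
    also have "\<dots> = (\<Prod>q<k. \<Sum>b<?n. g $$ (e i q, b) * h $$ (b, e j q))" by (rule esum)
    also have "\<dots> = (\<Prod>q<k. (g * h) $$ (e i q, e j q))"
      by (intro prod.cong HOL.refl) (use elt ij mat_mult_entry[OF that] in \<open>simp del: index_mult_mat(1) less_nn\<close>)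
    finally show "\<pi> (g * h) $$ (i, j) = (\<pi> g * \<pi> h) $$ (i, j)" using ij by (simp add: \<pi>_def)
  qed (auto simp: \<pi>_def)
  have one: "\<pi> (1\<^sub>m ?n) = 1\<^sub>m d"
  proof (rule eq_matI)
    fix i j assume "i < dim_row (1\<^sub>m d)" "j < dim_col (1\<^sub>m d)"
    then have ij: "i < d" "j < d" by auto
    have "\<pi> (1\<^sub>m ?n) $$ (i, j) = (\<Prod>q<k. if e i q = e j q then 1 else 0)"
      using ij elt[OF ij(1)] elt[OF ij(2)] by (simp add: \<pi>_def)
    also have "\<dots> = (if \<forall>q<k. e i q = e j q then 1 else 0)"
      by (auto intro!: prod.neutral prod_zero)
    also have "(\<forall>q<k. e i q = e j q) \<longleftrightarrow> e i = e j"
      using PiE_ext[OF eF[OF ij(1)] eF[OF ij(2)]] by auto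
    also have "e i = e j \<longleftrightarrow> i = j" using e ij by (auto simp: bij_betw_def inj_on_def)
    finally show "\<pi> (1\<^sub>m ?n) $$ (i, j) = 1\<^sub>m d $$ (i, j)" using ij by simp
  qed (auto simp: \<pi>_def)
  have "\<exists>f. polyfun ?n f \<and> (\<forall>g\<in>SO_odd m. \<pi> g $$ (i, j) = f g)" if ij: "i < d" "j < d" for i j
    by (intro exI[of _ "\<lambda>g. \<Prod>q<k. g $$ (e i q, e j q)"] conjI polyfun_prod polyfun_entry) (use elt ij in \<open>auto simp: \<pi>_def simp del: less_nn\<close>)
  then have rep: "rational_rep m d \<pi>"
    using pc mult one SO_carrier by (simp add: rational_rep_def[folded nn_def])
  \<comment> \<open>The determinant is the coordinate of the antisymmetric tensor: the sign of the
    map e i if it permutes {..<k}, and 0 otherwise.\<close>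
  define Dm where "Dm i = mat k k (\<lambda>(q, s). if e i q = s then 1 else 0 :: complex)" for i
  define v where "v = vec d (\<lambda>i. det (Dm i))"
  have vc: "v \<in> carrier_vec d" by (simp add: v_def)
  have Dc: "Dm i \<in> carrier_mat k k" for i by (simp add: Dm_def)
  \<comment> \<open>An upper triangular g preserves the span of the first k basis vectors, so it
    scales their antisymmetric tensor by the determinant of its leading block.\<close>
  have act: "\<pi> g *\<^sub>v v = (\<Prod>q<k. g $$ (q, q)) \<cdot>\<^sub>v v"
    if g: "g \<in> carrier_mat ?n ?n" and ut: "\<And>i j. j < i \<Longrightarrow> i < ?n \<Longrightarrow> g $$ (i, j) = 0" for g
  proof (rule eq_vecI)
    fix i assume "i < dim_vec ((\<Prod>q<k. g $$ (q, q)) \<cdot>\<^sub>v v)"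
    then have i: "i < d" by (simp add: v_def)
    let ?S = "{\<sigma>. \<sigma> permutes {0..<k}}"
    define M where "M = mat k k (\<lambda>(q, s). g $$ (e i q, s))"
    have Mc: "M \<in> carrier_mat k k" by (simp add: M_def)
    have Dd: "det (Dm j) = (\<Sum>\<sigma>\<in>?S. signof \<sigma> * (\<Prod>q<k. if e j q = \<sigma> q then 1 else 0))" for j
      unfolding det_def'[OF Dc] atLeast0LessThan
      by (intro sum.cong arg_cong2[where f = "(*)"] prod.cong HOL.refl) (use permutes_in_image in \<open>fastforce simp: Dm_def atLeast0LessThan\<close>)
    have "(\<pi> g *\<^sub>v v) $ i = (\<Sum>j<d. (\<Prod>q<k. g $$ (e i q, e j q)) * det (Dm j))"
      unfolding mat_vec_entry[OF pc vc i] by (intro sum.cong) (use i in \<open>auto simp: \<pi>_def v_def\<close>)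
    also have "\<dots> = (\<Sum>j<d. \<Sum>\<sigma>\<in>?S. signof \<sigma> * (\<Prod>q<k. g $$ (e i q, e j q) * (if e j q = \<sigma> q then 1 else 0)))"
      unfolding Dd sum_distrib_left prod.distrib by (intro sum.cong HOL.refl) (simp only: ac_simps)
    also have "\<dots> = (\<Sum>\<sigma>\<in>?S. signof \<sigma> * (\<Sum>j<d. \<Prod>q<k. g $$ (e i q, e j q) * (if e j q = \<sigma> q then 1 else 0)))"
      unfolding sum_distrib_left by (rule sum.swap)
    also have "\<dots> = (\<Sum>\<sigma>\<in>?S. signof \<sigma> * (\<Prod>q<k. \<Sum>b<?n. g $$ (e i q, b) * (if b = \<sigma> q then 1 else 0)))"
      by (intro sum.cong HOL.refl arg_cong2[where f = "(*)"] esum)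
    also have "\<dots> = (\<Sum>\<sigma>\<in>?S. signof \<sigma> * (\<Prod>q = 0..<k. M $$ (q, \<sigma> q)))"
    proof (intro sum.cong HOL.refl arg_cong2[where f = "(*)"])
      fix \<sigma> assume \<sigma>: "\<sigma> \<in> ?S"
      show "(\<Prod>q<k. \<Sum>b<?n. g $$ (e i q, b) * (if b = \<sigma> q then 1 else 0)) = (\<Prod>q = 0..<k. M $$ (q, \<sigma> q))"
        unfolding atLeast0LessThan
      proof (rule prod.cong)
        fix q assume q: "q \<in> {..<k}"
        have lt: "\<sigma> q < k" using \<sigma> q permutes_in_image[of \<sigma> "{0..<k}" q] by auto
        have "(\<Sum>b<?n. g $$ (e i q, b) * (if b = \<sigma> q then 1 else 0)) = (\<Sum>b<?n. if b = \<sigma> q then g $$ (e i q, \<sigma> q) else 0)"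
          by (intro sum.cong) auto
        also have "\<dots> = g $$ (e i q, \<sigma> q)" using lt k by simp
        finally show "(\<Sum>b<?n. g $$ (e i q, b) * (if b = \<sigma> q then 1 else 0)) = M $$ (q, \<sigma> q)"
          using q lt by (simp add: M_def)
      qed simp
    qed
    also have "\<dots> = det M" by (rule det_def'[OF Mc, symmetric])
    also have "M = Dm i * lead k g"
    proof (rule eq_matI)
      have lc: "lead k g \<in> carrier_mat k k" by (simp add: lead_def)
      fix q s assume "q < dim_row (Dm i * lead k g)" "s < dim_col (Dm i * lead k g)"
      then have qs: "q < k" "s < k" by (auto simp: Dm_def lead_def)
      have "(Dm i * lead k g) $$ (q, s) = (\<Sum>l<k. if l = e i q then g $$ (e i q, s) else 0)"
        unfolding mat_mult_entry[OF Dc lc qs] by (intro sum.cong) (use qs in \<open>auto simp: Dm_def lead_def\<close>)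
      also have "\<dots> = g $$ (e i q, s)" using ut[of s "e i q"] elt[OF i qs(1)] qs by auto
      finally show "M $$ (q, s) = (Dm i * lead k g) $$ (q, s)" using qs by (simp add: M_def)
    qed (auto simp: M_def Dm_def lead_def)
    also have "det (Dm i * lead k g) = det (Dm i) * det (lead k g)"
      by (rule det_mult[OF Dc]) (simp add: lead_def)
    also have "det (lead k g) = (\<Prod>q<k. g $$ (q, q))"
    proof -
      have lc: "lead k g \<in> carrier_mat k k" by (simp add: lead_def)
      have "upper_triangular (lead k g)" using ut k by (auto simp: lead_def)
      then show ?thesis using det_upper_triangular[OF _ lc] by (simp add: prod_list_diag[OF lc]) (simp add: lead_def)
    qed
    finally show "(\<pi> g *\<^sub>v v) $ i = ((\<Prod>q<k. g $$ (q, q)) \<cdot>\<^sub>v v) $ i" using i by (simp add: v_def)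
  qed (simp add: \<pi>_def v_def)
  have "\<pi> g *\<^sub>v v = v" if g: "g \<in> unipotent_upper m" for g
  proof -
    have u: "upper_uni ?n g" using g by (simp add: unipotent_upper_iff)
    then have "\<pi> g *\<^sub>v v = (\<Prod>q<k. g $$ (q, q)) \<cdot>\<^sub>v v" by (intro act) (auto simp: upper_uni_def)
    also have "(\<Prod>q<k. g $$ (q, q)) = 1" using u k by (intro prod.neutral) (auto simp: upper_uni_def)
    finally show ?thesis by simp
  qed
  moreover have "\<pi> (torus_elt m x) *\<^sub>v v = mon m x (\<lambda>i. if i < k then 1 else 0) \<cdot>\<^sub>v v" if x: "unitvals m x" for x
  proof -
    have "\<pi> (torus_elt m x) *\<^sub>v v = (\<Prod>q<k. torus_elt m x $$ (q, q)) \<cdot>\<^sub>v v"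
      by (rule act) (auto simp: torus_entry)
    also have "(\<Prod>q<k. torus_elt m x $$ (q, q)) = (\<Prod>q<k. x q)"
      using k by (intro prod.cong) (auto simp: torus_entry mon_wtv)
    also have "\<dots> = mon m x (\<lambda>i. if i < k then 1 else 0)"
      unfolding mon_def by (rule prod.mono_neutral_cong_left) (use k in auto)
    finally show ?thesis .
  qed
  moreover have "v \<noteq> 0\<^sub>v d"
  proof
    assume z: "v = 0\<^sub>v d"
    have "restrict (\<lambda>q. q) {..<k} \<in> ?F" using k by auto
    then obtain i where i: "i < d" "e i = restrict (\<lambda>q. q) {..<k}" using e unfolding bij_betw_def by (metis imageE lessThan_iff)
    have "Dm i = 1\<^sub>m k" by (intro eq_matI) (auto simp: Dm_def i(2))
    then have "v $ i = 1" using i(1) by (simp add: v_def)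
    then show False using z i(1) by simp
  qed
  ultimately have "hwr m d \<pi> (\<lambda>i. if i < k then 1 else 0)" using vc by (auto simp: hwr_def)
  then show ?thesis using rep by blast
qed

lemma exists_trivial: "\<exists>d \<pi>. rational_rep m d \<pi> \<and> hwr m d \<pi> 0"
proof -
  have "(\<lambda>i. if i < (0 :: nat) then 1 else 0) = (0 :: wt)" by (simp add: fun_eq_iff)
  then show ?thesis using exists_fundamental[of 0 m] by simp
qed

text \<open>Strip the first column from the Young diagram of \<eta>. What remains is a smaller
  partition, the column is a weight (1, ..., 1, 0, ..., 0), and highest weights add in tensor
  products.\<close>

theorem exists_hw_rep:
  assumes "dcow m \<eta>" "\<eta> \<in> wts m"
  shows "\<exists>d \<pi>. rational_rep m d \<pi> \<and> hwr m d \<pi> \<eta>"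
  using assms
proof (induction "nat (\<Sum>i<m. \<eta> i)" arbitrary: \<eta> rule: less_induct)
  case less
  have mono: "\<And>i j. i \<le> j \<Longrightarrow> j < m \<Longrightarrow> \<eta> j \<le> \<eta> i" and nonneg: "\<And>i. i < m \<Longrightarrow> 0 \<le> \<eta> i"
    using less.prems by (auto simp: dcow_def)
  show ?case
  proof (cases "\<exists>i<m. \<eta> i \<noteq> 0")
    case False
    then have "\<eta> = 0" using less.prems by (intro wts_eqI[of _ m]) auto
    then show ?thesis using exists_trivial by simp
  next
    case True
    \<comment> \<open>The number of positive parts, that is the length of the first column;
      subtracting one from exactly these parts keeps the weight dominant.\<close>
    define k where "k = card {i. i < m \<and> 0 < \<eta> i}"
    have "{i. i < m \<and> 0 < \<eta> i} = {..<k}"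
    proof -
      let ?A = "{i. i < m \<and> 0 < \<eta> i}"
      have "finite ?A" by simp
      have down: "j \<in> ?A" if "i \<in> ?A" "j \<le> i" for i j using that mono[of j i] by auto
      have "?A = {..<card ?A}"
      proof (cases "?A = {}")
        case True
        then show ?thesis by (metis card.empty lessThan_0)
      next
        case False
        obtain M where M: "M \<in> ?A" "\<And>a. a \<in> ?A \<Longrightarrow> a \<le> M"
          using Max_in[OF \<open>finite ?A\<close> False] Max_ge[OF \<open>finite ?A\<close>] by blast
        have "a \<in> ?A \<longleftrightarrow> a < Suc M" for a using M(2)[of a] down[OF M(1), of a] by (meson less_Suc_eq_le)
        then have eq: "?A = {..<Suc M}" by blast
        then show ?thesis by simp
      qed
      then show ?thesis by (simp add: k_def)
    qed
    then have pos: "i < k \<longleftrightarrow> i < m \<and> 0 < \<eta> i" for i by blast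
    have k0: "0 < k" "k \<le> m"
    proof -
      obtain i where "i < m" "\<eta> i \<noteq> 0" using True by blast
      then have "i < k" using pos[of i] nonneg[of i] by simp
      then show "0 < k" by simp
      show "k \<le> m" using pos[of "m"] by (meson leI less_irrefl)
    qed
    define f where "f = (\<lambda>i. if i < k then 1 else 0 :: int)"
    define \<eta>' where "\<eta>' = \<eta> - f"
    have "dcow m \<eta>'"
      unfolding dcow_def
    proof (intro conjI allI impI)
      fix i assume "i < m"
      then show "0 \<le> \<eta>' i" using nonneg[of i] pos[of i] by (auto simp: \<eta>'_def f_def)
    next
      fix i j assume ij: "i \<le> j" "j < m"
      show "\<eta>' j \<le> \<eta>' i"
        using mono[OF ij] ij pos[of i] pos[of j] nonneg[of i] nonneg[of j] by (auto simp: \<eta>'_def f_def)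
    qed
    moreover have "\<eta>' \<in> wts m" using less.prems(2) k0 by (auto simp: \<eta>'_def f_def wts_def)
    moreover have "nat (\<Sum>i<m. \<eta>' i) < nat (\<Sum>i<m. \<eta> i)"
    proof -
      have "(\<Sum>i<m. \<eta>' i) = (\<Sum>i<m. \<eta> i) - (\<Sum>i<m. f i)" by (simp add: \<eta>'_def sum_subtractf)
      moreover have "f 0 \<le> (\<Sum>i<m. f i)" using k0 by (intro member_le_sum) (auto simp: f_def)
      moreover have "0 \<le> (\<Sum>i<m. \<eta>' i)" using \<open>dcow m \<eta>'\<close> by (intro sum_nonneg) (auto simp: dcow_def)
      ultimately show ?thesis using k0 by (simp add: f_def)
    qed
    ultimately obtain d1 \<pi>1 where r1: "rational_rep m d1 \<pi>1" "hwr m d1 \<pi>1 \<eta>'"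
      using less.hyps by blast
    obtain d2 \<pi>2 where r2: "rational_rep m d2 \<pi>2" "hwr m d2 \<pi>2 f"
      using exists_fundamental[OF k0(2)] by (auto simp: f_def)
    have "\<eta>' + f = \<eta>" by (simp add: \<eta>'_def)
    then show ?thesis using tensor_rep[OF r1(1) r2(1)] tensor_hw[OF r1(1) r2(1) r1(2) r2(2)] by auto
  qed
qed

section \<open>The sign of the Weyl vector\<close>

lemma folded_class_exists:
  "\<exists>c. c \<le> m \<and> ([a = int c] (mod int (2 * m + 1)) \<or> [a = - int c] (mod int (2 * m + 1)))"
proof -
  let ?t = "int (2 * m + 1)"
  define b where "b = a mod ?t"
  have b: "0 \<le> b" "b < ?t" "[a = b] (mod ?t)" by (auto simp: b_def cong_def)
  show ?thesis
  proof (cases "b \<le> int m")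
    case True
    then show ?thesis using b by (intro exI[of _ "nat b"]) auto
  next
    case False
    have "[b = - int (nat (?t - b))] (mod ?t)" using b by (simp add: cong_iff_dvd_diff)
    then show ?thesis using b False cong_trans by (intro exI[of _ "nat (?t - b)"]) auto
  qed
qed

text \<open>For two candidates t divides their difference or their sum, both of absolute value at
  most 2m and hence below t.\<close>

lemma folded_class_unique:
  assumes "c \<le> m" "[a = int c] (mod int (2 * m + 1)) \<or> [a = - int c] (mod int (2 * m + 1))"
    and "c' \<le> m" "[a = int c'] (mod int (2 * m + 1)) \<or> [a = - int c'] (mod int (2 * m + 1))"
  shows "c = c'"
proof -
  let ?t = "int (2 * m + 1)"
  have z: "x = 0" if "?t dvd x" "\<bar>x\<bar> < ?t" for x :: int
    using that zdvd_not_zless[of "\<bar>x\<bar>" ?t] by (cases "x = 0") auto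
  have "?t dvd (int c - int c') \<or> ?t dvd (int c + int c')"
    using assms(2,4)
  proof (elim disjE)
    assume "[a = int c] (mod ?t)" "[a = int c'] (mod ?t)"
    then show ?thesis by (metis cong_iff_dvd_diff cong_sym cong_trans)
  next
    assume "[a = - int c] (mod ?t)" "[a = - int c'] (mod ?t)"
    then have "[- int c' = - int c] (mod ?t)" by (metis cong_sym cong_trans)
    then have "?t dvd - int c' - - int c" by (simp only: cong_iff_dvd_diff)
    then show ?thesis by (simp add: algebra_simps)
  next
    assume "[a = int c] (mod ?t)" "[a = - int c'] (mod ?t)"
    then have "[int c = - int c'] (mod ?t)" by (metis cong_sym cong_trans)
    then have "?t dvd int c - - int c'" by (simp only: cong_iff_dvd_diff)
    then show ?thesis by simp
  next
    assume "[a = - int c] (mod ?t)" "[a = int c'] (mod ?t)"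
    then have "[int c' = - int c] (mod ?t)" by (metis cong_sym cong_trans)
    then have "?t dvd int c' - - int c" by (simp only: cong_iff_dvd_diff)
    then show ?thesis by (simp add: add.commute)
  qed
  then show ?thesis using z[of "int c - int c'"] z[of "int c + int c'"] assms(1,3) by auto
qed

lemma folded_class_eqI:
  assumes "c \<le> m" "[a = int c] (mod int (2 * m + 1)) \<or> [a = - int c] (mod int (2 * m + 1))"
  shows "folded_class m a = c"
  unfolding folded_class_def by (rule the_equality) (use assms folded_class_unique in blast)+

lemma folded_class_le: "folded_class m a \<le> m"
  and folded_class_cong:
    "[a = int (folded_class m a)] (mod int (2 * m + 1)) \<or> [a = - int (folded_class m a)] (mod int (2 * m + 1))"
  using folded_class_exists[of m a] folded_class_eqI by blast+

lemma folding_sign_cong: "[a = folding_sign m a * int (folded_class m a)] (mod int (2 * m + 1))"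
  using folded_class_cong[of a m] by (auto simp: folding_sign_def)

lemma folding_sign_cases: "folding_sign m a = 1 \<or> folding_sign m a = - 1"
  by (simp add: folding_sign_def)

text \<open>
  The entries of $2 \rho_{B_m}$ are congruent to $-2, -4, \dots, -2m$, so their folded classes are
  the even ones, increasing, followed by the odd ones, decreasing.
\<close>

definition rho_entry :: "nat \<Rightarrow> nat \<Rightarrow> int" where
  "rho_entry m p = 2 * (int m - int p) - 1"

definition weyl_perm :: "nat \<Rightarrow> nat \<Rightarrow> nat" where
  "weyl_perm m p = (if p < m then m - folded_class m (rho_entry m p) else p)"

lemma folded_class_rho:
  assumes "p < m"
  shows "folded_class m (rho_entry m p) = (if 2 * p + 2 \<le> m then 2 * p + 2 else 2 * (m - p) - 1)"
proof (cases "2 * p + 2 \<le> m")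
  case True
  have "[rho_entry m p = - int (2 * p + 2)] (mod int (2 * m + 1))"
    by (simp add: cong_iff_dvd_diff rho_entry_def)
  then show ?thesis using True folded_class_eqI[OF True] by simp
next
  case False
  have "rho_entry m p = int (2 * (m - p) - 1)" using assms by (simp add: of_nat_diff rho_entry_def)
  then show ?thesis using False assms folded_class_eqI[of "2 * (m - p) - 1" m "rho_entry m p"] by simp
qed

lemma folding_sign_rho:
  assumes "p < m"
  shows "folding_sign m (rho_entry m p) = (if 2 * p + 2 \<le> m then - 1 else 1)"
proof (cases "2 * p + 2 \<le> m")
  case True
  \<comment> \<open>Both signs could hold only if t divided 4p + 4, while 0 < 4p + 4 \<le> 2m <
    t.\<close>
  have "\<not> [rho_entry m p = int (2 * p + 2)] (mod int (2 * m + 1))"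
  proof
    assume "[rho_entry m p = int (2 * p + 2)] (mod int (2 * m + 1))"
    then have "int (2 * m + 1) dvd rho_entry m p - int (2 * p + 2)" by (simp only: cong_iff_dvd_diff)
    then have "int (2 * m + 1) dvd int (2 * m + 1) - (rho_entry m p - int (2 * p + 2))" by (rule dvd_diff[OF dvd_refl])
    also have "int (2 * m + 1) - (rho_entry m p - int (2 * p + 2)) = int (4 * p + 4)" by (simp add: rho_entry_def algebra_simps)
    finally have d: "2 * m + 1 dvd 4 * p + 4" by (simp only: of_nat_dvd_iff)
    then have "4 * p + 4 = 2 * m + 1 \<or> 2 * (2 * m + 1) \<le> 4 * p + 4"
    proof -
      obtain k where k: "4 * p + 4 = (2 * m + 1) * k" using d by (elim dvdE)
      then have "k \<noteq> 0" by (intro notI) simp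
      then consider "k = 1" | "2 \<le> k" by linarith
      then show ?thesis
      proof cases
        case 2
        then have "(2 * m + 1) * 2 \<le> (2 * m + 1) * k" by (rule mult_le_mono2)
        then show ?thesis using k by simp
      qed (use k in simp)
    qed
    then show False using True by presburger
  qed
  then show ?thesis unfolding folding_sign_def folded_class_rho[OF assms] using True by simp
next
  case False
  have "rho_entry m p = int (2 * (m - p) - 1)" using assms by (simp add: of_nat_diff rho_entry_def)
  then show ?thesis unfolding folding_sign_def folded_class_rho[OF assms] using False by simp
qed

lemma weyl_perm_eq: "weyl_perm m p = (if p < m then if 2 * p + 2 \<le> m then m - (2 * p + 2) else 2 * p + 1 - m else p)"
  by (auto simp: weyl_perm_def folded_class_rho)

text \<open>The product of the disjoint swaps (m-2, m-1), (m-4, m-3), and so on. It carries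
  \<open>weyl_perm m\<close> to \<open>weyl_perm (Suc m)\<close>, which lets the sign be found by
  induction on the rank.\<close>

fun pair_swap :: "nat \<Rightarrow> nat \<Rightarrow> nat" where
  "pair_swap 0 = id"
| "pair_swap (Suc 0) = id"
| "pair_swap (Suc (Suc m)) = Transposition.transpose m (Suc m) \<circ> pair_swap m"

lemma pair_swap_eq: "pair_swap m x = (if x < m then if even (m - x) then Suc x else x - 1 else x)"
proof (induction m arbitrary: x rule: pair_swap.induct)
  case (3 m)
  consider "x < m" "even (m - x)" | "x < m" "odd (m - x)" | "x = m" | "x = Suc m" | "x > Suc m" by linarith
  then show ?case
  proof cases
    case 1
    then have "Suc x < m" by (metis Suc_lessI diff_Suc_eq_diff_pred even_Suc diff_Suc_1 Suc_diff_Suc diff_self_eq_0 odd_one One_nat_def)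
    then show ?thesis using 1 3 by (simp add: Suc_diff_le Transposition.transpose_def)
  qed (use 3 in \<open>auto simp: Suc_diff_le Transposition.transpose_def\<close>)
qed auto

lemma permutation_pair_swap: "permutation (pair_swap m)" and sign_pair_swap: "sign (pair_swap m) = (- 1) ^ (m div 2)"
proof (induction m rule: pair_swap.induct)
  case (3 m)
  {
    case 1
    show ?case unfolding pair_swap.simps by (intro permutation_compose permutation_swap_id 3)
  next
    case 2
    have "sign (Transposition.transpose m (Suc m)) = - 1" by (simp add: sign_swap_id)
    then show ?case unfolding pair_swap.simps sign_compose[OF permutation_swap_id 3(1)] 3(2) by simp
  }
qed (auto simp: sign_id)

lemma weyl_perm_Suc: "weyl_perm (Suc m) = pair_swap m \<circ> weyl_perm m"
proof
  fix p
  consider "p < m" "2 * p + 2 \<le> m" | "p < m" "2 * p + 2 = m + 1" | "p < m" "m + 1 < 2 * p + 2" | "p \<ge> m" by linarith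
  then show "weyl_perm (Suc m) p = (pair_swap m \<circ> weyl_perm m) p"
  proof cases
    case 1
    then have "weyl_perm m p = m - (2 * p + 2)" "weyl_perm (Suc m) p = Suc (m - (2 * p + 2))" by (auto simp: weyl_perm_eq)
    moreover have "even (m - (m - (2 * p + 2)))" using 1 by simp
    ultimately show ?thesis using 1 by (simp add: pair_swap_eq)
  next
    case 2
    then have "weyl_perm m p = 0" "weyl_perm (Suc m) p = 0" by (auto simp: weyl_perm_eq)
    moreover have "odd m" using 2 by presburger
    ultimately show ?thesis by (simp add: pair_swap_eq)
  next
    case 3
    then have "weyl_perm m p = 2 * p + 1 - m" "weyl_perm (Suc m) p = 2 * p + 1 - m - 1" by (auto simp: weyl_perm_eq)
    moreover have "pair_swap m x = x - 1" if "x < m" "odd (m - x)" for x using that by (simp add: pair_swap_eq)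
    moreover have "odd (m - (2 * p + 1 - m))"
    proof -
      have "m - (2 * p + 1 - m) = 2 * (m - p) - 1" using 3 by linarith
      then show ?thesis using 3 by simp
    qed
    moreover have "2 * p + 1 - m < m" using 3 by linarith
    ultimately have "pair_swap m (weyl_perm m p) = weyl_perm (Suc m) p" by metis
    then show ?thesis by simp
  next
    case 4
    then show ?thesis by (auto simp: weyl_perm_eq pair_swap_eq)
  qed
qed

lemma permutation_weyl_perm: "permutation (weyl_perm m)"
  and sign_weyl_perm_Suc: "sign (weyl_perm (Suc m)) = (- 1) ^ (m div 2) * sign (weyl_perm m)"
proof -
  show p: "permutation (weyl_perm m)" for m
  proof (induction m)
    case 0
    have "weyl_perm 0 = id" by (auto simp: weyl_perm_eq)
    then show ?case by simp
  next
    case (Suc m)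
    then show ?case unfolding weyl_perm_Suc by (intro permutation_compose permutation_pair_swap)
  qed
  show "sign (weyl_perm (Suc m)) = (- 1) ^ (m div 2) * sign (weyl_perm m)"
    unfolding weyl_perm_Suc sign_compose[OF permutation_pair_swap p] sign_pair_swap ..
qed

definition rho_sign :: "nat \<Rightarrow> int" where
  "rho_sign m = sign (weyl_perm m) * (\<Prod>p<m. folding_sign m (rho_entry m p))"

text \<open>The negative folding signs are those of the first m div 2 positions. The sign of the
  permutation picks up the sign of \<open>pair_swap\<close> at each step of the induction on m, and
  the exponents add up to the product of the two halves of m.\<close>

lemma rho_sign_eq: "rho_sign m = (- 1) ^ ((m div 2) * (Suc m div 2))"
proof -
  have "(\<Prod>p<m. folding_sign m (rho_entry m p)) = (\<Prod>p<m. if p < m div 2 then - 1 else 1)"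
    by (intro prod.cong) (auto simp: folding_sign_rho)
  also have "\<dots> = (\<Prod>p<m div 2. - 1)" by (intro prod.mono_neutral_cong_right) auto
  finally have f: "(\<Prod>p<m. folding_sign m (rho_entry m p)) = (- 1) ^ (m div 2)" by simp
  have "sign (weyl_perm m) * (- 1) ^ (m div 2) = ((- 1) ^ ((m div 2) * (Suc m div 2)) :: int)" for m
  proof (induction m)
    case 0
    have "weyl_perm 0 = id" by (auto simp: weyl_perm_eq)
    then show ?case by (simp add: sign_id)
  next
    case (Suc m)
    have e: "Suc m div 2 * (Suc (Suc m) div 2) = m div 2 * (Suc m div 2) + Suc m div 2" by simp
    have "sign (weyl_perm (Suc m)) * (- 1) ^ (Suc m div 2) =
        (sign (weyl_perm m) * (- 1) ^ (m div 2)) * ((- 1) ^ (Suc m div 2) :: int)"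
      by (simp add: sign_weyl_perm_Suc)
    also have "\<dots> = (- 1) ^ (m div 2 * (Suc m div 2)) * (- 1) ^ (Suc m div 2)" by (simp only: Suc.IH)
    finally show ?case unfolding e by (simp only: power_add)
  qed
  then show ?thesis by (simp add: rho_sign_def f)
qed

subsection \<open>The Jacobi symbol of -2\<close>

text \<open>On odd numbers this is the quadratic character modulo 8 that belongs to -2.\<close>

definition chi8 :: "nat \<Rightarrow> int" where
  "chi8 n = (if n mod 8 = 1 \<or> n mod 8 = 3 then 1 else - 1)"

text \<open>Gauss's lemma for the positive representative p - 2 of -2: the multiple x (p - 2)
  reduces to p - 2x, which exceeds (p - 1)/2 exactly for x \<le> p div 4. So the exponent of -1 is p
  div 4.\<close>

lemma Legendre_minus_two:
  assumes p: "prime p" "odd p"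
  shows "Legendre (- 2) (int p) = chi8 p"
proof -
  have p2: "2 < p" using p prime_ge_2_nat[of p] by (cases "p = 2") auto
  have c: "[- 2 = int p - 2] (mod int p)" by (simp add: cong_iff_dvd_diff)
  have nd: "\<not> int p dvd int p - 2"
  proof
    assume "int p dvd int p - 2"
    then have "int p dvd int p - (int p - 2)" by (rule dvd_diff[OF dvd_refl])
    then have "int p dvd 2" by simp
    then show False using p2 by (auto dest: zdvd_imp_le)
  qed
  interpret GAUSS p "int p - 2"
    using p p2 nd by unfold_locales (auto simp: cong_0_iff)
  have "Legendre (- 2) (int p) = Legendre (int p - 2) (int p)"
  proof -
    have "[x = - 2] (mod int p) \<longleftrightarrow> [x = int p - 2] (mod int p)" for x using c cong_sym cong_trans by blast
    moreover have "[- 2 = 0] (mod int p) \<longleftrightarrow> [int p - 2 = 0] (mod int p)" using c cong_sym cong_trans by blast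
    ultimately show ?thesis by (simp only: Legendre_def QuadRes_def)
  qed
  also have "\<dots> = (- 1) ^ card E" by (rule gauss_lemma)
  also have "card E = p div 4"
  proof -
    have md: "x * (int p - 2) mod int p = int p - 2 * x" if "x \<in> A" for x
    proof -
      have "[x * (int p - 2) = int p - 2 * x] (mod int p)"
      proof -
        have "x * (int p - 2) - (int p - 2 * x) = int p * (x - 1)" by (simp add: algebra_simps)
        then show ?thesis unfolding cong_iff_dvd_diff by simp
      qed
      moreover have "0 \<le> int p - 2 * x" "int p - 2 * x < int p" using that p2 by (auto simp: A_def)
      ultimately show ?thesis unfolding cong_def by (simp only: mod_pos_pos_trivial)
    qed
    have "C = (\<lambda>x. int p - 2 * x) ` A"
      unfolding C_def B_def image_image using md by (intro image_cong) auto
    then have "E = (\<lambda>x. int p - 2 * x) ` {x \<in> A. (int p - 1) div 2 < int p - 2 * x}"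
    proof -
      have "f ` A \<inter> {K<..} = f ` {x \<in> A. K < f x}" for f :: "int \<Rightarrow> int" and K by auto
      with \<open>C = (\<lambda>x. int p - 2 * x) ` A\<close> show ?thesis by (simp only: E_def)
    qed
    moreover have "{x \<in> A. (int p - 1) div 2 < int p - 2 * x} = {0<..int (p div 4)}"
    proof -
      have "x \<in> A \<and> (int p - 1) div 2 < int p - 2 * x \<longleftrightarrow> 0 < x \<and> x \<le> int (p div 4)" for x
      proof -
        define k where "k = p div 4"
        have k: "p = 4 * k + 1 \<or> p = 4 * k + 3" using p(2) unfolding k_def by presburger
        then have "p div 4 = k" by auto
        moreover have "x \<in> A \<longleftrightarrow> 0 < x \<and> 2 * x < int p" using k by (auto simp: A_def)
        moreover have "(int p - 1) div 2 < int p - 2 * x \<longleftrightarrow> 4 * x < int p + 1" using k by auto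
        ultimately show ?thesis using k by auto
      qed
      then show ?thesis unfolding set_eq_iff mem_Collect_eq greaterThanAtMost_iff by blast
    qed
    ultimately have "card E = card {0<..int (p div 4)}" by (simp add: card_image inj_on_def)
    then show ?thesis by simp
  qed
  also have "(- 1) ^ (p div 4) = chi8 p"
  proof -
    have "even (p div 4) \<longleftrightarrow> p mod 8 = 1 \<or> p mod 8 = 3" using p(2) by presburger
    then show ?thesis by (simp add: chi8_def)
  qed
  finally show ?thesis .
qed

lemma chi8_mult:
  assumes "odd a" "odd b"
  shows "chi8 (a * b) = chi8 a * chi8 b"
proof -
  have m: "x mod 8 = 1 \<or> x mod 8 = 3 \<or> x mod 8 = 5 \<or> x mod 8 = 7" if "odd x" for x :: nat using that by presburger
  have "(a * b) mod 8 = (a mod 8 * (b mod 8)) mod 8" by (simp add: mod_mult_eq)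
  then show ?thesis using m[OF assms(1)] m[OF assms(2)] by (elim disjE) (simp_all add: chi8_def)
qed

lemma Jacobi_minus_two:
  assumes "odd n"
  shows "Jacobi (- 2) n = chi8 n"
proof -
  have "odd (\<Prod>\<^sub># M) \<and> (\<Prod>p\<in>#M. Legendre (- 2) (int p)) = chi8 (\<Prod>\<^sub># M)"
    if "\<forall>p\<in>#M. prime p \<and> odd p" for M
    using that
  proof (induction M)
    case empty
    then show ?case by (simp add: chi8_def)
  next
    case (add p M)
    then show ?case by (simp add: Legendre_minus_two chi8_mult)
  qed
  moreover have "prime p \<and> odd p" if "p \<in># prime_factorization n" for p
    using that assms by (meson dvd_trans in_prime_factors_imp_dvd in_prime_factors_imp_prime)
  moreover have "\<Prod>\<^sub># (prime_factorization n) = n"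
    using assms by (intro prod_mset_prime_factorization_nat) (auto intro: odd_pos)
  ultimately show ?thesis by (simp add: Jacobi_def)
qed

text \<open>The Jacobi symbol of -2 modulo 2m + 1 equals the other factor s = (-1)^{m(m-1)/2}. Hence
  the whole sign is s^{m+1}, which is s for even m and 1 for odd m, as is the sign of
  \<rho>.\<close>

lemma epsilon_eq_rho_sign: "epsilon (2 * m + 1) = rho_sign m"
proof -
  define s where "s = (- 1 :: int) ^ (m * (m - 1) div 2)"
  have J: "Jacobi (- 2) (2 * m + 1) = s"
  proof -
    have "even (m * (m - 1) div 2) \<longleftrightarrow> m mod 4 = 0 \<or> m mod 4 = 1"
    proof -
      obtain q k where "m = 4 * q + k" "k < 4" by (metis mod_div_decomp mod_less_divisor mult.commute zero_less_numeral)
      then have k: "m = 4 * q \<or> m = 4 * q + 1 \<or> m = 4 * q + 2 \<or> m = 4 * q + 3" by auto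
      have h: "x = 2 * y \<Longrightarrow> x div 2 = y" for x y :: nat by simp
      from k show ?thesis
      proof (elim disjE)
        assume m: "m = 4 * q"
        have "m * (m - 1) = 2 * (2 * (q * (4 * q - 1)))" by (simp add: m)
        from h[OF this] show ?thesis by (simp add: m)
      next
        assume m: "m = 4 * q + 1"
        have "m * (m - 1) = 2 * (2 * (q * (4 * q + 1)))" by (simp add: m)
        from h[OF this] show ?thesis by (simp add: m)
      next
        assume m: "m = 4 * q + 2"
        have "m * (m - 1) = 2 * ((2 * q + 1) * (4 * q + 1))" by (simp add: m algebra_simps)
        from h[OF this] show ?thesis unfolding m by simp presburger
      next
        assume m: "m = 4 * q + 3"
        have "m * (m - 1) = 2 * ((4 * q + 3) * (2 * q + 1))" by (simp add: m algebra_simps)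
        from h[OF this] show ?thesis by (simp add: m)
      qed
    qed
    moreover have "(2 * m + 1) mod 8 = 1 \<or> (2 * m + 1) mod 8 = 3 \<longleftrightarrow> m mod 4 = 0 \<or> m mod 4 = 1" by presburger
    ultimately show ?thesis by (simp add: Jacobi_minus_two chi8_def s_def del: One_nat_def)
  qed
  have h: "(2 * m + 1 + 3) div 2 = m + 2" "(2 * m + 1 - 1) div 2 = m" by simp_all
  have ss: "s * s = 1" by (simp add: s_def flip: power_mult_distrib)
  have "epsilon (2 * m + 1) = s ^ (m + 2) * s"
    unfolding epsilon_def Let_def h J s_def ..
  also have "\<dots> = s ^ (m + 1)" using ss by (simp add: power_add power2_eq_square)
  also have "\<dots> = rho_sign m"
  proof (cases "even m")
    case True
    then obtain k where m: "m = 2 * k" by (elim evenE)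
    have "m * (m - 1) = 2 * (k * (2 * k - 1))" by (simp add: m)
    then have "s = (- 1) ^ (k * (2 * k - 1))" by (simp add: s_def)
    then have sk: "s = (- 1) ^ k" by (cases "k = 0") (auto simp: minus_one_power_iff)
    have "s ^ (m + 1) = s" using ss by (simp add: m power_mult power2_eq_square)
    moreover have "rho_sign m = (- 1) ^ (k * k)" by (simp add: rho_sign_eq m)
    ultimately show ?thesis by (simp add: sk minus_one_power_iff)
  next
    case False
    then obtain k where m: "m = 2 * k + 1" by (elim oddE)
    have "s ^ (m + 1) = (s * s) ^ (k + 1)" by (simp add: m power_mult_distrib flip: power_add) (simp add: mult_2)
    moreover have "rho_sign m = (- 1) ^ (k * (k + 1))" by (simp add: rho_sign_eq m)
    ultimately show ?thesis by (simp add: ss minus_one_power_iff)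
  qed
  finally show ?thesis .
qed

subsection \<open>Sequences meeting every folded class\<close>

definition all_classes :: "nat \<Rightarrow> (nat \<Rightarrow> int) \<Rightarrow> bool" where
  "all_classes m l \<longleftrightarrow> (\<forall>c\<in>{1..m}. \<exists>j<m. folded_class m (l j) = c)"

definition class_perm :: "nat \<Rightarrow> (nat \<Rightarrow> int) \<Rightarrow> nat \<Rightarrow> nat" where
  "class_perm m l p = (if p < m then m - folded_class m (l p) else p)"

definition class_sign :: "nat \<Rightarrow> (nat \<Rightarrow> int) \<Rightarrow> int" where
  "class_sign m l = sign (class_perm m l) * (\<Prod>p<m. folding_sign m (l p))"

text \<open>Pigeonhole: m positions covering m nonzero classes leave no room for a repetition or for
  class 0.\<close>

lemma all_classes_bij:
  assumes "all_classes m l"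
  shows "bij_betw (\<lambda>j. folded_class m (l j)) {..<m} {1..m}"
proof -
  let ?c = "\<lambda>j. folded_class m (l j)"
  have sub: "{1..m} \<subseteq> ?c ` {..<m}"
  proof
    fix c assume "c \<in> {1..m}"
    then obtain j where "j < m" "?c j = c" using assms unfolding all_classes_def by blast
    then show "c \<in> ?c ` {..<m}" by blast
  qed
  have "card (?c ` {..<m}) \<le> m" using card_image_le[of "{..<m}" ?c] by simp
  then have eq: "?c ` {..<m} = {1..m}" using card_seteq[OF _ sub] by simp
  then have "inj_on ?c {..<m}" by (intro eq_card_imp_inj_on) auto
  then show ?thesis using eq by (simp add: bij_betw_def)
qed

lemma class_perm_permutes:
  assumes "all_classes m l"
  shows "class_perm m l permutes {..<m}"
proof (rule bij_imp_permutes)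
  have "bij_betw (\<lambda>c. m - c) {1..m} {..<m}"
    by (rule bij_betwI[where g = "\<lambda>k. m - k"]) auto
  then have "bij_betw ((\<lambda>c. m - c) \<circ> (\<lambda>j. folded_class m (l j))) {..<m} {..<m}"
    using all_classes_bij[OF assms] bij_betw_trans by blast
  then show "bij_betw (class_perm m l) {..<m} {..<m}"
    by (rule bij_betw_cong[THEN iffD1, rotated]) (simp add: class_perm_def)
qed (simp add: class_perm_def)

lemma prod_folding_sign_cases:
  fixes k :: nat
  shows "(\<Prod>p<k. folding_sign m (f p)) = 1 \<or> (\<Prod>p<k. folding_sign m (f p)) = - 1"
proof (induction k)
  case (Suc k)
  then show ?case using folding_sign_cases[of m "f k"] by (elim disjE) (simp_all add: lessThan_Suc)
qed simp

lemma class_sign_cases: "class_sign m l = 1 \<or> class_sign m l = - 1"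
  using prod_folding_sign_cases[of m l m] by (auto simp: class_sign_def sign_def)

lemma det_monomial:
  assumes \<sigma>: "\<sigma> permutes {..<n}"
  shows "det (mat n n (\<lambda>(i, j). if j = \<sigma> i then f i else 0)) = of_int (sign \<sigma>) * (\<Prod>i<n. f i :: 'a :: comm_ring_1)"
proof -
  let ?A = "mat n n (\<lambda>(i, j). if j = \<sigma> i then f i else 0)"
  let ?S = "{\<pi>. \<pi> permutes {0..<n}}"
  have lt: "\<tau> i < n" if "\<tau> permutes {0..<n}" "i < n" for \<tau> i
    using permutes_in_image[OF that(1), of i] that(2) by simp
  have "det ?A = (\<Sum>\<pi>\<in>?S. signof \<pi> * (\<Prod>i = 0..<n. ?A $$ (i, \<pi> i)))"
    by (rule det_def') simp
  also have "\<dots> = (\<Sum>\<pi>\<in>?S. if \<pi> = \<sigma> then signof \<sigma> * (\<Prod>i<n. f i) else 0)"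
  proof (rule sum.cong)
    fix \<pi> assume \<pi>: "\<pi> \<in> ?S"
    show "signof \<pi> * (\<Prod>i = 0..<n. ?A $$ (i, \<pi> i)) = (if \<pi> = \<sigma> then signof \<sigma> * (\<Prod>i<n. f i) else 0)"
    proof (cases "\<pi> = \<sigma>")
      case True
      have "(\<Prod>i = 0..<n. ?A $$ (i, \<pi> i)) = (\<Prod>i<n. f i)"
        unfolding atLeast0LessThan by (rule prod.cong) (use True \<pi> lt in auto)
      then show ?thesis using True by simp
    next
      case False
      then obtain i where i: "\<pi> i \<noteq> \<sigma> i" by blast
      have "i < n"
      proof (rule ccontr)
        assume "\<not> i < n"
        then have "\<pi> i = i" "\<sigma> i = i" using \<pi> \<sigma> by (auto simp: permutes_def)
        then show False using i by simp
      qed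
      then have "?A $$ (i, \<pi> i) = 0" using i \<pi> lt by simp
      then have "(\<Prod>i = 0..<n. ?A $$ (i, \<pi> i)) = 0" using \<open>i < n\<close> by (intro prod_zero) auto
      then show ?thesis using False by simp
    qed
  qed simp
  also have "\<dots> = signof \<sigma> * (\<Prod>i<n. f i)"
    using \<sigma> by (simp add: atLeast0LessThan finite_permutations)
  finally show ?thesis .
qed

section \<open>The character at the principal element\<close>

lemma det_zero_row:
  assumes A: "A \<in> carrier_mat n n" and i: "i < n" "\<And>j. j < n \<Longrightarrow> A $$ (i, j) = (0 :: 'a :: comm_ring_1)"
  shows "det A = 0"
  unfolding det_def'[OF A]
proof (rule sum.neutral, rule ballI)
  fix \<pi> assume "\<pi> \<in> {\<pi>. \<pi> permutes {0..<n}}"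
  then have "\<pi> i < n" using permutes_in_image[of \<pi> "{0..<n}" i] i(1) by simp
  then have "(\<Prod>i = 0..<n. A $$ (i, \<pi> i)) = 0" using i by (intro prod_zero bexI[of _ i]) auto
  then show "signof \<pi> * (\<Prod>i = 0..<n. A $$ (i, \<pi> i)) = 0" by simp
qed

text \<open>The exponent m + 1 is (t + 1)/2, so the square is \<zeta>^{t+1} = \<zeta>.\<close>

definition root1 :: "nat \<Rightarrow> complex" where
  "root1 m = cis (2 * pi / real (2 * m + 1)) ^ (m + 1)"

lemma root1_nonzero: "root1 m \<noteq> 0"
  by (simp add: root1_def)

lemma cis_root: "cis (2 * pi / real (2 * m + 1)) ^ (2 * m + 1) = 1"
proof -
  have "real n * (2 * pi / real n) = 2 * pi" if "n \<noteq> 0" for n using that by simp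
  from this[of "2 * m + 1"] show ?thesis by (simp only: DeMoivre) simp
qed

lemma root1_square: "(root1 m)\<^sup>2 = cis (2 * pi / real (2 * m + 1))"
proof -
  have "(root1 m)\<^sup>2 = cis (2 * pi / real (2 * m + 1)) ^ (2 * m + 1 + 1)"
    unfolding root1_def power_mult[symmetric] by (simp add: algebra_simps)
  then show ?thesis by (simp only: power_add[of _ "2 * m + 1" 1] cis_root power_one_right mult_1)
qed

lemma cis_powi_eq_1: "cis (2 * pi / real (2 * m + 1)) powi k = 1 \<longleftrightarrow> int (2 * m + 1) dvd k"
proof
  assume "int (2 * m + 1) dvd k"
  then obtain q where "k = int (2 * m + 1) * q" by (elim dvdE)
  then have "cis (2 * pi / real (2 * m + 1)) powi k = (cis (2 * pi / real (2 * m + 1)) ^ (2 * m + 1)) powi q"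
    by (simp only: power_int_mult power_int_of_nat)
  then show "cis (2 * pi / real (2 * m + 1)) powi k = 1" by (simp only: cis_root power_int_1_left)
next
  assume a: "cis (2 * pi / real (2 * m + 1)) powi k = 1"
  let ?x = "of_int k * (2 * pi / real (2 * m + 1))"
  have "cos ?x = 1" using a unfolding cis_power_int by (simp add: complex_eq_iff)
  then obtain q :: int where "?x = of_int q * 2 * pi" using cos_one_2pi_int by blast
  then have "real_of_int k * (2 * pi) = (real (2 * m + 1) * of_int q) * (2 * pi)"
    by (simp only: times_divide_eq_right) (subst (asm) divide_eq_eq, simp add: ac_simps)
  then have "real_of_int k = of_int (int (2 * m + 1) * q)" by (simp only: mult_cancel_right) simp
  then have "k = int (2 * m + 1) * q" by (simp only: of_int_eq_iff)
  then show "int (2 * m + 1) dvd k" by simp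
qed

text \<open>Since m + 1 is prime to t, this square root of \<zeta> is again a primitive t-th root of
  unity.\<close>

lemma root1_powi_eq_1: "root1 m powi k = 1 \<longleftrightarrow> int (2 * m + 1) dvd k"
proof -
  have "root1 m powi k = cis (2 * pi / real (2 * m + 1)) powi (int (m + 1) * k)"
    by (simp only: root1_def power_int_mult power_int_of_nat)
  moreover have "coprime (int (2 * m + 1)) (int (m + 1))"
  proof (rule coprimeI)
    fix c assume "c dvd int (2 * m + 1)" "c dvd int (m + 1)"
    then have "c dvd 2 * int (m + 1) - int (2 * m + 1)" by (intro dvd_diff dvd_mult)
    then show "is_unit c" by simp
  qed
  ultimately show ?thesis by (simp only: cis_powi_eq_1 coprime_dvd_mult_right_iff)
qed

lemma root1_powi_eq: "root1 m powi a = root1 m powi b \<longleftrightarrow> [a = b] (mod int (2 * m + 1))"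
proof -
  have "root1 m powi a = root1 m powi b \<longleftrightarrow> root1 m powi (a - b) = 1"
    using root1_nonzero[of m] by (simp add: power_int_diff divide_eq_1_iff)
  then show ?thesis by (simp only: root1_powi_eq_1 cong_iff_dvd_diff)
qed

text \<open>A binomial evaluated at the root of unity. It is odd and t-periodic in a, hence up to
  the folding sign a function of the folded class alone.\<close>

definition sx :: "nat \<Rightarrow> int \<Rightarrow> complex" where
  "sx m a = root1 m powi a - root1 m powi (- a)"

lemma sx_cong:
  assumes "[a = b] (mod int (2 * m + 1))"
  shows "sx m a = sx m b"
proof -
  have "[- a = - b] (mod int (2 * m + 1))" using assms by (simp add: cong_minus_minus_iff)
  then show ?thesis unfolding sx_def using assms by (simp only: root1_powi_eq[THEN iffD2])
qed

lemma sx_uminus: "sx m (- a) = - sx m a"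
  by (simp add: sx_def)

lemma sx_0 [simp]: "sx m 0 = 0"
  by (simp add: sx_def)

text \<open>A zero would make t divide 2a, and 2 is invertible modulo the odd number t.\<close>

lemma sx_nonzero: "\<not> int (2 * m + 1) dvd a \<Longrightarrow> sx m a \<noteq> 0"
proof
  assume a: "\<not> int (2 * m + 1) dvd a" "sx m a = 0"
  then have "[a = - a] (mod int (2 * m + 1))" unfolding root1_powi_eq[symmetric] by (simp add: sx_def)
  then have "int (2 * m + 1) dvd 2 * a" by (simp add: cong_iff_dvd_diff)
  moreover have "coprime (int (2 * m + 1)) 2" by simp
  ultimately show False using a(1) by (simp only: coprime_dvd_mult_right_iff)
qed

definition sxmat :: "nat \<Rightarrow> (nat \<Rightarrow> int) \<Rightarrow> complex mat" where
  "sxmat m l = mat m m (\<lambda>(i, j). sx m (l j * (int i + 1)))"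

text \<open>Column j depends, up to the folding sign, only on the class of l j. So the matrix is the
  standard one for the exponents m, ..., 1 times a matrix Q with at most one entry in each column. Q
  is a signed permutation matrix if all nonzero classes occur and otherwise has a zero row.\<close>

lemma det_sxmat:
  "det (sxmat m l) = (if all_classes m l then of_int (class_sign m l) * det (sxmat m (\<lambda>k. int m - int k)) else 0)"
proof -
  let ?B = "sxmat m (\<lambda>k. int m - int k)"
  let ?c = "\<lambda>j. folded_class m (l j)"
  define Q where "Q = mat m m (\<lambda>(k, j). if ?c j = m - k then of_int (folding_sign m (l j)) else 0 :: complex)"
  have Bc: "?B \<in> carrier_mat m m" and Qc: "Q \<in> carrier_mat m m" by (auto simp: sxmat_def Q_def)
  have "sxmat m l = ?B * Q"
  proof (rule eq_matI)
    fix i j assume "i < dim_row (?B * Q)" "j < dim_col (?B * Q)"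
    then have ij: "i < m" "j < m" by (auto simp: sxmat_def Q_def)
    have "sx m (l j * (int i + 1)) = sx m (folding_sign m (l j) * int (?c j) * (int i + 1))"
      by (intro sx_cong cong_mult folding_sign_cong cong_refl)
    also have "\<dots> = of_int (folding_sign m (l j)) * sx m (int (?c j) * (int i + 1))"
      using folding_sign_cases[of m "l j"] by (auto simp: sx_uminus[symmetric])
    finally have s: "sx m (l j * (int i + 1)) = of_int (folding_sign m (l j)) * sx m (int (?c j) * (int i + 1))" .
    have "(?B * Q) $$ (i, j) = (\<Sum>k<m. if k = m - ?c j then
        (if ?c j = 0 then 0 else of_int (folding_sign m (l j)) * sx m (int (?c j) * (int i + 1))) else 0)"
      unfolding mat_mult_entry[OF Bc Qc ij]
    proof (rule sum.cong)
      fix k assume "k \<in> {..<m}"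
      then have k: "k < m" by simp
      have "?c j \<le> m" by (rule folded_class_le)
      then have "?c j = m - k \<longleftrightarrow> k = m - ?c j \<and> ?c j \<noteq> 0" using k by auto
      moreover have "int m - int (m - ?c j) = int (?c j)" using \<open>?c j \<le> m\<close> by simp
      ultimately show "?B $$ (i, k) * Q $$ (k, j) = (if k = m - ?c j then
        (if ?c j = 0 then 0 else of_int (folding_sign m (l j)) * sx m (int (?c j) * (int i + 1))) else 0)"
        using ij k by (auto simp: sxmat_def Q_def)
    qed simp
    also have "\<dots> = of_int (folding_sign m (l j)) * sx m (int (?c j) * (int i + 1))"
      using ij by (cases "?c j = 0") auto
    finally show "sxmat m l $$ (i, j) = (?B * Q) $$ (i, j)" using ij s by (simp add: sxmat_def)
  qed (auto simp: sxmat_def Q_def)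
  then have d: "det (sxmat m l) = det ?B * det Q" using det_mult[OF Bc Qc] by simp
  show ?thesis
  proof (cases "all_classes m l")
    case True
    have tQ: "transpose_mat Q = mat m m (\<lambda>(i, j). if j = class_perm m l i then of_int (folding_sign m (l i)) else 0)"
    proof (rule eq_matI)
      fix i j assume "i < dim_row (mat m m (\<lambda>(i, j). if j = class_perm m l i then of_int (folding_sign m (l i)) else 0 :: complex))"
        "j < dim_col (mat m m (\<lambda>(i, j). if j = class_perm m l i then of_int (folding_sign m (l i)) else 0 :: complex))"
      then have ij: "i < m" "j < m" by auto
      have "?c i \<in> {1..m}" using all_classes_bij[OF True] ij(1) by (auto simp: bij_betw_def)
      then have "?c i = m - j \<longleftrightarrow> j = m - ?c i" using ij by auto
      then show "transpose_mat Q $$ (i, j) = mat m m (\<lambda>(i, j). if j = class_perm m l i then of_int (folding_sign m (l i)) else 0) $$ (i, j)"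
        using ij by (simp add: Q_def class_perm_def)
    qed (auto simp: Q_def)
    have "det Q = det (transpose_mat Q)" using det_transpose[OF Qc] by simp
    also have "\<dots> = of_int (sign (class_perm m l)) * (\<Prod>i<m. of_int (folding_sign m (l i)))"
      unfolding tQ by (rule det_monomial[OF class_perm_permutes[OF True]])
    finally have "det Q = of_int (sign (class_perm m l)) * (\<Prod>i<m. of_int (folding_sign m (l i)))" .
    then show ?thesis using True d by (simp add: class_sign_def)
  next
    case False
    then obtain c where c: "c \<in> {1..m}" "\<And>j. j < m \<Longrightarrow> ?c j \<noteq> c" by (auto simp: all_classes_def)
    have "det Q = 0"
      by (rule det_zero_row[OF Qc, of "m - c"]) (use c in \<open>auto simp: Q_def\<close>)
    then show ?thesis using False d by simp
  qed
qed

lemma class_sign_rho2: "class_sign m (rho2 m) = rho_sign m"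
proof -
  have "class_perm m (rho2 m) = weyl_perm m"
    by (simp add: fun_eq_iff class_perm_def weyl_perm_def rho2_def rho_entry_def)
  moreover have "(\<Prod>p<m. folding_sign m (rho2 m p)) = (\<Prod>p<m. folding_sign m (rho_entry m p))"
    by (intro prod.cong) (auto simp: rho2_def rho_entry_def)
  ultimately show ?thesis by (simp add: class_sign_def rho_sign_def)
qed

definition yv :: "nat \<Rightarrow> nat \<Rightarrow> complex" where
  "yv m i = root1 m ^ (i + 1)"

lemma yv_square: "(yv m i)\<^sup>2 = cis (2 * pi / real (2 * m + 1)) ^ (i + 1)"
  unfolding yv_def root1_square[symmetric] power_mult[symmetric] by (simp only: mult.commute)

lemma unitvals_yv: "unitvals m (yv m)"
  by (simp add: unitvals_def yv_def root1_nonzero)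

lemma ev_det_altm: "ev m (yv m) (det (altm m l)) = det (sxmat m l)"
proof -
  interpret comm_ring_hom "ev m (yv m)" by (rule ev_hom[OF unitvals_yv])
  have "map_mat (ev m (yv m)) (altm m l) = sxmat m l"
  proof (rule eq_matI)
    fix i j assume "i < dim_row (sxmat m l)" "j < dim_col (sxmat m l)"
    then have ij: "i < m" "j < m" by (auto simp: sxmat_def)
    have mo: "mon m (yv m) (smw c i) = root1 m powi (c * (int i + 1))" for c
    proof -
      have "mon m (yv m) (smw c i) = (\<Prod>k<m. if k = i then yv m i powi c else 1)"
        unfolding mon_def by (intro prod.cong) (auto simp: smw_def)
      also have "\<dots> = yv m i powi c" using ij by simp
      also have "\<dots> = (root1 m powi (int i + 1)) powi c"
        unfolding yv_def by (metis of_nat_1 of_nat_add power_int_of_nat)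
      finally show ?thesis by (simp add: power_int_mult[symmetric] mult.commute)
    qed
    have neg: "- smw c i = smw (- c) i" for c by (simp add: smw_def fun_eq_iff)
    show "map_mat (ev m (yv m)) (altm m l) $$ (i, j) = sxmat m l $$ (i, j)"
      using ij by (simp add: altm_def sxmat_def bin_def ev_diff ev_single neg mo sx_def)
  qed (auto simp: altm_def sxmat_def)
  then show ?thesis using hom_det[of "altm m l"] by simp
qed

lemma ev_Delta_nonzero: "ev m (yv m) (Delta m) \<noteq> 0"
proof -
  \<comment> \<open>Written as powers of \<open>root1 m\<close>, the entries of the torus element
    have the exponents -m, ..., m in some order. Two of them differ by at most 2m, so no positive
    root gives a vanishing binomial.\<close>
  define e where "e i = (if i < m then int i + 1 else if i = m then 0 else int i - 2 * int m - 1)" for i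
  have mo: "mon m (yv m) (wtv m i) = root1 m powi e i" if i: "i \<le> 2 * m" for i
  proof -
    have y: "yv m k = root1 m powi (int k + 1)" for k
      unfolding yv_def by (metis of_nat_1 of_nat_add power_int_of_nat)
    have "inverse (yv m (2 * m - i)) = root1 m powi e i" if "i > m"
    proof -
      have "e i = - (int (2 * m - i) + 1)" using that i by (simp add: e_def of_nat_diff)
      then show ?thesis by (simp only: y power_int_minus)
    qed
    then show ?thesis using i by (simp add: mon_wtv) (auto simp: e_def y)
  qed
  have "ev m (yv m) (bin (rt m x)) \<noteq> 0" if x: "x \<in> Phi m" for x
  proof -
    obtain i j where ij: "x = (i, j)" "i < j" "i + j < 2 * m" using x by (auto simp: Phi_def)
    then have le: "i \<le> 2 * m" "j \<le> 2 * m" by auto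
    have m: "mon m (yv m) (wtv m a - wtv m b) = root1 m powi (e a - e b)" if "a \<le> 2 * m" "b \<le> 2 * m" for a b
    proof -
      have "mon m (yv m) (wtv m a - wtv m b) * mon m (yv m) (wtv m b) = mon m (yv m) (wtv m a)"
        by (simp add: mon_add[OF unitvals_yv, symmetric])
      then show ?thesis using that root1_nonzero[of m] by (simp add: mo power_int_diff field_simps)
    qed
    have "ev m (yv m) (bin (rt m x)) = sx m (e i - e j)"
      using m[OF le] m[OF le(2,1)] by (simp add: bin_def ev_diff ev_single rt_def ij(1) sx_def)
    moreover have "\<not> int (2 * m + 1) dvd e i - e j"
    proof
      assume d: "int (2 * m + 1) dvd e i - e j"
      have b: "e i - e j \<noteq> 0" "\<bar>e i - e j\<bar> < int (2 * m + 1)" using ij le by (auto simp: e_def split: if_splits)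
      then show False using d zdvd_not_zless[of "\<bar>e i - e j\<bar>" "int (2 * m + 1)"] by auto
    qed
    ultimately show ?thesis using sx_nonzero by simp
  qed
  then show ?thesis
    unfolding Delta_def ev_prod[OF unitvals_yv] by (simp add: prod_zero_iff finite_Phi)
qed

text \<open>If a class were missing, the denominator identity would make the nonzero value of
  \<open>Delta\<close> at the root of unity zero.\<close>

lemma all_classes_rho2: "all_classes m (rho2 m)"
proof (rule ccontr)
  assume "\<not> ?thesis"
  then have "ev m (yv m) (Delta m) = 0" using det_sxmat[of m "rho2 m"] by (simp only: Delta_eq_alt ev_det_altm if_False)
  then show False using ev_Delta_nonzero by simp
qed

lemma hwrepI:
  assumes "irreducible_rep m d \<pi>" "hwr m d \<pi> \<eta>" "\<eta> \<in> wts m"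
  obtains v where "hwrep m d \<pi> v \<eta>"
proof -
  obtain v where "v \<in> carrier_vec d" "v \<noteq> 0\<^sub>v d" "\<forall>g\<in>unipotent_upper m. \<pi> g *\<^sub>v v = v"
    "\<forall>x. unitvals m x \<longrightarrow> \<pi> (torus_elt m x) *\<^sub>v v = mon m x \<eta> \<cdot>\<^sub>v v"
    using assms(2) by (auto simp: hwr_def)
  then have "hwrep m d \<pi> v \<eta>"
    using assms(1,3) by unfold_locales (auto simp: irreducible_rep_def)
  then show thesis by (rule that)
qed

text \<open>Numerator and denominator of the character formula are signed multiples of one nonzero
  determinant, which cancels; the sign of the denominator is \<open>rho_sign m\<close>, equal to its
  own inverse.\<close>

lemma trace_principal_element:
  assumes irr: "irreducible_rep m d \<pi>" and hw: "hwr m d \<pi> \<eta>" and \<eta>: "\<eta> \<in> wts m" "dcow m \<eta>"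
  shows "(\<Sum>i<d. \<pi> (torus_elt m (\<lambda>i. cis (2 * pi / real (2 * m + 1)) ^ (i + 1))) $$ (i, i)) =
    (if all_classes m (dbl \<eta> + rho2 m) then of_int (class_sign m (dbl \<eta> + rho2 m) * rho_sign m) else 0)"
proof -
  let ?l = "dbl \<eta> + rho2 m" and ?D = "det (sxmat m (\<lambda>k. int m - int k))"
  obtain v where "hwrep m d \<pi> v \<eta>" by (rule hwrepI[OF irr hw \<eta>(1)])
  then interpret hwrep m d \<pi> v \<eta> .
  have "Delta m * chd = det (altm m ?l)"
    using \<eta>(2) by (intro weyl_character_formula) (auto simp: dcow_def)
  then have "ev m (yv m) (Delta m) * ev m (yv m) chd = det (sxmat m ?l)"
    by (simp only: ev_mult[OF unitvals_yv, symmetric] ev_det_altm)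
  moreover have D: "ev m (yv m) (Delta m) = of_int (rho_sign m) * ?D"
    using det_sxmat[of m "rho2 m"] by (simp only: Delta_eq_alt ev_det_altm all_classes_rho2 class_sign_rho2 if_True)
  moreover have "(of_int (rho_sign m) :: complex) * of_int (rho_sign m) = 1"
    using class_sign_cases[of m "rho2 m"] by (auto simp: class_sign_rho2)
  moreover have "?D \<noteq> 0" using ev_Delta_nonzero[of m] D by auto
  ultimately have "ev m (yv m) chd = (if all_classes m ?l then of_int (class_sign m ?l * rho_sign m) else 0)"
    using det_sxmat[of m ?l] by (auto simp: mult.commute mult.left_commute split: if_splits) (metis mult.assoc mult.left_neutral mult_cancel_right)+
  moreover have "ev m (yv m) chd = (\<Sum>i<d. \<pi> (torus_elt m (\<lambda>i. cis (2 * pi / real (2 * m + 1)) ^ (i + 1))) $$ (i, i))"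
    unfolding ev_chd[OF unitvals_yv] yv_square trc_def p_def by (intro sum.cong) (auto simp: ent_def)
  ultimately show ?thesis by simp
qed

theorem tau_B_value:
  assumes dom: "\<And>i j. i \<le> j \<Longrightarrow> j < m \<Longrightarrow> \<eta> $ j \<le> \<eta> $ i" "\<And>i. i < m \<Longrightarrow> 0 \<le> \<eta> $ i"
  defines "l \<equiv> (\<lambda>p. if p < m then 2 * \<eta> $ p + 2 * (int m - int p) - 1 else 0)"
  shows "tau_B m \<eta> = (if all_classes m l then of_int (class_sign m l * rho_sign m) else 0)"
proof -
  define f where "f = (\<lambda>i. if i < m then \<eta> $ i else 0)"
  have f: "f \<in> wts m" "dcow m f" using dom by (auto simp: wts_def dcow_def f_def)
  have l: "dbl f + rho2 m = l" by (auto simp: fun_eq_iff dbl_apply f_def rho2_def l_def)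
  have hw: "has_highest_weight m d \<pi> \<eta> \<longleftrightarrow> hwr m d \<pi> f" for d \<pi>
  proof -
    have "mon m x f = (\<Prod>i<m. x i powi (\<eta> $ i))" for x
      unfolding mon_def by (intro prod.cong) (auto simp: f_def)
    then show ?thesis by (simp add: has_highest_weight_def hwr_def unitvals_def)
  qed
  obtain d \<pi> where ex: "irreducible_rep m d \<pi>" "hwr m d \<pi> f"
    using exists_hw_rep[OF f(2,1)] exists_irreducible by blast
  show ?thesis
    unfolding tau_B_def irr_character_def hw
  proof (rule the_equality)
    show "\<exists>d \<pi>. irreducible_rep m d \<pi> \<and> hwr m d \<pi> f \<and>
        (if all_classes m l then of_int (class_sign m l * rho_sign m) else 0) =
        (\<Sum>i<d. \<pi> (torus_elt m (\<lambda>i. cis (2 * pi / real (2 * m + 1)) ^ (i + 1))) $$ (i, i))"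
      by (intro exI[of _ d] exI[of _ \<pi>] conjI ex trace_principal_element[OF ex f, unfolded l, symmetric])
  next
    fix c assume "\<exists>d \<pi>. irreducible_rep m d \<pi> \<and> hwr m d \<pi> f \<and>
        c = (\<Sum>i<d. \<pi> (torus_elt m (\<lambda>i. cis (2 * pi / real (2 * m + 1)) ^ (i + 1))) $$ (i, i))"
    then obtain d \<pi> where *: "irreducible_rep m d \<pi>" "hwr m d \<pi> f"
      "c = (\<Sum>i<d. \<pi> (torus_elt m (\<lambda>i. cis (2 * pi / real (2 * m + 1)) ^ (i + 1))) $$ (i, i))" by blast
    show "c = (if all_classes m l then of_int (class_sign m l * rho_sign m) else 0)"
      unfolding *(3) by (rule trace_principal_element[OF *(1,2) f, unfolded l])
  qed
qed

section \<open>Signed permutations and subsets\<close>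

lemma sorted_nth_less:
  fixes A :: "nat set"
  assumes "finite A" "i < j" "j < card A"
  shows "sorted_list_of_set A ! i < sorted_list_of_set A ! j"
proof -
  have "sorted_list_of_set A ! i \<le> sorted_list_of_set A ! j"
    using assms by (intro sorted_nth_mono) auto
  moreover have "sorted_list_of_set A ! i \<noteq> sorted_list_of_set A ! j"
    using assms nth_eq_iff_index_eq[OF distinct_sorted_list_of_set[of A], of i j] by auto
  ultimately show ?thesis by simp
qed

lemma sorted_nth_in: "finite A \<Longrightarrow> k < card A \<Longrightarrow> sorted_list_of_set A ! k \<in> (A :: nat set)"
  using nth_mem[of k "sorted_list_of_set A"] by simp

lemma in_sorted_nth:
  assumes "finite A" "a \<in> (A :: nat set)"
  obtains k where "k < card A" "sorted_list_of_set A ! k = a"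
proof -
  have "a \<in> set (sorted_list_of_set A)" using assms by simp
  then show thesis using that by (auto simp: in_set_conv_nth)
qed

lemma sorted_nth_unique:
  assumes "\<And>i j. i < j \<Longrightarrow> j < k \<Longrightarrow> f i < f j" "i < k"
  shows "sorted_list_of_set (f ` {..<k}) ! i = (f i :: nat)"
proof -
  let ?xs = "map f [0..<k]"
  have "sorted ?xs" using assms(1) by (auto simp: sorted_iff_nth_mono_less less_imp_le)
  moreover have "distinct ?xs"
    unfolding distinct_conv_nth using assms(1) by (auto simp: neq_iff)
  ultimately have "sorted_list_of_set (set ?xs) = ?xs" by (rule sorted_list_of_set.idem_if_sorted_distinct)
  then show ?thesis using assms(2) by (simp add: atLeast0LessThan)
qed

lemma card_less_sorted_nth:
  fixes A :: "nat set"
  assumes "finite A" "k < card A"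
  shows "card {i \<in> A. i < sorted_list_of_set A ! k} = k"
proof -
  let ?x = "\<lambda>i. sorted_list_of_set A ! i"
  have "{i \<in> A. i < ?x k} = ?x ` {..<k}"
  proof (intro equalityI subsetI)
    fix a assume "a \<in> {i \<in> A. i < ?x k}"
    then have a: "a \<in> A" "a < ?x k" by auto
    obtain j where j: "j < card A" "?x j = a" by (rule in_sorted_nth[OF assms(1) a(1)])
    have "j < k"
    proof (rule ccontr)
      assume "\<not> j < k"
      then have "?x k \<le> ?x j" using sorted_nth_less[OF assms(1), of k j] j(1) by (cases "j = k") auto
      then show False using a(2) j(2) by simp
    qed
    then show "a \<in> ?x ` {..<k}" using j(2) by blast
  next
    fix a assume "a \<in> ?x ` {..<k}"
    then show "a \<in> {i \<in> A. i < ?x k}"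
      using sorted_nth_less[OF assms(1)] sorted_nth_in[OF assms(1)] assms(2) by auto
  qed
  moreover have "inj_on ?x {..<k}"
    unfolding inj_on_def using assms nth_eq_iff_index_eq[OF distinct_sorted_list_of_set[of A]] by auto
  ultimately show ?thesis by (simp add: card_image)
qed

text \<open>Otherwise the bound just above the k-th element of A would have k + 1 elements of A
  below it but at most k elements of B.\<close>

lemma sorted_nth_le_if_card_le:
  assumes A: "finite A" "k < card A" and B: "finite B" "k < card B"
    and le: "\<And>x. card {i \<in> A. i < x} \<le> card {i \<in> B. i < x}"
  shows "sorted_list_of_set B ! k \<le> (sorted_list_of_set A ! k :: nat)"
proof (rule ccontr)
  let ?a = "sorted_list_of_set A ! k" and ?b = "sorted_list_of_set B ! k"
  assume "\<not> ?b \<le> ?a"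
  then have ba: "Suc ?a \<le> ?b" by simp
  have "{i \<in> A. i < Suc ?a} = insert ?a {i \<in> A. i < ?a}"
    using sorted_nth_in[OF A] by (auto simp: less_Suc_eq)
  then have "card {i \<in> A. i < Suc ?a} = Suc k" using card_less_sorted_nth[OF A] A(1) by simp
  moreover have "card {i \<in> B. i < Suc ?a} \<le> card {i \<in> B. i < ?b}"
    using ba B(1) by (intro card_mono) auto
  ultimately show False using le[of "Suc ?a"] card_less_sorted_nth[OF B] by simp
qed

lemma monomial_mult_vec:
  assumes "x \<in> carrier_vec n" "i < n" "\<sigma> i < n"
  shows "(mat n n (\<lambda>(i, j). if j = \<sigma> i then f i else 0) *\<^sub>v x) $ i = (f i * x $ \<sigma> i :: 'a :: comm_ring_1)"
proof -
  have "(mat n n (\<lambda>(i, j). if j = \<sigma> i then f i else 0) *\<^sub>v x) $ i = (\<Sum>j = 0..<n. (if j = \<sigma> i then f i else 0) * x $ j)"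
    using assms by (simp add: scalar_prod_def)
  also have "\<dots> = (\<Sum>j = 0..<n. if j = \<sigma> i then f i * x $ \<sigma> i else 0)"
    by (intro sum.cong) auto
  finally show ?thesis using assms(3) by simp
qed

section \<open>Parametrisation of \<open>W1\<close> by subsets and chiralities\<close>

locale branching =
  fixes m r :: nat and \<Lambda> :: "int vec"
  assumes r: "0 < r" and dom: "dominant_SO_odd (m + r) \<Lambda>"
begin

abbreviation R :: nat where "R \<equiv> m + r"

definition V :: "nat \<Rightarrow> int" where
  "V i = 2 * \<Lambda> $ i + 2 * (int R - int i) - 1"

lemma Lambda: "\<Lambda> \<in> carrier_vec R" "i \<le> j \<Longrightarrow> j < R \<Longrightarrow> \<Lambda> $ j \<le> \<Lambda> $ i" "i < R \<Longrightarrow> 0 \<le> \<Lambda> $ i"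
  using dom by (auto simp: dominant_SO_odd_def le_less)

lemma u_carrier: "u_vec R \<Lambda> \<in> carrier_vec R"
  using Lambda(1) by (simp add: u_vec_def rho_B_def)

lemma u_entry: "i < R \<Longrightarrow> u_vec R \<Lambda> $ i = of_int (V i) / 2"
  using Lambda(1) by (simp add: u_vec_def rho_B_def V_def field_simps)

lemma V_entry: "i < R \<Longrightarrow> V_vec R \<Lambda> $ i = V i"
  using u_carrier by (simp add: V_vec_def u_entry)

lemma V_class_eq: "i < R \<Longrightarrow> V_class m r \<Lambda> i = folded_class m (V i)"
  by (simp add: V_class_def V_entry)

lemma V_less: "i < j \<Longrightarrow> j < R \<Longrightarrow> V j < V i"
  using Lambda(2)[of i j] by (simp add: V_def)

lemma V_pos: "i < R \<Longrightarrow> 0 < V i"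
  using Lambda(3)[of i] by (simp add: V_def)

lemma V_mono: "i \<le> j \<Longrightarrow> j < R \<Longrightarrow> V j \<le> V i"
  using V_less[of i j] by (cases "i = j") auto

lemma V_less_iff: "i < R \<Longrightarrow> j < R \<Longrightarrow> V j < V i \<longleftrightarrow> i < j"
  using V_less[of i j] V_mono[of j i] by (meson leI linorder_not_less)

lemma V_inj: "i < R \<Longrightarrow> j < R \<Longrightarrow> V i = V j \<Longrightarrow> i = j"
  using V_less[of i j] V_less[of j i] by (cases i j rule: linorder_cases) auto

text \<open>Row i of the signed permutation matrix has its nonzero entry in column
  \<open>slot S i\<close>. As V decreases, listing the labels of S and of its complement
  increasingly makes both blocks decrease.\<close>

definition slot :: "nat set \<Rightarrow> nat \<Rightarrow> nat" where
  "slot S i = (if i < m then sorted_list_of_set S ! i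
     else if i < R then sorted_list_of_set ({..<R} - S) ! (i - m) else i)"

text \<open>\<open>wm S s\<close> is the element of $W^1$ with datum \<open>(S, s)\<close>.\<close>

definition wm :: "nat set \<Rightarrow> real \<Rightarrow> real mat" where
  "wm S s = mat R R (\<lambda>(i, j). if j = slot S i then if Suc i = R then s else 1 else 0)"

definition datum :: "nat set \<Rightarrow> real \<Rightarrow> bool" where
  "datum S s \<longleftrightarrow> S \<subseteq> {..<R} \<and> card S = m \<and> (s = 1 \<or> s = - 1)"

abbreviation co :: "nat set \<Rightarrow> nat set" where
  "co S \<equiv> {..<R} - S"

lemma datum_finite: "datum S s \<Longrightarrow> finite S"
  by (auto simp: datum_def intro: finite_subset)

lemma card_co: "datum S s \<Longrightarrow> card (co S) = r"
  using datum_finite[of S s] by (simp add: datum_def card_Diff_subset)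

lemma slot_first: "datum S s \<Longrightarrow> i < m \<Longrightarrow> slot S i \<in> S"
  using sorted_nth_in[of S i] datum_finite by (auto simp: slot_def datum_def)

lemma slot_last: "datum S s \<Longrightarrow> k < r \<Longrightarrow> slot S (m + k) \<in> co S"
  using sorted_nth_in[of "co S" k] card_co by (simp add: slot_def)

lemma slot_less: "datum S s \<Longrightarrow> i < R \<Longrightarrow> slot S i < R"
  using slot_first[of S s i] slot_last[of S s "i - m"] by (cases "i < m") (auto simp: datum_def)

lemma slot_permutes:
  assumes d: "datum S s"
  shows "slot S permutes {..<R}"
proof (rule bij_imp_permutes)
  have "{..<R} \<subseteq> slot S ` {..<R}"
  proof
    fix a assume a: "a \<in> {..<R}"
    show "a \<in> slot S ` {..<R}"
    proof (cases "a \<in> S")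
      case True
      obtain k where "k < card S" "sorted_list_of_set S ! k = a" by (rule in_sorted_nth[OF datum_finite[OF d] True])
      then have "k < m" "slot S k = a" using d by (auto simp: datum_def slot_def)
      then show ?thesis by force
    next
      case False
      then have ac: "a \<in> co S" and fin: "finite (co S)" using a by simp_all
      obtain k where "k < card (co S)" "sorted_list_of_set (co S) ! k = a" by (rule in_sorted_nth[OF fin ac])
      then have "m + k < R" "slot S (m + k) = a" using card_co[OF d] by (auto simp: slot_def)
      then show ?thesis by force
    qed
  qed
  moreover have "slot S ` {..<R} \<subseteq> {..<R}" using slot_less[OF d] by auto
  ultimately have eq: "slot S ` {..<R} = {..<R}" by blast
  then have "inj_on (slot S) {..<R}" by (intro eq_card_imp_inj_on) auto
  then show "bij_betw (slot S) {..<R} {..<R}" using eq by (simp add: bij_betw_def)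
qed (simp add: slot_def)

lemma slot_mono: "datum S s \<Longrightarrow> i < j \<Longrightarrow> j < m \<Longrightarrow> slot S i < slot S j"
  using sorted_nth_less[OF datum_finite, of S s i j] by (simp add: slot_def datum_def)

lemma slot_mono_last: "datum S s \<Longrightarrow> i < j \<Longrightarrow> j < r \<Longrightarrow> slot S (m + i) < slot S (m + j)"
  using sorted_nth_less[of "co S" i j] card_co by (simp add: slot_def)

lemma block_entries:
  fixes \<epsilon> :: "nat \<Rightarrow> real"
  assumes \<sigma>: "\<sigma> permutes {..<R}"
  defines "w \<equiv> mat R R (\<lambda>(i, j). if j = \<sigma> i then \<epsilon> i else 0)"
  shows "i < m \<Longrightarrow> p_block m r \<Lambda> w $ i = \<epsilon> i * (of_int (V (\<sigma> i)) / 2)"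
    and "k < r \<Longrightarrow> q_block m r \<Lambda> w $ k = \<epsilon> (m + k) * (of_int (V (\<sigma> (m + k))) / 2)"
proof -
  have e: "(w *\<^sub>v u_vec R \<Lambda>) $ i = \<epsilon> i * (of_int (V (\<sigma> i)) / 2)" if i: "i < R" for i
  proof -
    have "\<sigma> i < R" using permutes_in_image[OF \<sigma>, of i] i by simp
    then show ?thesis using monomial_mult_vec[OF u_carrier i, of \<sigma> \<epsilon>] by (simp add: w_def u_entry)
  qed
  have dim: "dim_row w = R" by (simp add: w_def)
  show "i < m \<Longrightarrow> p_block m r \<Lambda> w $ i = \<epsilon> i * (of_int (V (\<sigma> i)) / 2)"
    using e[of i] by (simp add: p_block_def vec_first_def)
  show "k < r \<Longrightarrow> q_block m r \<Lambda> w $ k = \<epsilon> (m + k) * (of_int (V (\<sigma> (m + k))) / 2)"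
    using e[of "m + k"] by (simp add: q_block_def vec_last_def dim)
qed

lemma p_entry: "datum S s \<Longrightarrow> i < m \<Longrightarrow> p_block m r \<Lambda> (wm S s) $ i = of_int (V (slot S i)) / 2"
  using block_entries(1)[OF slot_permutes, of S s i] r by (simp add: wm_def)

lemma q_entry:
  "datum S s \<Longrightarrow> k < r \<Longrightarrow> q_block m r \<Lambda> (wm S s) $ k = (if Suc k = r then s else 1) * (of_int (V (slot S (m + k))) / 2)"
  using block_entries(2)[OF slot_permutes, of S s k] by (simp add: wm_def)

lemma wm_in_W1:
  assumes d: "datum S s"
  shows "wm S s \<in> W1 m r \<Lambda>"
proof -
  have s: "\<bar>s\<bar> = 1" using d by (auto simp: datum_def)
  have "0 < V (slot S (R - Suc 0))" using r slot_less[OF d] by (intro V_pos) auto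
  then have Vl: "\<bar>real_of_int (V (slot S (R - Suc 0)))\<bar> = real_of_int (V (slot S (R - Suc 0)))" by simp
  have "wm S s \<in> weyl_B R"
    unfolding weyl_B_def wm_def using slot_permutes[OF d] d
    by (intro CollectI exI[of _ "slot S"] exI[of _ "\<lambda>i. if Suc i = R then s else 1"]) (auto simp: datum_def)
  moreover have "V (slot S j) < V (slot S i)" if "i < j" "j < m" for i j
    using slot_mono[OF d that] slot_less[OF d] that by (intro V_less) auto
  moreover have q: "V (slot S (m + j)) < V (slot S (m + i))" if "i < j" "j < r" for i j
    using slot_mono_last[OF d that] slot_less[OF d] that by (intro V_less) auto
  moreover have "0 < V (slot S i)" if "i < R" for i using V_pos slot_less[OF d that] by blast
  ultimately show ?thesis
    using q[of _ "r - 1"] s r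
    by (auto simp: W1_def Let_def p_entry[OF d] q_entry[OF d] abs_mult Vl)
qed

text \<open>Positivity of the first block and the bound by |q_r| force every sign to be 1 except the
  last one; strict decrease in the blocks forces increasing label order, since |q_r| is half the
  last V.\<close>

lemma W1_datum:
  assumes w: "w \<in> W1 m r \<Lambda>"
  obtains S s where "datum S s" "w = wm S s"
proof -
  obtain \<sigma> \<epsilon> where \<sigma>: "\<sigma> permutes {..<R}" and \<epsilon>: "\<And>i. i < R \<Longrightarrow> \<epsilon> i = 1 \<or> \<epsilon> i = - 1"
    and w': "w = mat R R (\<lambda>(i, j). if j = \<sigma> i then \<epsilon> i else (0 :: real))"
    using w by (auto simp: W1_def weyl_B_def)
  note ent = block_entries[OF \<sigma>, of _ \<epsilon>, folded w']
  have lt: "\<sigma> i < R" if "i < R" for i using permutes_in_image[OF \<sigma>, of i] that by simp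
  have inj: "\<sigma> i = \<sigma> j \<longleftrightarrow> i = j" for i j using permutes_inj[OF \<sigma>] by (auto simp: inj_def)
  have Vp: "0 < V (\<sigma> i)" if "i < R" for i using V_pos lt[OF that] by blast
  have p: "p_block m r \<Lambda> w $ j < p_block m r \<Lambda> w $ i" if "i < j" "j < m" for i j
    using w that by (simp add: W1_def Let_def)
  have p0: "0 < p_block m r \<Lambda> w $ i" if "i < m" for i
    using w that by (simp add: W1_def Let_def)
  have q: "q_block m r \<Lambda> w $ j < q_block m r \<Lambda> w $ i" if "i < j" "j < r - 1" for i j
    using w that by (simp add: W1_def Let_def)
  have q0: "\<bar>q_block m r \<Lambda> w $ (r - 1)\<bar> < q_block m r \<Lambda> w $ i" if "i < r - 1" for i
    using w that by (simp add: W1_def Let_def)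
  have e1: "\<epsilon> i = 1" if "i < m" for i
    using p0[OF that] ent(1)[OF that] \<epsilon>[of i] Vp[of i] that by auto
  have e2: "\<epsilon> (m + k) = 1" if "k < r - 1" for k
  proof -
    have k: "k < r" using that by simp
    have "0 < q_block m r \<Lambda> w $ k" using q0[OF that] abs_ge_zero by (rule le_less_trans[rotated])
    then show ?thesis using ent(2)[OF k] \<epsilon>[of "m + k"] Vp[of "m + k"] k by auto
  qed
  have s1: "\<sigma> i < \<sigma> j" if "i < j" "j < m" for i j
    using p[OF that] that ent(1)[of i] ent(1)[of j] e1 V_less_iff[of "\<sigma> i" "\<sigma> j"] lt by simp
  have s2: "\<sigma> (m + i) < \<sigma> (m + j)" if "i < j" "j < r" for i j
  proof (cases "j < r - 1")
    case True
    then show ?thesis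
      using q[OF that(1) True] that ent(2)[of i] ent(2)[of j] e2 V_less_iff[of "\<sigma> (m + i)" "\<sigma> (m + j)"] lt by simp
  next
    case False
    then have j: "j = r - 1" "i < r - 1" using that by auto
    have "\<bar>q_block m r \<Lambda> w $ (r - 1)\<bar> = of_int (V (\<sigma> (m + j))) / 2"
      using ent(2)[of j] \<epsilon>[of "m + j"] Vp[of "m + j"] that j by (auto simp: abs_mult)
    then have "V (\<sigma> (m + j)) < V (\<sigma> (m + i))" using q0[OF j(2)] ent(2)[of i] e2[OF j(2)] that by simp
    then show ?thesis using V_less_iff[of "\<sigma> (m + i)" "\<sigma> (m + j)"] lt that by simp
  qed
  define S where "S = \<sigma> ` {..<m}"
  define s where "s = \<epsilon> (R - 1)"
  have "card S = m" unfolding S_def by (simp add: card_image inj_on_def inj)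
  then have d: "datum S s" using lt \<epsilon>[of "R - 1"] r by (auto simp: datum_def S_def s_def)
  have co: "co S = (\<lambda>k. \<sigma> (m + k)) ` {..<r}"
  proof -
    have "{..<R} = \<sigma> ` {..<R}" using permutes_image[OF \<sigma>] by simp
    also have "\<sigma> ` {..<R} = S \<union> (\<lambda>k. \<sigma> (m + k)) ` {..<r}"
    proof (intro equalityI subsetI)
      fix x assume "x \<in> \<sigma> ` {..<R}"
      then obtain i where i: "i < R" "x = \<sigma> i" by blast
      show "x \<in> S \<union> (\<lambda>k. \<sigma> (m + k)) ` {..<r}"
      proof (cases "i < m")
        case False
        then have "i - m < r" "x = \<sigma> (m + (i - m))" using i by auto
        then show ?thesis by blast
      qed (use i in \<open>simp add: S_def\<close>)
    qed (auto simp: S_def)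
    finally have "{..<R} = S \<union> (\<lambda>k. \<sigma> (m + k)) ` {..<r}" .
    moreover have "S \<inter> (\<lambda>k. \<sigma> (m + k)) ` {..<r} = {}" by (auto simp: S_def inj)
    ultimately show ?thesis by blast
  qed
  have slot: "slot S i = \<sigma> i" if "i < R" for i
  proof (cases "i < m")
    case True
    then show ?thesis using sorted_nth_unique[of m \<sigma> i] s1 by (simp add: slot_def S_def)
  next
    case False
    then show ?thesis
      using sorted_nth_unique[of r "\<lambda>k. \<sigma> (m + k)" "i - m"] s2 that by (simp add: slot_def co)
  qed
  have \<epsilon>s: "\<epsilon> i = (if Suc i = R then s else 1)" if i: "i < R" for i
  proof (cases "Suc i = R")
    case True
    then have "i = R - 1" by simp
    then show ?thesis using True by (simp add: s_def)
  next
    case False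
    then show ?thesis using e1[of i] e2[of "i - m"] i by (cases "i < m") auto
  qed
  have "w = wm S s"
  proof (rule eq_matI)
    fix i j assume "i < dim_row (wm S s)" "j < dim_col (wm S s)"
    then have ij: "i < R" "j < R" by (auto simp: wm_def)
    show "w $$ (i, j) = wm S s $$ (i, j)"
      unfolding w' wm_def using ij slot[OF ij(1)] \<epsilon>s[OF ij(1)] by simp
  qed (auto simp: w' wm_def)
  then show thesis by (rule that[OF d])
qed

lemma S_of_wm:
  assumes d: "datum S s"
  shows "S_of m r (wm S s) = S"
proof -
  have e: "wm S s $$ (k, i) \<noteq> 0 \<longleftrightarrow> i = slot S k" if "k < m" "i < R" for k i
    using that r by (simp add: wm_def)
  have "S = slot S ` {..<m}"
  proof (intro equalityI subsetI)
    fix a assume a: "a \<in> S"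
    obtain k where "k < card S" "sorted_list_of_set S ! k = a" by (rule in_sorted_nth[OF datum_finite[OF d] a])
    then show "a \<in> slot S ` {..<m}" using d by (auto simp: datum_def slot_def image_iff)
  qed (use slot_first[OF d] in auto)
  moreover have "S_of m r (wm S s) = slot S ` {..<m}"
  proof (intro equalityI subsetI)
    fix i assume "i \<in> S_of m r (wm S s)"
    then obtain k where "i < R" "k < m" "wm S s $$ (k, i) \<noteq> 0" by (auto simp: S_of_def)
    then show "i \<in> slot S ` {..<m}" using e by blast
  next
    fix i assume "i \<in> slot S ` {..<m}"
    then obtain k where k: "k < m" "i = slot S k" by blast
    then have "i < R" using slot_less[OF d, of k] by simp
    then show "i \<in> S_of m r (wm S s)" using e[of k i] k unfolding S_of_def by blast
  qed
  ultimately show ?thesis by simp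
qed

lemma chirality_wm:
  assumes d: "datum S s"
  shows "chirality m r \<Lambda> (wm S s) = s"
proof -
  have "0 < V (slot S (R - 1))" using r slot_less[OF d] by (intro V_pos) auto
  then show ?thesis using q_entry[OF d, of "r - 1"] r d by (auto simp: chirality_def datum_def sgn_mult)
qed

lemma point_eq:
  assumes d: "datum S s"
  shows "point m r \<Lambda> S s = mu_of m r \<Lambda> (wm S s)"
proof -
  have "(THE w. w \<in> W1 m r \<Lambda> \<and> S_of m r w = S \<and> chirality m r \<Lambda> w = s) = wm S s"
  proof (rule the_equality)
    show "wm S s \<in> W1 m r \<Lambda> \<and> S_of m r (wm S s) = S \<and> chirality m r \<Lambda> (wm S s) = s"
      using wm_in_W1[OF d] S_of_wm[OF d] chirality_wm[OF d] by simp
  next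
    fix w assume w: "w \<in> W1 m r \<Lambda> \<and> S_of m r w = S \<and> chirality m r \<Lambda> w = s"
    then obtain S' s' where "datum S' s'" "w = wm S' s'" using W1_datum by blast
    then show "w = wm S s" using w S_of_wm chirality_wm by simp
  qed
  then show ?thesis by (simp add: point_def)
qed

lemma mu_carrier: "mu_of m r \<Lambda> w \<in> carrier_vec r"
  unfolding mu_of_def rho_D_def by (intro carrier_vecI) simp

lemma alternant_entry:
  assumes d: "datum S s" and k: "k < r"
  shows "alternant_index r (mu_of m r \<Lambda> (wm S s)) $ k = (if Suc k = r then s else 1) * of_int (V (slot S (m + k)))"
proof -
  have "mu_of m r \<Lambda> (wm S s) $ k + rho_D r $ k = q_block m r \<Lambda> (wm S s) $ k"
    using k by (simp add: mu_of_def rho_D_def)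
  moreover have "alternant_index r (mu_of m r \<Lambda> (wm S s)) $ k = 2 * (mu_of m r \<Lambda> (wm S s) $ k + rho_D r $ k)"
    using k mu_carrier[of "wm S s"] by (simp add: alternant_index_def rho_D_def)
  ultimately show ?thesis using q_entry[OF d k] by simp
qed

text \<open>The absolute values in the alternant index are the V on the complement of S, and V is
  injective; the last entry is nonzero, so its sign recovers s.\<close>

lemma mu_inj:
  assumes d: "datum S s" and d': "datum S' s'" and eq: "mu_of m r \<Lambda> (wm S s) = mu_of m r \<Lambda> (wm S' s')"
  shows "S = S' \<and> s = s'"
proof -
  have e: "(if Suc k = r then s else 1) * of_int (V (slot S (m + k))) =
      (if Suc k = r then s' else 1) * of_int (V (slot S' (m + k)))" if "k < r" for k
    using alternant_entry[OF d that] alternant_entry[OF d' that] eq by simp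
  have pos: "0 < V (slot S (m + k))" "0 < V (slot S' (m + k))" if "k < r" for k
    using that slot_less[OF d] slot_less[OF d'] by (auto intro!: V_pos)
  have sl: "slot S (m + k) = slot S' (m + k)" if k: "k < r" for k
  proof -
    have "\<bar>(if Suc k = r then s else 1) * of_int (V (slot S (m + k)))\<bar> = \<bar>(if Suc k = r then s' else 1) * of_int (V (slot S' (m + k)))\<bar>"
      using e[OF k] by simp
    then have "V (slot S (m + k)) = V (slot S' (m + k))"
      using pos[OF k] d d' by (auto simp: datum_def abs_mult split: if_splits)
    then show ?thesis using k slot_less[OF d] slot_less[OF d'] by (intro V_inj) auto
  qed
  have co: "co S = (\<lambda>k. slot S (m + k)) ` {..<r}" if d: "datum S s" for S s
  proof (intro equalityI subsetI)
    fix a assume a: "a \<in> co S"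
    obtain k where "k < card (co S)" "sorted_list_of_set (co S) ! k = a" by (rule in_sorted_nth[OF _ a]) simp
    then show "a \<in> (\<lambda>k. slot S (m + k)) ` {..<r}" using card_co[OF d] by (auto simp: slot_def image_iff)
  qed (use slot_last[OF d] in auto)
  have "co S = co S'" unfolding co[OF d] co[OF d'] using sl by (intro image_cong) auto
  then have "S = S'" using d d' by (auto simp: datum_def)
  moreover have "s = s'" using e[of "r - 1"] sl[of "r - 1"] pos[of "r - 1"] r by simp
  ultimately show ?thesis by simp
qed

lemma det_wm:
  assumes d: "datum S s"
  shows "det (wm S s) = 1 \<or> det (wm S s) = - 1"
proof -
  have "(\<Prod>i<R. if Suc i = R then s else 1) = (\<Prod>i<R. if i = R - 1 then s else 1)"
    using r by (intro prod.cong) auto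
  also have "\<dots> = s" using r by simp
  finally have "det (wm S s) = of_int (sign (slot S)) * s"
    unfolding wm_def det_monomial[OF slot_permutes[OF d]] by simp
  moreover have "real_of_int (sign (slot S)) = 1 \<or> real_of_int (sign (slot S)) = - 1"
    by (simp add: sign_def)
  moreover have "s = 1 \<or> s = - 1" using d by (simp add: datum_def)
  ultimately show ?thesis by (elim disjE) simp_all
qed

text \<open>A strictly increasing integer sequence gains at least 1 at each step; this is what makes
  \<open>eta_of\<close> weakly decreasing and nonnegative.\<close>

lemma slot_bound:
  assumes d: "datum S s" and ij: "i \<le> j" "j < m"
  shows "slot S i + (j - i) \<le> slot S j"
  using ij
proof (induction j)
  case (Suc j)
  then show ?case using slot_mono[OF d, of j "Suc j"] by (cases "i = Suc j") (auto simp: Suc_diff_le)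
qed simp

section \<open>The values of the character and of \<open>nu\<close>\<close>

lemma eta_entry:
  assumes d: "datum S s" and p: "p < m"
  shows "eta_of m r \<Lambda> (wm S s) $ p = \<Lambda> $ slot S p + (int R - int (slot S p)) - (int m - int p)"
proof -
  have "p_block m r \<Lambda> (wm S s) $ p - rho_B m $ p =
      of_int (\<Lambda> $ slot S p + (int R - int (slot S p)) - (int m - int p))"
    using p by (simp add: p_entry[OF d p] rho_B_def V_def field_simps)
  moreover have "eta_of m r \<Lambda> (wm S s) $ p = \<lfloor>p_block m r \<Lambda> (wm S s) $ p - rho_B m $ p\<rfloor>"
    using p by (simp add: eta_of_def rho_B_def)
  ultimately show ?thesis by (simp only: floor_of_int)
qed

lemma transversal_iff:
  "transversal m r \<Lambda> S \<longleftrightarrow> S \<subseteq> {..<R} \<and> bij_betw (V_class m r \<Lambda>) S {1..m}"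
proof
  assume t: "transversal m r \<Lambda> S"
  have le: "V_class m r \<Lambda> i \<le> m" for i by (simp add: V_class_def folded_class_le)
  have c: "V_class m r \<Lambda> i \<in> {1..m}" if "i \<in> S" for i
    using t that le[of i] by (auto simp: transversal_def Suc_le_eq)
  have "inj_on (V_class m r \<Lambda>) S"
  proof (rule inj_onI)
    fix i j assume ij: "i \<in> S" "j \<in> S" "V_class m r \<Lambda> i = V_class m r \<Lambda> j"
    have "\<exists>!k. k \<in> S \<and> V_class m r \<Lambda> k = V_class m r \<Lambda> i" using t c[OF ij(1)] by (simp add: transversal_def)
    then show "i = j" using ij by metis
  qed
  moreover have "{1..m} \<subseteq> V_class m r \<Lambda> ` S"
  proof
    fix j assume "j \<in> {1..m}"
    then obtain i where "i \<in> S" "V_class m r \<Lambda> i = j" using t unfolding transversal_def by blast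
    then show "j \<in> V_class m r \<Lambda> ` S" by blast
  qed
  ultimately show "S \<subseteq> {..<R} \<and> bij_betw (V_class m r \<Lambda>) S {1..m}"
    using c t by (auto simp: bij_betw_def transversal_def)
next
  assume b: "S \<subseteq> {..<R} \<and> bij_betw (V_class m r \<Lambda>) S {1..m}"
  have "\<exists>!i. i \<in> S \<and> V_class m r \<Lambda> i = j" if j: "j \<in> {1..m}" for j
    using b j unfolding bij_betw_def inj_on_def by (metis imageE)
  moreover have "V_class m r \<Lambda> i \<noteq> 0" if "i \<in> S" for i
  proof -
    have "V_class m r \<Lambda> i \<in> {1..m}" using b that by (auto simp: bij_betw_def)
    then show ?thesis by simp
  qed
  ultimately show "transversal m r \<Lambda> S" using b unfolding transversal_def by blast
qed

lemma transversal_datum: "transversal m r \<Lambda> S \<Longrightarrow> s = 1 \<or> s = - 1 \<Longrightarrow> datum S s"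
  by (auto simp: transversal_iff datum_def dest: bij_betw_same_card)

text \<open>Twice the shifted weight \<eta>_w + \<rho> lists the V_i with i in S in decreasing
  order. Meeting all nonzero classes then means that S is a transversal, and
  \<open>class_sign\<close> becomes \<open>delta_sign\<close>.\<close>

lemma tau_wm:
  assumes d: "datum S s"
  shows "tau_B m (eta_of m r \<Lambda> (wm S s)) =
    (if transversal m r \<Lambda> S then of_int (delta_sign m r \<Lambda> S * rho_sign m) else 0)"
proof -
  define l where "l = (\<lambda>p. if p < m then V (slot S p) else 0)"
  have sl: "slot S p < R" if "p < m" for p using slot_less[OF d, of p] that by simp
  have cl: "folded_class m (l p) = V_class m r \<Lambda> (slot S p)" if "p < m" for p
    using that sl by (simp add: l_def V_class_eq)
  have "tau_B m (eta_of m r \<Lambda> (wm S s)) = (if all_classes m l then of_int (class_sign m l * rho_sign m) else 0)"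
  proof -
    let ?\<eta> = "eta_of m r \<Lambda> (wm S s)"
    have "(\<lambda>p. if p < m then 2 * ?\<eta> $ p + 2 * (int m - int p) - 1 else 0) = l"
      by (auto simp: fun_eq_iff l_def eta_entry[OF d] V_def)
    moreover have "?\<eta> $ j \<le> ?\<eta> $ i" if "i \<le> j" "j < m" for i j
    proof -
      have b: "int (slot S i) + (int j - int i) \<le> int (slot S j)" "slot S i \<le> slot S j"
        using slot_bound[OF d that] that by linarith+
      have "\<Lambda> $ slot S j \<le> \<Lambda> $ slot S i" using b(2) sl[of j] that by (intro Lambda(2))
      then show ?thesis using b(1) that eta_entry[OF d, of i] eta_entry[OF d, of j] by linarith
    qed
    moreover have "0 \<le> ?\<eta> $ i" if "i < m" for i
    proof -
      have "slot S i + (m - 1 - i) \<le> slot S (m - 1)" using that by (intro slot_bound[OF d]) auto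
      then have "int (slot S i) + int m - int i \<le> int R" using sl[of "m - 1"] that by linarith
      then show ?thesis using Lambda(3)[OF sl[OF that]] eta_entry[OF d that] by linarith
    qed
    ultimately show ?thesis using tau_B_value[of m ?\<eta>] by simp
  qed
  moreover have "all_classes m l \<longleftrightarrow> transversal m r \<Lambda> S"
  proof -
    have im: "slot S ` {..<m} = S"
    proof (intro equalityI subsetI)
      fix a assume a: "a \<in> S"
      obtain k where "k < card S" "sorted_list_of_set S ! k = a" by (rule in_sorted_nth[OF datum_finite[OF d] a])
      then show "a \<in> slot S ` {..<m}" using d by (auto simp: datum_def slot_def image_iff)
    qed (use slot_first[OF d] in auto)
    have "all_classes m l \<longleftrightarrow> {1..m} \<subseteq> V_class m r \<Lambda> ` S"
    proof -
      have "all_classes m l \<longleftrightarrow> (\<forall>c\<in>{1..m}. \<exists>j<m. V_class m r \<Lambda> (slot S j) = c)"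
        unfolding all_classes_def using cl by metis
      also have "\<dots> \<longleftrightarrow> {1..m} \<subseteq> V_class m r \<Lambda> ` slot S ` {..<m}"
      proof -
        have "(\<forall>c\<in>A. \<exists>j<m. h j = c) \<longleftrightarrow> A \<subseteq> h ` {..<m}" for A and h :: "nat \<Rightarrow> nat"
          unfolding subset_iff image_iff Bex_def Ball_def lessThan_iff by metis
        then show ?thesis unfolding image_image .
      qed
      finally show ?thesis unfolding im .
    qed
    also have "\<dots> \<longleftrightarrow> bij_betw (V_class m r \<Lambda>) S {1..m}"
    proof
      assume sub: "{1..m} \<subseteq> V_class m r \<Lambda> ` S"
      have fin: "finite S" by (rule datum_finite[OF d])
      have "card (V_class m r \<Lambda> ` S) \<le> m" using card_image_le[OF fin, of "V_class m r \<Lambda>"] d by (simp add: datum_def)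
      then have eq: "V_class m r \<Lambda> ` S = {1..m}" using card_seteq[OF _ sub] fin by simp
      then have "inj_on (V_class m r \<Lambda>) S" using fin d by (intro eq_card_imp_inj_on) (auto simp: datum_def)
      then show "bij_betw (V_class m r \<Lambda>) S {1..m}" using eq by (simp add: bij_betw_def)
    qed (simp add: bij_betw_def)
    finally show ?thesis using d by (auto simp: transversal_iff datum_def)
  qed
  moreover have "class_sign m l = delta_sign m r \<Lambda> S"
  proof -
    have nth: "sorted_list_of_set S ! p = slot S p" if "p < m" for p using that by (simp add: slot_def)
    have "class_perm m l = (\<lambda>p. if p < m then m - V_class m r \<Lambda> (sorted_list_of_set S ! p) else p)"
      by (auto simp: fun_eq_iff class_perm_def cl nth)
    moreover have "(\<Prod>p<m. folding_sign m (l p)) = (\<Prod>p<m. folding_sign m (V_vec R \<Lambda> $ (sorted_list_of_set S ! p)))"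
      using sl by (intro prod.cong) (auto simp: nth l_def V_entry)
    ultimately show ?thesis by (simp add: class_sign_def delta_sign_def Let_def)
  qed
  ultimately show ?thesis by simp
qed

text \<open>Distinct elements of \<open>W1\<close> have distinct points, so the defining sum has a
  single term.\<close>

lemma nu_wm:
  assumes d: "datum S s"
  shows "nu m r \<Lambda> (mu_of m r \<Lambda> (wm S s)) = complex_of_real (det (wm S s)) * tau_B m (eta_of m r \<Lambda> (wm S s))"
proof -
  have "{w \<in> W1 m r \<Lambda>. mu_of m r \<Lambda> w = mu_of m r \<Lambda> (wm S s)} = {wm S s}"
  proof (intro equalityI subsetI)
    fix w assume w: "w \<in> {w \<in> W1 m r \<Lambda>. mu_of m r \<Lambda> w = mu_of m r \<Lambda> (wm S s)}"
    then obtain S' s' where "datum S' s'" "w = wm S' s'" using W1_datum by blast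
    then show "w \<in> {wm S s}" using mu_inj[of S' s' S s] d w by auto
  qed (use wm_in_W1[OF d] in auto)
  then show ?thesis by (simp add: nu_def)
qed

lemma delta_sign_cases: "delta_sign m r \<Lambda> S = 1 \<or> delta_sign m r \<Lambda> S = - 1"
  unfolding delta_sign_def Let_def sign_def
  using prod_folding_sign_cases[of m "\<lambda>p. V_vec R \<Lambda> $ (sorted_list_of_set S ! p)" m] by auto

lemma rho_sign_cases: "rho_sign m = 1 \<or> rho_sign m = - 1"
  by (simp add: rho_sign_eq minus_one_power_iff)

lemma tau_wm_nonzero_iff:
  assumes "datum S s"
  shows "tau_B m (eta_of m r \<Lambda> (wm S s)) \<noteq> 0 \<longleftrightarrow> transversal m r \<Lambda> S"
  using delta_sign_cases[of S] rho_sign_cases by (auto simp: tau_wm[OF assms])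

lemma supp_nu_eq:
  "supp_nu m r \<Lambda> = (\<lambda>(S, s). mu_of m r \<Lambda> (wm S s)) ` ({S. transversal m r \<Lambda> S} \<times> {1, - 1})"
proof (intro equalityI subsetI)
  fix \<mu> assume \<mu>: "\<mu> \<in> supp_nu m r \<Lambda>"
  then have "(\<Sum>w | w \<in> W1 m r \<Lambda> \<and> mu_of m r \<Lambda> w = \<mu>. complex_of_real (det w) * tau_B m (eta_of m r \<Lambda> w)) \<noteq> 0"
    by (simp add: supp_nu_def nu_def)
  then have "{w. w \<in> W1 m r \<Lambda> \<and> mu_of m r \<Lambda> w = \<mu>} \<noteq> {}" by (metis sum.empty)
  then obtain w where w: "w \<in> W1 m r \<Lambda>" "mu_of m r \<Lambda> w = \<mu>" by auto
  obtain S s where d: "datum S s" "w = wm S s" by (rule W1_datum[OF w(1)])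
  have "nu m r \<Lambda> (mu_of m r \<Lambda> (wm S s)) \<noteq> 0" using \<mu> d(2) w(2) by (simp add: supp_nu_def)
  then have "transversal m r \<Lambda> S" using nu_wm[OF d(1)] tau_wm_nonzero_iff[OF d(1)] by simp
  moreover have "s \<in> {1, - 1}" using d(1) by (simp add: datum_def)
  ultimately show "\<mu> \<in> (\<lambda>(S, s). mu_of m r \<Lambda> (wm S s)) ` ({S. transversal m r \<Lambda> S} \<times> {1, - 1})"
    using d(2) w(2) by force
next
  fix \<mu> assume "\<mu> \<in> (\<lambda>(S, s). mu_of m r \<Lambda> (wm S s)) ` ({S. transversal m r \<Lambda> S} \<times> {1, - 1})"
  then obtain S s where S: "transversal m r \<Lambda> S" "s = 1 \<or> s = - 1" "\<mu> = mu_of m r \<Lambda> (wm S s)" by auto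
  have d: "datum S s" by (rule transversal_datum[OF S(1,2)])
  then show "\<mu> \<in> supp_nu m r \<Lambda>"
    using S nu_wm[OF d] tau_wm_nonzero_iff[OF d] det_wm[OF d] mu_carrier by (auto simp: supp_nu_def)
qed

text \<open>A transversal is the image of a unique choice function that picks one index from each
  nonzero class.\<close>

lemma card_transversals:
  "finite {S. transversal m r \<Lambda> S}" "card {S. transversal m r \<Lambda> S} = (\<Prod>j = 1..m. class_count m r \<Lambda> j)"
proof -
  let ?c = "V_class m r \<Lambda>"
  let ?B = "\<lambda>j. {i. i < R \<and> ?c i = j}"
  have fB: "f j < R" "?c (f j) = j" if "f \<in> PiE {1..m} ?B" "j \<in> {1..m}" for f j
    using PiE_mem[OF that] by auto
  have "bij_betw (\<lambda>f. f ` {1..m}) (PiE {1..m} ?B) {S. transversal m r \<Lambda> S}"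
    unfolding bij_betw_def
  proof (intro conjI inj_onI equalityI subsetI)
    fix f g assume f: "f \<in> PiE {1..m} ?B" and g: "g \<in> PiE {1..m} ?B" and eq: "f ` {1..m} = g ` {1..m}"
    show "f = g"
    proof (rule PiE_ext[OF f g])
      fix j assume j: "j \<in> {1..m}"
      then obtain k where k: "k \<in> {1..m}" "f j = g k" using eq by blast
      then have "j = k" using fB(2)[OF f j] fB(2)[OF g k(1)] by simp
      then show "f j = g j" using k by simp
    qed
  next
    fix S assume "S \<in> (\<lambda>f. f ` {1..m}) ` PiE {1..m} ?B"
    then obtain f where f: "f \<in> PiE {1..m} ?B" and S: "S = f ` {1..m}" by blast
    have "bij_betw ?c S {1..m}"
      unfolding S by (rule bij_betwI[where g = f]) (use fB[OF f] in auto)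
    then show "S \<in> {S. transversal m r \<Lambda> S}" using fB(1)[OF f] by (auto simp: transversal_iff S)
  next
    fix S assume "S \<in> {S. transversal m r \<Lambda> S}"
    then have S: "S \<subseteq> {..<R}" "bij_betw ?c S {1..m}" by (auto simp: transversal_iff)
    let ?f = "restrict (inv_into S ?c) {1..m}"
    have b: "bij_betw (inv_into S ?c) {1..m} S" by (rule bij_betw_inv_into[OF S(2)])
    then have "?f ` {1..m} = S" by (simp add: bij_betw_def)
    moreover have "?f \<in> PiE {1..m} ?B"
    proof (rule PiE_I)
      fix j assume j: "j \<in> {1..m}"
      have "inv_into S ?c j \<in> S" using b j by (auto simp: bij_betw_def)
      moreover have "?c (inv_into S ?c j) = j" by (rule bij_betw_inv_into_right[OF S(2) j])
      ultimately show "?f j \<in> ?B j" using S(1) j by auto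
    qed auto
    ultimately show "S \<in> (\<lambda>f. f ` {1..m}) ` PiE {1..m} ?B" by blast
  qed
  then show "card {S. transversal m r \<Lambda> S} = (\<Prod>j = 1..m. class_count m r \<Lambda> j)"
    by (simp add: bij_betw_same_card[symmetric] card_PiE class_count_def)
  have "{S. transversal m r \<Lambda> S} \<subseteq> Pow {..<R}" by (auto simp: transversal_iff)
  then show "finite {S. transversal m r \<Lambda> S}" by (rule finite_subset) simp
qed

lemma supp_nu_card: "finite (supp_nu m r \<Lambda>)" "card (supp_nu m r \<Lambda>) = 2 * (\<Prod>j = 1..m. class_count m r \<Lambda> j)"
proof -
  have "inj_on (\<lambda>(S, s). mu_of m r \<Lambda> (wm S s)) ({S. transversal m r \<Lambda> S} \<times> {1, - 1})"
  proof (rule inj_onI, clarify)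
    fix S s S' s'
    assume "transversal m r \<Lambda> S" "s \<in> {1, - 1}" "transversal m r \<Lambda> S'" "s' \<in> {1, - 1}"
      and "mu_of m r \<Lambda> (wm S s) = mu_of m r \<Lambda> (wm S' s')"
    then show "S = S' \<and> s = s'" by (intro mu_inj transversal_datum) auto
  qed
  then show "card (supp_nu m r \<Lambda>) = 2 * (\<Prod>j = 1..m. class_count m r \<Lambda> j)"
    unfolding supp_nu_eq by (simp add: card_image card_cartesian_product card_transversals)
  show "finite (supp_nu m r \<Lambda>)" unfolding supp_nu_eq using card_transversals(1) by simp
qed

section \<open>The dominating transversal\<close>

lemma S_min_transversal:
  assumes "\<forall>j\<in>{1..m}. class_count m r \<Lambda> j \<ge> 1"
  shows "transversal m r \<Lambda> (S_min m r \<Lambda>)"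
    and "j \<in> {1..m} \<Longrightarrow> \<exists>i\<in>S_min m r \<Lambda>. V_class m r \<Lambda> i = j \<and> (\<forall>k<R. V_class m r \<Lambda> k = j \<longrightarrow> k \<le> i)"
proof -
  let ?c = "V_class m r \<Lambda>"
  let ?B = "\<lambda>j. {i. i < R \<and> ?c i = j}"
  have mem: "Max (?B j) \<in> ?B j" if j: "j \<in> {1..m}" for j
  proof (rule Max_in)
    have "card (?B j) \<noteq> 0" using assms j by (fastforce simp: class_count_def)
    then show "?B j \<noteq> {}" by (metis card.empty)
  qed simp
  have "bij_betw ?c (S_min m r \<Lambda>) {1..m}"
    unfolding S_min_def by (rule bij_betwI[where g = "\<lambda>j. Max (?B j)"]) (use mem in auto)
  moreover have "S_min m r \<Lambda> \<subseteq> {..<R}" using mem by (auto simp: S_min_def)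
  ultimately show "transversal m r \<Lambda> (S_min m r \<Lambda>)" by (simp add: transversal_iff)
  assume j: "j \<in> {1..m}"
  then show "\<exists>i\<in>S_min m r \<Lambda>. ?c i = j \<and> (\<forall>k<R. ?c k = j \<longrightarrow> k \<le> i)"
    using mem[OF j] unfolding S_min_def by (intro bexI[of _ "Max (?B j)"]) auto
qed

text \<open>Below any bound, every transversal has at least as many elements as \<open>S_min\<close>, so the complement of
  \<open>S_min\<close> has the smallest indices.\<close>

lemma S_min_slot_le:
  assumes ne: "\<forall>j\<in>{1..m}. class_count m r \<Lambda> j \<ge> 1" and S: "transversal m r \<Lambda> S" and k: "k < r"
  shows "slot (S_min m r \<Lambda>) (m + k) \<le> slot S (m + k)"
proof -
  let ?c = "V_class m r \<Lambda>" and ?M = "S_min m r \<Lambda>"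
  note T = S_min_transversal[OF ne]
  have d: "datum ?M 1" "datum S 1" using T(1) S by (auto intro: transversal_datum)
  have cnt: "card {i \<in> ?M. i < x} \<le> card {i \<in> S. i < x}" for x
  proof (rule card_inj_on_le)
    \<comment> \<open>Each element of \<open>S_min\<close> goes to the element of S in the same
      class; its label is no larger, so it stays below the bound x.\<close>
    let ?g = "\<lambda>i. inv_into S ?c (?c i)"
    have S': "bij_betw ?c S {1..m}" and M': "bij_betw ?c ?M {1..m}" and sub: "S \<subseteq> {..<R}"
      using S T(1) by (auto simp: transversal_iff)
    have c: "?c i \<in> {1..m}" if "i \<in> ?M" for i using M' that by (auto simp: bij_betw_def)
    have g: "?g i \<in> S" "?c (?g i) = ?c i" if "i \<in> ?M" for i
      using bij_betw_inv_into_right[OF S' c[OF that]] bij_betw_inv_into[OF S'] c[OF that] by (auto simp: bij_betw_def)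
    show "inj_on ?g {i \<in> ?M. i < x}"
    proof (rule inj_onI)
      fix i j assume ij: "i \<in> {i \<in> ?M. i < x}" "j \<in> {i \<in> ?M. i < x}" "?g i = ?g j"
      have "?c i = ?c (?g i)" by (rule g(2)[symmetric]) (use ij(1) in blast)
      also have "\<dots> = ?c (?g j)" by (rule arg_cong[OF ij(3)])
      also have "\<dots> = ?c j" by (rule g(2)) (use ij(2) in blast)
      finally have "?c i = ?c j" .
      then show "i = j" by (rule inj_onD[OF bij_betw_imp_inj_on[OF M']]) (use ij in auto)
    qed
    show "?g ` {i \<in> ?M. i < x} \<subseteq> {i \<in> S. i < x}"
    proof
      fix a assume "a \<in> ?g ` {i \<in> ?M. i < x}"
      then obtain i where i: "i \<in> ?M" "i < x" "a = ?g i" by blast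
      obtain i' where i': "i' \<in> ?M" "?c i' = ?c i" "\<forall>k<R. ?c k = ?c i \<longrightarrow> k \<le> i'" using T(2)[OF c[OF i(1)]] by blast
      have "i' = i" using M' i(1) i'(1,2) by (auto simp: bij_betw_def inj_on_def)
      moreover have "?g i < R" using g(1)[OF i(1)] sub by auto
      ultimately have "?g i \<le> i" using i'(3) g(2)[OF i(1)] by blast
      then show "a \<in> {i \<in> S. i < x}" using i g(1)[OF i(1)] by simp
    qed
    show "finite {i \<in> S. i < x}" using datum_finite[OF d(2)] by simp
  qed
  \<comment> \<open>A set and its complement share the labels below x, so more elements in S there
    means fewer in its complement.\<close>
  have split: "card {i \<in> A. i < x} + card {i \<in> co A. i < x} = card {i \<in> {..<R}. i < x}" if "datum A 1" for A x
  proof -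
    have A: "A \<subseteq> {..<R}" using that by (simp add: datum_def)
    have "{i \<in> {..<R}. i < x} = {i \<in> A. i < x} \<union> {i \<in> co A. i < x}" using A by auto
    then show ?thesis using datum_finite[OF that] by (simp only:) (subst card_Un_disjoint, auto)
  qed
  have "card {i \<in> co S. i < x} \<le> card {i \<in> co ?M. i < x}" for x
    using split[OF d(1), of x] split[OF d(2), of x] cnt[of x] by linarith
  then have "sorted_list_of_set (co ?M) ! k \<le> sorted_list_of_set (co S) ! k"
    using card_co[OF d(1)] card_co[OF d(2)] k by (intro sorted_nth_le_if_card_le) auto
  then show ?thesis using k by (simp add: slot_def)
qed

text \<open>The complement of \<open>S_min\<close> has the smallest labels position by position, and
  V decreases, so its entries are largest; a chirality -1 only lowers the last entry. Equality in
  all coordinates would give the same point.\<close>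

lemma alternant_index_dominated:
  assumes ne: "\<forall>j\<in>{1..m}. class_count m r \<Lambda> j \<ge> 1"
    and \<mu>: "\<mu> \<in> supp_nu m r \<Lambda> - {point m r \<Lambda> (S_min m r \<Lambda>) 1}"
  shows "\<forall>k<r. alternant_index r \<mu> $ k \<le> alternant_index r (point m r \<Lambda> (S_min m r \<Lambda>) 1) $ k"
    and "\<exists>k<r. alternant_index r \<mu> $ k < alternant_index r (point m r \<Lambda> (S_min m r \<Lambda>) 1) $ k"
proof -
  let ?M = "S_min m r \<Lambda>"
  obtain S s where S: "transversal m r \<Lambda> S" "s = 1 \<or> s = - 1" "\<mu> = mu_of m r \<Lambda> (wm S s)"
    using \<mu> by (auto simp: supp_nu_eq)
  have d: "datum S s" by (rule transversal_datum[OF S(1,2)])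
  have M: "datum ?M 1" using S_min_transversal(1)[OF ne] by (intro transversal_datum) auto
  have le: "alternant_index r \<mu> $ k \<le> alternant_index r (point m r \<Lambda> ?M 1) $ k" if k: "k < r" for k
  proof -
    have "V (slot S (m + k)) \<le> V (slot ?M (m + k))"
      using S_min_slot_le[OF ne S(1) k] slot_less[OF d, of "m + k"] k by (intro V_mono) auto
    moreover have "0 < V (slot S (m + k))" using slot_less[OF d, of "m + k"] k by (intro V_pos) auto
    ultimately show ?thesis
      using S(2) by (auto simp: S(3) point_eq[OF M] alternant_entry[OF d k] alternant_entry[OF M k])
  qed
  then show "\<forall>k<r. alternant_index r \<mu> $ k \<le> alternant_index r (point m r \<Lambda> ?M 1) $ k" by blast
  show "\<exists>k<r. alternant_index r \<mu> $ k < alternant_index r (point m r \<Lambda> ?M 1) $ k"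
  proof (rule ccontr)
    assume "\<not> ?thesis"
    then have eq: "alternant_index r \<mu> $ k = alternant_index r (point m r \<Lambda> ?M 1) $ k" if "k < r" for k
      using le[OF that] that by (meson order.order_iff_strict)
    have c: "\<mu> \<in> carrier_vec r" "point m r \<Lambda> ?M 1 \<in> carrier_vec r" by (auto simp: S(3) point_eq[OF M] mu_carrier)
    have "\<mu> = point m r \<Lambda> ?M 1"
    proof (rule eq_vecI)
      fix k assume "k < dim_vec (point m r \<Lambda> ?M 1)"
      then have k: "k < r" using c by simp
      then show "\<mu> $ k = point m r \<Lambda> ?M 1 $ k" using eq[OF k] c by (simp add: alternant_index_def rho_D_def)
    qed (use c in simp)
    then show False using \<mu> by simp
  qed
qed

text \<open>The alternant index is \<mu> shifted by a fixed vector and doubled, so coordinatewise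
  comparisons pass to \<mu>, and positive weights preserve them in the sum.\<close>

lemma scalar_prod_less_if_alternant_less:
  assumes c: "w0 \<in> carrier_vec r" "\<mu> \<in> carrier_vec r" "\<mu>' \<in> carrier_vec r" and pos: "\<forall>k<r. 0 < w0 $ k"
    and le: "\<forall>k<r. alternant_index r \<mu> $ k \<le> alternant_index r \<mu>' $ k"
    and lt: "\<exists>k<r. alternant_index r \<mu> $ k < alternant_index r \<mu>' $ k"
  shows "w0 \<bullet> \<mu> < w0 \<bullet> \<mu>'"
proof -
  have a: "alternant_index r \<nu> $ k = 2 * (\<nu> $ k + rho_D r $ k)" if "\<nu> \<in> carrier_vec r" "k < r" for \<nu> k
    using that by (simp add: alternant_index_def rho_D_def)
  obtain k where k: "k < r" "\<mu> $ k < \<mu>' $ k" using lt a[OF c(2)] a[OF c(3)] by auto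
  have "(\<Sum>k<r. w0 $ k * \<mu> $ k) < (\<Sum>k<r. w0 $ k * \<mu>' $ k)"
  proof (rule sum_strict_mono_ex1)
    show "\<forall>k\<in>{..<r}. w0 $ k * \<mu> $ k \<le> w0 $ k * \<mu>' $ k"
      using le pos a[OF c(2)] a[OF c(3)] by (auto intro!: mult_left_mono simp: less_imp_le)
    show "\<exists>k\<in>{..<r}. w0 $ k * \<mu> $ k < w0 $ k * \<mu>' $ k" using k pos by (auto intro!: bexI[of _ k])
  qed simp
  then show ?thesis using c by (simp add: scalar_prod_def atLeast0LessThan)
qed

end

theorem proposition5p10:
  fixes t m r :: nat and \<Lambda> :: "int vec"
  assumes "t = 2 * m + 1" and "t \<ge> 3" and "r \<ge> 2"
    and "dominant_SO_odd (m + r) \<Lambda>"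
  shows
    "(\<forall>w \<in> W1 m r \<Lambda>. tau_B m (eta_of m r \<Lambda> w) \<noteq> 0 \<longleftrightarrow> transversal m r \<Lambda> (S_of m r w))
     \<and>
     (finite (supp_nu m r \<Lambda>) \<and>
      card (supp_nu m r \<Lambda>) = 2 * (\<Prod>j = 1..m. class_count m r \<Lambda> j) \<and>
      (\<forall>S. transversal m r \<Lambda> S \<longrightarrow>
         point m r \<Lambda> S 1 \<in> supp_nu m r \<Lambda> \<and> point m r \<Lambda> S (-1) \<in> supp_nu m r \<Lambda> \<and>
         point m r \<Lambda> S 1 \<noteq> point m r \<Lambda> S (-1)))
     \<and>
     ((\<forall>\<mu> \<in> carrier_vec r. nu m r \<Lambda> \<mu> = 0) \<longleftrightarrow> (\<exists>j \<in> {1..m}. class_count m r \<Lambda> j = 0))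
     \<and>
     (\<forall>w \<in> W1 m r \<Lambda>. transversal m r \<Lambda> (S_of m r w) \<longrightarrow>
        nu m r \<Lambda> (mu_of m r \<Lambda> w) =
          of_int (epsilon t) * complex_of_real (det w) * of_int (delta_sign m r \<Lambda> (S_of m r w)) \<and>
        nu m r \<Lambda> (mu_of m r \<Lambda> w) \<in> {1, -1})
     \<and>
     ((\<forall>j \<in> {1..m}. class_count m r \<Lambda> j \<ge> 1) \<longrightarrow>
        transversal m r \<Lambda> (S_min m r \<Lambda>) \<and>
        point m r \<Lambda> (S_min m r \<Lambda>) 1 \<in> supp_nu m r \<Lambda> \<and>
        (\<forall>\<mu> \<in> supp_nu m r \<Lambda> - {point m r \<Lambda> (S_min m r \<Lambda>) 1}.
           (\<forall>k < r. alternant_index r \<mu> $ k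
                    \<le> alternant_index r (point m r \<Lambda> (S_min m r \<Lambda>) 1) $ k) \<and>
           (\<exists>k < r. alternant_index r \<mu> $ k
                    < alternant_index r (point m r \<Lambda> (S_min m r \<Lambda>) 1) $ k)) \<and>
        (\<forall>w\<^sub>0 \<in> carrier_vec r. (\<forall>k < r. 0 < w\<^sub>0 $ k) \<longrightarrow>
           (\<forall>\<mu> \<in> supp_nu m r \<Lambda> - {point m r \<Lambda> (S_min m r \<Lambda>) 1}.
              w\<^sub>0 \<bullet> \<mu> < w\<^sub>0 \<bullet> point m r \<Lambda> (S_min m r \<Lambda>) 1)))"
    (is "?i \<and> ?ii \<and> ?iii \<and> ?iv \<and> ?v")
proof -
  interpret branching m r \<Lambda> using assms by unfold_locales auto
  have i: ?i
  proof
    fix w assume "w \<in> W1 m r \<Lambda>"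
    then obtain S s where "datum S s" "w = wm S s" by (rule W1_datum)
    then show "tau_B m (eta_of m r \<Lambda> w) \<noteq> 0 \<longleftrightarrow> transversal m r \<Lambda> (S_of m r w)"
      using tau_wm_nonzero_iff S_of_wm by simp
  qed
  have pt: "point m r \<Lambda> S s \<in> supp_nu m r \<Lambda>" if "transversal m r \<Lambda> S" "s = 1 \<or> s = - 1" for S s
    unfolding point_eq[OF transversal_datum[OF that]] supp_nu_eq using that by force
  have ii: ?ii
  proof (intro conjI allI impI)
    fix S assume S: "transversal m r \<Lambda> S"
    show "point m r \<Lambda> S 1 \<in> supp_nu m r \<Lambda>" "point m r \<Lambda> S (- 1) \<in> supp_nu m r \<Lambda>" using pt[OF S] by auto
    have d: "datum S 1" "datum S (- 1)" using S by (auto intro: transversal_datum)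
    show "point m r \<Lambda> S 1 \<noteq> point m r \<Lambda> S (- 1)"
      unfolding point_eq[OF d(1)] point_eq[OF d(2)] using mu_inj[OF d] by auto
  qed (rule supp_nu_card)+
  have iii: ?iii
  proof -
    have "(\<forall>\<mu>\<in>carrier_vec r. nu m r \<Lambda> \<mu> = 0) \<longleftrightarrow> supp_nu m r \<Lambda> = {}" by (auto simp: supp_nu_def)
    also have "\<dots> \<longleftrightarrow> card (supp_nu m r \<Lambda>) = 0" using supp_nu_card(1) by simp
    also have "\<dots> \<longleftrightarrow> (\<exists>j\<in>{1..m}. class_count m r \<Lambda> j = 0)" unfolding supp_nu_card(2) by simp
    finally show ?thesis .
  qed
  have iv: ?iv
  proof (intro ballI impI)
    fix w assume w: "w \<in> W1 m r \<Lambda>" and tr: "transversal m r \<Lambda> (S_of m r w)"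
    obtain S s where d: "datum S s" "w = wm S s" by (rule W1_datum[OF w])
    have S: "S_of m r w = S" using S_of_wm d by simp
    have "nu m r \<Lambda> (mu_of m r \<Lambda> w) = complex_of_real (det w) * of_int (delta_sign m r \<Lambda> S * rho_sign m)"
      using tr unfolding S by (simp add: d(2) nu_wm[OF d(1)] tau_wm[OF d(1)])
    moreover have "epsilon t = rho_sign m" using assms(1) epsilon_eq_rho_sign by simp
    ultimately show "nu m r \<Lambda> (mu_of m r \<Lambda> w) =
        of_int (epsilon t) * complex_of_real (det w) * of_int (delta_sign m r \<Lambda> (S_of m r w)) \<and>
        nu m r \<Lambda> (mu_of m r \<Lambda> w) \<in> {1, -1}"
      using det_wm[OF d(1)] delta_sign_cases[of S] rho_sign_cases unfolding S d(2)[symmetric] by auto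
  qed
  have v: ?v
  proof (intro impI conjI ballI)
    assume ne: "\<forall>j\<in>{1..m}. class_count m r \<Lambda> j \<ge> 1"
    note T = S_min_transversal(1)[OF ne]
    show "transversal m r \<Lambda> (S_min m r \<Lambda>)" by (rule T)
    show P: "point m r \<Lambda> (S_min m r \<Lambda>) 1 \<in> supp_nu m r \<Lambda>" using pt[OF T] by simp
    fix \<mu> assume \<mu>: "\<mu> \<in> supp_nu m r \<Lambda> - {point m r \<Lambda> (S_min m r \<Lambda>) 1}"
    note A = alternant_index_dominated[OF ne \<mu>]
    show "\<forall>k<r. alternant_index r \<mu> $ k \<le> alternant_index r (point m r \<Lambda> (S_min m r \<Lambda>) 1) $ k" by (rule A(1))
    show "\<exists>k<r. alternant_index r \<mu> $ k < alternant_index r (point m r \<Lambda> (S_min m r \<Lambda>) 1) $ k" by (rule A(2))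
  next
    fix w0 :: "real vec" and \<mu>
    assume ne: "\<forall>j\<in>{1..m}. class_count m r \<Lambda> j \<ge> 1" and w0: "w0 \<in> carrier_vec r" "\<forall>k<r. 0 < w0 $ k"
      and \<mu>: "\<mu> \<in> supp_nu m r \<Lambda> - {point m r \<Lambda> (S_min m r \<Lambda>) 1}"
    have "\<mu> \<in> carrier_vec r" "point m r \<Lambda> (S_min m r \<Lambda>) 1 \<in> carrier_vec r"
      using \<mu> pt[OF S_min_transversal(1)[OF ne], of 1] by (auto simp: supp_nu_def)
    then show "w0 \<bullet> \<mu> < w0 \<bullet> point m r \<Lambda> (S_min m r \<Lambda>) 1"
      by (rule scalar_prod_less_if_alternant_less[OF w0(1) _ _ w0(2) alternant_index_dominated[OF ne \<mu>]])
  qed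
  show ?thesis using i ii iii iv v by blast
qed

end
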